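(* Let $\theta>0$, $c_n=\langle n\rangle^{-(\frac12+\theta)}$ for $n\in\mathbb{Z}$, and $z_0>0$. For each $\epsilon>0$ let $u^\omega$ be the solution of $$i u_t+\Delta u=\epsilon^2|u|^2u \ \text{ on } \mathbb{T},\qquad u(0,x)=u_0^\omega(x)=\sum_{n\in\mathbb{Z}}c_n g_n^\omega e^{inx},$$ where $(g_n^\omega)_{n\in\mathbb{Z}}$ are i.i.d. standard complex Gaussian random variables. Let $T_\epsilon>0$ satisfy $T_\epsilon\approx\epsilon^{-1}$, i.e. $K^{-1}\epsilon^{-1}\le T_\epsilon\le K\epsilon^{-1}$ for some constant $K\ge 1$ independent of $\epsilon$. Then $$\lim_{\epsilon\to0^+}\epsilon\,\ln\mathbb{P}\Big(\|u^\omega\|_{L^\infty_{t,x}([0,T_\epsilon]\times\mathbb{T})}>z_0\epsilon^{-\frac12}\Big)=-\frac{z_0^2}{\sum_{n\in\mathbb{Z}}|c_n|^2}.$$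
   Context: $\mathbb{T}=\mathbb{R}/2\pi\mathbb{Z}$, $\Delta=\partial_x^2$, $\langle n\rangle=(1+|n|^2)^{1/2}$. A standard complex Gaussian $g$ is a centered circularly symmetric complex Gaussian with $\mathbb{E}|g|^2=1$. The random data $u_0^\omega$ lies in $L^2(\mathbb{T})$ almost surely, and $u^\omega$ denotes the global solution given by the (classical, Bourgain 1993) global flow of the one-dimensional periodic cubic NLS for $L^2(\mathbb{T})$ initial data. The solution depends on $\epsilon$; this dependence is suppressed in the notation. *)

theory Defs
  imports "HOL-Probability.Probability"
begin

text \<open>Functions on the circle \<open>\<real> / 2\<pi>\<int>\<close> are represented by their values on the fundamental
  domain \<open>[0, 2\<pi>)\<close>; only their classes modulo null sets matter below.\<close>

definition torus :: "real measure" where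
  "torus = restrict_space lborel {0..<2 * pi}"

definition in_L2 :: "(real \<Rightarrow> complex) \<Rightarrow> bool" where
  "in_L2 f \<longleftrightarrow> f \<in> borel_measurable torus \<and> integrable torus (\<lambda>x. (cmod (f x))\<^sup>2)"

definition norm_L2 :: "(real \<Rightarrow> complex) \<Rightarrow> real" where
  "norm_L2 f = sqrt (LINT x|torus. (cmod (f x))\<^sup>2)"

definition has_sum_L2 :: "('i \<Rightarrow> real \<Rightarrow> complex) \<Rightarrow> (real \<Rightarrow> complex) \<Rightarrow> bool" where
  "has_sum_L2 F f \<longleftrightarrow> in_L2 f \<and>
     ((\<lambda>I. norm_L2 (\<lambda>x. f x - (\<Sum>i\<in>I. F i x))) \<longlongrightarrow> 0) (finite_subsets_at_top UNIV)"

definition fourier_coefficient :: "(real \<Rightarrow> complex) \<Rightarrow> int \<Rightarrow> complex" where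
  "fourier_coefficient f n = (LINT x|torus. f x * cis (- (of_int n * x))) / (2 * pi)"

text \<open>\<open>global_nls_solution \<epsilon> f u\<close>: the function \<open>u\<close> (time first, then space) is the global solution
  of \<open>i u\<^sub>t + u\<^sub>x\<^sub>x = \<epsilon>\<^sup>2 |u|\<^sup>2 u\<close> with datum \<open>f \<in> L\<^sup>2\<close>, that is, \<open>u\<close> lies in
  \<open>C(\<real>; L\<^sup>2) \<inter> L\<^sup>4\<^bsub>loc\<^esub>(\<real>; L\<^sup>4)\<close> and satisfies the Duhamel formula
  \<open>u(t) = S(t) f - i \<epsilon>\<^sup>2 \<integral>\<^sub>0\<^sup>t S(t - s) (|u|\<^sup>2 u)(s) ds\<close>, where \<open>S(t)\<close> is the multiplier
  \<open>exp(- i t n\<^sup>2)\<close>, so that the formula is read off on each Fourier mode.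
  By the \<open>L\<^sup>4\<close> Strichartz estimate of Bourgain the solution in this class exists and is unique
  (up to null sets), and it is the one given by his global \<open>L\<^sup>2\<close> flow.\<close>

definition global_nls_solution ::
    "real \<Rightarrow> (real \<Rightarrow> complex) \<Rightarrow> (real \<Rightarrow> real \<Rightarrow> complex) \<Rightarrow> bool" where
  "global_nls_solution \<epsilon> f u \<longleftrightarrow>
     (\<lambda>(t, x). u t x) \<in> borel_measurable (lborel \<Otimes>\<^sub>M torus) \<and>
     (\<forall>t. in_L2 (u t)) \<and>
     (\<forall>t. ((\<lambda>s. norm_L2 (\<lambda>x. u s x - u t x)) \<longlongrightarrow> 0) (at t)) \<and>
     (\<forall>R>0. integrable (restrict_space lborel {-R..R} \<Otimes>\<^sub>M torus) (\<lambda>(t, x). (cmod (u t x)) ^ 4)) \<and>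
     (\<forall>t n. fourier_coefficient (u t) n =
        cis (- (t * (of_int n)\<^sup>2)) * fourier_coefficient f n
        - \<i> * of_real (\<epsilon>\<^sup>2) *
          (LBINT s=ereal 0..ereal t. cis (- ((t - s) * (of_int n)\<^sup>2)) *
             fourier_coefficient (\<lambda>x. of_real ((cmod (u s x))\<^sup>2) * u s x) n))"

definition norm_Linf :: "real \<Rightarrow> (real \<Rightarrow> real \<Rightarrow> complex) \<Rightarrow> ereal" where
  "norm_Linf T u = esssup (restrict_space lborel {0..T} \<Otimes>\<^sub>M torus) (\<lambda>(t, x). ereal (cmod (u t x)))"

definition standard_complex_gaussian :: "'w measure \<Rightarrow> ('w \<Rightarrow> complex) \<Rightarrow> bool" where
  "standard_complex_gaussian M g \<longleftrightarrow>
     distributed M lborel (\<lambda>w. Re (g w)) (normal_density 0 (sqrt (1/2))) \<and>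
     distributed M lborel (\<lambda>w. Im (g w)) (normal_density 0 (sqrt (1/2))) \<and>
     prob_space.indep_var M borel (\<lambda>w. Re (g w)) borel (\<lambda>w. Im (g w))"

definition japanese_bracket :: "int \<Rightarrow> real" where
  "japanese_bracket n = sqrt (1 + (of_int n)\<^sup>2)"

end

theory Submission
  imports Defs
begin

text \<open>The rescaled solution \<open>v = \<epsilon>\<^sup>1\<^sup>/\<^sup>2 u\<close> solves the equation with coupling \<open>\<epsilon>\<close>, over a time of order \<open>1 / \<epsilon>\<close>,
  and the question is when \<open>|v|\<close> exceeds \<open>z\<^sub>0\<close>. In the interaction picture the resonant terms of the
  nonlinearity merely rotate each mode, with a speed that is the same for all modes up to a multiple of
  the squared amplitude of the mode; the nonresonant terms oscillate, and an integration by parts in time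
  shows that they move the modes by only \<open>O(\<epsilon>)\<close> in \<open>\<ell>\<^sup>1\<close>. Hence \<open>|v|\<close> is bounded by the sum of the
  initial amplitudes of the low modes plus the sup norm of the linear evolution of the high modes, up to a
  small error. The high modes are negligible at the scale of the large deviation, by a union bound over
  dyadic blocks. By Cauchy--Schwarz the sum of the low amplitudes \<open>c\<^sub>n |g\<^sub>n|\<close> exceeds
  \<open>z\<^sub>0 \<epsilon>\<^sup>-\<^sup>1\<^sup>/\<^sup>2\<close> only if \<open>\<Sum> |g\<^sub>n|\<^sup>2 \<ge> z\<^sub>0\<^sup>2 / (\<epsilon> \<Sum> c\<^sub>n\<^sup>2)\<close> over these modes, which is a chi-squared event of the
  claimed exponential order. For the lower bound, the sup norm dominates the real part at \<open>t = x = 0\<close> of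
  every Fejer mean of the datum, a Gaussian variable whose variance is close to \<open>\<Sum> c\<^sub>n\<^sup>2 / 2\<close>.\<close>

subsection \<open>Square integrable functions on the circle\<close>

text \<open>Two obstacles shape the proof. Nothing is assumed on how the solution depends on
  \<omega>, so the event of the theorem is first identified, up to a null set, with a measurable
  one: essential bounds are expressed by Fejer means at rational times and points, and the Fourier
  coefficients are recovered as limits of Picard iterates for a truncated nonlinearity, which are
  measurable by construction. Moreover the solution is controlled a priori only in L2 at each time
  and in L4 of space-time; its modes are absolutely continuous in time, and the coefficients of the
  nonlinearity lie in l4 for almost every time. Integration by parts therefore produces trilinear
  sums with one entry in l4 and two in l2. The resulting l1 bound involves the mass and the
  space-time L4 norm, and a continuity argument closes it as long as coupling times length of time
  stays bounded. The speeds of rotation differ between the modes; after a common phase is removed,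
  the remaining angles sum to at most the coupling times the time integral of the mass, so they
  hardly disturb the high modes, whose amplitudes are small.\<close>

lemma square_integrable_mult:
  fixes f g :: "'a \<Rightarrow> complex"
  assumes [measurable]: "f \<in> borel_measurable M" "g \<in> borel_measurable M"
    and "integrable M (\<lambda>x. (cmod (f x))\<^sup>2)" "integrable M (\<lambda>x. (cmod (g x))\<^sup>2)"
  shows "integrable M (\<lambda>x. f x * g x)"
proof (rule Bochner_Integration.integrable_bound)
  show "integrable M (\<lambda>x. (cmod (f x))\<^sup>2 + (cmod (g x))\<^sup>2)" using assms by simp
  show "AE x in M. norm (f x * g x) \<le> norm ((cmod (f x))\<^sup>2 + (cmod (g x))\<^sup>2)"
  proof (rule AE_I2)
    fix x
    have "2 * (cmod (f x) * cmod (g x)) \<le> (cmod (f x))\<^sup>2 + (cmod (g x))\<^sup>2"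
      using sum_squares_bound[of "cmod (f x)" "cmod (g x)"] by (simp add: mult.assoc)
    moreover have "0 \<le> cmod (f x) * cmod (g x)" "0 \<le> (cmod (f x))\<^sup>2 + (cmod (g x))\<^sup>2" by simp_all
    ultimately show "norm (f x * g x) \<le> norm ((cmod (f x))\<^sup>2 + (cmod (g x))\<^sup>2)"
      unfolding norm_mult real_norm_def by linarith
  qed
qed measurable

lemma Cauchy_Schwarz_integral:
  fixes f g :: "'a \<Rightarrow> complex"
  assumes [measurable]: "f \<in> borel_measurable M" "g \<in> borel_measurable M"
    and f: "integrable M (\<lambda>x. (cmod (f x))\<^sup>2)" and g: "integrable M (\<lambda>x. (cmod (g x))\<^sup>2)"
  shows "(LINT x|M. cmod (f x) * cmod (g x))\<^sup>2
      \<le> (LINT x|M. (cmod (f x))\<^sup>2) * (LINT x|M. (cmod (g x))\<^sup>2)"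
proof -
  have fg: "integrable M (\<lambda>x. cmod (f x) * cmod (g x))"
    using integrable_norm[OF square_integrable_mult[OF assms]] by (simp add: norm_mult)
  have "(\<integral>\<^sup>+x. ennreal (cmod (f x)) * ennreal (cmod (g x)) \<partial>M)\<^sup>2
      \<le> (\<integral>\<^sup>+x. ennreal (cmod (f x)) ^ 2 \<partial>M) * (\<integral>\<^sup>+x. ennreal (cmod (g x)) ^ 2 \<partial>M)"
    by (rule Cauchy_Schwarz_nn_integral) measurable
  also have "(\<integral>\<^sup>+x. ennreal (cmod (f x)) * ennreal (cmod (g x)) \<partial>M)
      = ennreal (LINT x|M. cmod (f x) * cmod (g x))"
    using nn_integral_eq_integral[OF fg] by (simp add: ennreal_mult)
  also have "(\<integral>\<^sup>+x. ennreal (cmod (f x)) ^ 2 \<partial>M) = ennreal (LINT x|M. (cmod (f x))\<^sup>2)"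
    using nn_integral_eq_integral[OF f] by (simp add: ennreal_power)
  also have "(\<integral>\<^sup>+x. ennreal (cmod (g x)) ^ 2 \<partial>M) = ennreal (LINT x|M. (cmod (g x))\<^sup>2)"
    using nn_integral_eq_integral[OF g] by (simp add: ennreal_power)
  finally show ?thesis
    by (simp add: ennreal_power ennreal_mult[symmetric])
qed

lemma Cauchy_Schwarz_integral_norm:
  fixes f g :: "'a \<Rightarrow> complex"
  assumes "f \<in> borel_measurable M" "g \<in> borel_measurable M"
    and "integrable M (\<lambda>x. (cmod (f x))\<^sup>2)" "integrable M (\<lambda>x. (cmod (g x))\<^sup>2)"
  shows "cmod (LINT x|M. f x * g x)
      \<le> sqrt (LINT x|M. (cmod (f x))\<^sup>2) * sqrt (LINT x|M. (cmod (g x))\<^sup>2)"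
proof -
  have "cmod (LINT x|M. f x * g x) \<le> (LINT x|M. cmod (f x) * cmod (g x))"
    using integral_norm_bound[of M "\<lambda>x. f x * g x"] by (simp add: norm_mult)
  also have "\<dots> \<le> sqrt ((LINT x|M. (cmod (f x))\<^sup>2) * (LINT x|M. (cmod (g x))\<^sup>2))"
    by (rule real_le_rsqrt[OF Cauchy_Schwarz_integral[OF assms]])
  finally show ?thesis by (simp add: real_sqrt_mult)
qed

lemma space_torus [simp]: "space torus = {0..<2 * pi}"
  by (simp add: torus_def space_restrict_space)

lemma measurable_torus_borel: "f \<in> borel_measurable borel \<Longrightarrow> f \<in> borel_measurable torus"
  unfolding torus_def by (rule measurable_restrict_space1) simp

lemma emeasure_torus: "emeasure torus (space torus) = ennreal (2 * pi)"
  unfolding torus_def by (simp add: emeasure_restrict_space space_restrict_space)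

interpretation torus: finite_measure torus
  by standard (simp add: emeasure_torus[simplified])

lemma measure_torus [simp]: "measure torus {0..<2 * pi} = 2 * pi"
  using emeasure_torus by (simp add: measure_def)

lemma measurable_cis [measurable]: "cis \<in> borel_measurable borel"
  by (intro borel_measurable_continuous_onI continuous_intros)

lemma measurable_cis_torus [measurable]: "(\<lambda>x. cis (a * x)) \<in> borel_measurable torus"
  by (rule measurable_torus_borel) measurable

lemma measurable_cnj [measurable]: "cnj \<in> borel_measurable borel"
  by (intro borel_measurable_continuous_onI continuous_intros)

lemma norm_L2_nonneg [simp]: "0 \<le> norm_L2 f"
  unfolding norm_L2_def by simp

lemma norm_L2_power2: "(norm_L2 f)\<^sup>2 = (LINT x|torus. (cmod (f x))\<^sup>2)"
  unfolding norm_L2_def by simp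

lemma in_L2_measurable: "in_L2 f \<Longrightarrow> f \<in> borel_measurable torus"
  unfolding in_L2_def by simp

lemma in_L2_bounded:
  assumes [measurable]: "f \<in> borel_measurable torus" and "AE x in torus. cmod (f x) \<le> B"
  shows "in_L2 f"
  unfolding in_L2_def
proof
  show "integrable torus (\<lambda>x. (cmod (f x))\<^sup>2)"
  proof (rule torus.integrable_const_bound[where B = "B\<^sup>2"])
    show "AE x in torus. norm ((cmod (f x))\<^sup>2) \<le> B\<^sup>2"
      using assms(2) by eventually_elim (auto intro: power_mono)
  qed measurable
qed measurable

lemma in_L2_mult:
  assumes "in_L2 f" "in_L2 g"
  shows "integrable torus (\<lambda>x. f x * g x)"
  using assms square_integrable_mult[of f torus g] unfolding in_L2_def by auto

lemma in_L2_cnj: "in_L2 f \<Longrightarrow> in_L2 (\<lambda>x. cnj (f x))"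
  unfolding in_L2_def by auto

lemma in_L2_scale: "in_L2 f \<Longrightarrow> in_L2 (\<lambda>x. c * f x)"
  unfolding in_L2_def by (auto simp: norm_mult power_mult_distrib)

lemma in_L2_add:
  assumes "in_L2 f" "in_L2 g" shows "in_L2 (\<lambda>x. f x + g x)"
  unfolding in_L2_def
proof
  have [measurable]: "f \<in> borel_measurable torus" "g \<in> borel_measurable torus"
    using assms by (auto simp: in_L2_def)
  show "(\<lambda>x. f x + g x) \<in> borel_measurable torus" by measurable
  show "integrable torus (\<lambda>x. (cmod (f x + g x))\<^sup>2)"
  proof (rule Bochner_Integration.integrable_bound)
    show "integrable torus (\<lambda>x. 2 * (cmod (f x))\<^sup>2 + 2 * (cmod (g x))\<^sup>2)"
      using assms by (simp add: in_L2_def)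
    show "AE x in torus. norm ((cmod (f x + g x))\<^sup>2) \<le> norm (2 * (cmod (f x))\<^sup>2 + 2 * (cmod (g x))\<^sup>2)"
    proof (rule AE_I2)
      fix x
      have "(cmod (f x + g x))\<^sup>2 \<le> (cmod (f x) + cmod (g x))\<^sup>2"
        by (intro power_mono norm_triangle_ineq) simp
      also have "\<dots> \<le> 2 * (cmod (f x))\<^sup>2 + 2 * (cmod (g x))\<^sup>2"
        using sum_squares_bound[of "cmod (f x)" "cmod (g x)"] by (simp add: power2_sum)
      finally show "norm ((cmod (f x + g x))\<^sup>2) \<le> norm (2 * (cmod (f x))\<^sup>2 + 2 * (cmod (g x))\<^sup>2)"
        by simp
    qed
  qed measurable
qed

lemma in_L2_diff:
  assumes "in_L2 f" "in_L2 g" shows "in_L2 (\<lambda>x. f x - g x)"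
  using in_L2_add[OF assms(1) in_L2_scale[OF assms(2), of "-1"]] by simp

lemma in_L2_sum:
  "finite I \<Longrightarrow> (\<And>i. i \<in> I \<Longrightarrow> in_L2 (F i)) \<Longrightarrow> in_L2 (\<lambda>x. \<Sum>i\<in>I. F i x)"
proof (induction I rule: finite_induct)
  case empty show ?case by (simp add: in_L2_def)
next
  case (insert i I) then show ?case by (simp add: in_L2_add)
qed

lemma in_L2_cis: "in_L2 (\<lambda>x. c * cis (of_int n * x))"
  by (rule in_L2_bounded[where B = "cmod c"]) (auto simp: norm_mult)

lemma in_L2_trig: "finite I \<Longrightarrow> in_L2 (\<lambda>x. \<Sum>n\<in>I. \<alpha> n * cis (of_int n * x))"
  by (intro in_L2_sum in_L2_cis)

lemma in_L2_integrable: "in_L2 f \<Longrightarrow> integrable torus f"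
  using in_L2_mult[of f "\<lambda>_. 1"] in_L2_cis[of 1 0] by simp

lemma norm_L2_triangle:
  assumes f: "in_L2 f" and g: "in_L2 g"
  shows "norm_L2 (\<lambda>x. f x + g x) \<le> norm_L2 f + norm_L2 g"
proof (rule power2_le_imp_le)
  have [measurable]: "f \<in> borel_measurable torus" "g \<in> borel_measurable torus"
    using assms by (auto simp: in_L2_def)
  note i = f[unfolded in_L2_def, THEN conjunct2] g[unfolded in_L2_def, THEN conjunct2]
  have fg: "integrable torus (\<lambda>x. cmod (f x) * cmod (g x))"
    using integrable_norm[OF in_L2_mult[OF assms]] by (simp add: norm_mult)
  have "(norm_L2 (\<lambda>x. f x + g x))\<^sup>2 = (LINT x|torus. (cmod (f x + g x))\<^sup>2)"
    by (simp add: norm_L2_power2)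
  also have "\<dots> \<le> (LINT x|torus. (cmod (f x))\<^sup>2 + (cmod (g x))\<^sup>2 + 2 * (cmod (f x) * cmod (g x)))"
  proof (rule integral_mono)
    show "integrable torus (\<lambda>x. (cmod (f x + g x))\<^sup>2)" using in_L2_add[OF assms] by (simp add: in_L2_def)
    show "integrable torus (\<lambda>x. (cmod (f x))\<^sup>2 + (cmod (g x))\<^sup>2 + 2 * (cmod (f x) * cmod (g x)))"
      using i fg by simp
    fix x
    have "(cmod (f x + g x))\<^sup>2 \<le> (cmod (f x) + cmod (g x))\<^sup>2"
      by (intro power_mono norm_triangle_ineq) simp
    then show "(cmod (f x + g x))\<^sup>2 \<le> (cmod (f x))\<^sup>2 + (cmod (g x))\<^sup>2 + 2 * (cmod (f x) * cmod (g x))"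
      by (simp add: power2_sum)
  qed
  also have "\<dots> = (norm_L2 f)\<^sup>2 + (norm_L2 g)\<^sup>2 + 2 * (LINT x|torus. cmod (f x) * cmod (g x))"
    using i fg by (simp add: norm_L2_power2)
  also have "(LINT x|torus. cmod (f x) * cmod (g x)) \<le> norm_L2 f * norm_L2 g"
    unfolding norm_L2_def real_sqrt_mult[symmetric]
    by (rule real_le_rsqrt, rule Cauchy_Schwarz_integral) (use i in auto)
  finally show "(norm_L2 (\<lambda>x. f x + g x))\<^sup>2 \<le> (norm_L2 f + norm_L2 g)\<^sup>2"
    by (simp add: power2_sum)
qed simp

lemma norm_L2_scale: "norm_L2 (\<lambda>x. c * f x) = cmod c * norm_L2 f"
  unfolding norm_L2_def by (simp add: norm_mult power_mult_distrib real_sqrt_mult)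

lemma norm_L2_minus_commute: "norm_L2 (\<lambda>x. f x - g x) = norm_L2 (\<lambda>x. g x - f x)"
  unfolding norm_L2_def by (simp add: norm_minus_commute)

lemma norm_L2_triangle_diff:
  assumes "in_L2 f" "in_L2 g" "in_L2 h"
  shows "norm_L2 (\<lambda>x. f x - h x) \<le> norm_L2 (\<lambda>x. f x - g x) + norm_L2 (\<lambda>x. g x - h x)"
  using norm_L2_triangle[OF in_L2_diff[OF assms(1,2)] in_L2_diff[OF assms(2,3)]] by simp

lemma norm_L2_diff_lower:
  assumes f: "in_L2 f" and g: "in_L2 g"
  shows "\<bar>norm_L2 f - norm_L2 g\<bar> \<le> norm_L2 (\<lambda>x. f x - g x)"
  using norm_L2_triangle[OF in_L2_diff[OF f g] g] norm_L2_triangle[OF in_L2_diff[OF g f] f]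
  by (simp add: norm_L2_minus_commute[of f g])

lemma norm_L2_bound:
  assumes "f \<in> borel_measurable torus" and "AE x in torus. cmod (f x) \<le> B" and "0 \<le> B"
  shows "norm_L2 f \<le> sqrt (2 * pi) * B"
proof -
  have "(LINT x|torus. (cmod (f x))\<^sup>2) \<le> (LINT x|torus. B\<^sup>2)"
  proof (rule integral_mono_AE)
    show "integrable torus (\<lambda>x. (cmod (f x))\<^sup>2)" using in_L2_bounded[OF assms(1,2)] by (simp add: in_L2_def)
    show "AE x in torus. (cmod (f x))\<^sup>2 \<le> B\<^sup>2"
      using assms(2) by eventually_elim (auto intro: power_mono)
  qed simp
  then have "norm_L2 f \<le> sqrt (2 * pi * B\<^sup>2)" unfolding norm_L2_def by simp
  then show ?thesis using assms(3) by (simp add: real_sqrt_mult)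
qed

lemma has_vector_derivative_cis:
  "((\<lambda>x. cis (a * x)) has_vector_derivative (\<i> * of_real a * cis (a * x))) (at x within S)"
proof -
  have "((\<lambda>z. exp (\<i> * of_real a * z)) has_field_derivative
      (\<i> * of_real a * exp (\<i> * of_real a * of_real x))) (at (of_real x))"
    by (auto intro!: derivative_eq_intros)
  from has_vector_derivative_real_field[OF this, of S] show ?thesis
    by (simp add: cis_conv_exp mult.assoc)
qed

lemma integral_torus_eq:
  fixes f :: "real \<Rightarrow> complex"
  assumes [measurable]: "f \<in> borel_measurable borel"
  shows "(LINT x|torus. f x) = (LBINT x=ereal 0..ereal (2*pi). f x)"
proof -
  have "(LINT x|torus. f x) = (LINT x:{0..<2*pi}|lborel. f x)"
    unfolding torus_def set_lebesgue_integral_def by (rule integral_restrict_space) simp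
  also have "\<dots> = (LINT x:{0..2*pi}|lborel. f x)"
  proof (rule set_integral_cong_set)
    have "AE x in lborel. x \<noteq> 2 * pi" by (rule AE_lborel_singleton)
    then show "AE x in lborel. (x \<in> {0..2 * pi}) = (x \<in> {0..<2 * pi})"
      by eventually_elim auto
  qed (auto simp: set_borel_measurable_def)
  also have "\<dots> = (LBINT x=ereal 0..ereal (2*pi). f x)"
    by (rule interval_integral_Icc[symmetric]) simp
  finally show ?thesis .
qed

lemma integral_cis_torus: "(LINT x|torus. cis (of_int n * x)) = (if n = 0 then 2 * pi else 0)"
proof (cases "n = 0")
  case True then show ?thesis by (simp add: scaleR_conv_of_real)
next
  case False
  define F where "F x = cis (of_int n * x) / (\<i> * of_int n)" for x :: real
  have "(LINT x|torus. cis (of_int n * x)) = (LBINT x=ereal 0..ereal (2*pi). cis (of_int n * x))"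
    by (rule integral_torus_eq) measurable
  also have "\<dots> = F (2 * pi) - F 0"
  proof (rule interval_integral_FTC_finite)
    show "continuous_on {min 0 (2*pi)..max 0 (2 * pi)} (\<lambda>x. cis (of_int n * x))"
      by (intro continuous_intros)
    fix x :: real
    have "((\<lambda>x. cis (of_int n * x) / (\<i> * of_int n)) has_vector_derivative
        (\<i> * of_real (of_int n) * cis (of_int n * x)) / (\<i> * of_int n)) (at x within {min 0 (2*pi)..max 0 (2 * pi)})"
      by (intro has_vector_derivative_divide has_vector_derivative_cis)
    then show "(F has_vector_derivative cis (of_int n * x)) (at x within {min 0 (2*pi)..max 0 (2 * pi)})"
      unfolding F_def using False by simp
  qed
  also have "\<dots> = 0"
  proof -
    have "cis (of_int n * (2 * pi)) = 1"
      using cis_multiple_2pi[of "of_int n"] by (simp add: mult.commute)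
    then show ?thesis by (simp add: F_def)
  qed
  finally show ?thesis using False by simp
qed

subsection \<open>Fourier coefficients\<close>

lemma fc_add:
  assumes "in_L2 f" "in_L2 g"
  shows "fourier_coefficient (\<lambda>x. f x + g x) n = fourier_coefficient f n + fourier_coefficient g n"
proof -
  have "integrable torus (\<lambda>x. f x * cis (- (of_int n * x)))" "integrable torus (\<lambda>x. g x * cis (- (of_int n * x)))"
    using in_L2_mult[OF assms(1) in_L2_cis[of 1 "-n"]] in_L2_mult[OF assms(2) in_L2_cis[of 1 "-n"]] by simp_all
  then show ?thesis unfolding fourier_coefficient_def by (simp add: distrib_right add_divide_distrib)
qed

lemma fc_scale: "fourier_coefficient (\<lambda>x. c * f x) n = c * fourier_coefficient f n"
  unfolding fourier_coefficient_def by (simp add: mult.assoc)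

lemma fc_diff:
  assumes "in_L2 f" "in_L2 g"
  shows "fourier_coefficient (\<lambda>x. f x - g x) n = fourier_coefficient f n - fourier_coefficient g n"
  using fc_add[OF assms(1) in_L2_scale[OF assms(2), of "-1"]] fc_scale[of "-1" g n] by simp

lemma fc_cis: "fourier_coefficient (\<lambda>x. c * cis (of_int m * x)) n = (if m = n then c else 0)"
proof -
  have "(\<lambda>x. cis (of_int m * x) * cis (- (of_int n * x))) = (\<lambda>x. cis (of_int (m - n) * x))"
    by (simp add: cis_mult fun_eq_iff algebra_simps)
  note eq = this
  have "fourier_coefficient (\<lambda>x. c * cis (of_int m * x)) n
      = c * (LINT x|torus. cis (of_int (m - n) * x)) / (2 * pi)"
    unfolding fourier_coefficient_def mult.assoc integral_mult_right_zero eq ..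
  then show ?thesis unfolding integral_cis_torus by simp
qed

lemma fc_sum:
  assumes "finite I" "\<And>i. i \<in> I \<Longrightarrow> in_L2 (F i)"
  shows "fourier_coefficient (\<lambda>x. \<Sum>i\<in>I. F i x) n = (\<Sum>i\<in>I. fourier_coefficient (F i) n)"
  using assms
proof (induction I rule: finite_induct)
  case empty show ?case by (simp add: fourier_coefficient_def)
next
  case (insert i I)
  then have "in_L2 (\<lambda>x. \<Sum>i\<in>I. F i x)" by (intro in_L2_sum) auto
  then show ?case using insert by (simp add: fc_add)
qed

lemma fc_trig:
  assumes "finite I"
  shows "fourier_coefficient (\<lambda>x. \<Sum>m\<in>I. \<alpha> m * cis (of_int m * x)) n = (if n \<in> I then \<alpha> n else 0)"
  using assms by (subst fc_sum) (auto simp: in_L2_cis fc_cis)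

lemma integrable_mult_cis:
  assumes "integrable torus f"
  shows "integrable torus (\<lambda>x. f x * cis (a * x))"
  by (rule Bochner_Integration.integrable_bound[OF assms]) (use assms in \<open>auto simp: norm_mult\<close>)

text \<open>Only integrability of \<open>f\<close> is assumed, because the identity is also applied
  to the cubic term of an L4 function, which need not be square integrable.\<close>

lemma integral_mult_cnj_trig:
  assumes f: "integrable torus f" and I: "finite I"
  shows "(LINT x|torus. f x * cnj (\<Sum>m\<in>I. \<alpha> m * cis (of_int m * x)))
    = 2 * pi * (\<Sum>m\<in>I. fourier_coefficient f m * cnj (\<alpha> m))"
proof -
  have i: "integrable torus (\<lambda>x. f x * cis (- (of_int m * x)))" for m
    using integrable_mult_cis[OF f, of "- of_int m"] by simp
  have "(\<lambda>x. f x * cnj (\<Sum>m\<in>I. \<alpha> m * cis (of_int m * x)))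
      = (\<lambda>x. \<Sum>m\<in>I. cnj (\<alpha> m) * (f x * cis (- (of_int m * x))))"
    by (simp add: fun_eq_iff sum_distrib_left cis_cnj algebra_simps)
  then have "(LINT x|torus. f x * cnj (\<Sum>m\<in>I. \<alpha> m * cis (of_int m * x)))
      = (\<Sum>m\<in>I. cnj (\<alpha> m) * (LINT x|torus. f x * cis (- (of_int m * x))))"
    using i by (simp add: Bochner_Integration.integral_sum)
  then show ?thesis
    by (simp add: fourier_coefficient_def sum_distrib_left algebra_simps)
qed

lemma norm_L2_diff_power2:
  assumes f: "in_L2 f" and g: "in_L2 g"
  shows "(norm_L2 (\<lambda>x. f x - g x))\<^sup>2
    = (norm_L2 f)\<^sup>2 + (norm_L2 g)\<^sup>2 - 2 * Re (LINT x|torus. f x * cnj (g x))"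
proof -
  have i: "integrable torus (\<lambda>x. f x * cnj (g x))" by (rule in_L2_mult[OF f in_L2_cnj[OF g]])
  have eq: "(cmod (f x - g x))\<^sup>2 = (cmod (f x))\<^sup>2 + (cmod (g x))\<^sup>2 - 2 * Re (f x * cnj (g x))" for x
    by (simp only: cmod_power2) (simp add: power2_eq_square algebra_simps)
  define R where "R x = Re (f x * cnj (g x))" for x
  have "integrable torus R" unfolding R_def using i by (rule integrable_Re)
  moreover have "(LINT x|torus. R x) = Re (LINT x|torus. f x * cnj (g x))"
    unfolding R_def using i by (rule integral_Re)
  ultimately show ?thesis using f g
    unfolding norm_L2_power2 eq in_L2_def R_def[symmetric] by simp
qed

lemma norm_L2_trig:
  assumes "finite I"
  shows "(norm_L2 (\<lambda>x. \<Sum>m\<in>I. \<alpha> m * cis (of_int m * x)))\<^sup>2 = 2 * pi * (\<Sum>m\<in>I. (cmod (\<alpha> m))\<^sup>2)"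
proof -
  let ?p = "\<lambda>x. \<Sum>m\<in>I. \<alpha> m * cis (of_int m * x)"
  have "complex_of_real ((norm_L2 ?p)\<^sup>2) = (LINT x|torus. ?p x * cnj (?p x))"
    by (simp only: norm_L2_power2 integral_complex_of_real[symmetric] complex_norm_square)
  also have "\<dots> = 2 * pi * (\<Sum>m\<in>I. fourier_coefficient ?p m * cnj (\<alpha> m))"
    using assms by (intro integral_mult_cnj_trig in_L2_integrable in_L2_trig)
  also have "(\<Sum>m\<in>I. fourier_coefficient ?p m * cnj (\<alpha> m)) = (\<Sum>m\<in>I. of_real ((cmod (\<alpha> m))\<^sup>2))"
    by (intro sum.cong refl) (simp add: fc_trig[OF assms] complex_norm_square[symmetric])
  finally show ?thesis unfolding of_real_sum[symmetric] of_real_mult[symmetric] of_real_eq_iff .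
qed

text \<open>Completing the square: \<alpha> enters only through its distance to the Fourier
  coefficients. Bessel's inequality, best approximation, the error of the Fejer means and that of
  the Picard iterates are all read off from this identity.\<close>

lemma norm_L2_diff_trig:
  assumes f: "in_L2 f" and I: "finite I"
  shows "(norm_L2 (\<lambda>x. f x - (\<Sum>m\<in>I. \<alpha> m * cis (of_int m * x))))\<^sup>2
    = (norm_L2 f)\<^sup>2 - 2 * pi * (\<Sum>m\<in>I. (cmod (fourier_coefficient f m))\<^sup>2)
      + 2 * pi * (\<Sum>m\<in>I. (cmod (fourier_coefficient f m - \<alpha> m))\<^sup>2)"
proof -
  have eq: "(cmod (z - w))\<^sup>2 = (cmod z)\<^sup>2 + (cmod w)\<^sup>2 - 2 * Re (z * cnj w)" for z w
    by (simp only: cmod_power2) (simp add: power2_eq_square algebra_simps)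
  show ?thesis
    unfolding norm_L2_diff_power2[OF f in_L2_trig[OF I]] integral_mult_cnj_trig[OF in_L2_integrable[OF f] I]
      norm_L2_trig[OF I] eq
    by (simp add: sum.distrib sum_subtractf sum_distrib_left algebra_simps)
qed

lemma Bessel_inequality:
  assumes f: "in_L2 f" and I: "finite I"
  shows "2 * pi * (\<Sum>m\<in>I. (cmod (fourier_coefficient f m))\<^sup>2) \<le> (norm_L2 f)\<^sup>2"
proof -
  have "0 \<le> (norm_L2 (\<lambda>x. f x - (\<Sum>m\<in>I. fourier_coefficient f m * cis (of_int m * x))))\<^sup>2" by simp
  then show ?thesis unfolding norm_L2_diff_trig[OF f I] by simp
qed

lemma best_approximation:
  assumes f: "in_L2 f" and I: "finite I"
  shows "norm_L2 (\<lambda>x. f x - (\<Sum>m\<in>I. fourier_coefficient f m * cis (of_int m * x)))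
    \<le> norm_L2 (\<lambda>x. f x - (\<Sum>m\<in>I. \<alpha> m * cis (of_int m * x)))"
  by (rule power2_le_imp_le) (simp_all add: norm_L2_diff_trig[OF f I] sum_nonneg)

lemma fc_bound:
  assumes f: "in_L2 f"
  shows "(cmod (fourier_coefficient f n))\<^sup>2 \<le> (norm_L2 f)\<^sup>2 / (2 * pi)"
  using Bessel_inequality[OF f, of "{n}"] by (simp add: field_simps)

subsection \<open>Density of trigonometric polynomials\<close>

text \<open>The inductive form carries no index set, so closure under products takes two short
  inductions; \<open>trig_poly_sum\<close> recovers a finite sum.\<close>

inductive trig_poly :: "(real \<Rightarrow> complex) \<Rightarrow> bool" where
  mono: "trig_poly (\<lambda>x. c * cis (of_int n * x))"
| add: "trig_poly f \<Longrightarrow> trig_poly g \<Longrightarrow> trig_poly (\<lambda>x. f x + g x)"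

lemma trig_poly_const: "trig_poly (\<lambda>x. c)"
  using trig_poly.mono[of c 0] by simp

lemma trig_poly_mult_mono: "trig_poly f \<Longrightarrow> trig_poly (\<lambda>x. c * cis (of_int n * x) * f x)"
proof (induction rule: trig_poly.induct)
  case (mono c' m)
  have "(\<lambda>x. c * cis (of_int n * x) * (c' * cis (of_int m * x))) = (\<lambda>x. (c * c') * cis (of_int (n + m) * x))"
  proof
    fix x
    have "cis (of_int n * x) * cis (of_int m * x) = cis (of_int (n + m) * x)"
      by (simp add: cis_mult algebra_simps)
    then show "c * cis (of_int n * x) * (c' * cis (of_int m * x)) = (c * c') * cis (of_int (n + m) * x)"
      by (metis mult.assoc mult.left_commute)
  qed
  then show ?case using trig_poly.mono[of "c * c'" "n + m"] by metis
next
  case (add f g) then show ?case by (simp add: distrib_left trig_poly.add)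
qed

lemma trig_poly_mult: "trig_poly f \<Longrightarrow> trig_poly g \<Longrightarrow> trig_poly (\<lambda>x. f x * g x)"
proof (induction rule: trig_poly.induct)
  case (mono c n) then show ?case by (rule trig_poly_mult_mono)
next
  case (add f1 f2) then show ?case by (simp add: distrib_right trig_poly.add)
qed

lemma trig_poly_sum:
  assumes "trig_poly f"
  shows "\<exists>I \<alpha>. finite I \<and> f = (\<lambda>x. \<Sum>m\<in>I. \<alpha> m * cis (of_int m * x))"
  using assms
proof (induction rule: trig_poly.induct)
  case (mono c n) show ?case by (intro exI[of _ "{n}"] exI[of _ "\<lambda>_. c"]) simp
next
  case (add f g)
  then obtain I \<alpha> J \<beta> where I: "finite I" "f = (\<lambda>x. \<Sum>m\<in>I. \<alpha> m * cis (of_int m * x))"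
    and J: "finite J" "g = (\<lambda>x. \<Sum>m\<in>J. \<beta> m * cis (of_int m * x))" by blast
  have "f x = (\<Sum>m\<in>I \<union> J. (if m \<in> I then \<alpha> m else 0) * cis (of_int m * x))" for x
    unfolding I(2) using I(1) J(1) by (intro sum.mono_neutral_cong_left) auto
  moreover have "g x = (\<Sum>m\<in>I \<union> J. (if m \<in> J then \<beta> m else 0) * cis (of_int m * x))" for x
    unfolding J(2) using I(1) J(1) by (intro sum.mono_neutral_cong_left) auto
  ultimately have "(\<lambda>x. f x + g x) = (\<lambda>x. \<Sum>m\<in>I \<union> J.
      ((if m \<in> I then \<alpha> m else 0) + (if m \<in> J then \<beta> m else 0)) * cis (of_int m * x))"
    by (simp add: sum.distrib distrib_right fun_eq_iff)
  then show ?case using I(1) J(1)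
    by (intro exI[of _ "I \<union> J"] exI[of _ "\<lambda>m. (if m \<in> I then \<alpha> m else 0) + (if m \<in> J then \<beta> m else 0)"]) simp
qed

lemma in_L2_trig_poly: "trig_poly f \<Longrightarrow> in_L2 f"
  using trig_poly_sum in_L2_trig by metis

lemma trig_poly_real_polynomial:
  assumes "real_polynomial_function h"
  shows "trig_poly (\<lambda>x. of_real (h (cis x)))"
  using assms
proof (induction rule: real_polynomial_function.induct)
  case (linear h)
  \<comment> \<open>A real-linear map on the plane is determined by \<open>h 1\<close> and
    \<open>h \<i>\<close>; Euler's formulas turn cosine and sine into the frequencies 1 and
    -1.\<close>
  have "complex_of_real (h (cis x)) = ((of_real (h 1) - \<i> * of_real (h \<i>)) / 2) * cis (of_int 1 * x)
      + ((of_real (h 1) + \<i> * of_real (h \<i>)) / 2) * cis (of_int (-1) * x)" for x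
  proof -
    have c: "cis x = cos x *\<^sub>R 1 + sin x *\<^sub>R \<i>" by (simp add: complex_eq_iff)
    have "h (cis x) = cos x * h 1 + sin x * h \<i>"
      unfolding c using bounded_linear.linear[OF linear] by (simp add: linear_add linear_scale)
    then show ?thesis by (simp add: complex_eq_iff field_simps)
  qed
  then show ?case using trig_poly.add[OF trig_poly.mono trig_poly.mono] by presburger
next
  case (const c) show ?case by (rule trig_poly_const)
next
  case (add f g) then show ?case by (simp add: trig_poly.add)
next
  case (mult f g) then show ?case by (simp add: trig_poly_mult)
qed

section \<open>Density: from continuous functions to Borel indicators to all of L2\<close>

definition trig_closure :: "(real \<Rightarrow> complex) \<Rightarrow> bool" where
  "trig_closure f \<longleftrightarrow> in_L2 f \<and> (\<forall>\<delta>>0. \<exists>p. trig_poly p \<and> norm_L2 (\<lambda>x. f x - p x) < \<delta>)"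

lemma trig_closure_add:
  assumes f: "trig_closure f" and g: "trig_closure g"
  shows "trig_closure (\<lambda>x. f x + g x)"
  unfolding trig_closure_def
proof (intro conjI allI impI)
  show "in_L2 (\<lambda>x. f x + g x)" using f g by (intro in_L2_add) (auto simp: trig_closure_def)
  fix \<delta> :: real assume "0 < \<delta>"
  then obtain p q where p: "trig_poly p" "norm_L2 (\<lambda>x. f x - p x) < \<delta>/2"
    and q: "trig_poly q" "norm_L2 (\<lambda>x. g x - q x) < \<delta>/2"
    using f g unfolding trig_closure_def by (meson half_gt_zero)
  have "in_L2 (\<lambda>x. f x - p x)" "in_L2 (\<lambda>x. g x - q x)"
    using f g in_L2_diff[OF _ in_L2_trig_poly[OF p(1)]] in_L2_diff[OF _ in_L2_trig_poly[OF q(1)]]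
    by (simp_all add: trig_closure_def)
  from norm_L2_triangle[OF this]
  have "norm_L2 (\<lambda>x. (f x + g x) - (p x + q x)) < \<delta>" using p q by (simp add: algebra_simps)
  then show "\<exists>p. trig_poly p \<and> norm_L2 (\<lambda>x. f x + g x - p x) < \<delta>"
    using trig_poly.add[OF p(1) q(1)] by blast
qed

lemma trig_closure_trig_poly: "trig_poly p \<Longrightarrow> trig_closure p"
  unfolding trig_closure_def by (auto simp: in_L2_trig_poly norm_L2_def intro!: exI[of _ p])

lemma trig_closure_limit:
  assumes f: "in_L2 f" and "\<And>k. trig_closure (h k)"
    and lim: "(\<lambda>k::nat. norm_L2 (\<lambda>x. f x - h k x)) \<longlonglongrightarrow> 0"
  shows "trig_closure f"
  unfolding trig_closure_def
proof (intro conjI allI impI f)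
  fix \<delta> :: real assume "0 < \<delta>"
  then have "eventually (\<lambda>k. norm_L2 (\<lambda>x. f x - h k x) < \<delta>/2) sequentially"
    by (intro order_tendstoD(2)[OF lim]) simp
  then obtain k where k: "norm_L2 (\<lambda>x. f x - h k x) < \<delta>/2" by (auto simp: eventually_sequentially)
  obtain p where p: "trig_poly p" "norm_L2 (\<lambda>x. h k x - p x) < \<delta>/2"
    using assms(2)[of k] \<open>0 < \<delta>\<close> unfolding trig_closure_def by (meson half_gt_zero)
  have "norm_L2 (\<lambda>x. f x - p x) < \<delta>"
    using norm_L2_triangle_diff[of f "h k" p] f assms(2)[of k] p k
    by (auto simp: trig_closure_def in_L2_trig_poly)
  then show "\<exists>p. trig_poly p \<and> norm_L2 (\<lambda>x. f x - p x) < \<delta>" using p by blast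
qed

lemma trig_closure_scale:
  assumes f: "trig_closure f" shows "trig_closure (\<lambda>x. c * f x)"
  unfolding trig_closure_def
proof (intro conjI allI impI)
  show "in_L2 (\<lambda>x. c * f x)" using f by (intro in_L2_scale) (auto simp: trig_closure_def)
  fix \<delta> :: real assume d: "0 < \<delta>"
  then obtain p where p: "trig_poly p" "norm_L2 (\<lambda>x. f x - p x) < \<delta> / (cmod c + 1)"
    using f unfolding trig_closure_def by (metis add_nonneg_pos divide_pos_pos norm_ge_zero zero_less_one)
  have "norm_L2 (\<lambda>x. c * f x - c * p x) = cmod c * norm_L2 (\<lambda>x. f x - p x)"
    using norm_L2_scale[of c "\<lambda>x. f x - p x"] by (simp add: right_diff_distrib)
  also have "\<dots> \<le> cmod c * (\<delta> / (cmod c + 1))" using p by (intro mult_left_mono) auto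
  also have "\<dots> < \<delta>"
  proof -
    have "0 < cmod c + 1" by (simp add: add_nonneg_pos)
    then show ?thesis using d by (simp add: pos_divide_less_eq distrib_left)
  qed
  finally show "\<exists>p. trig_poly p \<and> norm_L2 (\<lambda>x. c * f x - p x) < \<delta>"
    using trig_poly_mult[OF trig_poly_const p(1)] by blast
qed

lemma trig_closure_sum:
  "finite I \<Longrightarrow> (\<And>i. i \<in> I \<Longrightarrow> trig_closure (F i)) \<Longrightarrow> trig_closure (\<lambda>x. \<Sum>i\<in>I. F i x)"
  by (induction I rule: finite_induct) (auto simp: trig_closure_add trig_closure_trig_poly trig_poly_const)

lemma norm_L2_tendsto_0:
  assumes f: "f \<in> borel_measurable torus" and h: "\<And>k::nat. h k \<in> borel_measurable torus"
    and w: "in_L2 w" and lim: "AE x in torus. (\<lambda>k. h k x) \<longlonglongrightarrow> f x"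
    and dom: "\<And>k. AE x in torus. cmod (f x - h k x) \<le> cmod (w x)"
  shows "(\<lambda>k. norm_L2 (\<lambda>x. f x - h k x)) \<longlonglongrightarrow> 0"
proof -
  note [measurable] = f h
  have "(\<lambda>k. LINT x|torus. (cmod (f x - h k x))\<^sup>2) \<longlonglongrightarrow> (LINT x|torus. 0)"
  proof (rule integral_dominated_convergence)
    show "integrable torus (\<lambda>x. (cmod (w x))\<^sup>2)" using w by (simp add: in_L2_def)
    show "AE x in torus. (\<lambda>k. (cmod (f x - h k x))\<^sup>2) \<longlonglongrightarrow> 0"
      using lim
    proof eventually_elim
      case (elim x)
      have "(\<lambda>k. (cmod (f x - h k x))\<^sup>2) \<longlonglongrightarrow> (cmod (f x - f x))\<^sup>2"
        by (intro tendsto_intros elim)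
      then show ?case by simp
    qed
    show "AE x in torus. norm ((cmod (f x - h k x))\<^sup>2) \<le> (cmod (w x))\<^sup>2" for k
      using dom[of k] by eventually_elim (auto intro: power_mono)
  qed measurable
  then show ?thesis unfolding norm_L2_def using tendsto_real_sqrt[of _ 0] by fastforce
qed

text \<open>A function of \<open>cis x\<close> is periodic by construction, so the Stone-Weierstrass
  theorem is applied on the unit circle and no matching condition at the ends of the interval
  arises.\<close>

lemma trig_closure_continuous:
  fixes \<phi> :: "complex \<Rightarrow> real"
  assumes c: "continuous_on UNIV \<phi>"
  shows "trig_closure (\<lambda>x. of_real (\<phi> (cis x)))"
  unfolding trig_closure_def
proof (intro conjI allI impI)
  have m: "(\<lambda>x. complex_of_real (\<phi> (cis x))) \<in> borel_measurable borel"
    by (intro borel_measurable_continuous_onI continuous_intros continuous_on_compose2[OF c]) auto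
  obtain B where B: "\<And>z. z \<in> sphere 0 1 \<Longrightarrow> \<bar>\<phi> z\<bar> \<le> B"
  proof -
    have "compact (\<phi> ` sphere 0 1)"
      by (intro compact_continuous_image continuous_on_subset[OF c]) auto
    then show ?thesis using that compact_imp_bounded bounded_iff by (metis image_eqI real_norm_def)
  qed
  show "in_L2 (\<lambda>x. complex_of_real (\<phi> (cis x)))"
    by (rule in_L2_bounded[where B = B]) (auto intro!: measurable_torus_borel m B)
  fix \<delta> :: real assume d: "0 < \<delta>"
  \<comment> \<open>The tolerance \<delta> / 4 makes up for the factor \<open>sqrt (2 * pi)\<close>,
    less than 3, between the L2 norm and the sup norm.\<close>
  obtain h where h: "real_polynomial_function h" "\<And>z. z \<in> sphere 0 1 \<Longrightarrow> \<bar>\<phi> z - h z\<bar> < \<delta> / 4"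
    using Stone_Weierstrass_real_polynomial_function[of "sphere (0::complex) 1" \<phi> "\<delta>/4"] c d
    by (metis compact_sphere continuous_on_subset subset_UNIV zero_less_divide_iff zero_less_numeral)
  let ?p = "\<lambda>x. complex_of_real (h (cis x))"
  have p: "trig_poly ?p" by (rule trig_poly_real_polynomial[OF h(1)])
  have "norm_L2 (\<lambda>x. of_real (\<phi> (cis x)) - ?p x) \<le> sqrt (2 * pi) * (\<delta> / 4)"
  proof (rule norm_L2_bound)
    show "(\<lambda>x. of_real (\<phi> (cis x)) - ?p x) \<in> borel_measurable torus"
      using in_L2_measurable[OF in_L2_trig_poly[OF p]] measurable_torus_borel[OF m] by measurable
    have "cmod (of_real (\<phi> (cis x)) - ?p x) \<le> \<delta> / 4" for x
      using h(2)[of "cis x"] by (simp flip: of_real_diff)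
    then show "AE x in torus. cmod (of_real (\<phi> (cis x)) - ?p x) \<le> \<delta> / 4" by simp
  qed (use d in simp)
  also have "\<dots> < \<delta>"
  proof -
    have "sqrt (2 * pi) < sqrt 9" using pi_less_4 pi_approx(2) by (intro real_sqrt_less_mono) (simp, linarith?)
    also have "sqrt 9 = (3::real)" by (rule real_sqrt_unique) auto
    finally show ?thesis using d by (simp add: field_simps)
  qed
  finally show "\<exists>p. trig_poly p \<and> norm_L2 (\<lambda>x. of_real (\<phi> (cis x)) - p x) < \<delta>" using p by blast
qed

lemma trig_closure_open:
  assumes U: "open (U :: complex set)"
  shows "trig_closure (\<lambda>x. of_real (indicator U (cis x)))"
\<comment> \<open>The distance to the empty set is 0 by convention, so for the whole plane the
  approximants below would vanish identically.\<close>
proof (cases "U = UNIV")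
  case True then show ?thesis using trig_closure_trig_poly[OF trig_poly_const[of 1]] by simp
next
  case False
  let ?h = "\<lambda>(k::nat) z. min 1 (real k * infdist z (- U))"
  have [measurable]: "U \<in> sets borel" using U by simp
  have mU: "(\<lambda>x. complex_of_real (indicator U (cis x))) \<in> borel_measurable torus"
    by (intro measurable_torus_borel) measurable
  show ?thesis
  proof (rule trig_closure_limit)
    show "in_L2 (\<lambda>x. complex_of_real (indicator U (cis x)))"
      by (rule in_L2_bounded[OF mU, where B = 1]) (auto simp: indicator_def)
    show cl: "trig_closure (\<lambda>x. of_real (?h k (cis x)))" for k
      by (intro trig_closure_continuous continuous_intros)
    show "(\<lambda>k. norm_L2 (\<lambda>x. complex_of_real (indicator U (cis x)) - of_real (?h k (cis x)))) \<longlonglongrightarrow> 0"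
    proof (rule norm_L2_tendsto_0[OF mU])
      show "(\<lambda>x. complex_of_real (?h k (cis x))) \<in> borel_measurable torus" for k
        using cl by (auto simp: trig_closure_def in_L2_def)
      show "in_L2 (\<lambda>x. 1 * cis (of_int 0 * x))" by (rule in_L2_cis)
      have "(\<lambda>k. ?h k z) \<longlonglongrightarrow> indicator U z" for z
      proof (cases "z \<in> U")
        case True
        have "infdist z (- U) > 0"
          using True False U by (intro infdist_pos_not_in_closed) auto
        then obtain N :: nat where "1 < real N * infdist z (- U)" using reals_Archimedean3 by blast
        then have "1 \<le> real k * infdist z (- U)" if "k \<ge> N" for k
          using that by (smt (verit) infdist_nonneg mult_right_mono of_nat_mono)
        then have "\<forall>\<^sub>F k in sequentially. ?h k z = 1"
          by (auto simp: eventually_sequentially intro!: exI[of _ N])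
        then show ?thesis using True by (simp add: tendsto_eventually)
      next
        case False then show ?thesis by (simp add: infdist_zero)
      qed
      then show "AE x in torus. (\<lambda>k. complex_of_real (?h k (cis x))) \<longlonglongrightarrow> of_real (indicator U (cis x))"
        by (intro AE_I2 tendsto_of_real)
      have "cmod (complex_of_real (indicator U z) - of_real (?h k z)) \<le> 1" for k z
        using infdist_nonneg[of z "- U"]
        by (auto simp: indicator_def abs_le_iff simp flip: of_real_diff)
      then show "AE x in torus. cmod (complex_of_real (indicator U (cis x)) - of_real (?h k (cis x)))
          \<le> cmod (1 * cis (of_int 0 * x))" for k by simp
    qed
  qed
qed

text \<open>Dynkin's argument: open sets are stable under intersection, so only complements and
  countable disjoint unions remain. For the latter, the indicators of the finite unions are finite
  sums of indicators and increase to the limit.\<close>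

lemma trig_closure_borel:
  assumes "A \<in> sets (borel :: complex measure)"
  shows "trig_closure (\<lambda>x. of_real (indicator A (cis x)))"
proof -
  have eq: "sets borel = sigma_sets (UNIV :: complex set) {U. open U}" by (simp add: borel_def)
  have "Int_stable {U :: complex set. open U}" "{U. open U} \<subseteq> Pow (UNIV :: complex set)"
    "A \<in> sigma_sets UNIV {U. open U}" using assms eq by (auto simp: Int_stable_def)
  then show ?thesis
  proof (induction rule: sigma_sets_induct_disjoint)
    case (basic U) then show ?case by (auto intro: trig_closure_open)
  next
    case empty show ?case using trig_closure_trig_poly[OF trig_poly_const[of 0]] by simp
  next
    case (compl A)
    have "trig_closure (\<lambda>x. 1 + (-1) * of_real (indicator A (cis x)))"
      by (intro trig_closure_add trig_closure_scale compl trig_closure_trig_poly trig_poly_const)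
    moreover have "(1 + (-1) * complex_of_real (indicator A z)) = of_real (indicator (UNIV - A) z)" for z
      by (auto simp: indicator_def)
    ultimately show ?case by simp
  next
    case (union A)
    have mA: "A i \<in> sets borel" for i using union(2) eq by auto
    have mb: "(\<lambda>x. complex_of_real (indicator B (cis x))) \<in> borel_measurable torus"
      if [measurable]: "B \<in> sets borel" for B
      by (intro measurable_torus_borel) measurable
    let ?B = "\<lambda>k. \<Union>i<k. A i"
    have B: "trig_closure (\<lambda>x. of_real (indicator (?B k) (cis x)))" for k
    proof -
      have "complex_of_real (indicator (?B k) z) = (\<Sum>i<k. of_real (indicator (A i) z))" for z
        using union(1) by (subst indicator_UN_disjoint)
          (auto simp: disjoint_family_on_def)
      then show ?thesis using trig_closure_sum[of "{..<k}" "\<lambda>i x. of_real (indicator (A i) (cis x))"] union(3) by simp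
    qed
    show ?case
    proof (rule trig_closure_limit[OF _ B])
      have mU: "(\<lambda>x. complex_of_real (indicator (\<Union> (range A)) (cis x))) \<in> borel_measurable torus"
        using mA by (intro mb) auto
      then show "in_L2 (\<lambda>x. complex_of_real (indicator (\<Union> (range A)) (cis x)))"
        by (rule in_L2_bounded[where B = 1]) (auto simp: indicator_def)
      show "(\<lambda>k. norm_L2 (\<lambda>x. complex_of_real (indicator (\<Union> (range A)) (cis x)) - of_real (indicator (?B k) (cis x)))) \<longlonglongrightarrow> 0"
      proof (rule norm_L2_tendsto_0[OF mU])
        show "(\<lambda>x. complex_of_real (indicator (?B k) (cis x))) \<in> borel_measurable torus" for k
          using mA by (intro mb) auto
        show "in_L2 (\<lambda>x. 1 * cis (of_int 0 * x))" by (rule in_L2_cis)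
        have "(\<lambda>k. indicator (?B k) z :: real) \<longlonglongrightarrow> indicator (\<Union> (range A)) z" for z
          by (rule LIMSEQ_indicator_UN)
        then show "AE x in torus. (\<lambda>k. complex_of_real (indicator (?B k) (cis x))) \<longlonglongrightarrow> of_real (indicator (\<Union> (range A)) (cis x))"
          by (intro AE_I2 tendsto_of_real)
        show "AE x in torus. cmod (complex_of_real (indicator (\<Union> (range A)) (cis x)) - of_real (indicator (?B k) (cis x)))
          \<le> cmod (1 * cis (of_int 0 * x))" for k by (auto simp: indicator_def)
      qed
    qed
  qed
qed

lemma trig_closure_cong:
  assumes "\<And>x. x \<in> space torus \<Longrightarrow> f x = g x" and f: "trig_closure f"
  shows "trig_closure g"
proof -
  have "norm_L2 (\<lambda>x. f x - p x) = norm_L2 (\<lambda>x. g x - p x)" for p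
    unfolding norm_L2_def using assms(1)
    by (intro arg_cong[where f = sqrt] Bochner_Integration.integral_cong) auto
  moreover have "f \<in> borel_measurable torus \<longleftrightarrow> g \<in> borel_measurable torus"
    by (rule measurable_cong) (rule assms(1))
  moreover have "integrable torus (\<lambda>x. (cmod (f x))\<^sup>2) \<longleftrightarrow> integrable torus (\<lambda>x. (cmod (g x))\<^sup>2)"
    using assms(1) by (intro Bochner_Integration.integrable_cong) auto
  ultimately show ?thesis using f by (simp add: trig_closure_def in_L2_def)
qed

text \<open>A Borel inverse of \<open>cis\<close> on the fundamental domain; it turns a Borel subset
  of the interval into the trace of a Borel subset of the plane. The clamp keeps the argument of
  \<open>arccos\<close> in its domain away from the circle, so that measurability holds on the whole
  plane.\<close>

definition circle_angle :: "complex \<Rightarrow> real" where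
  "circle_angle z = (if Im z \<ge> 0 then arccos (max (-1) (min 1 (Re z)))
     else 2 * pi - arccos (max (-1) (min 1 (Re z))))"

lemma circle_angle_measurable [measurable]: "circle_angle \<in> borel_measurable borel"
proof -
  have [measurable]: "(\<lambda>z. arccos (max (-1) (min 1 (Re z)))) \<in> borel_measurable borel"
    by (intro borel_measurable_continuous_onI continuous_on_compose2[OF continuous_on_arccos'] continuous_intros)
      auto
  show ?thesis unfolding circle_angle_def[abs_def] by measurable
qed

lemma circle_angle_cis:
  assumes "x \<in> {0..<2 * pi}" shows "circle_angle (cis x) = x"
proof -
  have m: "max (-1) (min 1 (cos x)) = cos x" by (simp add: max_def min_def) (metis cos_ge_minus_one cos_le_one order_antisym_conv)
  show ?thesis
  proof (cases "x \<le> pi")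
    case True
    then have "0 \<le> sin x" using assms by (simp add: sin_ge_zero)
    then show ?thesis using True assms by (simp add: circle_angle_def m arccos_cos)
  next
    case False
    then have "sin x < 0" using assms by (simp add: sin_lt_zero)
    moreover have "arccos (cos x) = 2 * pi - x"
      using arccos_cos[of "2 * pi - x"] False assms by simp
    ultimately show ?thesis by (simp add: circle_angle_def m)
  qed
qed

lemma trig_closure_indicator:
  assumes "A \<in> sets torus"
  shows "trig_closure (\<lambda>x. of_real (indicator A x))"
proof (rule trig_closure_cong)
  have A: "A \<in> sets borel" using assms by (auto simp: torus_def sets_restrict_space)
  then have "circle_angle -` A \<in> sets borel" using measurable_sets_borel[OF circle_angle_measurable] by simp
  then show "trig_closure (\<lambda>x. of_real (indicator (circle_angle -` A) (cis x)))" by (rule trig_closure_borel)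
qed (simp add: indicator_def circle_angle_cis)

lemma trig_closure_L2:
  assumes f: "in_L2 f" shows "trig_closure f"
proof -
  have mf [measurable]: "f \<in> borel_measurable torus" using f by (simp add: in_L2_def)
  obtain s where s: "\<And>i::nat. simple_function torus (s i)"
      "\<And>x. x \<in> space torus \<Longrightarrow> (\<lambda>i. s i x) \<longlonglongrightarrow> f x"
      "\<And>i x. x \<in> space torus \<Longrightarrow> dist (s i x) 0 \<le> 2 * dist (f x) 0"
    using borel_measurable_implies_sequence_metric[OF mf, of 0] by blast
  have cs: "trig_closure (s i)" for i
  proof (rule trig_closure_cong)
    have fin: "finite (s i ` space torus)" using s(1)[of i] by (simp add: simple_function_def)
    show "trig_closure (\<lambda>x. \<Sum>y\<in>s i ` space torus. y * of_real (indicator (s i -` {y} \<inter> space torus) x))"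
      using s(1)[of i] fin
      by (intro trig_closure_sum trig_closure_scale trig_closure_indicator) (auto simp: simple_function_def)
    fix x assume x: "x \<in> space torus"
    have "(\<Sum>y\<in>s i ` space torus. y * of_real (indicator (s i -` {y} \<inter> space torus) x))
        = (\<Sum>y\<in>s i ` space torus. if y = s i x then y else 0)"
      using x by (intro sum.cong) (auto simp: indicator_def)
    also have "\<dots> = s i x" using fin x by (simp add: sum.delta)
    finally show "(\<Sum>y\<in>s i ` space torus. y * of_real (indicator (s i -` {y} \<inter> space torus) x)) = s i x" .
  qed
  show ?thesis
  proof (rule trig_closure_limit[OF f cs])
    show "(\<lambda>k. norm_L2 (\<lambda>x. f x - s k x)) \<longlonglongrightarrow> 0"
    proof (rule norm_L2_tendsto_0[OF mf])
      show "s k \<in> borel_measurable torus" for k using s(1) by (rule borel_measurable_simple_function)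
      \<comment> \<open>The simple functions satisfy
        \<open>cmod (s k x) \<le> 2 * cmod (f x)\<close>, hence the majorant with the factor 1 +
        2.\<close>
      show "in_L2 (\<lambda>x. 3 * f x)" using f by (rule in_L2_scale)
      show "AE x in torus. (\<lambda>k. s k x) \<longlonglongrightarrow> f x" using s(2) by (intro AE_I2)
      show "AE x in torus. cmod (f x - s k x) \<le> cmod (3 * f x)" for k
      proof (rule AE_I2)
        fix x assume "x \<in> space torus"
        from s(3)[OF this, of k] have "cmod (s k x) \<le> 2 * cmod (f x)" by simp
        then show "cmod (f x - s k x) \<le> cmod (3 * f x)"
          using norm_triangle_ineq4[of "f x" "s k x"] by (simp add: norm_mult)
      qed
    qed
  qed
qed

subsection \<open>Parseval's identity\<close>

text \<open>By \<open>best_approximation\<close>, every finite set that contains the frequencies of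
  an approximating polynomial does at least as well as the polynomial. This gives convergence along
  the net of all finite sets.\<close>

lemma fourier_series_L2:
  assumes f: "in_L2 f"
  shows "((\<lambda>I. norm_L2 (\<lambda>x. f x - (\<Sum>m\<in>I. fourier_coefficient f m * cis (of_int m * x)))) \<longlongrightarrow> 0)
    (finite_subsets_at_top UNIV)"
proof (rule tendstoI)
  fix \<delta> :: real assume "0 < \<delta>"
  then obtain p where p: "trig_poly p" "norm_L2 (\<lambda>x. f x - p x) < \<delta>"
    using trig_closure_L2[OF f] unfolding trig_closure_def by blast
  obtain I \<alpha> where I: "finite I" "p = (\<lambda>x. \<Sum>m\<in>I. \<alpha> m * cis (of_int m * x))"
    using trig_poly_sum[OF p(1)] by blast
  show "\<forall>\<^sub>F J in finite_subsets_at_top UNIV.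
    dist (norm_L2 (\<lambda>x. f x - (\<Sum>m\<in>J. fourier_coefficient f m * cis (of_int m * x)))) 0 < \<delta>"
    unfolding eventually_finite_subsets_at_top
  proof (intro exI[of _ I] conjI allI impI I(1) subset_UNIV)
    fix J :: "int set" assume J: "finite J \<and> I \<subseteq> J \<and> J \<subseteq> UNIV"
    have "p x = (\<Sum>m\<in>J. (if m \<in> I then \<alpha> m else 0) * cis (of_int m * x))" for x
      unfolding I(2) using J by (intro sum.mono_neutral_cong_left) auto
    then have "norm_L2 (\<lambda>x. f x - (\<Sum>m\<in>J. fourier_coefficient f m * cis (of_int m * x)))
        \<le> norm_L2 (\<lambda>x. f x - p x)"
      using best_approximation[OF f, of J "\<lambda>m. if m \<in> I then \<alpha> m else 0"] J by simp
    then show "dist (norm_L2 (\<lambda>x. f x - (\<Sum>m\<in>J. fourier_coefficient f m * cis (of_int m * x)))) 0 < \<delta>"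
      using p(2) by simp
  qed
qed

text \<open>Only \<open>g\<close> is truncated: the error is the inner product of \<open>f\<close>
  with the remainder of \<open>g\<close>, to which Cauchy-Schwarz applies.\<close>

lemma Parseval_inner:
  assumes f: "in_L2 f" and g: "in_L2 g"
  shows "((\<lambda>n. fourier_coefficient f n * cnj (fourier_coefficient g n)) has_sum
    ((LINT x|torus. f x * cnj (g x)) / (2 * pi))) UNIV"
proof -
  let ?p = "\<lambda>I x. \<Sum>m\<in>I. fourier_coefficient g m * cis (of_int m * x)"
  let ?L = "LINT x|torus. f x * cnj (g x)"
  have ev: "\<forall>\<^sub>F I in finite_subsets_at_top UNIV.
      cmod ((\<Sum>n\<in>I. fourier_coefficient f n * cnj (fourier_coefficient g n)) - ?L / (2 * pi))
        \<le> norm_L2 f * norm_L2 (\<lambda>x. g x - ?p I x)"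
  proof (rule eventually_finite_subsets_at_top_weakI)
    fix I :: "int set" assume I: "finite I"
    have gp: "in_L2 (\<lambda>x. g x - ?p I x)" by (intro in_L2_diff g in_L2_trig I)
    have "?L - 2 * pi * (\<Sum>n\<in>I. fourier_coefficient f n * cnj (fourier_coefficient g n))
        = (LINT x|torus. f x * cnj (g x) - f x * cnj (?p I x))"
      unfolding integral_mult_cnj_trig[OF in_L2_integrable[OF f] I, symmetric]
      by (rule Bochner_Integration.integral_diff[symmetric])
        (intro in_L2_mult f in_L2_cnj g in_L2_trig I)+
    also have "\<dots> = (LINT x|torus. f x * cnj (g x - ?p I x))"
      by (simp add: right_diff_distrib)
    also have "cmod \<dots> \<le> norm_L2 f * norm_L2 (\<lambda>x. g x - ?p I x)"
      using Cauchy_Schwarz_integral_norm[of f torus "\<lambda>x. cnj (g x - ?p I x)"] f in_L2_cnj[OF gp]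
      unfolding in_L2_def norm_L2_def complex_mod_cnj by blast
    finally have *: "cmod (?L - 2 * pi * (\<Sum>n\<in>I. fourier_coefficient f n * cnj (fourier_coefficient g n)))
        \<le> norm_L2 f * norm_L2 (\<lambda>x. g x - ?p I x)" .
    have "(\<Sum>n\<in>I. fourier_coefficient f n * cnj (fourier_coefficient g n)) - ?L / (2 * pi)
       = - (?L - 2 * pi * (\<Sum>n\<in>I. fourier_coefficient f n * cnj (fourier_coefficient g n))) / of_real (2 * pi)"
      by (simp add: field_simps)
    then have "cmod ((\<Sum>n\<in>I. fourier_coefficient f n * cnj (fourier_coefficient g n)) - ?L / (2 * pi))
       = cmod (?L - 2 * pi * (\<Sum>n\<in>I. fourier_coefficient f n * cnj (fourier_coefficient g n))) / (2 * pi)"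
      by (simp only: norm_divide norm_minus_cancel norm_of_real) simp
    also have "\<dots> \<le> cmod (?L - 2 * pi * (\<Sum>n\<in>I. fourier_coefficient f n * cnj (fourier_coefficient g n))) / 1"
      using pi_gt3 by (intro divide_left_mono) auto
    finally show "cmod ((\<Sum>n\<in>I. fourier_coefficient f n * cnj (fourier_coefficient g n)) - ?L / (2 * pi))
        \<le> norm_L2 f * norm_L2 (\<lambda>x. g x - ?p I x)" using * by simp
  qed
  have "((\<lambda>I. norm_L2 f * norm_L2 (\<lambda>x. g x - ?p I x)) \<longlongrightarrow> norm_L2 f * 0) (finite_subsets_at_top UNIV)"
    by (intro tendsto_intros fourier_series_L2 g)
  then have "((\<lambda>I. (\<Sum>n\<in>I. fourier_coefficient f n * cnj (fourier_coefficient g n)) - ?L / (2 * pi)) \<longlongrightarrow> 0)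
      (finite_subsets_at_top UNIV)"
    by (intro Lim_null_comparison[OF ev]) simp
  then show ?thesis unfolding has_sum_def by (rule LIM_zero_cancel)
qed

lemma Parseval:
  assumes f: "in_L2 f"
  shows "((\<lambda>n. (cmod (fourier_coefficient f n))\<^sup>2) has_sum ((norm_L2 f)\<^sup>2 / (2 * pi))) UNIV"
proof -
  have "of_real ((norm_L2 f)\<^sup>2 / (2 * pi)) = (LINT x|torus. f x * cnj (f x)) / (2 * pi)"
    by (simp only: norm_L2_power2 integral_complex_of_real[symmetric] complex_norm_square of_real_divide)
  then have "((\<lambda>n. complex_of_real ((cmod (fourier_coefficient f n))\<^sup>2)) has_sum
      of_real ((norm_L2 f)\<^sup>2 / (2 * pi))) UNIV"
    using Parseval_inner[OF f f] unfolding complex_norm_square by simp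
  then show ?thesis by (simp only: has_sum_of_real_iff)
qed

lemma fc_cnj: "fourier_coefficient (\<lambda>x. cnj (f x)) n = cnj (fourier_coefficient f (- n))"
proof -
  have "cnj (LINT x|torus. f x * cis (- (of_int (- n) * x))) = (LINT x|torus. cnj (f x * cis (- (of_int (- n) * x))))"
    by (rule Bochner_Integration.integral_cnj[symmetric])
  then show ?thesis unfolding fourier_coefficient_def by (simp add: cis_cnj)
qed

text \<open>Parseval's identity for \<open>f\<close> and the modulated conjugate \<open>?h\<close>
  of \<open>g\<close>, whose coefficient at \<open>k\<close> is the conjugate of that of
  \<open>g\<close> at \<open>n - k\<close>.\<close>

lemma fc_mult:
  assumes f: "in_L2 f" and g: "in_L2 g"
  shows "((\<lambda>k. fourier_coefficient f k * fourier_coefficient g (n - k)) has_sum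
    fourier_coefficient (\<lambda>x. f x * g x) n) UNIV"
proof -
  let ?h = "\<lambda>x. cnj (g x) * cis (of_int n * x)"
  have h: "in_L2 ?h"
    using in_L2_cnj[OF g] unfolding in_L2_def by (auto simp: norm_mult)
  have "fourier_coefficient ?h k = cnj (fourier_coefficient g (n - k))" for k
  proof -
    have "fourier_coefficient ?h k = fourier_coefficient (\<lambda>x. cnj (g x)) (k - n)"
      unfolding fourier_coefficient_def
      by (simp add: mult.assoc cis_mult algebra_simps)
    then show ?thesis by (simp add: fc_cnj)
  qed
  moreover have "(LINT x|torus. f x * cnj (?h x)) / (2 * pi) = fourier_coefficient (\<lambda>x. f x * g x) n"
    unfolding fourier_coefficient_def by (simp add: cis_cnj mult.assoc)
  ultimately show ?thesis using Parseval_inner[OF f h] by simp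
qed

text \<open>The squared excess of \<open>cmod (f x)\<close> over \<open>B\<close> is at most the
  squared distance of \<open>f x\<close> to any number of modulus at most \<open>B\<close>. Its
  integral is thus dominated by the squared L2 distance, along any filter and without passing to a
  subsequence that converges almost everywhere.\<close>

lemma AE_norm_le_limit:
  assumes f: "in_L2 f" and F: "F \<noteq> bot"
    and h: "\<forall>\<^sub>F k in F. in_L2 (h k) \<and> (AE x in torus. cmod (h k x) \<le> B)"
    and lim: "((\<lambda>k. norm_L2 (\<lambda>x. f x - h k x)) \<longlongrightarrow> 0) F"
  shows "AE x in torus. cmod (f x) \<le> B"
proof -
  have mf [measurable]: "f \<in> borel_measurable torus" using f by (simp add: in_L2_def)
  let ?e = "\<lambda>x. (max 0 (cmod (f x) - B))\<^sup>2"
  have le: "?e x \<le> (cmod (f x - z))\<^sup>2" if "cmod z \<le> B" for x z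
    using that norm_triangle_ineq2[of "f x" z] by (intro power_mono) auto
  have "\<forall>\<^sub>F k in F. integrable torus ?e \<and> (LINT x|torus. ?e x) \<le> (norm_L2 (\<lambda>x. f x - h k x))\<^sup>2"
    using h
  proof eventually_elim
    case (elim k)
    then have i: "integrable torus (\<lambda>x. (cmod (f x - h k x))\<^sup>2)"
      using in_L2_diff[OF f, of "h k"] by (simp add: in_L2_def)
    have ae: "AE x in torus. ?e x \<le> (cmod (f x - h k x))\<^sup>2"
      using elim[THEN conjunct2] by eventually_elim (rule le)
    have ie: "integrable torus ?e"
      by (rule Bochner_Integration.integrable_bound[OF i]) (use ae in auto)
    then show ?case using integral_mono_AE[OF ie i ae] by (simp add: norm_L2_power2)
  qed
  then have ie: "integrable torus ?e" and "\<forall>\<^sub>F k in F. (LINT x|torus. ?e x) \<le> (norm_L2 (\<lambda>x. f x - h k x))\<^sup>2"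
    using F by (auto simp: eventually_conj_iff)
  moreover have "((\<lambda>k. (norm_L2 (\<lambda>x. f x - h k x))\<^sup>2) \<longlongrightarrow> 0) F"
    using tendsto_power[OF lim, of 2] by simp
  ultimately have "(LINT x|torus. ?e x) \<le> 0"
    using tendsto_lowerbound F by blast
  moreover have "0 \<le> (LINT x|torus. ?e x)" by simp
  ultimately have "(LINT x|torus. ?e x) = 0" by simp
  then have "AE x in torus. ?e x = 0"
    using integral_nonneg_eq_0_iff_AE[OF ie] by simp
  then show ?thesis by eventually_elim (simp add: max_def split: if_splits)
qed

subsection \<open>Fejer means\<close>

text \<open>Fejer means take the place of partial sums because their kernel is positive: an
  essential bound passes from a function to all its means with the same constant, and back. The
  argument is a family of coefficients, since the means are also formed for coefficients not yet
  known to come from a function.\<close>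

definition fejer_mean :: "nat \<Rightarrow> (int \<Rightarrow> complex) \<Rightarrow> real \<Rightarrow> complex" where
  "fejer_mean k \<alpha> x = (\<Sum>n\<in>{- int k..int k}. (of_real (1 - \<bar>of_int n\<bar> / real k) * \<alpha> n) * cis (of_int n * x))"

text \<open>The difference n arises from k - |n| pairs. In the induction the new row, column and
  corner contribute the differences -k, ..., k exactly once each.\<close>

lemma sum_diff_pairs:
  fixes \<phi> :: "int \<Rightarrow> complex"
  shows "(\<Sum>j\<in>{0..<int k}. \<Sum>l\<in>{0..<int k}. \<phi> (j - l)) = (\<Sum>n\<in>{- int k..int k}. of_real (real k - \<bar>of_int n\<bar>) * \<phi> n)"
proof (induction k)
  case 0 show ?case by simp
next
  case (Suc k)
  let ?I = "{0..<int k}" and ?J = "{- int k..int k}"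
  have I: "{0..<int (Suc k)} = insert (int k) ?I" by auto
  have J: "{- int (Suc k)..int (Suc k)} = insert (int k + 1) (insert (- int k - 1) ?J)" by auto
  have "(\<Sum>j\<in>{0..<int (Suc k)}. \<Sum>l\<in>{0..<int (Suc k)}. \<phi> (j - l))
      = (\<Sum>j\<in>?I. \<Sum>l\<in>?I. \<phi> (j - l)) + ((\<Sum>j\<in>?I. \<phi> (j - int k)) + (\<phi> 0 + (\<Sum>l\<in>?I. \<phi> (int k - l))))"
    unfolding I by (simp add: sum.distrib)
  also have "(\<Sum>j\<in>?I. \<phi> (j - int k)) = (\<Sum>n\<in>{- int k..<0}. \<phi> n)"
    by (rule sum.reindex_bij_witness[of _ "\<lambda>n. n + int k" "\<lambda>j. j - int k"]) auto
  also have "(\<Sum>l\<in>?I. \<phi> (int k - l)) = (\<Sum>n\<in>{0<..int k}. \<phi> n)"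
    by (rule sum.reindex_bij_witness[of _ "\<lambda>n. int k - n" "\<lambda>j. int k - j"]) auto
  also have "(\<Sum>n\<in>{- int k..<0}. \<phi> n) + (\<phi> 0 + (\<Sum>n\<in>{0<..int k}. \<phi> n)) = (\<Sum>n\<in>?J. \<phi> n)"
  proof -
    have J: "?J = {- int k..<0} \<union> insert 0 {0<..int k}" by auto
    have "sum \<phi> ({- int k..<0} \<union> insert 0 {0<..int k}) = sum \<phi> {- int k..<0} + sum \<phi> (insert 0 {0<..int k})"
      by (rule sum.union_disjoint) auto
    then show ?thesis unfolding J by simp
  qed
  also have "(\<Sum>j\<in>?I. \<Sum>l\<in>?I. \<phi> (j - l)) + (\<Sum>n\<in>?J. \<phi> n)
      = (\<Sum>n\<in>?J. of_real (real (Suc k) - \<bar>of_int n\<bar>) * \<phi> n)"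
    unfolding Suc.IH by (simp add: sum.distrib[symmetric] algebra_simps)
  also have "\<dots> = (\<Sum>n\<in>{- int (Suc k)..int (Suc k)}. of_real (real (Suc k) - \<bar>of_int n\<bar>) * \<phi> n)"
    unfolding J by simp
  finally show ?case .
qed

lemma fejer_mean_pairs:
  assumes "k > 0"
  shows "fejer_mean k \<alpha> x = (\<Sum>j\<in>{0..<int k}. \<Sum>l\<in>{0..<int k}. \<alpha> (j - l) * cis (of_int (j - l) * x)) / of_nat k"
proof -
  have "of_real (1 - \<bar>of_int n\<bar> / real k) = of_real (real k - \<bar>of_int n\<bar>) / complex_of_nat k" for n :: int
    using assms by (simp add: field_simps)
  then show ?thesis
    unfolding sum_diff_pairs[of "\<lambda>n. \<alpha> n * cis (of_int n * x)" k] fejer_mean_def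
    by (simp add: sum_divide_distrib mult.assoc)
qed

text \<open>Positivity of the Fejer kernel: up to the factor 2 pi it is the squared modulus of an
  exponential sum \<open>p\<close> with k terms, divided by k, and the integral of
  \<open>(cmod (p y))\<^sup>2\<close> is 2 pi k.\<close>

lemma fejer_mean_bound:
  assumes h: "in_L2 h" and B: "AE x in torus. cmod (h x) \<le> B" and k: "k > 0"
  shows "cmod (fejer_mean k (fourier_coefficient h) x) \<le> B"
proof -
  have mh [measurable]: "h \<in> borel_measurable torus" using h by (simp add: in_L2_def)
  let ?I = "{0..<int k}"
  define p where "p y = (\<Sum>j\<in>?I. cis (- (of_int j * x)) * cis (of_int j * y))" for y
  have p: "in_L2 p" unfolding p_def by (intro in_L2_trig) simp
  have hi: "integrable torus (\<lambda>y. h y * cis (- (of_int m * y)))" for m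
    using in_L2_mult[OF h in_L2_cis[of 1 "-m"]] by simp
  have pw: "h y * (cnj (p y) * p y) = (\<Sum>j\<in>?I. \<Sum>l\<in>?I. cis (of_int (j - l) * x) * (h y * cis (- (of_int (j - l) * y))))" for y
  proof -
    have "cnj (p y) * p y = (\<Sum>j\<in>?I. \<Sum>l\<in>?I. (cis (of_int j * x) * cis (- (of_int j * y))) * (cis (- (of_int l * x)) * cis (of_int l * y)))"
      unfolding p_def by (simp add: sum_product cis_cnj)
    also have "\<dots> = (\<Sum>j\<in>?I. \<Sum>l\<in>?I. cis (of_int (j - l) * x) * cis (- (of_int (j - l) * y)))"
      by (intro sum.cong refl) (simp add: cis_mult algebra_simps)
    finally show ?thesis by (simp add: sum_distrib_left mult.left_commute)
  qed
  have "(LINT y|torus. h y * (cnj (p y) * p y))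
      = (\<Sum>j\<in>?I. \<Sum>l\<in>?I. cis (of_int (j - l) * x) * (LINT y|torus. h y * cis (- (of_int (j - l) * y))))"
    unfolding pw using hi by (simp add: Bochner_Integration.integral_sum del: of_int_diff)
  also have "\<dots> = 2 * pi * (of_nat k * fejer_mean k (fourier_coefficient h) x)"
    unfolding fejer_mean_pairs[OF k] using k
    by (simp add: fourier_coefficient_def sum_distrib_left sum_divide_distrib mult.commute)
  finally have eq: "2 * pi * (of_nat k * fejer_mean k (fourier_coefficient h) x) = (LINT y|torus. h y * (cnj (p y) * p y))" ..
  have n: "norm (h y * (cnj (p y) * p y)) = cmod (h y) * (cmod (p y))\<^sup>2" for y
    by (simp add: norm_mult power2_eq_square)
  have i2: "integrable torus (\<lambda>y. B * (cmod (p y))\<^sup>2)" using p by (simp add: in_L2_def)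
  have ae: "AE y in torus. norm (h y * (cnj (p y) * p y)) \<le> B * (cmod (p y))\<^sup>2"
    using B unfolding n by eventually_elim (intro mult_right_mono, auto)
  have mp [measurable]: "p \<in> borel_measurable torus" using p by (simp add: in_L2_def)
  have i1: "integrable torus (\<lambda>y. h y * (cnj (p y) * p y))"
    by (rule Bochner_Integration.integrable_bound[OF i2]) (use ae in \<open>auto elim: eventually_mono\<close>)
  have "2 * pi * (real k * cmod (fejer_mean k (fourier_coefficient h) x)) = cmod (LINT y|torus. h y * (cnj (p y) * p y))"
    unfolding eq[symmetric] by (simp add: norm_mult)
  also have "\<dots> \<le> (LINT y|torus. B * (cmod (p y))\<^sup>2)"
    using integral_norm_bound[of torus "\<lambda>y. h y * (cnj (p y) * p y)"]
      integral_mono_AE[OF integrable_norm[OF i1] i2 ae] by linarith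
  also have "\<dots> = B * (2 * pi * real k)"
    unfolding p_def using norm_L2_trig[of ?I "\<lambda>j. cis (- (of_int j * x))"]
    by (simp add: norm_L2_power2)
  finally have "(2 * pi * real k) * cmod (fejer_mean k (fourier_coefficient h) x) \<le> (2 * pi * real k) * B"
    by (simp add: algebra_simps)
  then show ?thesis using k by (simp add: mult_le_cancel_left_pos)
qed

lemma fejer_mean_tendsto:
  assumes h: "in_L2 h"
  shows "(\<lambda>k. norm_L2 (\<lambda>x. h x - fejer_mean k (fourier_coefficient h) x)) \<longlonglongrightarrow> 0"
proof -
  let ?c = "\<lambda>n. (cmod (fourier_coefficient h n))\<^sup>2"
  have sq: "(norm_L2 (\<lambda>x. h x - fejer_mean k (fourier_coefficient h) x))\<^sup>2
      = (norm_L2 h)\<^sup>2 - 2 * pi * (\<Sum>n\<in>{- int k..int k}. ?c n)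
        + 2 * pi * (\<Sum>n\<in>{- int k..int k}. (\<bar>of_int n\<bar> / real k)\<^sup>2 * ?c n)" for k
  proof -
    have "cmod (fourier_coefficient h n - of_real (1 - \<bar>of_int n\<bar> / real k) * fourier_coefficient h n)
        = \<bar>of_int n\<bar> / real k * cmod (fourier_coefficient h n)" for n
    proof -
      have "fourier_coefficient h n - of_real (1 - \<bar>of_int n\<bar> / real k) * fourier_coefficient h n
          = of_real (\<bar>of_int n\<bar> / real k) * fourier_coefficient h n"
        by (simp add: algebra_simps)
      then show ?thesis by (simp only: norm_mult norm_of_real) simp
    qed
    then show ?thesis unfolding fejer_mean_def
      by (subst norm_L2_diff_trig[OF h]) (simp_all only: power_mult_distrib finite_atLeastAtMost_int)
  qed
  have "(\<lambda>k. (norm_L2 (\<lambda>x. h x - fejer_mean k (fourier_coefficient h) x))\<^sup>2) \<longlonglongrightarrow> 0"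
  proof (rule order_tendstoI)
    fix a :: real assume "a < 0"
    then show "\<forall>\<^sub>F k in sequentially. a < (norm_L2 (\<lambda>x. h x - fejer_mean k (fourier_coefficient h) x))\<^sup>2"
      by (intro always_eventually allI less_le_trans[OF _ zero_le_power2])
  next
    fix \<delta> :: real assume d: "0 < \<delta>"
    have "\<forall>\<^sub>F J in finite_subsets_at_top UNIV. (norm_L2 h)\<^sup>2 / (2 * pi) - \<delta> / (4 * pi) < sum ?c J"
      using Parseval[OF h] d unfolding has_sum_def by (intro order_tendstoD(1)) auto
    \<comment> \<open>\<open>J\<close> carries the Parseval sum up to \<delta> / (4 * pi). On
      \<open>J\<close> the factors \<open>(\<bar>n\<bar> / k)\<^sup>2\<close> tend to 0; off
      \<open>J\<close> they are at most 1, and these terms cancel against the subtracted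
      ones.\<close>
    then obtain J where J: "finite J" "(norm_L2 h)\<^sup>2 / (2 * pi) - \<delta> / (4 * pi) < sum ?c J"
      unfolding eventually_finite_subsets_at_top by blast
    have J2: "(norm_L2 h)\<^sup>2 - 2 * pi * sum ?c J < \<delta> / 2"
      using J(2) pi_gt_zero by (simp add: field_simps)
    have "(\<lambda>k. 2 * pi * (\<Sum>n\<in>J. (\<bar>of_int n\<bar> * (1 / real k))\<^sup>2 * ?c n)) \<longlonglongrightarrow> 2 * pi * (\<Sum>n\<in>J. (\<bar>of_int n\<bar> * 0)\<^sup>2 * ?c n)"
      by (intro tendsto_intros lim_1_over_n)
    then have e1: "\<forall>\<^sub>F k in sequentially. 2 * pi * (\<Sum>n\<in>J. (\<bar>of_int n\<bar> / real k)\<^sup>2 * ?c n) < \<delta> / 2"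
      using d by (intro order_tendstoD(2)[of _ 0]) (simp_all add: tendsto_mult_right_zero)
    obtain N where N: "J \<subseteq> {- int N..int N}"
    proof -
      obtain b where "\<And>n. n \<in> J \<Longrightarrow> \<bar>n\<bar> \<le> b" using J(1) finite_abs_int_segment
        by (metis Max_ge abs_ge_self finite_imageI image_eqI)
      then have "J \<subseteq> {- int (nat b)..int (nat b)}" by (force simp: abs_le_iff)
      then show ?thesis using that by blast
    qed
    have e2: "\<forall>\<^sub>F k in sequentially. k \<ge> max 1 N" by (rule eventually_ge_at_top)
    show "\<forall>\<^sub>F k in sequentially. (norm_L2 (\<lambda>x. h x - fejer_mean k (fourier_coefficient h) x))\<^sup>2 < \<delta>"
      using e1 e2
    proof eventually_elim
      case (elim k)
      let ?I = "{- int k..int k}"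
      have sub: "J \<subseteq> ?I" using N elim(2) by fastforce
      have split: "sum f ?I = sum f J + sum f (?I - J)" for f :: "int \<Rightarrow> real"
        using sub by (metis add.commute finite_atLeastAtMost_int sum.subset_diff)
      have "(\<Sum>n\<in>?I - J. (\<bar>of_int n\<bar> / real k)\<^sup>2 * ?c n) \<le> (\<Sum>n\<in>?I - J. 1 * ?c n)"
      proof (intro sum_mono mult_right_mono)
        fix n assume "n \<in> ?I - J"
        then have "\<bar>real_of_int n\<bar> / real k \<le> 1" using elim(2) by (auto simp: divide_le_eq abs_le_iff)
        then have "(\<bar>real_of_int n\<bar> / real k)\<^sup>2 \<le> 1\<^sup>2" by (intro power_mono) auto
        then show "(\<bar>real_of_int n\<bar> / real k)\<^sup>2 \<le> 1" by simp
      qed simp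
      then have "2 * pi * (\<Sum>n\<in>?I - J. (\<bar>of_int n\<bar> / real k)\<^sup>2 * ?c n) \<le> 2 * pi * sum ?c (?I - J)"
        by (simp add: mult_left_mono)
      then show ?case unfolding sq split distrib_left using elim(1) J2 by linarith
    qed
  qed
  then show ?thesis using tendsto_real_sqrt[of _ 0] by fastforce
qed

text \<open>With \<open>fejer_mean_bound\<close> this makes an essential bound a countable family of
  conditions on the Fourier coefficients, as measurability in \<omega> demands. The means are
  continuous in x, so rational points determine them.\<close>

lemma fejer_mean_bounded_imp_AE_bounded:
  assumes h: "in_L2 h" and B: "\<And>k x. k > 0 \<Longrightarrow> x \<in> \<rat> \<Longrightarrow> cmod (fejer_mean k (fourier_coefficient h) x) \<le> B"
  shows "AE x in torus. cmod (h x) \<le> B"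
proof (rule AE_norm_le_limit[OF h, of sequentially])
  have all: "cmod (fejer_mean k (fourier_coefficient h) x) \<le> B" if k: "k > 0" for k x
  proof -
    let ?S = "{x. cmod (fejer_mean k (fourier_coefficient h) x) \<le> B}"
    have "closed ?S" unfolding fejer_mean_def
      by (intro closed_Collect_le continuous_intros)
    moreover have "\<rat> \<subseteq> ?S" using B k by auto
    ultimately have "closure \<rat> \<subseteq> ?S" by (simp add: closure_minimal)
    moreover have "closure (\<rat> :: real set) = UNIV" by (rule Rats_closure_real)
    ultimately show ?thesis by auto
  qed
  show "\<forall>\<^sub>F k in sequentially. in_L2 (fejer_mean k (fourier_coefficient h)) \<and>
      (AE x in torus. cmod (fejer_mean k (fourier_coefficient h) x) \<le> B)"
    using eventually_gt_at_top[of 0]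
  proof eventually_elim
    case (elim k) then show ?case unfolding fejer_mean_def[abs_def]
      by (intro conjI in_L2_trig AE_I2) (use all[OF elim] in \<open>auto simp: fejer_mean_def\<close>)
  qed
  show "(\<lambda>k. norm_L2 (\<lambda>x. h x - fejer_mean k (fourier_coefficient h) x)) \<longlonglongrightarrow> 0"
    by (rule fejer_mean_tendsto[OF h])
qed simp

subsection \<open>A trilinear estimate with divisor weights\<close>

text \<open>The convention \<open>0 powr (- s) = 0\<close> removes the singular term. The set is
  split by sign so that \<open>nat \<circ> abs\<close> is injective on each half.\<close>

lemma sum_abs_int_powr_le:
  fixes s :: real assumes "s > 1"
  obtains S where "S \<ge> 0" "\<And>K. finite K \<Longrightarrow> (\<Sum>k\<in>K. \<bar>of_int k\<bar> powr (- s)) \<le> S"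
proof -
  let ?f = "\<lambda>n::nat. real n powr (- s)"
  have sm: "summable ?f" using assms by (subst summable_real_powr_iff) simp
  show thesis
  proof (rule that[of "2 * suminf ?f"])
    show "0 \<le> 2 * suminf ?f" using sm by (simp add: suminf_nonneg)
    fix K :: "int set" assume K: "finite K"
    have le: "(\<Sum>k\<in>J. \<bar>of_int k\<bar> powr (- s)) \<le> suminf ?f" if "finite J" "inj_on (nat \<circ> abs) J" for J :: "int set"
    proof -
      have "(\<Sum>k\<in>J. \<bar>of_int k\<bar> powr (- s)) = (\<Sum>n\<in>(nat \<circ> abs) ` J. ?f n)"
        using that(2) by (subst sum.reindex) (auto intro!: sum.cong)
      also have "\<dots> \<le> suminf ?f" using sm that(1) by (intro sum_le_suminf) auto
      finally show ?thesis .
    qed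
    have "(\<Sum>k\<in>K. \<bar>of_int k\<bar> powr (- s)) = (\<Sum>k\<in>K \<inter> {0..}. \<bar>of_int k\<bar> powr (- s)) + (\<Sum>k\<in>K - {0..}. \<bar>of_int k\<bar> powr (- s))"
      using K by (rule sum.Int_Diff)
    also have "\<dots> \<le> suminf ?f + suminf ?f"
      using K by (intro add_mono le) (auto simp: inj_on_def)
    finally show "(\<Sum>k\<in>K. \<bar>of_int k\<bar> powr (- s)) \<le> 2 * suminf ?f" by simp
  qed
qed

lemma sum_power4_le:
  fixes f :: "'a \<Rightarrow> real"
  assumes "finite I" "(\<Sum>i\<in>I. (f i)\<^sup>2) \<le> A\<^sup>2"
  shows "(\<Sum>i\<in>I. (f i) ^ 4) \<le> A ^ 4"
proof -
  have "(f i)\<^sup>2 \<le> A\<^sup>2" if "i \<in> I" for i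
    using member_le_sum[of i I "\<lambda>i. (f i)\<^sup>2"] assms that by auto
  then have "(\<Sum>i\<in>I. (f i) ^ 4) \<le> (\<Sum>i\<in>I. A\<^sup>2 * (f i)\<^sup>2)"
    by (intro sum_mono) (simp add: power4_eq_xxxx power2_eq_square mult_right_mono flip: mult.assoc,
        metis mult_right_mono zero_le_square mult.assoc)
  also have "\<dots> = A\<^sup>2 * (\<Sum>i\<in>I. (f i)\<^sup>2)" by (rule sum_distrib_left[symmetric])
  also have "\<dots> \<le> A\<^sup>2 * A\<^sup>2" by (rule mult_left_mono[OF assms(2)]) simp
  finally show ?thesis by (simp add: power4_eq_xxxx power2_eq_square)
qed

text \<open>Hoelder's inequality with exponents 4 and 4/3: the kernel to the power 4/3 decays like
  |k|^(-6/5) and is summable. Two applications of Cauchy-Schwarz do this with h = |k|^(-3/10), whose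
  cube is the kernel and whose fourth power is the summable weight.\<close>

lemma sum_mult_kernel_le:
  fixes f :: "int \<Rightarrow> real"
  assumes S: "\<And>K. finite K \<Longrightarrow> (\<Sum>k\<in>K. \<bar>of_int k\<bar> powr (- (6/5))) \<le> S" "0 \<le> S"
    and I: "finite I" and A: "(\<Sum>p\<in>I. (f p) ^ 4) \<le> A ^ 4" "0 \<le> A"
    and f: "\<And>p. 0 \<le> f p"
  shows "(\<Sum>p\<in>I. f p * \<bar>of_int (p - c)\<bar> powr (- (9/10))) \<le> (1 + S) * A"
proof -
  define h :: "int \<Rightarrow> real" where "h k = \<bar>of_int k\<bar> powr (- (3/10))" for k
  have hp: "h k ^ n = \<bar>of_int k\<bar> powr (- (3/10) * real n)" if "n > 0" for k and n :: nat
    using that unfolding h_def by (cases "k = 0") (auto simp: powr_powr powr_realpow[symmetric])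
  have h3: "\<bar>of_int k\<bar> powr (- (9/10)) = h k ^ 3" and h4: "\<bar>of_int k\<bar> powr (- (6/5)) = h k ^ 4" for k
    using hp[of 3 k] hp[of 4 k] by simp_all
  have H: "(\<Sum>p\<in>I. h (p - c) ^ 4) \<le> S"
  proof -
    have "(\<Sum>p\<in>I. h (p - c) ^ 4) = (\<Sum>k\<in>(\<lambda>p. p - c) ` I. h k ^ 4)"
      by (subst sum.reindex) (auto simp: inj_on_def)
    then show ?thesis using S(1)[of "(\<lambda>p. p - c) ` I"] I by (simp add: h4)
  qed
  have "(\<Sum>p\<in>I. f p * h (p - c) ^ 3)\<^sup>2 = (\<Sum>p\<in>I. (f p * h (p - c)) * (h (p - c))\<^sup>2)\<^sup>2"
    by (intro arg_cong[where f = "\<lambda>x. x\<^sup>2"] sum.cong refl) (simp add: power3_eq_cube power2_eq_square)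
  also have "\<dots> \<le> (\<Sum>p\<in>I. (f p * h (p - c))\<^sup>2) * (\<Sum>p\<in>I. ((h (p - c))\<^sup>2)\<^sup>2)"
    by (rule Cauchy_Schwarz_ineq_sum)
  also have "\<dots> \<le> (\<Sum>p\<in>I. (f p * h (p - c))\<^sup>2) * S"
    using H by (intro mult_left_mono) (auto intro: sum_nonneg)
  finally have 1: "(\<Sum>p\<in>I. f p * h (p - c) ^ 3)\<^sup>2 \<le> (\<Sum>p\<in>I. (f p * h (p - c))\<^sup>2) * S" .
  have "(\<Sum>p\<in>I. (f p * h (p - c))\<^sup>2)\<^sup>2 = (\<Sum>p\<in>I. (f p)\<^sup>2 * (h (p - c))\<^sup>2)\<^sup>2"
    by (simp add: power_mult_distrib)
  also have "\<dots> \<le> (\<Sum>p\<in>I. ((f p)\<^sup>2)\<^sup>2) * (\<Sum>p\<in>I. ((h (p - c))\<^sup>2)\<^sup>2)"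
    by (rule Cauchy_Schwarz_ineq_sum)
  also have "\<dots> \<le> A ^ 4 * S"
    using H A by (intro mult_mono) (auto intro: sum_nonneg)
  finally have 2: "(\<Sum>p\<in>I. (f p * h (p - c))\<^sup>2)\<^sup>2 \<le> A ^ 4 * S" .
  have "(\<Sum>p\<in>I. f p * h (p - c) ^ 3) ^ 4 = ((\<Sum>p\<in>I. f p * h (p - c) ^ 3)\<^sup>2)\<^sup>2" by simp
  also have "\<dots> \<le> ((\<Sum>p\<in>I. (f p * h (p - c))\<^sup>2) * S)\<^sup>2" by (rule power_mono[OF 1]) simp
  also have "\<dots> \<le> (A ^ 4 * S) * S\<^sup>2" by (subst power_mult_distrib) (rule mult_right_mono[OF 2], simp)
  also have "\<dots> = A ^ 4 * S ^ 3" by (simp add: power3_eq_cube power2_eq_square)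
  \<comment> \<open>The constant obtained so far is S^(3/4); replacing it by 1 + S avoids the
    fractional power.\<close>
  also have "\<dots> \<le> A ^ 4 * (1 + S) ^ 4"
  proof (rule mult_left_mono)
    have "S ^ 3 \<le> (1 + S) ^ 3" using S(2) by (intro power_mono) auto
    also have "\<dots> \<le> (1 + S) ^ 4" using S(2) by (intro power_increasing) auto
    finally show "S ^ 3 \<le> (1 + S) ^ 4" .
  qed simp
  also have "\<dots> = ((1 + S) * A) ^ 4" by (simp add: power_mult_distrib)
  finally show ?thesis unfolding h3 using A(2) S(2) by (rule_tac power_le_imp_le_base[of _ 3]) simp_all
qed

text \<open>The kernel 1 / |k| is not summable. It is split as \<open>sqrt (a k * b k)\<close>,
  where b is summable and a lies in l^(4/3), the dual of l4. The two inequalities differ in which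
  factor is kept linear: that factor will be the one in l4.\<close>

lemma trilinear_Cauchy_Schwarz:
  fixes f1 f2 f3 :: "int \<Rightarrow> real"
  assumes pos: "\<And>n. 0 \<le> f1 n" "\<And>n. 0 \<le> f2 n" "\<And>n. 0 \<le> f3 n"
  defines "a \<equiv> \<lambda>k::int. \<bar>of_int k\<bar> powr (- (9/10) :: real)" and "b \<equiv> \<lambda>k::int. \<bar>of_int k\<bar> powr (- (11/10) :: real)"
  shows "(\<Sum>(p, q, r)\<in>I. f1 p * f2 q * f3 r / (\<bar>of_int (p - q)\<bar> * \<bar>of_int (r - q)\<bar>))\<^sup>2
      \<le> (\<Sum>(p, q, r)\<in>I. f1 p * (f2 q)\<^sup>2 * a (p - q) * b (r - q)) * (\<Sum>(p, q, r)\<in>I. f1 p * (f3 r)\<^sup>2 * b (p - q) * a (r - q))"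
    and "(\<Sum>(p, q, r)\<in>I. f1 p * f2 q * f3 r / (\<bar>of_int (p - q)\<bar> * \<bar>of_int (r - q)\<bar>))\<^sup>2
      \<le> (\<Sum>(p, q, r)\<in>I. f2 q * (f1 p)\<^sup>2 * a (p - q) * b (r - q)) * (\<Sum>(p, q, r)\<in>I. f2 q * (f3 r)\<^sup>2 * b (p - q) * a (r - q))"
proof -
  have ab: "sqrt (a k * b k) = 1 / \<bar>of_int k\<bar>" for k
  proof (cases "k = 0")
    case False
    then have "a k * b k = \<bar>of_int k\<bar> powr (- 2)" unfolding a_def b_def by (simp flip: powr_add)
    also have "\<dots> = (1 / \<bar>of_int k\<bar>)\<^sup>2" using False by (simp add: powr_minus powr_numeral divide_inverse power_inverse)
    finally show ?thesis by simp
  qed (simp add: a_def)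
  have nn: "0 \<le> a k" "0 \<le> b k" for k by (simp_all add: a_def b_def)
  have sq: "f1 p * f2 q * f3 r / (\<bar>of_int (p - q)\<bar> * \<bar>of_int (r - q)\<bar>) =
     f1 p * f2 q * f3 r * (sqrt (a (p - q)) * sqrt (b (p - q)) * sqrt (a (r - q)) * sqrt (b (r - q)))" for p q r
    using ab[of "p - q"] ab[of "r - q"] unfolding real_sqrt_mult by (simp add: mult.assoc)
  have e1: "f1 p * f2 q * f3 r / (\<bar>of_int (p - q)\<bar> * \<bar>of_int (r - q)\<bar>) =
     sqrt (f1 p * (f2 q)\<^sup>2 * a (p - q) * b (r - q)) * sqrt (f1 p * (f3 r)\<^sup>2 * b (p - q) * a (r - q))" for p q r
  proof -
    have "sqrt (f1 p) * sqrt (f1 p) = f1 p" using pos by simp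
    then show ?thesis unfolding sq real_sqrt_mult using pos by (simp add: ac_simps)
  qed
  have e2: "f1 p * f2 q * f3 r / (\<bar>of_int (p - q)\<bar> * \<bar>of_int (r - q)\<bar>) =
     sqrt (f2 q * (f1 p)\<^sup>2 * a (p - q) * b (r - q)) * sqrt (f2 q * (f3 r)\<^sup>2 * b (p - q) * a (r - q))" for p q r
  proof -
    have "sqrt (f2 q) * sqrt (f2 q) = f2 q" using pos by simp
    then show ?thesis unfolding sq real_sqrt_mult using pos by (simp add: ac_simps)
  qed
  have s1: "(sqrt (f1 p * (f2 q)\<^sup>2 * a (p - q) * b (r - q)))\<^sup>2 = f1 p * (f2 q)\<^sup>2 * a (p - q) * b (r - q)"
    "(sqrt (f1 p * (f3 r)\<^sup>2 * b (p - q) * a (r - q)))\<^sup>2 = f1 p * (f3 r)\<^sup>2 * b (p - q) * a (r - q)"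
    "(sqrt (f2 q * (f1 p)\<^sup>2 * a (p - q) * b (r - q)))\<^sup>2 = f2 q * (f1 p)\<^sup>2 * a (p - q) * b (r - q)"
    "(sqrt (f2 q * (f3 r)\<^sup>2 * b (p - q) * a (r - q)))\<^sup>2 = f2 q * (f3 r)\<^sup>2 * b (p - q) * a (r - q)" for p q r
    using pos nn by (auto intro!: real_sqrt_pow2 mult_nonneg_nonneg)
  show "(\<Sum>(p, q, r)\<in>I. f1 p * f2 q * f3 r / (\<bar>of_int (p - q)\<bar> * \<bar>of_int (r - q)\<bar>))\<^sup>2
      \<le> (\<Sum>(p, q, r)\<in>I. f1 p * (f2 q)\<^sup>2 * a (p - q) * b (r - q)) * (\<Sum>(p, q, r)\<in>I. f1 p * (f3 r)\<^sup>2 * b (p - q) * a (r - q))"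
    using Cauchy_Schwarz_ineq_sum[of "\<lambda>(p, q, r). sqrt (f1 p * (f2 q)\<^sup>2 * a (p - q) * b (r - q))"
        "\<lambda>(p, q, r). sqrt (f1 p * (f3 r)\<^sup>2 * b (p - q) * a (r - q))" I]
    unfolding e1 case_prod_unfold s1 .
  show "(\<Sum>(p, q, r)\<in>I. f1 p * f2 q * f3 r / (\<bar>of_int (p - q)\<bar> * \<bar>of_int (r - q)\<bar>))\<^sup>2
      \<le> (\<Sum>(p, q, r)\<in>I. f2 q * (f1 p)\<^sup>2 * a (p - q) * b (r - q)) * (\<Sum>(p, q, r)\<in>I. f2 q * (f3 r)\<^sup>2 * b (p - q) * a (r - q))"
    using Cauchy_Schwarz_ineq_sum[of "\<lambda>(p, q, r). sqrt (f2 q * (f1 p)\<^sup>2 * a (p - q) * b (r - q))"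
        "\<lambda>(p, q, r). sqrt (f2 q * (f3 r)\<^sup>2 * b (p - q) * a (r - q))" I]
    unfolding e2 case_prod_unfold s1 .
qed

lemma sum_shift_kernel_le:
  fixes b :: "int \<Rightarrow> real"
  assumes "\<And>K. finite K \<Longrightarrow> sum b K \<le> S" "finite I"
  shows "(\<Sum>r\<in>I. b (r - q)) \<le> S" "(\<Sum>r\<in>I. b (q - r)) \<le> S"
proof -
  have "(\<Sum>r\<in>I. b (r - q)) = sum b ((\<lambda>r. r - q) ` I)" "(\<Sum>r\<in>I. b (q - r)) = sum b ((\<lambda>r. q - r) ` I)"
    by (subst sum.reindex; simp add: inj_on_def)+
  then show "(\<Sum>r\<in>I. b (r - q)) \<le> S" "(\<Sum>r\<in>I. b (q - r)) \<le> S" using assms by simp_all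
qed

text \<open>The denominator is half the resonance phase 2 (p - q) (r - q) that integration by parts
  divides by. One entry has to be allowed in l4, since the time derivative of a mode is a
  coefficient of the cubic nonlinearity. Terms with p = q or r = q vanish because division by 0
  gives 0.\<close>

lemma trilinear_estimate:
  obtains C :: real where "C \<ge> 0"
    and "\<And>I (f1 :: int \<Rightarrow> real) (f2 :: int \<Rightarrow> real) (f3 :: int \<Rightarrow> real) A1 A2 A3. finite I \<Longrightarrow> (\<And>n. 0 \<le> f1 n) \<Longrightarrow> (\<And>n. 0 \<le> f2 n) \<Longrightarrow> (\<And>n. 0 \<le> f3 n) \<Longrightarrow>
      0 \<le> A1 \<Longrightarrow> 0 \<le> A2 \<Longrightarrow> 0 \<le> A3 \<Longrightarrow>
      (\<Sum>n\<in>I. f1 n ^ 4) \<le> A1 ^ 4 \<Longrightarrow> (\<Sum>n\<in>I. (f2 n)\<^sup>2) \<le> A2\<^sup>2 \<Longrightarrow> (\<Sum>n\<in>I. (f3 n)\<^sup>2) \<le> A3\<^sup>2 \<Longrightarrow>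
      (\<Sum>(p, q, r)\<in>I \<times> I \<times> I. f1 p * f2 q * f3 r / (\<bar>of_int (p - q)\<bar> * \<bar>of_int (r - q)\<bar>)) \<le> C * A1 * A2 * A3"
    and "\<And>I (f1 :: int \<Rightarrow> real) (f2 :: int \<Rightarrow> real) (f3 :: int \<Rightarrow> real) A1 A2 A3. finite I \<Longrightarrow> (\<And>n. 0 \<le> f1 n) \<Longrightarrow> (\<And>n. 0 \<le> f2 n) \<Longrightarrow> (\<And>n. 0 \<le> f3 n) \<Longrightarrow>
      0 \<le> A1 \<Longrightarrow> 0 \<le> A2 \<Longrightarrow> 0 \<le> A3 \<Longrightarrow>
      (\<Sum>n\<in>I. (f1 n)\<^sup>2) \<le> A1\<^sup>2 \<Longrightarrow> (\<Sum>n\<in>I. f2 n ^ 4) \<le> A2 ^ 4 \<Longrightarrow> (\<Sum>n\<in>I. (f3 n)\<^sup>2) \<le> A3\<^sup>2 \<Longrightarrow>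
      (\<Sum>(p, q, r)\<in>I \<times> I \<times> I. f1 p * f2 q * f3 r / (\<bar>of_int (p - q)\<bar> * \<bar>of_int (r - q)\<bar>)) \<le> C * A1 * A2 * A3"
proof -
  obtain S :: real where S: "S \<ge> 0" "\<And>K. finite K \<Longrightarrow> (\<Sum>k\<in>K. \<bar>of_int k\<bar> powr (- (6/5))) \<le> S"
    by (rule sum_abs_int_powr_le[of "6/5"]) auto
  define a :: "int \<Rightarrow> real" where "a = (\<lambda>k. \<bar>of_int k\<bar> powr (- (9/10)))"
  define b :: "int \<Rightarrow> real" where "b = (\<lambda>k. \<bar>of_int k\<bar> powr (- (11/10)))"
  obtain S' where S': "S' \<ge> 0" "\<And>K. finite K \<Longrightarrow> sum b K \<le> S'"
    unfolding b_def by (rule sum_abs_int_powr_le[of "11/10"]) auto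
  have nn: "0 \<le> a k" "0 \<le> b k" and sym: "a (p - q) = a (q - p)" "b (p - q) = b (q - p)" for k p q
    by (simp_all add: a_def b_def abs_minus_commute)
  define W where "W = 1 + S"
  have W: "(\<Sum>p\<in>I. f p * a (p - c)) \<le> W * A"
    if "finite I" "(\<Sum>p\<in>I. (f p) ^ 4) \<le> A ^ 4" "0 \<le> A" "\<And>p. 0 \<le> f p" for I f A c
    unfolding W_def a_def by (rule sum_mult_kernel_le) (use that S in auto)
  have b_sum: "(\<Sum>r\<in>I. b (r - q)) \<le> S'" "(\<Sum>r\<in>I. b (q - r)) \<le> S'" if "finite I" for I q
    using sum_shift_kernel_le[of b S' I q] S'(2) that by auto
  define C where "C = W * S'"
  have W0: "0 \<le> W" using S(1) by (simp add: W_def)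
  have final: "X \<le> C * A1 * A2 * A3" if "X\<^sup>2 \<le> Y * Z" "Y \<le> C * A1 * A2\<^sup>2" "Z \<le> C * A1 * A3\<^sup>2"
    "0 \<le> Y" "0 \<le> A1" "0 \<le> A2" "0 \<le> A3" for X Y Z A1 A2 A3 :: real
  proof (rule power2_le_imp_le)
    have C0: "0 \<le> C" using W0 S'(1) by (simp add: C_def)
    have "Y * Z \<le> (C * A1 * A2\<^sup>2) * (C * A1 * A3\<^sup>2)"
      using mult_left_mono[OF that(3,4)] mult_right_mono[OF that(2), of "C * A1 * A3\<^sup>2"] that C0 by simp
    then show "X\<^sup>2 \<le> (C * A1 * A2 * A3)\<^sup>2" using that(1) by (simp add: power2_eq_square ac_simps)
    show "0 \<le> C * A1 * A2 * A3" using that C0 by simp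
  qed
  show thesis
  proof (rule that[of C])
    show "0 \<le> C" using W0 S'(1) by (simp add: C_def)
  next
    fix I and f1 f2 f3 :: "int \<Rightarrow> real" and A1 A2 A3 :: real
    assume I: "finite I" and p: "\<And>n. 0 \<le> f1 n" "\<And>n. 0 \<le> f2 n" "\<And>n. 0 \<le> f3 n"
      and A: "0 \<le> A1" "0 \<le> A2" "0 \<le> A3"
      and f: "(\<Sum>n\<in>I. f1 n ^ 4) \<le> A1 ^ 4" "(\<Sum>n\<in>I. (f2 n)\<^sup>2) \<le> A2\<^sup>2" "(\<Sum>n\<in>I. (f3 n)\<^sup>2) \<le> A3\<^sup>2"
    let ?Y = "\<Sum>(p, q, r)\<in>I \<times> I \<times> I. f1 p * (f2 q)\<^sup>2 * a (p - q) * b (r - q)"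
    let ?Z = "\<Sum>(p, q, r)\<in>I \<times> I \<times> I. f1 p * (f3 r)\<^sup>2 * b (p - q) * a (r - q)"
    have "?Y = (\<Sum>q\<in>I. (f2 q)\<^sup>2 * ((\<Sum>p\<in>I. f1 p * a (p - q)) * (\<Sum>r\<in>I. b (r - q))))"
    proof -
      have "?Y = (\<Sum>p\<in>I. \<Sum>q\<in>I. \<Sum>r\<in>I. f1 p * (f2 q)\<^sup>2 * a (p - q) * b (r - q))"
        by (simp add: sum.cartesian_product)
      also have "\<dots> = (\<Sum>q\<in>I. \<Sum>p\<in>I. \<Sum>r\<in>I. f1 p * (f2 q)\<^sup>2 * a (p - q) * b (r - q))" by (rule sum.swap)
      finally show ?thesis by (simp add: sum_distrib_left sum_distrib_right ac_simps)
    qed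
    also have "\<dots> \<le> (\<Sum>q\<in>I. (f2 q)\<^sup>2 * ((W * A1) * S'))"
      using I p A f W0 nn by (intro sum_mono mult_left_mono mult_mono W b_sum sum_nonneg) auto
    also have "\<dots> \<le> A2\<^sup>2 * ((W * A1) * S')"
      using f(2) W0 A S'(1) unfolding sum_distrib_right[symmetric] by (intro mult_right_mono) auto
    finally have Y: "?Y \<le> C * A1 * A2\<^sup>2" by (simp add: C_def ac_simps)
    \<comment> \<open>In the second factor the variable q is replaced by k = p - q. Then
      \<open>f1 p\<close> meets the kernel \<open>a (p - (r + k))\<close> and can be summed over p
      first, after which \<open>b k\<close> is summed over the finite set \<open>?K\<close> of
      differences.\<close>
    let ?K = "(\<lambda>(p, q). p - q) ` (I \<times> I)"
    have "?Z = (\<Sum>r\<in>I. (f3 r)\<^sup>2 * (\<Sum>p\<in>I. \<Sum>q\<in>I. f1 p * b (p - q) * a (r - q)))"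
    proof -
      have "?Z = (\<Sum>p\<in>I. \<Sum>q\<in>I. \<Sum>r\<in>I. f1 p * (f3 r)\<^sup>2 * b (p - q) * a (r - q))"
        by (simp add: sum.cartesian_product)
      also have "\<dots> = (\<Sum>p\<in>I. \<Sum>r\<in>I. \<Sum>q\<in>I. f1 p * (f3 r)\<^sup>2 * b (p - q) * a (r - q))"
        by (intro sum.cong refl sum.swap)
      also have "\<dots> = (\<Sum>r\<in>I. \<Sum>p\<in>I. \<Sum>q\<in>I. f1 p * (f3 r)\<^sup>2 * b (p - q) * a (r - q))" by (rule sum.swap)
      finally show ?thesis by (simp add: sum_distrib_left ac_simps)
    qed
    also have "\<dots> \<le> (\<Sum>r\<in>I. (f3 r)\<^sup>2 * (S' * (W * A1)))"
    proof (intro sum_mono mult_left_mono)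
      fix r
      have "(\<Sum>p\<in>I. \<Sum>q\<in>I. f1 p * b (p - q) * a (r - q)) \<le> (\<Sum>p\<in>I. \<Sum>k\<in>?K. f1 p * b k * a (p - (r + k)))"
      proof (rule sum_mono)
        fix p assume p': "p \<in> I"
        have "(\<Sum>q\<in>I. f1 p * b (p - q) * a (r - q)) = (\<Sum>k\<in>(\<lambda>q. p - q) ` I. f1 p * b k * a (p - (r + k)))"
          using sym by (subst sum.reindex) (auto simp: inj_on_def algebra_simps)
        also have "\<dots> \<le> (\<Sum>k\<in>?K. f1 p * b k * a (p - (r + k)))"
          using I p' p nn by (intro sum_mono2) auto
        finally show "(\<Sum>q\<in>I. f1 p * b (p - q) * a (r - q)) \<le> (\<Sum>k\<in>?K. f1 p * b k * a (p - (r + k)))" .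
      qed
      also have "\<dots> = (\<Sum>k\<in>?K. b k * (\<Sum>p\<in>I. f1 p * a (p - (r + k))))"
        by (subst sum.swap) (simp add: sum_distrib_left ac_simps)
      also have "\<dots> \<le> (\<Sum>k\<in>?K. b k * (W * A1))"
        using I p A f nn by (intro sum_mono mult_left_mono W) auto
      also have "\<dots> \<le> S' * (W * A1)"
        using S'(2)[of ?K] I W0 A unfolding sum_distrib_right[symmetric] by (intro mult_right_mono) auto
      finally show "(\<Sum>p\<in>I. \<Sum>q\<in>I. f1 p * b (p - q) * a (r - q)) \<le> S' * (W * A1)" .
    qed simp
    also have "\<dots> \<le> A3\<^sup>2 * (S' * (W * A1))"
      using f(3) W0 A S'(1) unfolding sum_distrib_right[symmetric] by (intro mult_right_mono) auto
    finally have Z: "?Z \<le> C * A1 * A3\<^sup>2" by (simp add: C_def ac_simps)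
    have Y0: "0 \<le> ?Y" using p nn by (intro sum_nonneg) auto
    show "(\<Sum>(p, q, r)\<in>I \<times> I \<times> I. f1 p * f2 q * f3 r / (\<bar>of_int (p - q)\<bar> * \<bar>of_int (r - q)\<bar>)) \<le> C * A1 * A2 * A3"
      (is "?X \<le> _")
    proof -
      have "?X\<^sup>2 \<le> ?Y * ?Z" unfolding a_def b_def by (rule trilinear_Cauchy_Schwarz(1)[OF p])
      from final[OF this Y Z Y0 A] show ?thesis .
    qed
  next
    fix I and f1 f2 f3 :: "int \<Rightarrow> real" and A1 A2 A3 :: real
    assume I: "finite I" and p: "\<And>n. 0 \<le> f1 n" "\<And>n. 0 \<le> f2 n" "\<And>n. 0 \<le> f3 n"
      and A: "0 \<le> A1" "0 \<le> A2" "0 \<le> A3"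
      and f: "(\<Sum>n\<in>I. (f1 n)\<^sup>2) \<le> A1\<^sup>2" "(\<Sum>n\<in>I. f2 n ^ 4) \<le> A2 ^ 4" "(\<Sum>n\<in>I. (f3 n)\<^sup>2) \<le> A3\<^sup>2"
    let ?Y = "\<Sum>(p, q, r)\<in>I \<times> I \<times> I. f2 q * (f1 p)\<^sup>2 * a (p - q) * b (r - q)"
    let ?Z = "\<Sum>(p, q, r)\<in>I \<times> I \<times> I. f2 q * (f3 r)\<^sup>2 * b (p - q) * a (r - q)"
    \<comment> \<open>With the l4 entry in the middle, both factors have this shape: the variable
      without a function carries the summable kernel b and is summed first, then q against
      a.\<close>
    have bd: "(\<Sum>p\<in>I. (g p)\<^sup>2 * (\<Sum>q\<in>I. f2 q * a (q - p) * (\<Sum>r\<in>I. b (r - q)))) \<le> C * A2 * B\<^sup>2"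
      if g: "(\<Sum>n\<in>I. (g n)\<^sup>2) \<le> B\<^sup>2" for g B
    proof -
      have "(\<Sum>p\<in>I. (g p)\<^sup>2 * (\<Sum>q\<in>I. f2 q * a (q - p) * (\<Sum>r\<in>I. b (r - q))))
          \<le> (\<Sum>p\<in>I. (g p)\<^sup>2 * (\<Sum>q\<in>I. f2 q * a (q - p) * S'))"
        using I p nn by (intro sum_mono mult_left_mono b_sum sum_nonneg mult_nonneg_nonneg) auto
      also have "\<dots> \<le> (\<Sum>p\<in>I. (g p)\<^sup>2 * (W * A2 * S'))"
      proof (intro sum_mono mult_left_mono)
        fix p'
        have "(\<Sum>q\<in>I. f2 q * a (q - p') * S') = (\<Sum>q\<in>I. f2 q * a (q - p')) * S'"
          by (rule sum_distrib_right[symmetric])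
        also have "\<dots> \<le> W * A2 * S'"
          using I p A f S'(1) by (intro mult_right_mono W) auto
        finally show "(\<Sum>q\<in>I. f2 q * a (q - p') * S') \<le> W * A2 * S'" .
      qed simp
      also have "\<dots> \<le> B\<^sup>2 * (W * A2 * S')"
        using g W0 A S'(1) unfolding sum_distrib_right[symmetric] by (intro mult_right_mono) auto
      finally show ?thesis by (simp add: C_def ac_simps)
    qed
    have "?Y = (\<Sum>p\<in>I. (f1 p)\<^sup>2 * (\<Sum>q\<in>I. f2 q * a (q - p) * (\<Sum>r\<in>I. b (r - q))))"
    proof -
      have "?Y = (\<Sum>p\<in>I. \<Sum>q\<in>I. \<Sum>r\<in>I. f2 q * (f1 p)\<^sup>2 * a (p - q) * b (r - q))"
        by (simp add: sum.cartesian_product)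
      then show ?thesis by (simp add: sum_distrib_left sym(1)[of _ p] ac_simps) (simp only: sym(1))
    qed
    then have Y: "?Y \<le> C * A2 * A1\<^sup>2" using bd[OF f(1)] by simp
    have "?Z = (\<Sum>r\<in>I. (f3 r)\<^sup>2 * (\<Sum>q\<in>I. f2 q * a (q - r) * (\<Sum>p\<in>I. b (p - q))))"
    proof -
      have "?Z = (\<Sum>p\<in>I. \<Sum>q\<in>I. \<Sum>r\<in>I. f2 q * (f3 r)\<^sup>2 * b (p - q) * a (r - q))"
        by (simp add: sum.cartesian_product)
      also have "\<dots> = (\<Sum>p\<in>I. \<Sum>r\<in>I. \<Sum>q\<in>I. f2 q * (f3 r)\<^sup>2 * b (p - q) * a (r - q))"
        by (intro sum.cong refl sum.swap)
      also have "\<dots> = (\<Sum>r\<in>I. \<Sum>p\<in>I. \<Sum>q\<in>I. f2 q * (f3 r)\<^sup>2 * b (p - q) * a (r - q))" by (rule sum.swap)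
      also have "\<dots> = (\<Sum>r\<in>I. \<Sum>q\<in>I. \<Sum>p\<in>I. f2 q * (f3 r)\<^sup>2 * b (p - q) * a (q - r))"
      proof (rule sum.cong[OF refl])
        fix r
        have "(\<Sum>p\<in>I. \<Sum>q\<in>I. f2 q * (f3 r)\<^sup>2 * b (p - q) * a (r - q))
            = (\<Sum>q\<in>I. \<Sum>p\<in>I. f2 q * (f3 r)\<^sup>2 * b (p - q) * a (r - q))" by (rule sum.swap)
        then show "(\<Sum>p\<in>I. \<Sum>q\<in>I. f2 q * (f3 r)\<^sup>2 * b (p - q) * a (r - q))
            = (\<Sum>q\<in>I. \<Sum>p\<in>I. f2 q * (f3 r)\<^sup>2 * b (p - q) * a (q - r))"
          using sym(1)[of r] by simp
      qed
      finally show ?thesis by (simp add: sum_distrib_left ac_simps)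
    qed
    then have Z: "?Z \<le> C * A2 * A3\<^sup>2" using bd[OF f(3)] by simp
    have Y0: "0 \<le> ?Y" using p nn by (intro sum_nonneg) auto
    show "(\<Sum>(p, q, r)\<in>I \<times> I \<times> I. f1 p * f2 q * f3 r / (\<bar>of_int (p - q)\<bar> * \<bar>of_int (r - q)\<bar>)) \<le> C * A1 * A2 * A3"
      (is "?X \<le> _")
    proof -
      have "?X\<^sup>2 \<le> ?Y * ?Z" unfolding a_def b_def by (rule trilinear_Cauchy_Schwarz(2)[OF p])
      from final[OF this Y Z Y0 A(2,1,3)] show ?thesis by (simp add: ac_simps)
    qed
  qed
qed

section \<open>The trilinear bound with the l4 entry in any position\<close>

definition l2_le :: "(int \<Rightarrow> real) \<Rightarrow> real \<Rightarrow> bool" where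
  "l2_le f A \<longleftrightarrow> (\<forall>n. 0 \<le> f n) \<and> 0 \<le> A \<and> (\<forall>I. finite I \<longrightarrow> (\<Sum>n\<in>I. (f n)\<^sup>2) \<le> A\<^sup>2)"

definition l4_le :: "(int \<Rightarrow> real) \<Rightarrow> real \<Rightarrow> bool" where
  "l4_le f A \<longleftrightarrow> (\<forall>n. 0 \<le> f n) \<and> 0 \<le> A \<and> (\<forall>I. finite I \<longrightarrow> (\<Sum>n\<in>I. f n ^ 4) \<le> A ^ 4)"

lemma l2_le_imp_l4_le: "l2_le f A \<Longrightarrow> l4_le f A"
  unfolding l2_le_def l4_le_def using sum_power4_le by blast

definition trilinear_form :: "(int \<times> int \<times> int) set \<Rightarrow> (int \<Rightarrow> real) \<Rightarrow> (int \<Rightarrow> real) \<Rightarrow> (int \<Rightarrow> real) \<Rightarrow> real" where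
  "trilinear_form F f1 f2 f3 =
    (\<Sum>(p, q, r)\<in>F. f1 p * f2 q * f3 r / (\<bar>of_int (p - q)\<bar> * \<bar>of_int (r - q)\<bar>))"

definition trilinear_bounded :: "real \<Rightarrow> bool" where
  "trilinear_bounded C \<longleftrightarrow> C \<ge> 0 \<and> (\<forall>F f1 f2 f3 A1 A2 A3. finite F \<longrightarrow>
     l4_le f1 A1 \<and> l2_le f2 A2 \<and> l2_le f3 A3 \<or> l2_le f1 A1 \<and> l4_le f2 A2 \<and> l2_le f3 A3 \<or>
     l2_le f1 A1 \<and> l2_le f2 A2 \<and> l4_le f3 A3 \<longrightarrow>
     trilinear_form F f1 f2 f3 \<le> C * A1 * A2 * A3)"

text \<open>A finite set of triples lies in a cube, and enlarging it only adds nonnegative terms. An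
  l4 entry in the third position is reduced to the first by exchanging p and r, under which the
  weight is symmetric.\<close>

lemma ex_trilinear_bounded: "\<exists>C. trilinear_bounded C"
proof (rule trilinear_estimate)
  fix C :: real
  assume C: "C \<ge> 0"
    and C1: "\<And>I (f1 :: int \<Rightarrow> real) (f2 :: int \<Rightarrow> real) (f3 :: int \<Rightarrow> real) A1 A2 A3. finite I \<Longrightarrow> (\<And>n. 0 \<le> f1 n) \<Longrightarrow> (\<And>n. 0 \<le> f2 n) \<Longrightarrow> (\<And>n. 0 \<le> f3 n) \<Longrightarrow>
      0 \<le> A1 \<Longrightarrow> 0 \<le> A2 \<Longrightarrow> 0 \<le> A3 \<Longrightarrow>
      (\<Sum>n\<in>I. f1 n ^ 4) \<le> A1 ^ 4 \<Longrightarrow> (\<Sum>n\<in>I. (f2 n)\<^sup>2) \<le> A2\<^sup>2 \<Longrightarrow> (\<Sum>n\<in>I. (f3 n)\<^sup>2) \<le> A3\<^sup>2 \<Longrightarrow>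
      (\<Sum>(p, q, r)\<in>I \<times> I \<times> I. f1 p * f2 q * f3 r / (\<bar>of_int (p - q)\<bar> * \<bar>of_int (r - q)\<bar>)) \<le> C * A1 * A2 * A3"
    and C2: "\<And>I (f1 :: int \<Rightarrow> real) (f2 :: int \<Rightarrow> real) (f3 :: int \<Rightarrow> real) A1 A2 A3. finite I \<Longrightarrow> (\<And>n. 0 \<le> f1 n) \<Longrightarrow> (\<And>n. 0 \<le> f2 n) \<Longrightarrow> (\<And>n. 0 \<le> f3 n) \<Longrightarrow>
      0 \<le> A1 \<Longrightarrow> 0 \<le> A2 \<Longrightarrow> 0 \<le> A3 \<Longrightarrow>
      (\<Sum>n\<in>I. (f1 n)\<^sup>2) \<le> A1\<^sup>2 \<Longrightarrow> (\<Sum>n\<in>I. f2 n ^ 4) \<le> A2 ^ 4 \<Longrightarrow> (\<Sum>n\<in>I. (f3 n)\<^sup>2) \<le> A3\<^sup>2 \<Longrightarrow>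
      (\<Sum>(p, q, r)\<in>I \<times> I \<times> I. f1 p * f2 q * f3 r / (\<bar>of_int (p - q)\<bar> * \<bar>of_int (r - q)\<bar>)) \<le> C * A1 * A2 * A3"
  have "trilinear_form F f1 f2 f3 \<le> C * A1 * A2 * A3"
    if F: "finite F" and h: "l4_le f1 A1 \<and> l2_le f2 A2 \<and> l2_le f3 A3 \<or> l2_le f1 A1 \<and> l4_le f2 A2 \<and> l2_le f3 A3 \<or>
     l2_le f1 A1 \<and> l2_le f2 A2 \<and> l4_le f3 A3" for F f1 f2 f3 A1 A2 A3
  proof -
    define I where "I = fst ` F \<union> (fst \<circ> snd) ` F \<union> (snd \<circ> snd) ` F"
    have I: "finite I" using F by (simp add: I_def)
    have "fst z \<in> I \<and> fst (snd z) \<in> I \<and> snd (snd z) \<in> I" if "z \<in> F" for z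
      using imageI[OF that, of fst] imageI[OF that, of "fst \<circ> snd"] imageI[OF that, of "snd \<circ> snd"]
      unfolding I_def by simp
    then have sub: "F \<subseteq> I \<times> I \<times> I" by (auto simp: mem_Times_iff)
    have pos: "0 \<le> f1 n" "0 \<le> f2 n" "0 \<le> f3 n" for n using h by (auto simp: l2_le_def l4_le_def)
    have A: "0 \<le> A1" "0 \<le> A2" "0 \<le> A3" using h by (auto simp: l2_le_def l4_le_def)
    have le: "trilinear_form F f1 f2 f3 \<le> trilinear_form (I \<times> I \<times> I) f1 f2 f3"
      unfolding trilinear_form_def using I sub pos by (intro sum_mono2) auto
    have swap: "trilinear_form (I \<times> I \<times> I) f1 f2 f3 = trilinear_form (I \<times> I \<times> I) f3 f2 f1"
      unfolding trilinear_form_def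
      by (rule sum.reindex_bij_witness[of _ "\<lambda>(p, q, r). (r, q, p)" "\<lambda>(p, q, r). (r, q, p)"]) (auto simp: ac_simps)
    from h show ?thesis
    proof (elim disjE conjE)
      assume h: "l4_le f1 A1" "l2_le f2 A2" "l2_le f3 A3"
      have "trilinear_form (I \<times> I \<times> I) f1 f2 f3 \<le> C * A1 * A2 * A3"
        unfolding trilinear_form_def
        by (rule C1[OF I pos A]) (use h I in \<open>simp_all add: l2_le_def l4_le_def\<close>)
      with le show ?thesis by (rule order_trans)
    next
      assume h: "l2_le f1 A1" "l4_le f2 A2" "l2_le f3 A3"
      have "trilinear_form (I \<times> I \<times> I) f1 f2 f3 \<le> C * A1 * A2 * A3"
        unfolding trilinear_form_def
        by (rule C2[OF I pos A]) (use h I in \<open>simp_all add: l2_le_def l4_le_def\<close>)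
      with le show ?thesis by (rule order_trans)
    next
      assume h: "l2_le f1 A1" "l2_le f2 A2" "l4_le f3 A3"
      have "trilinear_form (I \<times> I \<times> I) f3 f2 f1 \<le> C * A3 * A2 * A1"
        unfolding trilinear_form_def
        by (rule C1[OF I pos(3,2,1) A(3,2,1)]) (use h I in \<open>simp_all add: l2_le_def l4_le_def\<close>)
      with le show ?thesis unfolding swap by (simp add: ac_simps)
    qed
  qed
  then show "\<exists>C. trilinear_bounded C" using C unfolding trilinear_bounded_def by blast
qed

text \<open>Fixed once and for all, so that later bounds become explicit expressions in a constant
  that depends neither on the solution nor on \<epsilon>.\<close>

definition trilinear_const :: real where
  "trilinear_const = (SOME C. trilinear_bounded C)"

lemma trilinear_const: "trilinear_bounded trilinear_const"
  unfolding trilinear_const_def by (rule someI_ex[OF ex_trilinear_bounded])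

lemma trilinear_const_nonneg: "0 \<le> trilinear_const"
  using trilinear_const by (simp add: trilinear_bounded_def)

lemma trilinear_form_le:
  assumes "finite F"
  shows "l4_le f1 A1 \<Longrightarrow> l2_le f2 A2 \<Longrightarrow> l2_le f3 A3 \<Longrightarrow> trilinear_form F f1 f2 f3 \<le> trilinear_const * A1 * A2 * A3"
    and "l2_le f1 A1 \<Longrightarrow> l4_le f2 A2 \<Longrightarrow> l2_le f3 A3 \<Longrightarrow> trilinear_form F f1 f2 f3 \<le> trilinear_const * A1 * A2 * A3"
    and "l2_le f1 A1 \<Longrightarrow> l2_le f2 A2 \<Longrightarrow> l4_le f3 A3 \<Longrightarrow> trilinear_form F f1 f2 f3 \<le> trilinear_const * A1 * A2 * A3"
  using trilinear_const assms unfolding trilinear_bounded_def by blast+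

text \<open>Young's inequality for the convolution of two sequences in l^(4/3) with values in l2.
  The sequences are written as cubes of r, so that only integer powers occur.\<close>

lemma sum_convolution_square_le:
  fixes r :: "int \<Rightarrow> real"
  assumes I: "finite I" and M: "finite M" and r: "\<And>n. n \<notin> I \<Longrightarrow> r n = 0"
  shows "(\<Sum>m\<in>M. (\<Sum>n\<in>I. r n ^ 3 * r (m - n) ^ 3)\<^sup>2) \<le> (\<Sum>n\<in>I. r n ^ 4) ^ 3"
proof -
  let ?X = "\<Sum>n\<in>I. r n ^ 4"
  have X0: "0 \<le> ?X" by (intro sum_nonneg) simp
  have sub: "(\<Sum>m\<in>J. r m ^ 4) \<le> ?X" if "finite J" for J
  proof -
    have "(\<Sum>m\<in>J. r m ^ 4) = (\<Sum>m\<in>J \<inter> I. r m ^ 4)" using that r by (intro sum.mono_neutral_right) auto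
    also have "\<dots> \<le> ?X" using I by (intro sum_mono2) auto
    finally show ?thesis .
  qed
  have sh: "(\<Sum>n\<in>J. r (m - n) ^ 4) \<le> ?X" "(\<Sum>n\<in>J. r (n - m) ^ 4) \<le> ?X" if "finite J" for m J
    using sum_shift_kernel_le[of "\<lambda>n. r n ^ 4" ?X J m] sub that by auto
  have summand: "(\<Sum>n\<in>I. r n ^ 3 * r (m - n) ^ 3)\<^sup>2 \<le> (\<Sum>n\<in>I. r n ^ 4 * r (m - n) ^ 4) * ?X" for m
  proof -
    have "(\<Sum>n\<in>I. r n ^ 3 * r (m - n) ^ 3)\<^sup>2 = (\<Sum>n\<in>I. ((r n)\<^sup>2 * (r (m - n))\<^sup>2) * (r n * r (m - n)))\<^sup>2"
      by (intro arg_cong[where f = "\<lambda>x. x\<^sup>2"] sum.cong refl) (simp add: power3_eq_cube power2_eq_square)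
    also have "\<dots> \<le> (\<Sum>n\<in>I. ((r n)\<^sup>2 * (r (m - n))\<^sup>2)\<^sup>2) * (\<Sum>n\<in>I. (r n * r (m - n))\<^sup>2)"
      by (rule Cauchy_Schwarz_ineq_sum)
    also have "\<dots> \<le> (\<Sum>n\<in>I. ((r n)\<^sup>2 * (r (m - n))\<^sup>2)\<^sup>2) * ?X"
    proof (rule mult_left_mono)
      have "(\<Sum>n\<in>I. (r n * r (m - n))\<^sup>2) \<le> (\<Sum>n\<in>I. (r n ^ 4 + r (m - n) ^ 4) / 2)"
      proof (rule sum_mono)
        fix n
        have "2 * ((r n)\<^sup>2 * (r (m - n))\<^sup>2) \<le> ((r n)\<^sup>2)\<^sup>2 + ((r (m - n))\<^sup>2)\<^sup>2"
          using sum_squares_bound[of "(r n)\<^sup>2" "(r (m - n))\<^sup>2"] by (simp add: mult.assoc)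
        then show "(r n * r (m - n))\<^sup>2 \<le> (r n ^ 4 + r (m - n) ^ 4) / 2"
          by (simp add: power_mult_distrib)
      qed
      also have "\<dots> \<le> ?X" using sh(1)[OF I, of m] by (simp add: sum.distrib flip: sum_divide_distrib)
      finally show "(\<Sum>n\<in>I. (r n * r (m - n))\<^sup>2) \<le> ?X" .
    qed (simp add: sum_nonneg)
    finally show ?thesis by (simp add: power_mult_distrib)
  qed
  have "(\<Sum>m\<in>M. (\<Sum>n\<in>I. r n ^ 3 * r (m - n) ^ 3)\<^sup>2) \<le> (\<Sum>m\<in>M. (\<Sum>n\<in>I. r n ^ 4 * r (m - n) ^ 4) * ?X)"
    by (intro sum_mono summand)
  also have "\<dots> = (\<Sum>n\<in>I. r n ^ 4 * (\<Sum>m\<in>M. r (m - n) ^ 4)) * ?X"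
    by (simp only: sum_distrib_right[symmetric], subst sum.swap) (simp only: sum_distrib_left)
  also have "\<dots> \<le> (\<Sum>n\<in>I. r n ^ 4 * ?X) * ?X"
    using sh(2)[OF M] X0 by (intro mult_right_mono sum_mono mult_left_mono) auto
  also have "\<dots> = ?X ^ 3" by (simp add: sum_distrib_right[symmetric] power3_eq_cube)
  finally show ?thesis .
qed

text \<open>A case of the Hausdorff--Young inequality: on trigonometric polynomials the norms of
  \<open>\<ell>\<^sup>4\<^sup>/\<^sup>3\<close> and \<open>L\<^sup>4\<close> are compared by squaring the polynomial, and the inequality from \<open>L\<^sup>4\<^sup>/\<^sup>3\<close> to \<open>\<ell>\<^sup>4\<close>
  follows by duality.\<close>

lemma trig_L4_le:
  fixes b :: "int \<Rightarrow> complex" and r :: "int \<Rightarrow> real"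
  assumes I: "finite I" and r: "\<And>n. n \<notin> I \<Longrightarrow> r n = 0" and b: "\<And>n. cmod (b n) = r n ^ 3"
  shows "(LINT x|torus. (cmod (\<Sum>n\<in>I. b n * cis (of_int n * x))) ^ 4) \<le> 2 * pi * (\<Sum>n\<in>I. r n ^ 4) ^ 3"
proof -
  let ?f = "\<lambda>x. \<Sum>n\<in>I. b n * cis (of_int n * x)"
  have b0: "b n = 0" if "n \<notin> I" for n using b[of n] r[OF that] by simp
  define M where "M = (\<lambda>(i, j). i + j) ` (I \<times> I)"
  have M: "finite M" using I by (simp add: M_def)
  have sq: "?f x * ?f x = (\<Sum>m\<in>M. (\<Sum>n\<in>I. b n * b (m - n)) * cis (of_int m * x))" for x
  proof -
    have "?f x * ?f x = (\<Sum>n\<in>I. \<Sum>l\<in>I. b n * b l * cis (of_int (n + l) * x))"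
      unfolding sum_product by (intro sum.cong refl) (simp add: cis_mult distrib_right)
    also have "\<dots> = (\<Sum>n\<in>I. \<Sum>m\<in>M. b n * b (m - n) * cis (of_int m * x))"
    proof (rule sum.cong[OF refl])
      fix n assume n: "n \<in> I"
      have "(\<Sum>l\<in>I. b n * b l * cis (of_int (n + l) * x)) = (\<Sum>m\<in>(\<lambda>l. n + l) ` I. b n * b (m - n) * cis (of_int m * x))"
        by (subst sum.reindex) (auto simp: inj_on_def)
      also have "\<dots> = (\<Sum>m\<in>M. b n * b (m - n) * cis (of_int m * x))"
      proof (rule sum.mono_neutral_left[OF M])
        show "(\<lambda>l. n + l) ` I \<subseteq> M" using n by (auto simp: M_def)
        show "\<forall>m\<in>M - (\<lambda>l. n + l) ` I. b n * b (m - n) * cis (of_int m * x) = 0"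
        proof
          fix m assume "m \<in> M - (\<lambda>l. n + l) ` I"
          then have "m - n \<notin> I" by (metis DiffD2 add.commute diff_add_cancel image_eqI)
          then show "b n * b (m - n) * cis (of_int m * x) = 0" using b0 by simp
        qed
      qed
      finally show "(\<Sum>l\<in>I. b n * b l * cis (of_int (n + l) * x)) = (\<Sum>m\<in>M. b n * b (m - n) * cis (of_int m * x))" .
    qed
    also have "\<dots> = (\<Sum>m\<in>M. \<Sum>n\<in>I. b n * b (m - n) * cis (of_int m * x))" by (rule sum.swap)
    finally show ?thesis by (simp add: sum_distrib_right)
  qed
  have "(LINT x|torus. (cmod (?f x)) ^ 4) = (LINT x|torus. (cmod (?f x * ?f x))\<^sup>2)"
    by (intro Bochner_Integration.integral_cong refl) (simp add: norm_mult power4_eq_xxxx power2_eq_square)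
  also have "\<dots> = 2 * pi * (\<Sum>m\<in>M. (cmod (\<Sum>n\<in>I. b n * b (m - n)))\<^sup>2)"
    unfolding sq using norm_L2_trig[OF M] by (simp add: norm_L2_power2)
  also have "\<dots> \<le> 2 * pi * (\<Sum>m\<in>M. (\<Sum>n\<in>I. r n ^ 3 * r (m - n) ^ 3)\<^sup>2)"
  proof (intro mult_left_mono sum_mono power_mono)
    fix m
    show "cmod (\<Sum>n\<in>I. b n * b (m - n)) \<le> (\<Sum>n\<in>I. r n ^ 3 * r (m - n) ^ 3)"
      by (rule order_trans[OF norm_sum]) (simp add: norm_mult b)
  qed auto
  also have "\<dots> \<le> 2 * pi * (\<Sum>n\<in>I. r n ^ 4) ^ 3"
    by (intro mult_left_mono sum_convolution_square_le I M r) auto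
  finally show ?thesis .
qed

lemma torus_integrable_le_power4:
  fixes v :: "real \<Rightarrow> complex"
  assumes [measurable]: "v \<in> borel_measurable torus" and v: "integrable torus (\<lambda>x. (cmod (v x)) ^ 4)" and k: "k \<le> 4"
  shows "integrable torus (\<lambda>x. (cmod (v x)) ^ k)"
proof (rule Bochner_Integration.integrable_bound)
  show "integrable torus (\<lambda>x. 1 + (cmod (v x)) ^ 4)" using v by simp
  show "AE x in torus. norm ((cmod (v x)) ^ k) \<le> norm (1 + (cmod (v x)) ^ 4)"
  proof (rule AE_I2)
    fix x
    show "norm ((cmod (v x)) ^ k) \<le> norm (1 + (cmod (v x)) ^ 4)"
    proof (cases "cmod (v x) \<le> 1")
      case True
      then have "(cmod (v x)) ^ k \<le> 1" by (simp add: power_le_one)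
      then show ?thesis using zero_le_power[of "cmod (v x)" 4] by (simp add: add_increasing2)
    next
      case False
      then have "(cmod (v x)) ^ k \<le> (cmod (v x)) ^ 4" using k by (intro power_increasing) auto
      then show ?thesis by simp
    qed
  qed
qed measurable

lemma cubic_integrable:
  fixes v :: "real \<Rightarrow> complex"
  assumes [measurable]: "v \<in> borel_measurable torus" and v: "integrable torus (\<lambda>x. (cmod (v x)) ^ 4)"
  shows "integrable torus (\<lambda>x. of_real ((cmod (v x))\<^sup>2) * v x)"
  by (rule Bochner_Integration.integrable_bound[OF torus_integrable_le_power4[OF assms, of 3]])
    (auto simp: norm_mult power3_eq_cube power2_eq_square)

text \<open>The coefficients N are tested against \<open>b n = (r n)\<^sup>2 * N n\<close>, so that
  the pairing is the fourth power sum X and the moduli are cubes as in \<open>trig_L4_le\<close>.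
  Two uses of Cauchy-Schwarz replace Hoelder's inequality and lead to
  \<open>X ^ 4 \<le> ?W ^ 3 * X ^ 3\<close>. Restricting N to the finite set I makes X finite, so
  the cube may be cancelled.\<close>

lemma fc_cubic_l4:
  fixes v :: "real \<Rightarrow> complex"
  assumes mv [measurable]: "v \<in> borel_measurable torus" and v: "integrable torus (\<lambda>x. (cmod (v x)) ^ 4)"
    and I: "finite I"
  shows "(\<Sum>n\<in>I. (cmod (fourier_coefficient (\<lambda>x. of_real ((cmod (v x))\<^sup>2) * v x) n)) ^ 4)
    \<le> (LINT x|torus. (cmod (v x)) ^ 4) ^ 3"
proof -
  let ?N = "\<lambda>x. complex_of_real ((cmod (v x))\<^sup>2) * v x"
  let ?W = "LINT x|torus. (cmod (v x)) ^ 4"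
  define N where "N n = (if n \<in> I then fourier_coefficient ?N n else 0)" for n
  define r where "r n = cmod (N n)" for n
  define b where "b n = of_real ((r n)\<^sup>2) * N n" for n
  define X where "X = (\<Sum>n\<in>I. r n ^ 4)"
  have X0: "0 \<le> X" unfolding X_def by (intro sum_nonneg) simp
  have W0: "0 \<le> ?W" by simp
  have r: "r n = 0" if "n \<notin> I" for n using that by (simp add: r_def N_def)
  have b: "cmod (b n) = r n ^ 3" for n
    by (simp add: b_def r_def norm_mult power3_eq_cube power2_eq_square)
  let ?f = "\<lambda>x. \<Sum>n\<in>I. b n * cis (of_int n * x)"
  have mf [measurable]: "?f \<in> borel_measurable torus" by (rule in_L2_measurable[OF in_L2_trig[OF I]])
  obtain B where B: "\<And>x. cmod (?f x) \<le> B"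
  proof (rule that[of "\<Sum>n\<in>I. cmod (b n)"])
    show "cmod (?f x) \<le> (\<Sum>n\<in>I. cmod (b n))" for x
      by (rule order_trans[OF norm_sum]) (simp add: norm_mult)
  qed
  have B0: "0 \<le> B" using B[of 0] norm_ge_zero order_trans by blast
  have fk: "cmod (?f x) ^ k \<le> B ^ k" for x k using B by (intro power_mono) auto
  have i4: "integrable torus (\<lambda>x. (cmod (?f x)) ^ 4)"
    by (rule torus.integrable_const_bound[where B = "B ^ 4"]) (use fk in auto)
  have vf: "integrable torus (\<lambda>x. (cmod (v x))\<^sup>2 * (cmod (?f x))\<^sup>2)"
  proof (rule Bochner_Integration.integrable_bound)
    show "integrable torus (\<lambda>x. B\<^sup>2 * (cmod (v x))\<^sup>2)"
      using torus_integrable_le_power4[OF mv v, of 2] by simp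
    show "AE x in torus. norm ((cmod (v x))\<^sup>2 * (cmod (?f x))\<^sup>2) \<le> norm (B\<^sup>2 * (cmod (v x))\<^sup>2)"
    proof (rule AE_I2)
      fix x
      show "norm ((cmod (v x))\<^sup>2 * (cmod (?f x))\<^sup>2) \<le> norm (B\<^sup>2 * (cmod (v x))\<^sup>2)"
        using mult_right_mono[OF fk[of x 2], of "(cmod (v x))\<^sup>2"] by (simp add: mult.commute)
    qed
  qed measurable
  have c1: "(LINT x|torus. (cmod (v x)) ^ 3 * cmod (?f x))\<^sup>2
      \<le> ?W * (LINT x|torus. (cmod (v x))\<^sup>2 * (cmod (?f x))\<^sup>2)"
    using Cauchy_Schwarz_integral[of "\<lambda>x. of_real ((cmod (v x))\<^sup>2)" torus "\<lambda>x. v x * ?f x"] v vf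
      borel_measurable_times[OF mv mf]
    by (simp add: norm_mult power_mult_distrib power3_eq_cube power2_eq_square power4_eq_xxxx ac_simps)
  have c2: "(LINT x|torus. (cmod (v x))\<^sup>2 * (cmod (?f x))\<^sup>2)\<^sup>2 \<le> ?W * (LINT x|torus. (cmod (?f x)) ^ 4)"
    using Cauchy_Schwarz_integral[of "\<lambda>x. of_real ((cmod (v x))\<^sup>2)" torus "\<lambda>x. of_real ((cmod (?f x))\<^sup>2)"] v i4
    by (simp add: norm_power)
  have c3: "(LINT x|torus. (cmod (?f x)) ^ 4) \<le> 2 * pi * X ^ 3"
    unfolding X_def by (rule trig_L4_le[OF I r b])
  have "of_real (2 * pi * X) = 2 * pi * (\<Sum>n\<in>I. fourier_coefficient ?N n * cnj (b n))"
  proof -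
    have "fourier_coefficient ?N n * cnj (b n) = of_real (r n ^ 4)" if "n \<in> I" for n
    proof -
      have "fourier_coefficient ?N n * cnj (b n) = of_real ((r n)\<^sup>2) * (N n * cnj (N n))"
        using that by (simp add: b_def N_def)
      also have "N n * cnj (N n) = of_real ((r n)\<^sup>2)" by (simp only: complex_norm_square r_def)
      finally show ?thesis by (simp add: power4_eq_xxxx power2_eq_square)
    qed
    then show ?thesis by (simp add: X_def)
  qed
  also have "\<dots> = (LINT x|torus. ?N x * cnj (?f x))"
    by (rule integral_mult_cnj_trig[symmetric, OF cubic_integrable[OF mv v] I])
  finally have "2 * pi * X = cmod (LINT x|torus. ?N x * cnj (?f x))"
    using X0 by (metis abs_of_nonneg norm_of_real mult_nonneg_nonneg pi_ge_zero zero_le_numeral)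
  also have "\<dots> \<le> (LINT x|torus. (cmod (v x)) ^ 3 * cmod (?f x))"
    using integral_norm_bound[of torus "\<lambda>x. ?N x * cnj (?f x)"]
    by (simp add: norm_mult power3_eq_cube power2_eq_square mult.assoc del: cnj_sum)
  finally have "2 * pi * X \<le> (LINT x|torus. (cmod (v x)) ^ 3 * cmod (?f x))" .
  then have "(2 * pi * X)\<^sup>2 \<le> (LINT x|torus. (cmod (v x)) ^ 3 * cmod (?f x))\<^sup>2"
    using X0 by (intro power_mono) auto
  also note c1
  finally have "((2 * pi * X)\<^sup>2)\<^sup>2 \<le> (?W * (LINT x|torus. (cmod (v x))\<^sup>2 * (cmod (?f x))\<^sup>2))\<^sup>2"
    by (intro power_mono) auto
  also have "\<dots> = ?W\<^sup>2 * (LINT x|torus. (cmod (v x))\<^sup>2 * (cmod (?f x))\<^sup>2)\<^sup>2" by (rule power_mult_distrib)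
  also have "\<dots> \<le> ?W\<^sup>2 * (?W * (2 * pi * X ^ 3))"
    using c2 mult_left_mono[OF c3 W0] by (intro mult_left_mono) (auto intro: order_trans)
  finally have "(2 * pi) ^ 4 * X ^ 4 \<le> (2 * pi) * (?W ^ 3 * X ^ 3)"
    by (simp add: power_mult_distrib power2_eq_square power3_eq_cube power4_eq_xxxx ac_simps)
  also have "\<dots> \<le> (2 * pi) ^ 4 * (?W ^ 3 * X ^ 3)"
  proof (rule mult_right_mono)
    have "(1::real) \<le> 2 * pi" using pi_gt3 by simp
    then show "2 * pi \<le> (2 * pi) ^ 4" using power_increasing[of 1 4 "2 * pi"] by simp
  qed (use X0 W0 in simp)
  finally have "X ^ 4 \<le> ?W ^ 3 * X ^ 3" by simp
  then have "X \<le> ?W ^ 3"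
    using X0 W0 by (cases "X = 0") (auto simp: power4_eq_xxxx power3_eq_cube zero_less_mult_iff)
  then show ?thesis by (simp add: X_def r_def N_def)
qed

subsection \<open>Absolutely continuous functions\<close>

text \<open>Absolute continuity in integrated form. The nonlinearity is only integrable in time, so
  the modes have no derivative at every time, and the Duhamel formula delivers exactly this
  statement.\<close>

definition antideriv_on :: "real \<Rightarrow> (real \<Rightarrow> complex) \<Rightarrow> (real \<Rightarrow> complex) \<Rightarrow> bool" where
  "antideriv_on T F f \<longleftrightarrow> set_integrable lborel {0..T} f \<and>
     (\<forall>t\<in>{0..T}. F t = F 0 + (LINT s:{0..t}|lborel. f s))"

lemma antideriv_onD:
  assumes "antideriv_on T F f"
  shows "set_integrable lborel {0..T} f"
    and "t \<in> {0..T} \<Longrightarrow> F t = F 0 + (LINT s:{0..t}|lborel. f s)"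
  using assms unfolding antideriv_on_def by blast+

lemma antideriv_on_continuous:
  assumes "antideriv_on T F f"
  shows "continuous_on {0..T} F"
proof -
  note i = antideriv_onD(1)[OF assms]
  have eq: "F t = F 0 + integral {0..t} f" if "t \<in> {0..T}" for t
  proof -
    have "set_integrable lborel {0..t} f" by (rule set_integrable_subset[OF i]) (use that in auto)
    then show ?thesis using antideriv_onD(2)[OF assms that] set_borel_integral_eq_integral(2) by metis
  qed
  have "continuous_on {0..T} (\<lambda>t. F 0 + integral {0..t} f)"
    using set_borel_integral_eq_integral(1)[OF i]
    by (intro continuous_intros indefinite_integral_continuous_1)
  then show ?thesis by (rule continuous_on_eq) (rule eq[symmetric])
qed

lemma set_integrable_mult_continuous:
  fixes f g :: "real \<Rightarrow> 'a :: {real_normed_field, banach, second_countable_topology}"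
  assumes f: "set_integrable lborel {0..T} f" and g: "continuous_on {0..T} g"
  shows "set_integrable lborel {0..T} (\<lambda>s. f s * g s)"
proof -
  obtain B where B: "\<And>s. s \<in> {0..T} \<Longrightarrow> norm (g s) \<le> B"
    using compact_continuous_image[OF g compact_Icc] compact_imp_bounded bounded_iff by (metis image_eqI)
  have m: "(\<lambda>s. indicator {0..T} s *\<^sub>R g s) \<in> borel_measurable lborel"
    using borel_measurable_continuous_on_indicator[OF _ g] by simp
  have fm: "(\<lambda>s. indicator {0..T} s *\<^sub>R f s) \<in> borel_measurable lborel"
    using f unfolding set_integrable_def by auto
  have eq: "indicator {0..T} s *\<^sub>R (f s * g s) = (indicator {0..T} s *\<^sub>R f s) * (indicator {0..T} s *\<^sub>R g s)" for s
    by (simp add: indicator_def)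
  show ?thesis unfolding set_integrable_def
  proof (rule Bochner_Integration.integrable_bound)
    show "integrable lborel (\<lambda>s. B * norm (indicator {0..T} s *\<^sub>R f s))"
      using f unfolding set_integrable_def by (intro integrable_mult_right integrable_norm)
    show "(\<lambda>s. indicator {0..T} s *\<^sub>R (f s * g s)) \<in> borel_measurable lborel"
      unfolding eq using fm m by (intro borel_measurable_times)
    show "AE s in lborel. norm (indicator {0..T} s *\<^sub>R (f s * g s)) \<le> norm (B * norm (indicator {0..T} s *\<^sub>R f s))"
    proof (rule AE_I2)
      fix s show "norm (indicator {0..T} s *\<^sub>R (f s * g s)) \<le> norm (B * norm (indicator {0..T} s *\<^sub>R f s))"
      proof (cases "s \<in> {0..T}")
        case True
        then have "norm (g s) \<le> \<bar>B\<bar>" using B[of s] by linarith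
        from mult_left_mono[OF this, of "norm (f s)"] show ?thesis
          using True by (simp add: norm_mult abs_mult mult.commute)
      qed simp
    qed
  qed
qed

text \<open>Integration by parts for absolutely continuous functions, by Fubini on the two triangles of
  the square \<open>[0, t]\<^sup>2\<close>.\<close>

lemma double_integral_triangles:
  fixes f g :: "real \<Rightarrow> complex"
  assumes f: "set_integrable lborel {0..t} f" and g: "set_integrable lborel {0..t} g"
  shows "(LINT s:{0..t}|lborel. f s) * (LINT s:{0..t}|lborel. g s)
     = (LINT s:{0..t}|lborel. f s * (LINT r:{0..s}|lborel. g r)) + (LINT s:{0..t}|lborel. (LINT r:{0..s}|lborel. f r) * g s)"
proof -
  define \<phi> where "\<phi> s = indicator {0..t} s *\<^sub>R f s" for s
  define \<psi> where "\<psi> s = indicator {0..t} s *\<^sub>R g s" for s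
  have i\<phi>: "integrable lborel \<phi>" and i\<psi>: "integrable lborel \<psi>"
    using f g unfolding set_integrable_def \<phi>_def \<psi>_def by auto
  have [measurable]: "\<phi> \<in> borel_measurable borel" "\<psi> \<in> borel_measurable borel"
    using i\<phi> i\<psi> by auto
  define H where "H = (\<lambda>(s, r). \<phi> s * \<psi> r)"
  have mH [measurable]: "H \<in> borel_measurable (lborel \<Otimes>\<^sub>M lborel)"
    unfolding H_def by measurable
  have iH: "integrable (lborel \<Otimes>\<^sub>M lborel) H"
  proof (rule lborel_pair.Fubini_integrable[OF mH])
    have "(\<lambda>s. LINT r|lborel. norm (H (s, r))) = (\<lambda>s. norm (\<phi> s) * (LINT r|lborel. norm (\<psi> r)))"
      by (simp add: H_def norm_mult)
    then show "integrable lborel (\<lambda>s. LINT r|lborel. norm (H (s, r)))"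
      using i\<phi> by simp
    show "AE s in lborel. integrable lborel (\<lambda>r. H (s, r))"
      using i\<psi> by (simp add: H_def)
  qed
  define H1 where "H1 = (\<lambda>(s::real, r::real). if r \<le> s then H (s, r) else 0)"
  define H2 where "H2 = (\<lambda>(s::real, r::real). if r \<le> s then 0 else H (s, r))"
  have [measurable]: "H1 \<in> borel_measurable (lborel \<Otimes>\<^sub>M lborel)" "H2 \<in> borel_measurable (lborel \<Otimes>\<^sub>M lborel)"
    unfolding H1_def H2_def H_def by measurable
  have iH1: "integrable (lborel \<Otimes>\<^sub>M lborel) H1" and iH2: "integrable (lborel \<Otimes>\<^sub>M lborel) H2"
    by (rule Bochner_Integration.integrable_bound[OF iH]; force simp: H1_def H2_def)+
  have "(LINT s|lborel. \<phi> s) * (LINT s|lborel. \<psi> s) = (LINT s|lborel. LINT r|lborel. H (s, r))"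
    by (simp add: H_def)
  also have "\<dots> = integral\<^sup>L (lborel \<Otimes>\<^sub>M lborel) H" by (rule lborel_pair.integral_fst'[OF iH])
  also have "\<dots> = integral\<^sup>L (lborel \<Otimes>\<^sub>M lborel) (\<lambda>z. H1 z + H2 z)"
    by (intro Bochner_Integration.integral_cong refl) (auto simp: H1_def H2_def)
  also have "\<dots> = integral\<^sup>L (lborel \<Otimes>\<^sub>M lborel) H1 + integral\<^sup>L (lborel \<Otimes>\<^sub>M lborel) H2"
    by (rule Bochner_Integration.integral_add[OF iH1 iH2])
  also have "integral\<^sup>L (lborel \<Otimes>\<^sub>M lborel) H1 = (LINT s|lborel. LINT r|lborel. H1 (s, r))"
    by (rule lborel_pair.integral_fst'[OF iH1, symmetric])
  also have "\<dots> = (LINT s:{0..t}|lborel. f s * (LINT r:{0..s}|lborel. g r))"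
    unfolding set_lebesgue_integral_def
  proof (intro Bochner_Integration.integral_cong refl)
    fix s :: real
    have "(\<lambda>r. H1 (s, r)) = (\<lambda>r. \<phi> s * (indicator {0..s} r *\<^sub>R g r))"
      by (auto simp: H1_def H_def \<phi>_def \<psi>_def fun_eq_iff indicator_def)
    then have "(LINT r|lborel. H1 (s, r)) = \<phi> s * (LINT r|lborel. indicator {0..s} r *\<^sub>R g r)"
      by (simp only: integral_mult_right_zero)
    then show "(LINT r|lborel. H1 (s, r)) = indicator {0..t} s *\<^sub>R (f s * (LINT r|lborel. indicator {0..s} r *\<^sub>R g r))"
      by (simp add: \<phi>_def)
  qed
  also have "integral\<^sup>L (lborel \<Otimes>\<^sub>M lborel) H2 = (LINT r|lborel. LINT s|lborel. H2 (s, r))"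
    using lborel_pair.integral_snd[of "\<lambda>s r. H2 (s, r)"] iH2 by simp
  also have "\<dots> = (LINT s:{0..t}|lborel. (LINT r:{0..s}|lborel. f r) * g s)"
    unfolding set_lebesgue_integral_def
  proof (intro Bochner_Integration.integral_cong refl)
    fix r :: real
    have "(LINT s|lborel. H2 (s, r)) = (LINT s|lborel. (indicator {0..r} s *\<^sub>R f s) * \<psi> r)"
    proof (rule integral_cong_AE)
      show "(\<lambda>s. H2 (s, r)) \<in> borel_measurable lborel" by measurable
      have eq: "(indicator {0..r} s *\<^sub>R f s) * \<psi> r = indicator {0..r} s *\<^sub>R \<phi> s * \<psi> r" for s
        by (auto simp: \<phi>_def \<psi>_def indicator_def)
      show "(\<lambda>s. (indicator {0..r} s *\<^sub>R f s) * \<psi> r) \<in> borel_measurable lborel"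
        unfolding eq by measurable
      have "AE s in lborel. s \<noteq> r" by (rule AE_lborel_singleton)
      then show "AE s in lborel. H2 (s, r) = (indicator {0..r} s *\<^sub>R f s) * \<psi> r"
        by eventually_elim (auto simp: H2_def H_def \<phi>_def \<psi>_def indicator_def)
    qed
    then have "(LINT s|lborel. H2 (s, r)) = (LINT s|lborel. indicator {0..r} s *\<^sub>R f s) * \<psi> r"
      by (simp only: integral_mult_left_zero)
    then show "(LINT s|lborel. H2 (s, r)) = indicator {0..t} r *\<^sub>R ((LINT s|lborel. indicator {0..r} s *\<^sub>R f s) * g r)"
      by (simp add: \<psi>_def)
  qed
  finally show ?thesis unfolding \<phi>_def \<psi>_def set_lebesgue_integral_def .
qed

lemma antideriv_on_mult:
  assumes F: "antideriv_on T F f" and G: "antideriv_on T G g"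
  shows "antideriv_on T (\<lambda>t. F t * G t) (\<lambda>t. f t * G t + F t * g t)"
  unfolding antideriv_on_def
proof (intro conjI ballI)
  note iF = antideriv_onD(1)[OF F] and iG = antideriv_onD(1)[OF G]
  have i1: "set_integrable lborel {0..T} (\<lambda>t. f t * G t)"
    by (rule set_integrable_mult_continuous[OF iF antideriv_on_continuous[OF G]])
  have i2: "set_integrable lborel {0..T} (\<lambda>t. F t * g t)"
    using set_integrable_mult_continuous[OF iG antideriv_on_continuous[OF F]] by (simp add: mult.commute)
  show "set_integrable lborel {0..T} (\<lambda>t. f t * G t + F t * g t)" using i1 i2 by simp
  fix t assume t: "t \<in> {0..T}"
  have sub: "{0..t} \<subseteq> {0..T}" using t by auto
  note j1 = set_integrable_subset[OF i1 _ sub, simplified] and j2 = set_integrable_subset[OF i2 _ sub, simplified]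
    and jF = set_integrable_subset[OF iF _ sub, simplified] and jG = set_integrable_subset[OF iG _ sub, simplified]
  let ?P = "\<lambda>s. LINT r:{0..s}|lborel. f r" and ?Q = "\<lambda>s. LINT r:{0..s}|lborel. g r"
  have PF: "?P s = F s - F 0" and QG: "?Q s = G s - G 0" if "s \<in> {0..t}" for s
    using antideriv_onD(2)[OF F, of s] antideriv_onD(2)[OF G, of s] subsetD[OF sub that] by (simp_all only: add_diff_cancel_left')
  have k1: "set_integrable lborel {0..t} (\<lambda>s. f s * ?Q s)"
  proof -
    have "set_integrable lborel {0..t} (\<lambda>s. f s * G s - G 0 * f s)"
      using j1 jF by (intro set_integral_diff) auto
    moreover have "set_integrable lborel {0..t} (\<lambda>s. f s * G s - G 0 * f s) = set_integrable lborel {0..t} (\<lambda>s. f s * ?Q s)"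
      by (intro set_integrable_cong refl) (simp only: QG right_diff_distrib mult.commute)
    ultimately show ?thesis by simp
  qed
  have k2: "set_integrable lborel {0..t} (\<lambda>s. ?P s * g s)"
  proof -
    have "set_integrable lborel {0..t} (\<lambda>s. F s * g s - F 0 * g s)"
      using j2 jG by (intro set_integral_diff) auto
    moreover have "set_integrable lborel {0..t} (\<lambda>s. F s * g s - F 0 * g s) = set_integrable lborel {0..t} (\<lambda>s. ?P s * g s)"
      by (intro set_integrable_cong refl) (simp only: PF left_diff_distrib)
    ultimately show ?thesis by simp
  qed
  \<comment> \<open>The initial values are split off, \<open>F = F 0 + ?P\<close> and
    \<open>G = G 0 + ?Q\<close>; what remains are the integrals over the two triangles, which add up
    to \<open>?P t * ?Q t\<close>.\<close>
  have "(LINT s:{0..t}|lborel. f s * G s + F s * g s)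
      = (LINT s:{0..t}|lborel. G 0 * f s + F 0 * g s + (f s * ?Q s + ?P s * g s))"
    by (intro set_lebesgue_integral_cong) (auto simp: PF QG algebra_simps)
  also have "\<dots> = G 0 * ?P t + F 0 * ?Q t + ((LINT s:{0..t}|lborel. f s * ?Q s) + (LINT s:{0..t}|lborel. ?P s * g s))"
    using jF jG k1 k2 by (simp add: set_integral_add)
  also have "\<dots> = G 0 * ?P t + F 0 * ?Q t + ?P t * ?Q t"
    by (simp only: double_integral_triangles[OF jF jG])
  also have "\<dots> = F t * G t - F 0 * G 0"
    using t by (simp add: PF QG algebra_simps)
  finally show "F t * G t = F 0 * G 0 + (LINT s:{0..t}|lborel. f s * G s + F s * g s)" by simp
qed

lemma antideriv_on_cnj:
  assumes "antideriv_on T F f" shows "antideriv_on T (\<lambda>t. cnj (F t)) (\<lambda>t. cnj (f t))"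
proof -
  have eq: "indicator A s *\<^sub>R cnj (f s) = cnj (indicator A s *\<^sub>R f s)" for A and s :: real by simp
  show ?thesis unfolding antideriv_on_def
  proof (intro conjI ballI)
    show "set_integrable lborel {0..T} (\<lambda>t. cnj (f t))"
      using antideriv_onD(1)[OF assms] unfolding set_integrable_def eq by (rule integrable_cnj)
    fix t assume "t \<in> {0..T}"
    from arg_cong[OF antideriv_onD(2)[OF assms this], of cnj]
    show "cnj (F t) = cnj (F 0) + (LINT s:{0..t}|lborel. cnj (f s))"
      unfolding set_lebesgue_integral_def eq Bochner_Integration.integral_cnj complex_cnj_add .
  qed
qed

lemma antideriv_on_C1:
  assumes "\<And>t. t \<in> {0..T} \<Longrightarrow> (F has_vector_derivative f t) (at t within {0..T})"
    and c: "continuous_on {0..T} f"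
  shows "antideriv_on T F f"
  unfolding antideriv_on_def
proof (intro conjI ballI)
  show i: "set_integrable lborel {0..T} f" by (rule borel_integrable_atLeastAtMost'[OF c])
  fix t assume t: "t \<in> {0..T}"
  have "(f has_integral (F t - F 0)) {0..t}"
    using t by (intro fundamental_theorem_of_calculus)
      (auto intro: has_vector_derivative_within_subset[OF assms(1)])
  moreover have "(LINT s:{0..t}|lborel. f s) = integral {0..t} f"
    by (rule set_borel_integral_eq_integral(2)) (rule set_integrable_subset[OF i], use t in auto)
  ultimately show "F t = F 0 + (LINT s:{0..t}|lborel. f s)" by (simp add: integral_unique)
qed

lemma antideriv_on_cis:
  assumes a: "continuous_on {0..T} a"
  shows "antideriv_on T (\<lambda>t. cis (LINT s:{0..t}|lborel. a s)) (\<lambda>t. \<i> * of_real (a t) * cis (LINT s:{0..t}|lborel. a s))"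
proof -
  let ?A = "\<lambda>t. LINT s:{0..t}|lborel. a s"
  have i: "set_integrable lborel {0..T} a" by (rule borel_integrable_atLeastAtMost'[OF a])
  have eq: "?A t = integral {0..t} a" if "t \<in> {0..T}" for t
    by (rule set_borel_integral_eq_integral(2)) (rule set_integrable_subset[OF i], use that in auto)
  have dA: "(?A has_vector_derivative a t) (at t within {0..T})" if t: "t \<in> {0..T}" for t
  proof (rule has_vector_derivative_transform[OF t])
    show "((\<lambda>t. integral {0..t} a) has_vector_derivative a t) (at t within {0..T})"
      by (rule integral_has_vector_derivative[OF a t])
  qed (simp add: eq)
  have cA: "continuous_on {0..T} ?A"
    by (rule continuous_on_vector_derivative[OF dA])
  show ?thesis
  proof (rule antideriv_on_C1)
    fix t assume t: "t \<in> {0..T}"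
    have "((cis \<circ> ?A) has_vector_derivative (a t *\<^sub>R (\<i> * of_real 1 * cis (1 * ?A t)))) (at t within {0..T})"
      by (rule vector_diff_chain_within[OF dA[OF t]])
        (use has_vector_derivative_cis[of 1 "?A t"] in simp)
    then show "((\<lambda>t. cis (?A t)) has_vector_derivative \<i> * of_real (a t) * cis (?A t)) (at t within {0..T})"
      by (simp add: o_def scaleR_conv_of_real ac_simps)
  qed (intro continuous_intros a cA)
qed

lemma antideriv_on_cis_linear:
  "antideriv_on T (\<lambda>t. cis (a * t)) (\<lambda>t. \<i> * of_real a * cis (a * t))"
  by (rule antideriv_on_C1) (intro has_vector_derivative_cis continuous_intros)+

lemma antideriv_on_scale:
  assumes "antideriv_on T F f" shows "antideriv_on T (\<lambda>t. c * F t) (\<lambda>t. c * f t)"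
  unfolding antideriv_on_def
proof (intro conjI ballI)
  show "set_integrable lborel {0..T} (\<lambda>t. c * f t)" using antideriv_onD(1)[OF assms] by simp
  fix t assume "t \<in> {0..T}"
  from arg_cong[OF antideriv_onD(2)[OF assms this], of "\<lambda>z. c * z"]
  show "c * F t = c * F 0 + (LINT s:{0..t}|lborel. c * f s)" by (simp only: distrib_left set_integral_mult_right)
qed

section \<open>Symmetric partial sums and limits under the integral\<close>

lemma filterlim_symmetric_intervals:
  "filterlim (\<lambda>L::nat. {- int L..int L}) (finite_subsets_at_top UNIV) sequentially"
  unfolding filterlim_finite_subsets_at_top
proof (intro allI impI)
  fix X :: "int set" assume "finite X \<and> X \<subseteq> UNIV"
  then have X: "finite X" by simp
  obtain b where b: "\<And>n. n \<in> X \<Longrightarrow> \<bar>n\<bar> \<le> b"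
    using finite_imageI[OF X, of abs] Max_ge by (metis image_eqI)
  show "\<forall>\<^sub>F L in sequentially. finite {- int L..int L} \<and> X \<subseteq> {- int L..int L} \<and> {- int L..int L} \<subseteq> UNIV"
    using eventually_ge_at_top[of "nat b"]
  proof eventually_elim
    case (elim L)
    have "n \<in> {- int L..int L}" if "n \<in> X" for n using b[OF that] elim by auto
    then show ?case by auto
  qed
qed

text \<open>Dominated convergence is a statement on sequences, so unordered sums over the integers
  are turned into limits of symmetric partial sums.\<close>

lemma has_sum_tendsto_symmetric:
  assumes "(f has_sum x) (UNIV :: int set)"
  shows "(\<lambda>L::nat. \<Sum>n\<in>{- int L..int L}. f n) \<longlonglongrightarrow> x"
  using filterlim_compose[OF assms[unfolded has_sum_def] filterlim_symmetric_intervals] .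

lemma has_sum_remove_point:
  fixes f :: "int \<Rightarrow> complex"
  assumes "(f has_sum x) UNIV"
  shows "((\<lambda>n. if n = c then 0 else f n) has_sum (x - f c)) UNIV"
proof -
  have "((\<lambda>n. if n = c then - f c else 0) has_sum (- f c)) UNIV"
    by (rule has_sum_finite_neutralI[of "{c}"]) auto
  note s = has_sum_add[OF assms this]
  have "(\<lambda>n. f n + (if n = c then - f c else 0)) = (\<lambda>n. if n = c then 0 else f n)" by auto
  with s show ?thesis by simp
qed

lemma set_LINT_dominated_convergence:
  fixes s :: "nat \<Rightarrow> real \<Rightarrow> complex"
  assumes f: "set_borel_measurable lborel J f" and s: "\<And>i. set_integrable lborel J (s i)"
    and w: "set_integrable lborel J w"
    and lim: "AE x in lborel. x \<in> J \<longrightarrow> (\<lambda>i. s i x) \<longlonglongrightarrow> f x"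
    and bound: "\<And>i. AE x in lborel. x \<in> J \<longrightarrow> cmod (s i x) \<le> w x"
  shows "set_integrable lborel J f" and "(\<lambda>i. LINT x:J|lborel. s i x) \<longlonglongrightarrow> (LINT x:J|lborel. f x)"
proof -
  let ?f = "\<lambda>x. indicator J x *\<^sub>R f x" and ?s = "\<lambda>i x. indicator J x *\<^sub>R s i x"
    and ?w = "\<lambda>x. indicator J x *\<^sub>R w x"
  have 1: "?f \<in> borel_measurable lborel" using f by (simp add: set_borel_measurable_def)
  have 2: "?s i \<in> borel_measurable lborel" for i using s[of i] unfolding set_integrable_def by auto
  have 3: "integrable lborel ?w" using w by (simp add: set_integrable_def)
  have 4: "AE x in lborel. (\<lambda>i. ?s i x) \<longlonglongrightarrow> ?f x"
    using lim by eventually_elim (auto simp: indicator_def)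
  have 5: "AE x in lborel. norm (?s i x) \<le> ?w x" for i
    using bound[of i] by eventually_elim (auto simp: indicator_def)
  show "set_integrable lborel J f"
    unfolding set_integrable_def by (rule integrable_dominated_convergence[OF 1 2 3 4 5])
  show "(\<lambda>i. LINT x:J|lborel. s i x) \<longlonglongrightarrow> (LINT x:J|lborel. f x)"
    unfolding set_lebesgue_integral_def by (rule integral_dominated_convergence[OF 1 2 3 4 5])
qed

lemma set_borel_measurable_lim:
  fixes s :: "nat \<Rightarrow> real \<Rightarrow> complex"
  assumes s: "\<And>i. set_integrable lborel J (s i)" and lim: "\<And>x. x \<in> J \<Longrightarrow> (\<lambda>i. s i x) \<longlonglongrightarrow> f x"
  shows "set_borel_measurable lborel J f"
  unfolding set_borel_measurable_def
proof (rule borel_measurable_LIMSEQ_metric)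
  show "(\<lambda>x. indicator J x *\<^sub>R s i x) \<in> borel_measurable lborel" for i
    using s[of i] unfolding set_integrable_def by auto
  show "(\<lambda>i. indicator J x *\<^sub>R s i x) \<longlonglongrightarrow> indicator J x *\<^sub>R f x" for x
    using lim[of x] by (cases "x \<in> J") auto
qed

lemma set_integral_norm_bound': 
  fixes f :: "real \<Rightarrow> complex"
  assumes "set_integrable lborel J f"
  shows "cmod (LINT s:J|lborel. f s) \<le> (LINT s:J|lborel. cmod (f s))"
  using integral_norm_bound[of lborel "\<lambda>x. indicator J x *\<^sub>R f x"]
  unfolding set_lebesgue_integral_def by simp

lemma set_integral_singleton: "(LINT s:{t}|lborel. f s) = (0 :: 'a :: {banach, second_countable_topology})"
proof -
  have "AE s in lborel. indicator {t} s *\<^sub>R f s = 0"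
    using AE_lborel_singleton[of t] by eventually_elim (simp add: indicator_def)
  then show ?thesis unfolding set_lebesgue_integral_def by (rule integral_eq_zero_AE)
qed

lemma set_integral_sum:
  fixes f :: "'i \<Rightarrow> real \<Rightarrow> 'a :: {banach, second_countable_topology}"
  assumes "\<And>i. i \<in> I \<Longrightarrow> set_integrable lborel J (f i)"
  shows "(LINT s:J|lborel. (\<Sum>i\<in>I. f i s)) = (\<Sum>i\<in>I. LINT s:J|lborel. f i s)"
  using assms unfolding set_lebesgue_integral_def set_integrable_def scaleR_sum_right
  by (rule Bochner_Integration.integral_sum)

lemma set_integrable_sum:
  fixes f :: "'i \<Rightarrow> real \<Rightarrow> 'a :: {banach, second_countable_topology}"
  assumes "\<And>i. i \<in> I \<Longrightarrow> set_integrable lborel J (f i)"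
  shows "set_integrable lborel J (\<lambda>s. \<Sum>i\<in>I. f i s)"
  using assms unfolding set_integrable_def scaleR_sum_right
  by (rule Bochner_Integration.integrable_sum)

subsection \<open>Normal form\<close>

text \<open>The Fourier modes of a solution in the interaction picture: \<open>U\<close> and \<open>N\<close> are the coefficients of the
  solution and of its cubic nonlinearity, \<open>A\<close> those of the squared modulus, \<open>M\<close> is the mass, and \<open>w\<close>
  dominates the nonlinearity in \<open>\<ell>\<^sup>4\<close>.\<close>

locale nls_modes =
  fixes T lam :: real and a U N A :: "int \<Rightarrow> real \<Rightarrow> complex" and M w :: "real \<Rightarrow> real"
  assumes T: "0 \<le> T" and lam: "0 < lam"
    and U_eq: "\<And>n s. U n s = cis (- (s * (of_int n)\<^sup>2)) * a n s"
    and a_int: "\<And>n. antideriv_on T (a n) (\<lambda>s. - (\<i> * of_real lam) * cis (s * (of_int n)\<^sup>2) * N n s)"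
    and M_sum: "\<And>t. t \<in> {0..T} \<Longrightarrow> ((\<lambda>n. (cmod (a n t))\<^sup>2) has_sum M t) UNIV"
    and M_cont: "continuous_on {0..T} M"
    and w_int: "set_integrable lborel {0..T} w" and w_nonneg: "\<And>s. 0 \<le> w s"
    and N_l4: "AE s in lborel. s \<in> {0..T} \<longrightarrow> (\<forall>I. finite I \<longrightarrow> (\<Sum>n\<in>I. (cmod (N n s)) ^ 4) \<le> w s ^ 4)"
    and A_sum: "\<And>s k. s \<in> {0..T} \<Longrightarrow> ((\<lambda>m. U (m + k) s * cnj (U m s)) has_sum A k s) UNIV"
    and A_l2: "AE s in lborel. s \<in> {0..T} \<longrightarrow> (\<forall>I. finite I \<longrightarrow> (\<Sum>n\<in>I. (cmod (A n s))\<^sup>2) \<le> (w s)\<^sup>2)"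
    and N_sum: "AE s in lborel. s \<in> {0..T} \<longrightarrow> (\<forall>n. ((\<lambda>k. A k s * U (n - k) s) has_sum N n s) UNIV)"
begin

definition y :: "real \<Rightarrow> real" where "y s = sqrt (M s)"

definition h :: "int \<Rightarrow> real \<Rightarrow> complex" where
  "h n s = - (\<i> * of_real lam) * cis (s * (of_int n)\<^sup>2) * N n s"

text \<open>The resonant part of the nonlinearity only rotates the mode \<open>n\<close>, with the real speed \<open>g n\<close>. In \<open>b\<close>
  this rotation is removed, so that \<open>b\<close> is driven by nonresonant terms alone.\<close>

definition g :: "int \<Rightarrow> real \<Rightarrow> real" where "g n s = lam * (2 * M s - (cmod (a n s))\<^sup>2)"

definition G :: "int \<Rightarrow> real \<Rightarrow> real" where "G n t = (LINT s:{0..t}|lborel. g n s)"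

definition b :: "int \<Rightarrow> real \<Rightarrow> complex" where "b n t = cis (G n t) * a n t"

definition E :: "int \<Rightarrow> real \<Rightarrow> complex" where "E n s = cis (G n s) * cis (s * (of_int n)\<^sup>2)"

text \<open>The nonresonant remainder. In the cubic sum the resonant terms form two families, each
  with sum \<open>M s * U n s\<close>; their common term
  \<open>(cmod (a n s))\<^sup>2 * U n s\<close> is counted once, which explains the factor 2 M -
  |a|^2.\<close>

definition R :: "int \<Rightarrow> real \<Rightarrow> complex" where
  "R n s = N n s - of_real (2 * M s - (cmod (a n s))\<^sup>2) * U n s"

lemma U_norm [simp]: "cmod (U n s) = cmod (a n s)"
  by (simp add: U_eq norm_mult)

lemma E_norm [simp]: "cmod (E n s) = 1"
  by (simp add: E_def norm_mult)

lemma h_norm: "cmod (h n s) = lam * cmod (N n s)"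
  using lam by (simp add: h_def norm_mult)

lemma a_cont: "continuous_on {0..T} (a n)"
  by (rule antideriv_on_continuous[OF a_int])

lemma U_cont: "continuous_on {0..T} (U n)"
  unfolding U_eq[abs_def] by (intro continuous_intros a_cont)

lemma g_cont: "continuous_on {0..T} (g n)"
  unfolding g_def[abs_def] by (intro continuous_intros a_cont M_cont)

lemma cisG_int: "antideriv_on T (\<lambda>t. cis (G n t)) (\<lambda>t. \<i> * of_real (g n t) * cis (G n t))"
  unfolding G_def by (rule antideriv_on_cis[OF g_cont])

lemma E_cont: "continuous_on {0..T} (E n)"
  unfolding E_def[abs_def] by (intro continuous_intros antideriv_on_continuous[OF cisG_int])

lemma M_nonneg: "t \<in> {0..T} \<Longrightarrow> 0 \<le> M t"
  by (rule has_sum_nonneg[OF M_sum]) auto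

lemma sum_a_le: "t \<in> {0..T} \<Longrightarrow> finite I \<Longrightarrow> (\<Sum>n\<in>I. (cmod (a n t))\<^sup>2) \<le> M t"
  by (rule finite_sum_le_has_sum[OF M_sum]) auto

lemma y_nonneg: "t \<in> {0..T} \<Longrightarrow> 0 \<le> y t"
  using M_nonneg by (simp add: y_def)

lemma y_power2: "t \<in> {0..T} \<Longrightarrow> (y t)\<^sup>2 = M t"
  using M_nonneg by (simp add: y_def)

lemma y_cont: "continuous_on {0..T} y"
  unfolding y_def[abs_def] by (intro continuous_intros M_cont)

lemma a_l2: "t \<in> {0..T} \<Longrightarrow> l2_le (\<lambda>n. cmod (a n t)) (y t)"
  unfolding l2_le_def using y_nonneg sum_a_le y_power2 by auto

lemma a_sq_le: "t \<in> {0..T} \<Longrightarrow> (cmod (a n t))\<^sup>2 \<le> M t"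
  using sum_a_le[of t "{n}"] by simp

lemma a_le: "t \<in> {0..T} \<Longrightarrow> cmod (a n t) \<le> y t"
  using a_sq_le y_nonneg y_power2 by (metis power2_le_imp_le)

lemma g_bounds: "t \<in> {0..T} \<Longrightarrow> 0 \<le> g n t" "t \<in> {0..T} \<Longrightarrow> g n t \<le> lam * (2 * M t)"
  using lam a_sq_le[of t n] M_nonneg[of t] unfolding g_def by (auto intro!: mult_nonneg_nonneg mult_left_mono)

lemma set_integrable_cont: "continuous_on {0..T} f \<Longrightarrow> t \<in> {0..T} \<Longrightarrow> set_integrable lborel {0..t} f"
  for f :: "real \<Rightarrow> 'b :: {banach, second_countable_topology}"
  by (rule set_integrable_subset[OF borel_integrable_atLeastAtMost']) auto

lemma set_integrable_sub:
  "set_integrable lborel {0..T} f \<Longrightarrow> t \<in> {0..T} \<Longrightarrow> set_integrable lborel {0..t} f"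
  for f :: "real \<Rightarrow> 'b :: {banach, second_countable_topology}"
  by (rule set_integrable_subset) auto

text \<open>The factor \<open>cis (G n t)\<close> contributes \<i> times \<open>g n\<close> to the
  derivative of \<open>b n\<close>. This cancels the resonant part of the nonlinearity exactly and
  leaves \<open>E n s * R n s\<close>.\<close>

lemma ER_int: "set_integrable lborel {0..T} (\<lambda>s. E n s * R n s)"
  and b_eq: "t \<in> {0..T} \<Longrightarrow> b n t - a n 0 = - (\<i> * of_real lam) * (LINT s:{0..t}|lborel. E n s * R n s)"
proof -
  define d where "d s = \<i> * of_real (g n s) * cis (G n s) * a n s + cis (G n s) * h n s" for s
  have bd: "antideriv_on T (b n) d"
    unfolding b_def[abs_def] d_def h_def using antideriv_on_mult[OF cisG_int a_int] .
  have d_eq: "d s = - (\<i> * of_real lam) * (E n s * R n s)" for s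
  proof -
    have "cis (s * (of_int n)\<^sup>2) * U n s = a n s"
      by (simp add: U_eq mult.assoc[symmetric] cis_mult)
    then have ER: "E n s * R n s = E n s * N n s - of_real (2 * M s - (cmod (a n s))\<^sup>2) * cis (G n s) * a n s"
      unfolding R_def E_def by (simp add: algebra_simps)
    have "d s = - (\<i> * of_real lam) * (E n s * N n s - of_real (2 * M s - (cmod (a n s))\<^sup>2) * cis (G n s) * a n s)"
      unfolding d_def h_def E_def g_def by (simp add: algebra_simps)
    then show ?thesis by (simp only: ER)
  qed
  have "set_integrable lborel {0..T} (\<lambda>s. (\<i> / of_real lam) * d s)"
    using antideriv_onD(1)[OF bd] by simp
  then show "set_integrable lborel {0..T} (\<lambda>s. E n s * R n s)"
    unfolding d_eq using lam by (simp add: mult.assoc[symmetric])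
  show "b n t - a n 0 = - (\<i> * of_real lam) * (LINT s:{0..t}|lborel. E n s * R n s)" if t: "t \<in> {0..T}"
  proof -
    have "b n 0 = a n 0" by (simp add: b_def G_def set_integral_singleton)
    moreover have "b n t = b n 0 + (LINT s:{0..t}|lborel. d s)" by (rule antideriv_onD(2)[OF bd t])
    ultimately show ?thesis unfolding d_eq set_integral_mult_right by simp
  qed
qed

text \<open>The index k is the frequency of the squared modulus and m the summation index in its
  coefficient, so the three modes have frequencies p = m + k, q = m and r = n - k. The excluded
  cases are p = q and r = q, where the phase vanishes.\<close>

definition resonant_free :: "int \<times> int \<times> int \<Rightarrow> bool" where
  "resonant_free = (\<lambda>(n, k, m). k \<noteq> 0 \<and> m \<noteq> n - k)"

definition summand :: "int \<times> int \<times> int \<Rightarrow> real \<Rightarrow> complex" where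
  "summand = (\<lambda>(n, k, m) s. E n s * (U (n - k) s * (U (m + k) s * cnj (U m s))))"

definition prod3 :: "int \<Rightarrow> int \<Rightarrow> int \<Rightarrow> real \<Rightarrow> real" where
  "prod3 p q r s = cmod (a p s) * cmod (a q s) * cmod (a r s)"

text \<open>A bound for the time derivative of the rotation factor times three modes. The first term
  comes from the rotation, whose speed is at most 2 lam M; the others come from the product rule, as
  each mode changes at the rate lam |N|.\<close>

definition dprod3 :: "int \<Rightarrow> int \<Rightarrow> int \<Rightarrow> real \<Rightarrow> real" where
  "dprod3 p q r s = lam * (2 * M s * prod3 p q r s + cmod (N p s) * cmod (a q s) * cmod (a r s)
     + cmod (a p s) * cmod (N q s) * cmod (a r s) + cmod (a p s) * cmod (a q s) * cmod (N r s))"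

definition weight :: "int \<Rightarrow> int \<Rightarrow> int \<Rightarrow> real" where
  "weight p q r = 1 / (\<bar>of_int (p - q)\<bar> * \<bar>of_int (r - q)\<bar>)"

text \<open>Integration by parts against the oscillating factor with frequency
  \<open>n\<^sup>2 - p\<^sup>2 + q\<^sup>2 - r\<^sup>2 = 2 (p - q) (r - q)\<close>, where \<open>p - q + r = n\<close>.\<close>

lemma summand_by_parts:
  assumes "resonant_free (n, k, m)"
  shows "\<exists>Z. set_integrable lborel {0..T} Z \<and>
    (\<forall>s\<in>{0..T}. cmod (Z s) \<le> dprod3 (m + k) m (n - k) s) \<and>
    (\<forall>t\<in>{0..T}. cmod (LINT s:{0..t}|lborel. summand (n, k, m) s)
       \<le> (1/2) * weight (m + k) m (n - k) * (prod3 (m + k) m (n - k) t + prod3 (m + k) m (n - k) 0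
            + (LINT s:{0..t}|lborel. cmod (Z s))))"
proof -
  define p where "p = m + k"
  define q where "q = m"
  define r where "r = n - k"
  define \<Omega> :: real where "\<Omega> = 2 * of_int (p - q) * of_int (r - q)"
  have \<Omega>0: "\<Omega> \<noteq> 0" using assms by (auto simp: resonant_free_def \<Omega>_def p_def q_def r_def)
  have \<Omega>_eq: "\<Omega> = (of_int n)\<^sup>2 - (of_int r)\<^sup>2 - (of_int p)\<^sup>2 + (of_int q)\<^sup>2"
    unfolding \<Omega>_def p_def q_def r_def by (simp add: power2_eq_square algebra_simps)
  have w_eq: "1 / \<bar>\<Omega>\<bar> = (1/2) * weight p q r"
    unfolding weight_def \<Omega>_def by (simp add: abs_mult del: of_int_diff)
  define X where "X s = cis (G n s) * (a p s * (cnj (a q s) * a r s))" for s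
  define Z where "Z s = (\<i> * of_real (g n s) * cis (G n s)) * (a p s * (cnj (a q s) * a r s))
    + cis (G n s) * (h p s * (cnj (a q s) * a r s) + a p s * (cnj (h q s) * a r s + cnj (a q s) * h r s))" for s
  have Xd: "antideriv_on T X Z"
    unfolding X_def[abs_def] Z_def h_def
    by (intro antideriv_on_mult cisG_int a_int antideriv_on_cnj)
  define F where "F s = (1 / (\<i> * of_real \<Omega>)) * cis (\<Omega> * s)" for s
  have Fd: "antideriv_on T F (\<lambda>s. cis (\<Omega> * s))"
    using antideriv_on_scale[OF antideriv_on_cis_linear[of T \<Omega>], of "1 / (\<i> * of_real \<Omega>)"] \<Omega>0
    unfolding F_def[abs_def] by simp
  have FXd: "antideriv_on T (\<lambda>s. F s * X s) (\<lambda>s. cis (\<Omega> * s) * X s + F s * Z s)"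
    by (rule antideriv_on_mult[OF Fd Xd])
  have Fn: "cmod (F s) = 1 / \<bar>\<Omega>\<bar>" for s by (simp add: F_def norm_mult norm_divide)
  have Xn: "cmod (X s) = prod3 p q r s" for s by (simp add: X_def prod3_def norm_mult)
  have iZ: "set_integrable lborel {0..T} Z" by (rule antideriv_onD(1)[OF Xd])
  have iFZ: "set_integrable lborel {0..T} (\<lambda>s. F s * Z s)"
    using set_integrable_mult_continuous[OF iZ antideriv_on_continuous[OF Fd]] by (simp add: mult.commute)
  have iX: "set_integrable lborel {0..T} (\<lambda>s. cis (\<Omega> * s) * X s)"
    by (intro borel_integrable_atLeastAtMost' continuous_intros antideriv_on_continuous[OF Xd])
  have eq: "summand (n, k, m) s = cis (\<Omega> * s) * X s" for s
  proof -
    have "cis (s * (of_int n)\<^sup>2) * (cis (- (s * (of_int r)\<^sup>2)) * (cis (- (s * (of_int p)\<^sup>2)) * cnj (cis (- (s * (of_int q)\<^sup>2))))) = cis (\<Omega> * s)"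
      unfolding cis_cnj cis_mult \<Omega>_eq by (simp add: algebra_simps)
    note * = this[symmetric]
    show ?thesis unfolding * summand_def X_def E_def U_eq p_def q_def r_def
      by (simp add: ac_simps)
  qed
  show ?thesis
  proof (intro exI[of _ Z] conjI ballI iZ)
    fix s assume s: "s \<in> {0..T}"
    have "cmod (Z s) \<le> cmod ((\<i> * of_real (g n s) * cis (G n s)) * (a p s * (cnj (a q s) * a r s)))
       + (cmod (h p s * (cnj (a q s) * a r s)) + (cmod (a p s * (cnj (h q s) * a r s)) + cmod (a p s * (cnj (a q s) * h r s))))"
    proof -
      have "cmod (u + c * (v1 + (v2 + v3))) \<le> cmod u + (cmod v1 + (cmod v2 + cmod v3))"
        if "cmod c = 1" for u c v1 v2 v3
        using norm_triangle_ineq[of u "c * (v1 + (v2 + v3))"] norm_triangle_ineq[of v1 "v2 + v3"]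
          norm_triangle_ineq[of v2 v3] that by (simp add: norm_mult)
      then show ?thesis unfolding Z_def distrib_left[of "a p s"] by simp
    qed
    also have "\<dots> = g n s * prod3 p q r s + lam * (cmod (N p s) * cmod (a q s) * cmod (a r s)
       + cmod (a p s) * cmod (N q s) * cmod (a r s) + cmod (a p s) * cmod (a q s) * cmod (N r s))"
      using g_bounds(1)[OF s, of n] by (simp add: norm_mult h_norm prod3_def algebra_simps)
    also have "\<dots> \<le> lam * (2 * M s) * prod3 p q r s + lam * (cmod (N p s) * cmod (a q s) * cmod (a r s)
       + cmod (a p s) * cmod (N q s) * cmod (a r s) + cmod (a p s) * cmod (a q s) * cmod (N r s))"
      using g_bounds(2)[OF s, of n] by (intro add_right_mono mult_right_mono) (auto simp: prod3_def)
    also have "\<dots> = dprod3 p q r s" by (simp add: dprod3_def algebra_simps)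
    finally show "cmod (Z s) \<le> dprod3 (m + k) m (n - k) s" by (simp add: p_def q_def r_def)
  next
    fix t assume t: "t \<in> {0..T}"
    have "F t * X t = F 0 * X 0 + (LINT s:{0..t}|lborel. cis (\<Omega> * s) * X s + F s * Z s)"
      by (rule antideriv_onD(2)[OF FXd t])
    also have "(LINT s:{0..t}|lborel. cis (\<Omega> * s) * X s + F s * Z s)
        = (LINT s:{0..t}|lborel. cis (\<Omega> * s) * X s) + (LINT s:{0..t}|lborel. F s * Z s)"
      by (rule set_integral_add) (rule set_integrable_sub[OF iX t] set_integrable_sub[OF iFZ t])+
    finally have "(LINT s:{0..t}|lborel. summand (n, k, m) s) = F t * X t - F 0 * X 0 - (LINT s:{0..t}|lborel. F s * Z s)"
      unfolding eq by (simp add: algebra_simps)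
    also have "cmod \<dots> \<le> cmod (F t * X t) + cmod (F 0 * X 0) + cmod (LINT s:{0..t}|lborel. F s * Z s)"
      by (intro order_trans[OF norm_triangle_ineq4] add_right_mono norm_triangle_ineq4)
    also have "cmod (LINT s:{0..t}|lborel. F s * Z s) \<le> (LINT s:{0..t}|lborel. cmod (F s * Z s))"
      by (rule set_integral_norm_bound'[OF set_integrable_sub[OF iFZ t]])
    also have "(LINT s:{0..t}|lborel. cmod (F s * Z s)) = 1 / \<bar>\<Omega>\<bar> * (LINT s:{0..t}|lborel. cmod (Z s))"
      unfolding norm_mult Fn set_integral_mult_right ..
    finally have "cmod (LINT s:{0..t}|lborel. summand (n, k, m) s)
       \<le> 1 / \<bar>\<Omega>\<bar> * (prod3 p q r t + prod3 p q r 0 + (LINT s:{0..t}|lborel. cmod (Z s)))"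
      unfolding norm_mult Fn Xn by (simp add: distrib_left)
    then show "cmod (LINT s:{0..t}|lborel. summand (n, k, m) s)
       \<le> (1/2) * weight (m + k) m (n - k) * (prod3 (m + k) m (n - k) t + prod3 (m + k) m (n - k) 0
            + (LINT s:{0..t}|lborel. cmod (Z s)))"
      unfolding w_eq unfolding p_def q_def r_def .
  qed
qed

section \<open>Summation of the integrated terms over the frequencies\<close>

definition nf_density :: "real \<Rightarrow> real" where
  "nf_density s = 2 * y s ^ 5 + 3 * (w s * (y s)\<^sup>2)"

definition nf_bound :: "real \<Rightarrow> real" where
  "nf_bound t = trilinear_const / 2 * (y t ^ 3 + y 0 ^ 3 + lam * (LINT s:{0..t}|lborel. nf_density s))"

lemma nf_density_int: "set_integrable lborel {0..T} nf_density"
proof -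
  have "set_integrable lborel {0..T} (\<lambda>s. w s * (y s)\<^sup>2)"
    by (intro set_integrable_mult_continuous w_int continuous_intros y_cont)
  moreover have "set_integrable lborel {0..T} (\<lambda>s. 2 * y s ^ 5)"
    by (intro borel_integrable_atLeastAtMost' continuous_intros y_cont)
  ultimately show ?thesis unfolding nf_density_def[abs_def] by simp
qed

lemma triple_index_inj: "inj_on (\<lambda>(n, k, m). (m + k, m, n - k)) (F :: (int \<times> int \<times> int) set)"
  by (auto simp: inj_on_def)

lemma weighted_sum_eq:
  assumes "finite F"
  shows "(\<Sum>(n, k, m)\<in>F. weight (m + k) m (n - k) * (f1 (m + k) * f2 m * f3 (n - k)))
    = trilinear_form ((\<lambda>(n, k, m). (m + k, m, n - k)) ` F) f1 f2 f3"
  unfolding trilinear_form_def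
  by (subst sum.reindex[OF triple_index_inj]) (auto intro!: sum.cong simp: weight_def)

lemma sum_prod3_le:
  assumes F: "finite F" and t: "t \<in> {0..T}"
  shows "(\<Sum>(n, k, m)\<in>F. weight (m + k) m (n - k) * prod3 (m + k) m (n - k) t) \<le> trilinear_const * y t ^ 3"
proof -
  have "(\<Sum>(n, k, m)\<in>F. weight (m + k) m (n - k) * prod3 (m + k) m (n - k) t)
     \<le> trilinear_const * y t * y t * y t"
    unfolding prod3_def weighted_sum_eq[OF F, of "\<lambda>n. cmod (a n t)" "\<lambda>n. cmod (a n t)" "\<lambda>n. cmod (a n t)"]
    by (rule trilinear_form_le(1)[OF finite_imageI[OF F] l2_le_imp_l4_le[OF a_l2[OF t]] a_l2[OF t] a_l2[OF t]])
  then show ?thesis by (simp add: power3_eq_cube mult.assoc)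
qed

text \<open>The rotation contributes 2 M y^3 = 2 y^5, and each of the three positions that the
  nonlinearity can take contributes w y^2 by the trilinear bound with an l4 entry there. These are
  the terms of \<open>nf_density\<close>.\<close>

lemma sum_dprod3_le:
  assumes F: "finite F"
  shows "AE s in lborel. s \<in> {0..T} \<longrightarrow>
    (\<Sum>(n, k, m)\<in>F. weight (m + k) m (n - k) * dprod3 (m + k) m (n - k) s) \<le> trilinear_const * (lam * nf_density s)"
  using N_l4
proof eventually_elim
  case (elim s)
  show ?case
  proof
    assume s: "s \<in> {0..T}"
    have N4: "l4_le (\<lambda>n. cmod (N n s)) (w s)"
      unfolding l4_le_def using elim s w_nonneg by auto
    note a2 = a_l2[OF s]
    let ?F = "(\<lambda>(n, k, m). (m + k, m, n - k)) ` F"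
    let ?a = "\<lambda>n. cmod (a n s)" and ?N = "\<lambda>n. cmod (N n s)"
    have "(\<Sum>(n, k, m)\<in>F. weight (m + k) m (n - k) * dprod3 (m + k) m (n - k) s)
      = lam * (2 * M s * (\<Sum>(n, k, m)\<in>F. weight (m + k) m (n - k) * (?a (m + k) * ?a m * ?a (n - k)))
         + (\<Sum>(n, k, m)\<in>F. weight (m + k) m (n - k) * (?N (m + k) * ?a m * ?a (n - k)))
         + (\<Sum>(n, k, m)\<in>F. weight (m + k) m (n - k) * (?a (m + k) * ?N m * ?a (n - k)))
         + (\<Sum>(n, k, m)\<in>F. weight (m + k) m (n - k) * (?a (m + k) * ?a m * ?N (n - k))))"
      unfolding dprod3_def prod3_def sum_distrib_left sum.distrib[symmetric]
      by (intro sum.cong refl) (auto simp: algebra_simps)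
    also have "\<dots> = lam * (2 * M s * trilinear_form ?F ?a ?a ?a + trilinear_form ?F ?N ?a ?a
         + trilinear_form ?F ?a ?N ?a + trilinear_form ?F ?a ?a ?N)"
      by (simp only: weighted_sum_eq[OF F, of ?a ?a ?a] weighted_sum_eq[OF F, of ?N ?a ?a]
          weighted_sum_eq[OF F, of ?a ?N ?a] weighted_sum_eq[OF F, of ?a ?a ?N])
    also have "\<dots> \<le> lam * (2 * M s * (trilinear_const * y s * y s * y s) + trilinear_const * w s * y s * y s
         + trilinear_const * y s * w s * y s + trilinear_const * y s * y s * w s)"
      using lam M_nonneg[OF s] F a2 N4 l2_le_imp_l4_le[OF a2]
      by (intro mult_left_mono add_mono trilinear_form_le) auto
    also have "\<dots> = trilinear_const * (lam * nf_density s)"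
      unfolding nf_density_def y_power2[OF s, symmetric]
      by (simp add: algebra_simps power2_eq_square eval_nat_numeral)
    finally show "(\<Sum>(n, k, m)\<in>F. weight (m + k) m (n - k) * dprod3 (m + k) m (n - k) s)
      \<le> trilinear_const * (lam * nf_density s)" .
  qed
qed

text \<open>The sum is moved inside the time integral before the trilinear bound is applied at
  almost every time. The result therefore does not depend on the finite set of triples, which is
  what allows the passage to the full series.\<close>

lemma sum_summand_le:
  assumes F: "finite F" "\<And>z. z \<in> F \<Longrightarrow> resonant_free z" and t: "t \<in> {0..T}"
  shows "(\<Sum>z\<in>F. cmod (LINT s:{0..t}|lborel. summand z s)) \<le> nf_bound t"
proof -
  let ?W = "\<lambda>(n, k, m). weight (m + k) m (n - k)" and ?P = "\<lambda>(n, k, m) t. prod3 (m + k) m (n - k) t"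
    and ?D = "\<lambda>(n, k, m) t. dprod3 (m + k) m (n - k) t"
  have "\<exists>Z. set_integrable lborel {0..T} Z \<and> (\<forall>s\<in>{0..T}. cmod (Z s) \<le> ?D z s) \<and>
     cmod (LINT s:{0..t}|lborel. summand z s) \<le> (1/2) * ?W z * (?P z t + ?P z 0 + (LINT s:{0..t}|lborel. cmod (Z s)))"
    if "z \<in> F" for z
  proof -
    obtain n k m where z: "z = (n, k, m)" by (cases z)
    have rf: "resonant_free (n, k, m)" using F(2)[OF that] z by simp
    show ?thesis unfolding z using summand_by_parts[OF rf] t unfolding case_prod_conv by blast
  qed
  then have "\<forall>z\<in>F. \<exists>Z. set_integrable lborel {0..T} Z \<and> (\<forall>s\<in>{0..T}. cmod (Z s) \<le> ?D z s) \<and>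
     cmod (LINT s:{0..t}|lborel. summand z s) \<le> (1/2) * ?W z * (?P z t + ?P z 0 + (LINT s:{0..t}|lborel. cmod (Z s)))"
    by (rule ballI)
  from bchoice[OF this] obtain Z where Z0: "\<forall>z\<in>F. set_integrable lborel {0..T} (Z z) \<and> (\<forall>s\<in>{0..T}. cmod (Z z s) \<le> ?D z s) \<and>
     cmod (LINT s:{0..t}|lborel. summand z s) \<le> (1/2) * ?W z * (?P z t + ?P z 0 + (LINT s:{0..t}|lborel. cmod (Z z s)))" ..
  have Z: "\<And>z. z \<in> F \<Longrightarrow> set_integrable lborel {0..T} (Z z)"
    "\<And>z s. z \<in> F \<Longrightarrow> s \<in> {0..T} \<Longrightarrow> cmod (Z z s) \<le> ?D z s"
    "\<And>z. z \<in> F \<Longrightarrow> cmod (LINT s:{0..t}|lborel. summand z s)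
       \<le> (1/2) * ?W z * (?P z t + ?P z 0 + (LINT s:{0..t}|lborel. cmod (Z z s)))"
    using Z0 by blast+
  have iZ: "set_integrable lborel {0..t} (\<lambda>s. cmod (Z z s))" if "z \<in> F" for z
    by (intro set_integrable_norm set_integrable_sub[OF Z(1)[OF that] t])
  have W0: "0 \<le> ?W z" for z by (auto simp: weight_def split: prod.split)
  have "(\<Sum>z\<in>F. cmod (LINT s:{0..t}|lborel. summand z s))
     \<le> (\<Sum>z\<in>F. (1/2) * ?W z * (?P z t + ?P z 0 + (LINT s:{0..t}|lborel. cmod (Z z s))))"
    by (intro sum_mono Z)
  also have "\<dots> = (1/2) * ((\<Sum>z\<in>F. ?W z * ?P z t) + (\<Sum>z\<in>F. ?W z * ?P z 0) + (\<Sum>z\<in>F. ?W z * (LINT s:{0..t}|lborel. cmod (Z z s))))"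
    by (simp add: sum_distrib_left sum.distrib[symmetric] algebra_simps)
  also have "(\<Sum>z\<in>F. ?W z * (LINT s:{0..t}|lborel. cmod (Z z s))) = (LINT s:{0..t}|lborel. (\<Sum>z\<in>F. ?W z * cmod (Z z s)))"
    using iZ by (subst set_integral_sum) simp_all
  also have "(\<Sum>z\<in>F. ?W z * ?P z t) \<le> trilinear_const * y t ^ 3"
    using sum_prod3_le[OF F(1) t] by (simp add: case_prod_unfold)
  also have "(\<Sum>z\<in>F. ?W z * ?P z 0) \<le> trilinear_const * y 0 ^ 3"
    using sum_prod3_le[OF F(1), of 0] T by (simp add: case_prod_unfold)
  also have "(LINT s:{0..t}|lborel. (\<Sum>z\<in>F. ?W z * cmod (Z z s))) \<le> (LINT s:{0..t}|lborel. trilinear_const * (lam * nf_density s))"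
  proof (rule set_integral_mono_AE)
    show "set_integrable lborel {0..t} (\<lambda>s. \<Sum>z\<in>F. ?W z * cmod (Z z s))"
      using iZ by (intro set_integrable_sum) simp
    show "set_integrable lborel {0..t} (\<lambda>s. trilinear_const * (lam * nf_density s))"
      using set_integrable_sub[OF nf_density_int t] by simp
    show "AE s\<in>{0..t} in lborel. (\<Sum>z\<in>F. ?W z * cmod (Z z s)) \<le> trilinear_const * (lam * nf_density s)"
      using sum_dprod3_le[OF F(1)]
    proof eventually_elim
      case (elim s)
      show ?case
      proof
        assume "s \<in> {0..t}"
        then have s: "s \<in> {0..T}" using t by auto
        have "(\<Sum>z\<in>F. ?W z * cmod (Z z s)) \<le> (\<Sum>z\<in>F. ?W z * ?D z s)"
          using Z(2) s W0 by (intro sum_mono mult_left_mono) auto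
        also have "\<dots> \<le> trilinear_const * (lam * nf_density s)"
          using elim s by (simp add: case_prod_unfold)
        finally show "(\<Sum>z\<in>F. ?W z * cmod (Z z s)) \<le> trilinear_const * (lam * nf_density s)" .
      qed
    qed
  qed
  finally show ?thesis by (simp add: nf_bound_def algebra_simps)
qed

section \<open>From finite sets of triples to the full nonlinearity\<close>

definition Q :: "int \<Rightarrow> int \<Rightarrow> real \<Rightarrow> complex" where
  "Q n k s = (if k = 0 then 0 else E n s * (U (n - k) s * (A k s - U n s * cnj (U (n - k) s))))"

definition summand0 :: "int \<times> int \<times> int \<Rightarrow> real \<Rightarrow> complex" where
  "summand0 z s = (if resonant_free z then summand z s else 0)"

lemma summand0_int: "set_integrable lborel {0..T} (summand0 z)"
proof -
  obtain n k m where z: "z = (n, k, m)" by (cases z)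
  have "continuous_on {0..T} (summand0 z)"
    unfolding summand0_def[abs_def] summand_def z
    by (cases "resonant_free (n, k, m)") (simp_all, intro continuous_intros E_cont U_cont)
  then show ?thesis by (rule borel_integrable_atLeastAtMost')
qed

text \<open>Deleting the index m = n - k from the series of \<open>A k s\<close> subtracts
  \<open>U n s * cnj (U (n - k) s)\<close>, and this is the form of \<open>Q\<close>.\<close>

lemma summand0_lim:
  assumes s: "s \<in> {0..T}"
  shows "(\<lambda>L::nat. \<Sum>m\<in>{- int L..int L}. summand0 (n, k, m) s) \<longlonglongrightarrow> Q n k s"
proof (cases "k = 0")
  case True then show ?thesis by (simp add: summand0_def resonant_free_def Q_def)
next
  case False
  have "(\<lambda>L::nat. \<Sum>m\<in>{- int L..int L}. if m = n - k then 0 else U (m + k) s * cnj (U m s))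
      \<longlonglongrightarrow> A k s - U (n - k + k) s * cnj (U (n - k) s)"
    by (rule has_sum_tendsto_symmetric[OF has_sum_remove_point[OF A_sum[OF s]]])
  from tendsto_mult_left[OF this, of "E n s * U (n - k) s"]
  have "(\<lambda>L::nat. E n s * U (n - k) s * (\<Sum>m\<in>{- int L..int L}. if m = n - k then 0 else U (m + k) s * cnj (U m s)))
      \<longlonglongrightarrow> Q n k s" using False by (simp add: Q_def mult.assoc)
  moreover have "E n s * U (n - k) s * (\<Sum>m\<in>{- int L..int L}. if m = n - k then 0 else U (m + k) s * cnj (U m s))
      = (\<Sum>m\<in>{- int L..int L}. summand0 (n, k, m) s)" for L
    unfolding sum_distrib_left using False
    by (intro sum.cong refl) (auto simp: summand0_def resonant_free_def summand_def)
  ultimately show ?thesis by simp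
qed

lemma summand0_sum_bound:
  assumes s: "s \<in> {0..T}" and K: "finite K"
  shows "cmod (\<Sum>m\<in>K. summand0 (n, k, m) s) \<le> y s * M s"
proof -
  have "cmod (\<Sum>m\<in>K. summand0 (n, k, m) s) \<le> (\<Sum>m\<in>K. y s * (((cmod (a (m + k) s))\<^sup>2 + (cmod (a m s))\<^sup>2) / 2))"
  proof (rule order_trans[OF norm_sum sum_mono])
    fix m
    have "cmod (summand0 (n, k, m) s) \<le> cmod (a (n - k) s) * (cmod (a (m + k) s) * cmod (a m s))"
      by (simp add: summand0_def summand_def norm_mult)
    also have "\<dots> \<le> y s * (((cmod (a (m + k) s))\<^sup>2 + (cmod (a m s))\<^sup>2) / 2)"
      using a_le[OF s] y_nonneg[OF s] sum_squares_bound[of "cmod (a (m + k) s)" "cmod (a m s)"]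
      by (intro mult_mono) (auto simp: mult.assoc)
    finally show "cmod (summand0 (n, k, m) s) \<le> y s * (((cmod (a (m + k) s))\<^sup>2 + (cmod (a m s))\<^sup>2) / 2)" .
  qed
  also have "\<dots> = y s * (((\<Sum>m\<in>K. (cmod (a (m + k) s))\<^sup>2) + (\<Sum>m\<in>K. (cmod (a m s))\<^sup>2)) / 2)"
    by (simp add: sum_distrib_left sum.distrib[symmetric] sum_divide_distrib)
  also have "\<dots> \<le> y s * ((M s + M s) / 2)"
  proof (intro mult_left_mono divide_right_mono add_mono)
    have "(\<Sum>m\<in>K. (cmod (a (m + k) s))\<^sup>2) = (\<Sum>m\<in>(\<lambda>m. m + k) ` K. (cmod (a m s))\<^sup>2)"
      by (subst sum.reindex) (auto simp: inj_on_def)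
    also have "\<dots> \<le> M s" using K by (intro sum_a_le s) simp
    finally show "(\<Sum>m\<in>K. (cmod (a (m + k) s))\<^sup>2) \<le> M s" .
    show "(\<Sum>m\<in>K. (cmod (a m s))\<^sup>2) \<le> M s" by (rule sum_a_le[OF s K])
  qed (use y_nonneg[OF s] in auto)
  finally show ?thesis by simp
qed

lemma yM_int: "set_integrable lborel {0..T} (\<lambda>s. y s * M s)"
  by (intro borel_integrable_atLeastAtMost' continuous_intros y_cont M_cont)

text \<open>The triple series is summed iteratively: first over m, here, with the majorant y M, and
  then over k in \<open>ER_lim\<close>. This follows the way in which the nonlinearity is known as a
  series: a convolution with \<open>A\<close>, which is itself a convolution.\<close>

lemma Q_int: "set_integrable lborel {0..T} (Q n k)"
  and Q_lim: "t \<in> {0..T} \<Longrightarrow> (\<lambda>L::nat. \<Sum>m\<in>{- int L..int L}. LINT s:{0..t}|lborel. summand0 (n, k, m) s)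
      \<longlonglongrightarrow> (LINT s:{0..t}|lborel. Q n k s)"
proof -
  have i: "set_integrable lborel {0..t} (\<lambda>s. \<Sum>m\<in>{- int L..int L}. summand0 (n, k, m) s)" if t: "t \<in> {0..T}" for L t
    by (intro set_integrable_sum set_integrable_sub[OF summand0_int t])
  have m: "set_borel_measurable lborel {0..t} (Q n k)" if t: "t \<in> {0..T}" for t
    by (rule set_borel_measurable_lim[where s = "\<lambda>L s. \<Sum>m\<in>{- int L..int L}. summand0 (n, k, m) s", OF i[OF t]])
      (rule summand0_lim, use t in auto)
  have D: "set_integrable lborel {0..t} (Q n k)"
    "(\<lambda>L::nat. LINT s:{0..t}|lborel. (\<Sum>m\<in>{- int L..int L}. summand0 (n, k, m) s)) \<longlonglongrightarrow> (LINT s:{0..t}|lborel. Q n k s)"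
    if t: "t \<in> {0..T}" for t
  proof -
    have l: "AE s in lborel. s \<in> {0..t} \<longrightarrow> (\<lambda>L::nat. \<Sum>m\<in>{- int L..int L}. summand0 (n, k, m) s) \<longlonglongrightarrow> Q n k s"
      using t by (intro AE_I2 impI summand0_lim) auto
    have b: "AE s in lborel. s \<in> {0..t} \<longrightarrow> cmod (\<Sum>m\<in>{- int L..int L}. summand0 (n, k, m) s) \<le> y s * M s" for L
      using t by (intro AE_I2 impI summand0_sum_bound) auto
    note D = set_LINT_dominated_convergence[where s = "\<lambda>L s. \<Sum>m\<in>{- int L..int L}. summand0 (n, k, m) s",
        OF m[OF t] i[OF t] set_integrable_sub[OF yM_int t] l b]
    show "set_integrable lborel {0..t} (Q n k)"
      "(\<lambda>L::nat. LINT s:{0..t}|lborel. (\<Sum>m\<in>{- int L..int L}. summand0 (n, k, m) s)) \<longlonglongrightarrow> (LINT s:{0..t}|lborel. Q n k s)"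
      using D by auto
  qed
  show "set_integrable lborel {0..T} (Q n k)" using D(1)[of T] T by simp
  show "(\<lambda>L::nat. \<Sum>m\<in>{- int L..int L}. LINT s:{0..t}|lborel. summand0 (n, k, m) s)
      \<longlonglongrightarrow> (LINT s:{0..t}|lborel. Q n k s)" if t: "t \<in> {0..T}"
    using D(2)[OF t] by (subst (asm) set_integral_sum) (use set_integrable_sub[OF summand0_int t] in auto)
qed

lemma A_0: "s \<in> {0..T} \<Longrightarrow> A 0 s = of_real (M s)"
proof -
  assume s: "s \<in> {0..T}"
  have "((\<lambda>m. complex_of_real ((cmod (a m s))\<^sup>2)) has_sum of_real (M s)) UNIV"
    using M_sum[OF s] by (simp only: has_sum_of_real_iff)
  moreover have "U (m + 0) s * cnj (U m s) = of_real ((cmod (a m s))\<^sup>2)" for m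
    using complex_norm_square[of "U m s"] by simp
  ultimately show "A 0 s = of_real (M s)"
    using A_sum[OF s, of 0] has_sum_unique by (metis (no_types, lifting) has_sum_cong)
qed

lemma Q_sum_lim:
  "AE s in lborel. s \<in> {0..T} \<longrightarrow> (\<forall>n. (\<lambda>L::nat. \<Sum>k\<in>{- int L..int L}. Q n k s) \<longlonglongrightarrow> E n s * R n s)"
  using N_sum
proof eventually_elim
  case (elim s)
  show ?case
  proof (intro impI allI)
    fix n assume s: "s \<in> {0..T}"
    have "((\<lambda>k. complex_of_real ((cmod (a (n - k) s))\<^sup>2)) has_sum of_real (M s)) UNIV"
    proof -
      have "((\<lambda>m. (cmod (a m s))\<^sup>2) has_sum M s) UNIV" by (rule M_sum[OF s])
      moreover have "bij_betw (\<lambda>k. n - k) UNIV (UNIV :: int set)"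
        by (rule bij_betwI[of _ _ _ "\<lambda>k. n - k"]) auto
      ultimately have "((\<lambda>k. (cmod (a (n - k) s))\<^sup>2) has_sum M s) UNIV"
        using has_sum_reindex_bij_betw[of "\<lambda>k. n - k" UNIV UNIV "\<lambda>m. (cmod (a m s))\<^sup>2"] by simp
      then show ?thesis by (simp only: has_sum_of_real_iff)
    qed
    then have h0: "((\<lambda>k. U n s * complex_of_real ((cmod (a (n - k) s))\<^sup>2)) has_sum (U n s * of_real (M s))) UNIV"
      by (rule has_sum_cmult_right)
    have eq: "(\<lambda>k. U n s * complex_of_real ((cmod (a (n - k) s))\<^sup>2)) = (\<lambda>k. U (n - k) s * (U n s * cnj (U (n - k) s)))"
    proof
      fix k
      have "complex_of_real ((cmod (a (n - k) s))\<^sup>2) = U (n - k) s * cnj (U (n - k) s)"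
        using complex_norm_square[of "U (n - k) s"] unfolding U_norm .
      then show "U n s * complex_of_real ((cmod (a (n - k) s))\<^sup>2) = U (n - k) s * (U n s * cnj (U (n - k) s))"
        by (simp only: mult.left_commute)
    qed
    have h2: "((\<lambda>k. U (n - k) s * (U n s * cnj (U (n - k) s))) has_sum (U n s * of_real (M s))) UNIV"
      using h0 unfolding eq .
    have h1: "((\<lambda>k. A k s * U (n - k) s) has_sum N n s) UNIV" using elim s by simp
    \<comment> \<open>The k-th term of the nonlinearity minus its part with m = n - k; over all k
      these parts add up to \<open>U n s * M s\<close>. Deleting k = 0 afterwards removes the other
      resonant family without removing the common term twice.\<close>
    let ?f = "\<lambda>k. A k s * U (n - k) s + (-1) * (U (n - k) s * (U n s * cnj (U (n - k) s)))"
    have "(?f has_sum (N n s + (-1) * (U n s * of_real (M s)))) UNIV"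
      by (intro has_sum_add h1 has_sum_cmult_right h2)
    from has_sum_tendsto_symmetric[OF has_sum_remove_point[OF this, of 0]]
    have "(\<lambda>L::nat. \<Sum>k\<in>{- int L..int L}. if k = 0 then 0 else ?f k) \<longlonglongrightarrow>
        N n s + (-1) * (U n s * of_real (M s)) - ?f 0" .
    from tendsto_mult_left[OF this, of "E n s"]
    have l: "(\<lambda>L::nat. E n s * (\<Sum>k\<in>{- int L..int L}. if k = 0 then 0 else ?f k)) \<longlonglongrightarrow>
        E n s * (N n s + (-1) * (U n s * of_real (M s)) - ?f 0)" .
    have e1: "E n s * (\<Sum>k\<in>{- int L..int L}. if k = 0 then 0 else ?f k) = (\<Sum>k\<in>{- int L..int L}. Q n k s)" for L
      unfolding sum_distrib_left Q_def by (intro sum.cong refl) (auto simp: algebra_simps)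
    have e2: "N n s + (-1) * (U n s * of_real (M s)) - ?f 0 = R n s"
    proof -
      have "U n s * cnj (U n s) = of_real ((cmod (a n s))\<^sup>2)" using complex_norm_square[of "U n s"] by simp
      then show ?thesis unfolding R_def A_0[OF s] by (simp add: algebra_simps)
    qed
    show "(\<lambda>L::nat. \<Sum>k\<in>{- int L..int L}. Q n k s) \<longlonglongrightarrow> E n s * R n s"
      using l unfolding e1 e2 .
  qed
qed

text \<open>Cauchy-Schwarz between the coefficients of the squared modulus, bounded in l2 by w, and
  those of the solution. The bound is uniform in K and integrable in time, hence a majorant for the
  limit in k.\<close>

lemma Q_sum_bound:
  "AE s in lborel. s \<in> {0..T} \<longrightarrow> (\<forall>n K. finite K \<longrightarrow> cmod (\<Sum>k\<in>K. Q n k s) \<le> w s * y s + y s * M s)"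
  using A_l2
proof eventually_elim
  case (elim s)
  show ?case
  proof (intro impI allI)
    fix n and K :: "int set" assume s: "s \<in> {0..T}" and K: "finite K"
    have sh: "(\<Sum>k\<in>K. (cmod (a (n - k) s))\<^sup>2) \<le> M s"
    proof -
      have "(\<Sum>k\<in>K. (cmod (a (n - k) s))\<^sup>2) = (\<Sum>m\<in>(\<lambda>k. n - k) ` K. (cmod (a m s))\<^sup>2)"
        by (subst sum.reindex) (auto simp: inj_on_def)
      also have "\<dots> \<le> M s" using K by (intro sum_a_le s) simp
      finally show ?thesis .
    qed
    have "cmod (\<Sum>k\<in>K. Q n k s) \<le> (\<Sum>k\<in>K. cmod (A k s) * cmod (a (n - k) s) + cmod (a n s) * (cmod (a (n - k) s))\<^sup>2)"
    proof (rule order_trans[OF norm_sum sum_mono])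
      fix k
      have "cmod (Q n k s) \<le> cmod (a (n - k) s) * (cmod (A k s) + cmod (a n s) * cmod (a (n - k) s))"
        using norm_triangle_ineq4[of "A k s" "U n s * cnj (U (n - k) s)"]
        by (auto simp: Q_def norm_mult intro!: mult_left_mono)
      then show "cmod (Q n k s) \<le> cmod (A k s) * cmod (a (n - k) s) + cmod (a n s) * (cmod (a (n - k) s))\<^sup>2"
        by (simp add: algebra_simps power2_eq_square)
    qed
    also have "\<dots> = (\<Sum>k\<in>K. cmod (A k s) * cmod (a (n - k) s)) + cmod (a n s) * (\<Sum>k\<in>K. (cmod (a (n - k) s))\<^sup>2)"
      by (simp add: sum.distrib sum_distrib_left)
    also have "(\<Sum>k\<in>K. cmod (A k s) * cmod (a (n - k) s)) \<le> w s * y s"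
    proof (rule power2_le_imp_le)
      have "(\<Sum>k\<in>K. cmod (A k s) * cmod (a (n - k) s))\<^sup>2 \<le> (\<Sum>k\<in>K. (cmod (A k s))\<^sup>2) * (\<Sum>k\<in>K. (cmod (a (n - k) s))\<^sup>2)"
        by (rule Cauchy_Schwarz_ineq_sum)
      also have "\<dots> \<le> (w s)\<^sup>2 * M s"
      proof (rule mult_mono)
        show "(\<Sum>k\<in>K. (cmod (A k s))\<^sup>2) \<le> (w s)\<^sup>2" using elim s K by blast
      qed (auto intro: sum_nonneg sh)
      finally show "(\<Sum>k\<in>K. cmod (A k s) * cmod (a (n - k) s))\<^sup>2 \<le> (w s * y s)\<^sup>2"
        by (simp add: power_mult_distrib y_power2[OF s])
    qed (use w_nonneg y_nonneg[OF s] in simp)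
    also have "cmod (a n s) * (\<Sum>k\<in>K. (cmod (a (n - k) s))\<^sup>2) \<le> y s * M s"
      using a_le[OF s] sh y_nonneg[OF s] by (intro mult_mono) (auto intro: sum_nonneg)
    finally show "cmod (\<Sum>k\<in>K. Q n k s) \<le> w s * y s + y s * M s" by simp
  qed
qed

lemma ER_lim:
  assumes t: "t \<in> {0..T}"
  shows "(\<lambda>L::nat. \<Sum>k\<in>{- int L..int L}. LINT s:{0..t}|lborel. Q n k s) \<longlonglongrightarrow> (LINT s:{0..t}|lborel. E n s * R n s)"
proof -
  have i: "set_integrable lborel {0..t} (\<lambda>s. \<Sum>k\<in>{- int L..int L}. Q n k s)" for L
    by (intro set_integrable_sum set_integrable_sub[OF Q_int t])
  have m: "set_borel_measurable lborel {0..t} (\<lambda>s. E n s * R n s)"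
    using set_integrable_sub[OF ER_int t] unfolding set_integrable_def set_borel_measurable_def by auto
  have wy: "set_integrable lborel {0..T} (\<lambda>s. w s * y s + y s * M s)"
    by (intro set_integral_add set_integrable_mult_continuous w_int y_cont yM_int)
  have "(\<lambda>L::nat. LINT s:{0..t}|lborel. (\<Sum>k\<in>{- int L..int L}. Q n k s)) \<longlonglongrightarrow> (LINT s:{0..t}|lborel. E n s * R n s)"
  proof (rule set_LINT_dominated_convergence(2)[OF m i set_integrable_sub[OF wy t]])
    show "AE s in lborel. s \<in> {0..t} \<longrightarrow> (\<lambda>L::nat. \<Sum>k\<in>{- int L..int L}. Q n k s) \<longlonglongrightarrow> E n s * R n s"
      using Q_sum_lim by eventually_elim (use t in auto)
    show "AE s in lborel. s \<in> {0..t} \<longrightarrow> cmod (\<Sum>k\<in>{- int L..int L}. Q n k s) \<le> w s * y s + y s * M s" for L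
      using Q_sum_bound by eventually_elim (use t in auto)
  qed
  then show ?thesis by (subst (asm) set_integral_sum) (use set_integrable_sub[OF Q_int t] in auto)
qed

text \<open>The bound for finite sets of triples survives first the limit in m and then that in k,
  while the sum over n stays outside. An l1 bound on the modes is what bounds the Fourier series
  uniformly in x.\<close>

theorem sum_b_diff_le:
  assumes t: "t \<in> {0..T}" and I: "finite I"
  shows "(\<Sum>n\<in>I. cmod (b n t - a n 0)) \<le> lam * nf_bound t"
proof -
  have 1: "(\<Sum>n\<in>I. cmod (\<Sum>k\<in>{- int L..int L}. \<Sum>m\<in>{- int L'..int L'}. LINT s:{0..t}|lborel. summand0 (n, k, m) s)) \<le> nf_bound t"
    (is "?S \<le> _") for L L'
  proof -
    let ?B = "I \<times> {- int L..int L} \<times> {- int L'..int L'}"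
    let ?F = "{z \<in> ?B. resonant_free z}"
    have "?S \<le> (\<Sum>n\<in>I. \<Sum>k\<in>{- int L..int L}. \<Sum>m\<in>{- int L'..int L'}. cmod (LINT s:{0..t}|lborel. summand0 (n, k, m) s))"
      by (intro sum_mono order_trans[OF norm_sum] norm_sum)
    also have "\<dots> = (\<Sum>z\<in>?B. cmod (LINT s:{0..t}|lborel. summand0 z s))"
      by (simp add: sum.cartesian_product)
    also have "\<dots> = (\<Sum>z\<in>?F. cmod (LINT s:{0..t}|lborel. summand0 z s))"
      using I by (intro sum.mono_neutral_right) (auto simp: summand0_def[abs_def] set_lebesgue_integral_def)
    also have "\<dots> = (\<Sum>z\<in>?F. cmod (LINT s:{0..t}|lborel. summand z s))"
      by (intro sum.cong refl) (simp add: summand0_def[abs_def])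
    also have "\<dots> \<le> nf_bound t" using I by (intro sum_summand_le t) auto
    finally show ?thesis .
  qed
  have 2: "(\<Sum>n\<in>I. cmod (\<Sum>k\<in>{- int L..int L}. LINT s:{0..t}|lborel. Q n k s)) \<le> nf_bound t" for L
  proof (rule LIMSEQ_le_const2)
    show "(\<lambda>L'. \<Sum>n\<in>I. cmod (\<Sum>k\<in>{- int L..int L}. \<Sum>m\<in>{- int L'..int L'}. LINT s:{0..t}|lborel. summand0 (n, k, m) s))
       \<longlonglongrightarrow> (\<Sum>n\<in>I. cmod (\<Sum>k\<in>{- int L..int L}. LINT s:{0..t}|lborel. Q n k s))"
      by (intro tendsto_intros Q_lim t)
  qed (use 1 in blast)
  have 3: "(\<Sum>n\<in>I. cmod (LINT s:{0..t}|lborel. E n s * R n s)) \<le> nf_bound t"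
  proof (rule LIMSEQ_le_const2)
    show "(\<lambda>L. \<Sum>n\<in>I. cmod (\<Sum>k\<in>{- int L..int L}. LINT s:{0..t}|lborel. Q n k s))
       \<longlonglongrightarrow> (\<Sum>n\<in>I. cmod (LINT s:{0..t}|lborel. E n s * R n s))"
      by (intro tendsto_intros ER_lim t)
  qed (use 2 in blast)
  have "(\<Sum>n\<in>I. cmod (b n t - a n 0)) = lam * (\<Sum>n\<in>I. cmod (LINT s:{0..t}|lborel. E n s * R n s))"
    using lam by (simp add: b_eq[OF t] norm_mult sum_distrib_left)
  also have "\<dots> \<le> lam * nf_bound t" using 3 lam by (intro mult_left_mono) auto
  finally show ?thesis .
qed

end

subsection \<open>The modes of a solution\<close>

interpretation torus: sigma_finite_measure torus ..

locale nls_solution =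
  fixes \<epsilon> T :: real and f :: "real \<Rightarrow> complex" and v :: "real \<Rightarrow> real \<Rightarrow> complex"
  assumes eps: "0 < \<epsilon>" and T_pos: "0 < T" and sol: "global_nls_solution \<epsilon> f v"
begin

lemma v_measurable: "(\<lambda>(t, x). v t x) \<in> borel_measurable (lborel \<Otimes>\<^sub>M torus)"
  and v_L2: "in_L2 (v t)"
  and v_cont: "((\<lambda>s. norm_L2 (\<lambda>x. v s x - v t x)) \<longlongrightarrow> 0) (at t)"
  and v_L4: "R > 0 \<Longrightarrow> integrable (restrict_space lborel {-R..R} \<Otimes>\<^sub>M torus) (\<lambda>(t, x). (cmod (v t x)) ^ 4)"
  and v_duhamel: "fourier_coefficient (v t) n =
        cis (- (t * (of_int n)\<^sup>2)) * fourier_coefficient f n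
        - \<i> * of_real (\<epsilon>\<^sup>2) *
          (LBINT s=ereal 0..ereal t. cis (- ((t - s) * (of_int n)\<^sup>2)) *
             fourier_coefficient (\<lambda>x. of_real ((cmod (v s x))\<^sup>2) * v s x) n)"
  using sol unfolding global_nls_solution_def by blast+

definition lam :: real where "lam = \<epsilon>\<^sup>2"
definition U :: "int \<Rightarrow> real \<Rightarrow> complex" where "U n s = fourier_coefficient (v s) n"
definition a :: "int \<Rightarrow> real \<Rightarrow> complex" where "a n s = cis (s * (of_int n)\<^sup>2) * U n s"
definition N :: "int \<Rightarrow> real \<Rightarrow> complex" where
  "N n s = fourier_coefficient (\<lambda>x. of_real ((cmod (v s x))\<^sup>2) * v s x) n"
definition A :: "int \<Rightarrow> real \<Rightarrow> complex" where
  "A k s = fourier_coefficient (\<lambda>x. v s x * cnj (v s x)) k"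
definition M :: "real \<Rightarrow> real" where "M s = (norm_L2 (v s))\<^sup>2 / (2 * pi)"
definition W :: "real \<Rightarrow> real" where "W s = (LINT x|torus. (cmod (v s x)) ^ 4)"
text \<open>A single majorant for two quantities: the l4 norm of the nonlinearity is at most W^(3/4)
  and the l2 norm of the squared modulus at most W^(1/2). Both are at most 1 + W, which is
  integrable in time.\<close>

definition w :: "real \<Rightarrow> real" where "w s = 1 + W s"

lemma W_nonneg: "0 \<le> W s" unfolding W_def by simp

lemma v_meas [measurable]: "v s \<in> borel_measurable torus"
  using v_L2 in_L2_measurable by blast

lemma AE_L4: "AE s in lborel. s \<in> {0..T} \<longrightarrow> integrable torus (\<lambda>x. (cmod (v s x)) ^ 4)"
  and W_int: "set_integrable lborel {0..T} W"
proof -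
  interpret r: sigma_finite_measure "restrict_space lborel {-T..T}"
    by (intro sigma_finite_measure_restrict_space sigma_finite_lborel) auto
  interpret p: pair_sigma_finite "restrict_space lborel {-T..T}" torus ..
  have "AE s in restrict_space lborel {-T..T}. integrable torus (\<lambda>x. (cmod (v s x)) ^ 4)"
    using p.AE_integrable_fst'[OF v_L4[OF T_pos]] by simp
  then have "AE s in lborel. s \<in> {-T..T} \<longrightarrow> integrable torus (\<lambda>x. (cmod (v s x)) ^ 4)"
    by (subst (asm) AE_restrict_space_iff) auto
  then show "AE s in lborel. s \<in> {0..T} \<longrightarrow> integrable torus (\<lambda>x. (cmod (v s x)) ^ 4)"
    by eventually_elim (use T_pos in auto)
  have "integrable (restrict_space lborel {-T..T}) W"
    using p.integrable_fst'[OF v_L4[OF T_pos]] unfolding W_def[abs_def] by simp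
  then have "set_integrable lborel {-T..T} W"
    by (subst (asm) integrable_restrict_space) (auto simp: set_integrable_def)
  then show "set_integrable lborel {0..T} W"
    by (rule set_integrable_subset) (use T_pos in auto)
qed

lemma U_cis: "U n s = cis (- (s * (of_int n)\<^sup>2)) * a n s"
  by (simp add: a_def mult.assoc[symmetric] cis_mult)

lemma cmod_U: "cmod (U n s) = cmod (a n s)"
  by (simp add: a_def norm_mult)

lemma N_measurable: "N n \<in> borel_measurable lborel"
proof -
  note [measurable] = v_measurable
  have [measurable]: "(\<lambda>z. cis (- (of_int n * snd z))) \<in> borel_measurable (lborel \<Otimes>\<^sub>M torus)"
    using measurable_compose[OF measurable_snd measurable_cis_torus[of "- of_int n"], of lborel] by simp
  have vm: "(\<lambda>z. v (fst z) (snd z)) \<in> borel_measurable (lborel \<Otimes>\<^sub>M torus)"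
    using v_measurable by (simp add: case_prod_unfold)
  have "(\<lambda>z. of_real ((cmod (v (fst z) (snd z)))\<^sup>2) * v (fst z) (snd z) * cis (- (of_int n * snd z))) \<in> borel_measurable (lborel \<Otimes>\<^sub>M torus)"
    using vm by measurable
  then have "(\<lambda>s. LINT x|torus. of_real ((cmod (v s x))\<^sup>2) * v s x * cis (- (of_int n * x))) \<in> borel_measurable lborel"
    by (intro torus.borel_measurable_lebesgue_integral) (simp add: case_prod_unfold)
  then show ?thesis unfolding N_def[abs_def] fourier_coefficient_def by measurable
qed

lemma N_l4_W:
  assumes "integrable torus (\<lambda>x. (cmod (v s x)) ^ 4)" "finite I"
  shows "(\<Sum>n\<in>I. (cmod (N n s)) ^ 4) \<le> w s ^ 4"
proof -
  have "(\<Sum>n\<in>I. (cmod (N n s)) ^ 4) \<le> W s ^ 3"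
    unfolding N_def W_def by (rule fc_cubic_l4[OF v_meas assms])
  also have "\<dots> \<le> (1 + W s) ^ 3" using W_nonneg by (intro power_mono) auto
  also have "\<dots> \<le> (1 + W s) ^ 4" using W_nonneg[of s] by (intro power_increasing) auto
  finally show ?thesis by (simp add: w_def)
qed

lemma h_int: "set_integrable lborel {0..T} (\<lambda>s. cis (s * (of_int n)\<^sup>2) * N n s)"
proof -
  have wi: "set_integrable lborel {0..T} w"
    unfolding w_def[abs_def] by (intro set_integral_add W_int borel_integrable_atLeastAtMost' continuous_intros)
  have [measurable]: "N n \<in> borel_measurable borel" using N_measurable by simp
  show ?thesis unfolding set_integrable_def
  proof (rule Bochner_Integration.integrable_bound)
    show "integrable lborel (\<lambda>s. indicator {0..T} s *\<^sub>R w s)" using wi by (simp add: set_integrable_def)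
    show "AE s in lborel. norm (indicator {0..T} s *\<^sub>R (cis (s * (of_int n)\<^sup>2) * N n s)) \<le> norm (indicator {0..T} s *\<^sub>R w s)"
      using AE_L4
    proof eventually_elim
      case (elim s)
      show ?case
      proof (cases "s \<in> {0..T}")
        case True
        then have "(cmod (N n s)) ^ 4 \<le> w s ^ 4" using N_l4_W[of s "{n}"] elim by simp
        moreover have "0 \<le> w s" using W_nonneg[of s] by (simp add: w_def)
        ultimately have "cmod (N n s) \<le> w s" by (simp only: power_mono_iff norm_ge_zero zero_less_numeral)
        then show ?thesis using True by (simp add: norm_mult)
      qed simp
    qed
  qed measurable
qed

lemma norm_v_cont: "continuous_on S (\<lambda>t. norm_L2 (v t))"
  unfolding continuous_on_def
proof
  fix t assume "t \<in> S"
  have "((\<lambda>s. norm_L2 (v s) - norm_L2 (v t)) \<longlongrightarrow> 0) (at t)"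
    by (rule Lim_null_comparison[OF _ v_cont]) (simp add: norm_L2_diff_lower v_L2)
  then have "((\<lambda>s. norm_L2 (v s)) \<longlongrightarrow> norm_L2 (v t)) (at t)" by (rule LIM_zero_cancel)
  then show "((\<lambda>t. norm_L2 (v t)) \<longlongrightarrow> norm_L2 (v t)) (at t within S)" by (rule tendsto_within_subset) simp
qed

lemma a_eq: "t \<in> {0..T} \<Longrightarrow> a n t = fourier_coefficient f n + (LINT s:{0..t}|lborel. - (\<i> * of_real lam) * cis (s * (of_int n)\<^sup>2) * N n s)"
proof -
  assume t: "t \<in> {0..T}"
  have e: "cis (t * (of_int n)\<^sup>2) * (cis (- ((t - s) * (of_int n)\<^sup>2)) * N n s) = cis (s * (of_int n)\<^sup>2) * N n s" for s
    unfolding mult.assoc[symmetric] cis_mult by (simp add: algebra_simps)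
  have "(LBINT s=ereal 0..ereal t. cis (- ((t - s) * (of_int n)\<^sup>2)) * N n s)
      = (LINT s:{0..t}|lborel. cis (- ((t - s) * (of_int n)\<^sup>2)) * N n s)"
    using t by (intro interval_integral_Icc) auto
  then have "a n t = cis (t * (of_int n)\<^sup>2) * cis (- (t * (of_int n)\<^sup>2)) * fourier_coefficient f n
      - \<i> * of_real lam * (cis (t * (of_int n)\<^sup>2) * (LINT s:{0..t}|lborel. cis (- ((t - s) * (of_int n)\<^sup>2)) * N n s))"
    unfolding a_def U_def v_duhamel[of t n] N_def[symmetric] lam_def[symmetric] by (simp add: algebra_simps)
  also have "cis (t * (of_int n)\<^sup>2) * (LINT s:{0..t}|lborel. cis (- ((t - s) * (of_int n)\<^sup>2)) * N n s)
      = (LINT s:{0..t}|lborel. cis (s * (of_int n)\<^sup>2) * N n s)"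
    unfolding set_integral_mult_right[symmetric] e ..
  finally have "a n t = fourier_coefficient f n
      - \<i> * of_real lam * (LINT s:{0..t}|lborel. cis (s * (of_int n)\<^sup>2) * N n s)"
    by (simp add: cis_mult)
  moreover have "(LINT s:{0..t}|lborel. - (\<i> * of_real lam) * cis (s * (of_int n)\<^sup>2) * N n s)
      = - (\<i> * of_real lam) * (LINT s:{0..t}|lborel. cis (s * (of_int n)\<^sup>2) * N n s)"
    by (simp only: mult.assoc[of "- (\<i> * of_real lam)"] set_integral_mult_right)
  ultimately show ?thesis by simp
qed

lemma a_0: "a n 0 = fourier_coefficient f n"
  using a_eq[of 0 n] T_pos by (simp add: set_integral_singleton)

text \<open>Parseval's identity supplies the mass and Bessel's inequality the bound on the squared
  modulus. \<open>fc_mult\<close> is used twice: for the squared modulus, which only needs v in L2,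
  and for its product with v, at the almost all times when v lies in L4.\<close>

sublocale modes: nls_modes T lam a U N A M w
proof
  show "0 \<le> T" using T_pos by simp
  show "0 < lam" using eps by (simp add: lam_def)
  show "U n s = cis (- (s * (of_int n)\<^sup>2)) * a n s" for n s by (rule U_cis)
  show "antideriv_on T (a n) (\<lambda>s. - (\<i> * of_real lam) * cis (s * (of_int n)\<^sup>2) * N n s)" for n
    unfolding antideriv_on_def
  proof (intro conjI ballI)
    show "set_integrable lborel {0..T} (\<lambda>s. - (\<i> * of_real lam) * cis (s * (of_int n)\<^sup>2) * N n s)"
      using set_integrable_mult_right[OF h_int, of "- (\<i> * of_real lam)"] by (simp add: mult.assoc)
    fix t assume "t \<in> {0..T}"
    from a_eq[OF this] show "a n t = a n 0 + (LINT s:{0..t}|lborel. - (\<i> * of_real lam) * cis (s * (of_int n)\<^sup>2) * N n s)"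
      unfolding a_0 .
  qed
  show "((\<lambda>n. (cmod (a n t))\<^sup>2) has_sum M t) UNIV" for t
    using Parseval[OF v_L2[of t]] unfolding M_def cmod_U[symmetric] U_def .
  show "continuous_on {0..T} M" unfolding M_def[abs_def] by (intro continuous_intros norm_v_cont) simp
  show "set_integrable lborel {0..T} w"
    unfolding w_def[abs_def] by (intro set_integral_add W_int borel_integrable_atLeastAtMost' continuous_intros)
  show "0 \<le> w s" for s using W_nonneg[of s] by (simp add: w_def)
  show "AE s in lborel. s \<in> {0..T} \<longrightarrow> (\<forall>I. finite I \<longrightarrow> (\<Sum>n\<in>I. (cmod (N n s)) ^ 4) \<le> w s ^ 4)"
    using AE_L4 by eventually_elim (use N_l4_W in blast)
  show "((\<lambda>m. U (m + k) s * cnj (U m s)) has_sum A k s) UNIV" for s k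
  proof -
    have "((\<lambda>j. U j s * cnj (U (j - k) s)) has_sum A k s) UNIV"
      using fc_mult[OF v_L2[of s] in_L2_cnj[OF v_L2[of s]], of k] unfolding fc_cnj A_def U_def by simp
    moreover have "bij_betw (\<lambda>m. m + k) UNIV (UNIV :: int set)" by (rule bij_betwI[of _ _ _ "\<lambda>m. m - k"]) auto
    ultimately show ?thesis
      using has_sum_reindex_bij_betw[of "\<lambda>m. m + k" UNIV UNIV "\<lambda>j. U j s * cnj (U (j - k) s)"] by simp
  qed
  have sq: "v s x * cnj (v s x) = of_real ((cmod (v s x))\<^sup>2)" for s x by (simp only: complex_norm_square)
  have L2: "in_L2 (\<lambda>x. v s x * cnj (v s x))" if "integrable torus (\<lambda>x. (cmod (v s x)) ^ 4)" for s
    using that unfolding in_L2_def by (simp add: norm_mult power2_eq_square power4_eq_xxxx mult.assoc)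
  show "AE s in lborel. s \<in> {0..T} \<longrightarrow> (\<forall>I. finite I \<longrightarrow> (\<Sum>n\<in>I. (cmod (A n s))\<^sup>2) \<le> (w s)\<^sup>2)"
    using AE_L4
  proof eventually_elim
    case (elim s)
    show ?case
    proof (intro impI allI)
      fix I :: "int set" assume s: "s \<in> {0..T}" and I: "finite I"
      let ?S = "\<Sum>n\<in>I. (cmod (A n s))\<^sup>2"
      have "2 * pi * ?S \<le> (norm_L2 (\<lambda>x. v s x * cnj (v s x)))\<^sup>2"
        unfolding A_def by (rule Bessel_inequality[OF L2 I]) (use elim s in blast)
      also have "\<dots> = W s" unfolding norm_L2_power2 W_def by (simp add: norm_mult power2_eq_square power4_eq_xxxx mult.assoc)
      finally have "2 * pi * ?S \<le> W s" .
      moreover have "1 * ?S \<le> 2 * pi * ?S" using pi_gt3 by (intro mult_right_mono) (auto intro: sum_nonneg)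
      moreover have "W s \<le> (w s)\<^sup>2" using W_nonneg[of s] by (simp add: w_def power2_eq_square algebra_simps)
      ultimately show "?S \<le> (w s)\<^sup>2" by simp
    qed
  qed
  show "AE s in lborel. s \<in> {0..T} \<longrightarrow> (\<forall>n. ((\<lambda>k. A k s * U (n - k) s) has_sum N n s) UNIV)"
    using AE_L4
  proof eventually_elim
    case (elim s)
    show ?case
    proof (intro impI allI)
      fix n assume s: "s \<in> {0..T}"
      have "in_L2 (\<lambda>x. v s x * cnj (v s x))" using L2 elim s by blast
      from fc_mult[OF this v_L2[of s], of n]
      show "((\<lambda>k. A k s * U (n - k) s) has_sum N n s) UNIV"
        unfolding A_def U_def N_def sq .
    qed
  qed
qed

end

subsection \<open>Pointwise bounds\<close>

lemma cmod_cis_minus_1: "cmod (cis x - 1) \<le> \<bar>x\<bar>"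
  using iexp_approx1[of x 0] by (simp add: cis_conv_exp)

text \<open>Any exhausting sequence of finite sets may be used; later it consists of dyadic
  intervals, which fit the probabilistic bounds.\<close>

lemma AE_bounded_partial_sums:
  assumes h: "in_L2 h" and L: "filterlim \<Lambda> (finite_subsets_at_top UNIV) sequentially"
    and B: "\<And>m x. finite (\<Lambda> m) \<Longrightarrow> cmod (\<Sum>n\<in>\<Lambda> m. fourier_coefficient h n * cis (of_int n * x)) \<le> B"
  shows "AE x in torus. cmod (h x) \<le> B"
proof (rule AE_norm_le_limit[OF h, of sequentially])
  show "(\<lambda>m. norm_L2 (\<lambda>x. h x - (\<Sum>n\<in>\<Lambda> m. fourier_coefficient h n * cis (of_int n * x)))) \<longlonglongrightarrow> 0"
    by (rule filterlim_compose[OF fourier_series_L2[OF h] L])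
  have "\<forall>\<^sub>F m in sequentially. finite (\<Lambda> m)"
    using L unfolding filterlim_finite_subsets_at_top by (auto elim: eventually_mono dest: spec[of _ "{}"])
  then show "\<forall>\<^sub>F m in sequentially. in_L2 (\<lambda>x. \<Sum>n\<in>\<Lambda> m. fourier_coefficient h n * cis (of_int n * x)) \<and>
      (AE x in torus. cmod (\<Sum>n\<in>\<Lambda> m. fourier_coefficient h n * cis (of_int n * x)) \<le> B)"
    by eventually_elim (intro conjI in_L2_trig AE_I2 B)
qed simp

text \<open>At the first time \<tau> when one of the functions reaches its barrier, neither lies
  above its own, by the intermediate value theorem. The weak bounds hold up to \<tau>, and the
  strict ones at \<tau> contradict its choice. Two functions are run together because the mass and
  the time integral of the L4 norm are controlled jointly.\<close>

lemma continuity_method: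
  fixes \<phi> \<psi> :: "real \<Rightarrow> real"
  assumes c: "continuous_on {0..T} \<phi>" "continuous_on {0..T} \<psi>" and 0: "\<phi> 0 < Y" "\<psi> 0 < J"
    and step: "\<And>t. t \<in> {0..T} \<Longrightarrow> (\<And>s. s \<in> {0..t} \<Longrightarrow> \<phi> s \<le> Y \<and> \<psi> s \<le> J) \<Longrightarrow> \<phi> t < Y \<and> \<psi> t < J"
    and t: "t \<in> {0..T}"
  shows "\<phi> t < Y \<and> \<psi> t < J"
proof (rule ccontr)
  define S where "S = {t \<in> {0..T}. \<phi> t \<ge> Y} \<union> {t \<in> {0..T}. \<psi> t \<ge> J}"
  assume "\<not> ?thesis"
  then have ne: "t \<in> S" using t by (auto simp: S_def)
  have cl: "closed S" unfolding S_def
    by (intro closed_Un continuous_closed_preimage_constant continuous_on_closed_Collect_le) 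
      (auto intro!: continuous_closed_preimage[of _ _ "{Y..}", unfolded vimage_def Int_def, simplified]
        continuous_closed_preimage[of _ _ "{J..}", unfolded vimage_def Int_def, simplified] c)
  have bb: "bdd_below S" by (rule bdd_belowI[of _ 0]) (auto simp: S_def)
  define \<tau> where "\<tau> = Inf S"
  have \<tau>: "\<tau> \<in> S" unfolding \<tau>_def by (rule closed_contains_Inf[OF _ bb cl]) (use ne in auto)
  then have \<tau>T: "\<tau> \<in> {0..T}" by (auto simp: S_def)
  have low: "\<tau> \<le> s" if "s \<in> S" for s unfolding \<tau>_def by (rule cInf_lower[OF that bb])
  have le: "\<phi> \<tau> \<le> Y"
  proof (rule ccontr)
    assume "\<not> \<phi> \<tau> \<le> Y"
    then obtain s where "0 \<le> s" "s \<le> \<tau>" "\<phi> s = Y"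
      using IVT'[of \<phi> 0 Y \<tau>] 0 \<tau>T continuous_on_subset[OF c(1), of "{0..\<tau>}"] by auto
    then show False using low[of s] \<tau>T \<open>\<not> \<phi> \<tau> \<le> Y\<close> by (auto simp: S_def)
  qed
  have le2: "\<psi> \<tau> \<le> J"
  proof (rule ccontr)
    assume "\<not> \<psi> \<tau> \<le> J"
    then obtain s where "0 \<le> s" "s \<le> \<tau>" "\<psi> s = J"
      using IVT'[of \<psi> 0 J \<tau>] 0 \<tau>T continuous_on_subset[OF c(2), of "{0..\<tau>}"] by auto
    then show False using low[of s] \<tau>T \<open>\<not> \<psi> \<tau> \<le> J\<close> by (auto simp: S_def)
  qed
  have "\<phi> \<tau> < Y \<and> \<psi> \<tau> < J"
  proof (rule step[OF \<tau>T])
    fix s assume s: "s \<in> {0..\<tau>}"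
    show "\<phi> s \<le> Y \<and> \<psi> s \<le> J"
    proof (cases "s = \<tau>")
      case False
      then have "s \<notin> S" using low[of s] s by auto
      then show ?thesis using s \<tau>T by (auto simp: S_def)
    qed (use le le2 in auto)
  qed
  then show False using \<tau> by (auto simp: S_def)
qed

context nls_solution
begin

text \<open>The rotation is split into the phase \<open>G0\<close>, common to all modes and
  invisible in the modulus, and the small angles \<open>\<gamma> n\<close>. Replacing b by the
  initial value costs D. On the low modes only amplitudes are used. On the high ones the factor
  \<open>cis (\<gamma> n)\<close> is dropped at the cost \<open>\<gamma> n * \<eta>\<close> per
  mode; since \<open>\<gamma> n\<close> is lam times the time integral of the squared amplitude,
  these costs sum to the term with the integral of the mass, and the linear evolution
  remains.\<close>

lemma sup_bound:
  assumes t: "t \<in> {0..T}" and Low: "finite Low" and z: "(\<Sum>n\<in>Low. cmod (fourier_coefficient f n)) \<le> z"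
    and \<eta>: "0 \<le> \<eta>" and small: "\<And>n. n \<notin> Low \<Longrightarrow> cmod (fourier_coefficient f n) \<le> \<eta>"
    and L: "filterlim \<Lambda> (finite_subsets_at_top UNIV) sequentially"
    and lin: "\<And>m x. cmod (\<Sum>n\<in>\<Lambda> m - Low. cis (- (t * (of_int n)\<^sup>2)) * fourier_coefficient f n * cis (of_int n * x)) \<le> \<eta>"
    and D: "\<And>I. finite I \<Longrightarrow> (\<Sum>n\<in>I. cmod (modes.b n t - a n 0)) \<le> D"
  shows "AE x in torus. cmod (v t x) \<le> z + \<eta> + D + lam * \<eta> * (LINT s:{0..t}|lborel. M s)"
proof (rule AE_bounded_partial_sums[OF v_L2 L])
  fix m x assume fin: "finite (\<Lambda> m)"
  let ?fc = "fourier_coefficient f"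
  define c where "c n = cis (- (t * (of_int n)\<^sup>2))" for n :: int
  define \<gamma> where "\<gamma> n = lam * (LINT s:{0..t}|lborel. (cmod (a n s))\<^sup>2)" for n
  define G0 where "G0 = (LINT s:{0..t}|lborel. lam * (2 * M s))"
  have sa: "set_integrable lborel {0..t} (\<lambda>s. (cmod (a n s))\<^sup>2)" for n
    by (intro modes.set_integrable_cont[OF _ t] continuous_intros modes.a_cont)
  have sM: "set_integrable lborel {0..t} M"
    by (rule modes.set_integrable_cont[OF modes.M_cont t])
  have lam0: "0 < lam" by (rule modes.lam)
  have G_eq: "modes.G n t = G0 - \<gamma> n" for n
    unfolding modes.G_def modes.g_def G0_def \<gamma>_def right_diff_distrib
    using sa sM by (subst set_integral_diff(2)) simp_all
  have Ub: "cis G0 * U n t = c n * cis (\<gamma> n) * modes.b n t" for n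
  proof -
    have "c n * cis (\<gamma> n) * modes.b n t = (cis (\<gamma> n) * cis (modes.G n t)) * (c n * a n t)"
      unfolding modes.b_def by (simp add: ac_simps)
    also have "cis (\<gamma> n) * cis (modes.G n t) = cis G0" unfolding cis_mult G_eq by simp
    also have "c n * a n t = U n t" unfolding U_cis c_def ..
    finally show ?thesis ..
  qed
  have \<gamma>0: "0 \<le> \<gamma> n" for n
    unfolding \<gamma>_def using lam0 by (auto simp: set_lebesgue_integral_def intro!: mult_nonneg_nonneg Bochner_Integration.integral_nonneg)
  let ?e = "\<lambda>n. cis (of_int n * x)"
  let ?H = "\<Lambda> m - Low"
  have split: "(\<Sum>n\<in>\<Lambda> m. F n) = (\<Sum>n\<in>\<Lambda> m \<inter> Low. F n) + (\<Sum>n\<in>?H. F n)" for F :: "int \<Rightarrow> complex"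
    using fin by (rule sum.Int_Diff)
  have "cmod (\<Sum>n\<in>\<Lambda> m. fourier_coefficient (v t) n * ?e n) = cmod (cis G0 * (\<Sum>n\<in>\<Lambda> m. U n t * ?e n))"
    by (simp add: norm_mult U_def)
  also have "cis G0 * (\<Sum>n\<in>\<Lambda> m. U n t * ?e n) = (\<Sum>n\<in>\<Lambda> m. c n * cis (\<gamma> n) * modes.b n t * ?e n)"
    unfolding sum_distrib_left by (intro sum.cong refl) (simp only: Ub mult.assoc[symmetric])
  also have "\<dots> = (\<Sum>n\<in>\<Lambda> m. c n * cis (\<gamma> n) * (modes.b n t - a n 0) * ?e n)
      + (\<Sum>n\<in>\<Lambda> m. c n * cis (\<gamma> n) * ?fc n * ?e n)"
    unfolding a_0 sum.distrib[symmetric] by (intro sum.cong refl) (simp add: algebra_simps)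
  also have "(\<Sum>n\<in>\<Lambda> m. c n * cis (\<gamma> n) * ?fc n * ?e n)
      = (\<Sum>n\<in>\<Lambda> m \<inter> Low. c n * cis (\<gamma> n) * ?fc n * ?e n) +
        ((\<Sum>n\<in>?H. c n * (cis (\<gamma> n) - 1) * ?fc n * ?e n) + (\<Sum>n\<in>?H. c n * ?fc n * ?e n))"
    unfolding split sum.distrib[symmetric] by (intro arg_cong2[where f = "(+)"] sum.cong refl) (simp add: algebra_simps)
  also have "cmod ((\<Sum>n\<in>\<Lambda> m. c n * cis (\<gamma> n) * (modes.b n t - a n 0) * ?e n) + \<dots>)
      \<le> D + (z + (lam * \<eta> * (LINT s:{0..t}|lborel. M s) + \<eta>))"
  proof (intro order_trans[OF norm_triangle_ineq] add_mono)
    show "cmod (\<Sum>n\<in>\<Lambda> m. c n * cis (\<gamma> n) * (modes.b n t - a n 0) * ?e n) \<le> D"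
      by (rule order_trans[OF norm_sum]) (use D[OF fin] in \<open>simp add: norm_mult c_def\<close>)
    show "cmod (\<Sum>n\<in>\<Lambda> m \<inter> Low. c n * cis (\<gamma> n) * ?fc n * ?e n) \<le> z"
    proof (rule order_trans[OF norm_sum])
      have "(\<Sum>n\<in>\<Lambda> m \<inter> Low. cmod (c n * cis (\<gamma> n) * ?fc n * ?e n)) = (\<Sum>n\<in>\<Lambda> m \<inter> Low. cmod (?fc n))"
        by (simp add: norm_mult c_def)
      also have "\<dots> \<le> (\<Sum>n\<in>Low. cmod (?fc n))" using Low by (intro sum_mono2) auto
      finally show "(\<Sum>n\<in>\<Lambda> m \<inter> Low. cmod (c n * cis (\<gamma> n) * ?fc n * ?e n)) \<le> z" using z by simp
    qed
    show "cmod (\<Sum>n\<in>?H. c n * ?fc n * ?e n) \<le> \<eta>" unfolding c_def by (rule lin)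
    show "cmod (\<Sum>n\<in>?H. c n * (cis (\<gamma> n) - 1) * ?fc n * ?e n) \<le> lam * \<eta> * (LINT s:{0..t}|lborel. M s)"
    proof (rule order_trans[OF norm_sum])
      have "(\<Sum>n\<in>?H. cmod (c n * (cis (\<gamma> n) - 1) * ?fc n * ?e n)) \<le> (\<Sum>n\<in>?H. \<gamma> n * \<eta>)"
      proof (rule sum_mono)
        fix n assume "n \<in> ?H"
        then show "cmod (c n * (cis (\<gamma> n) - 1) * ?fc n * ?e n) \<le> \<gamma> n * \<eta>"
          using cmod_cis_minus_1[of "\<gamma> n"] \<gamma>0[of n] small[of n]
          by (auto simp: norm_mult c_def intro!: mult_mono)
      qed
      also have "\<dots> = lam * \<eta> * (\<Sum>n\<in>?H. LINT s:{0..t}|lborel. (cmod (a n s))\<^sup>2)"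
        by (simp add: \<gamma>_def sum_distrib_left algebra_simps)
      also have "(\<Sum>n\<in>?H. LINT s:{0..t}|lborel. (cmod (a n s))\<^sup>2) = (LINT s:{0..t}|lborel. (\<Sum>n\<in>?H. (cmod (a n s))\<^sup>2))"
        using sa by (subst set_integral_sum) simp_all
      also have "lam * \<eta> * \<dots> \<le> lam * \<eta> * (LINT s:{0..t}|lborel. M s)"
        using lam0 \<eta> t fin sM sa
        by (intro mult_left_mono set_integral_mono set_integrable_sum modes.sum_a_le) auto
      finally show "(\<Sum>n\<in>?H. cmod (c n * (cis (\<gamma> n) - 1) * ?fc n * ?e n)) \<le> lam * \<eta> * (LINT s:{0..t}|lborel. M s)" .
    qed
  qed
  finally show "cmod (\<Sum>n\<in>\<Lambda> m. fourier_coefficient (v t) n * ?e n) \<le> z + \<eta> + D + lam * \<eta> * (LINT s:{0..t}|lborel. M s)"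
    by simp
qed

lemma sup_imp_y: 
  assumes "AE x in torus. cmod (v t x) \<le> S" "0 \<le> S"
  shows "modes.y t \<le> S" and "W t \<le> 2 * pi * S ^ 4"
proof -
  have "norm_L2 (v t) \<le> sqrt (2 * pi) * S" by (rule norm_L2_bound[OF v_meas assms])
  then have "(norm_L2 (v t))\<^sup>2 \<le> (sqrt (2 * pi) * S)\<^sup>2" by (intro power_mono) auto
  then have "M t \<le> S\<^sup>2" unfolding M_def by (simp add: power_mult_distrib field_simps)
  then show "modes.y t \<le> S" unfolding modes.y_def using assms(2) by (simp add: real_le_lsqrt)
  have "W t \<le> (LINT x|torus. S ^ 4)" unfolding W_def
  proof (rule integral_mono_AE)
    have ae: "AE x in torus. (cmod (v t x)) ^ 4 \<le> S ^ 4"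
      using assms(1) by eventually_elim (auto intro: power_mono)
    show "integrable torus (\<lambda>x. (cmod (v t x)) ^ 4)"
      by (rule torus.integrable_const_bound[where B = "S ^ 4"]) (use ae in auto)
    show "AE x in torus. (cmod (v t x)) ^ 4 \<le> S ^ 4" by (rule ae)
  qed simp
  then show "W t \<le> 2 * pi * S ^ 4" by simp
qed

lemma integral_mono_upper:
  assumes "set_integrable lborel {0..T} F" "\<And>s. 0 \<le> F s" "t \<in> {0..T}"
  shows "(LINT s:{0..t}|lborel. F s) \<le> (LINT s:{0..T}|lborel. (F s :: real))"
  unfolding set_lebesgue_integral_def
proof (rule integral_mono)
  show "integrable lborel (\<lambda>s. indicator {0..t} s *\<^sub>R F s)"
    using set_integrable_subset[OF assms(1), of "{0..t}"] assms(3) by (simp add: set_integrable_def)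
  show "integrable lborel (\<lambda>s. indicator {0..T} s *\<^sub>R F s)" using assms(1) by (simp add: set_integrable_def)
  show "indicator {0..t} s *\<^sub>R F s \<le> indicator {0..T} s *\<^sub>R F s" for s
    using assms(2)[of s] assms(3) by (auto simp: indicator_def)
qed

text \<open>A qualitative bound without smallness: y is bounded by compactness and the normal form
  density is integrable. Its purpose is to make a cutoff of the nonlinearity at a large height
  inactive on the solution.\<close>

lemma bounded_solution:
  assumes Low: "finite Low" and \<eta>: "0 \<le> \<eta>" and small: "\<And>n. n \<notin> Low \<Longrightarrow> cmod (fourier_coefficient f n) \<le> \<eta>"
    and L: "filterlim \<Lambda> (finite_subsets_at_top UNIV) sequentially"
    and lin: "\<And>t m x. cmod (\<Sum>n\<in>\<Lambda> m - Low. cis (- (t * (of_int n)\<^sup>2)) * fourier_coefficient f n * cis (of_int n * x)) \<le> \<eta>"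
  shows "\<exists>B. \<forall>t\<in>{0..T}. AE x in torus. cmod (v t x) \<le> B"
proof -
  obtain Y where Y: "\<And>t. t \<in> {0..T} \<Longrightarrow> modes.y t \<le> Y"
    using compact_continuous_image[OF modes.y_cont compact_Icc] compact_imp_bounded bounded_iff
    by (metis abs_le_D1 image_eqI real_norm_def)
  define z where "z = (\<Sum>n\<in>Low. cmod (fourier_coefficient f n))"
  define D where "D = lam * (trilinear_const / 2 * (Y ^ 3 + Y ^ 3 + lam * (LINT s:{0..T}|lborel. modes.nf_density s)))"
  have T0: "0 \<in> {0..T}" "T \<in> {0..T}" using T_pos by auto
  have lam0: "0 < lam" by (rule modes.lam)
  show ?thesis
  proof (intro exI ballI)
    fix t assume t: "t \<in> {0..T}"
    have "modes.nf_bound t \<le> trilinear_const / 2 * (Y ^ 3 + Y ^ 3 + lam * (LINT s:{0..T}|lborel. modes.nf_density s))"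
      unfolding modes.nf_bound_def
    proof (intro mult_left_mono add_mono power_mono)
      show "(LINT s:{0..t}|lborel. modes.nf_density s) \<le> (LINT s:{0..T}|lborel. modes.nf_density s)"
      proof -
        \<comment> \<open>The density is extended by 0 because the nonnegativity of y is established
          only on the time interval, while \<open>integral_mono_upper\<close> asks for it at every
          time.\<close>
        let ?F = "\<lambda>s. if s \<in> {0..T} then modes.nf_density s else 0"
        have F: "set_integrable lborel {0..T} ?F"
          using modes.nf_density_int by (rule set_integrable_cong[THEN iffD1, rotated 3]) auto
        have "0 \<le> ?F s" for s
          using modes.y_nonneg[of s] W_nonneg[of s] by (auto simp: modes.nf_density_def w_def)
        from integral_mono_upper[OF F this t]
        have "(LINT s:{0..t}|lborel. ?F s) \<le> (LINT s:{0..T}|lborel. ?F s)" .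
        moreover have "(LINT s:{0..u}|lborel. ?F s) = (LINT s:{0..u}|lborel. modes.nf_density s)" if "u \<in> {0..T}" for u
          using that by (intro set_lebesgue_integral_cong) auto
        ultimately show ?thesis using t T0 by simp
      qed
    qed (use lam0 Y[OF t] Y[OF T0(1)] modes.y_nonneg t T0 trilinear_const_nonneg in auto)
    then have "lam * modes.nf_bound t \<le> D" unfolding D_def using lam0 by simp
    then have D: "(\<Sum>n\<in>I. cmod (modes.b n t - a n 0)) \<le> D" if "finite I" for I
      using modes.sum_b_diff_le[OF t that] by simp
    have "AE x in torus. cmod (v t x) \<le> z + \<eta> + D + lam * \<eta> * (LINT s:{0..t}|lborel. M s)"
      by (rule sup_bound[OF t Low _ \<eta> small L lin D]) (simp_all add: z_def)
    moreover have "(LINT s:{0..t}|lborel. M s) \<le> (LINT s:{0..T}|lborel. M s)"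
      by (rule integral_mono_upper[OF modes.set_integrable_cont[OF modes.M_cont T0(2)] _ t]) (simp add: M_def)
    then have "lam * \<eta> * (LINT s:{0..t}|lborel. M s) \<le> lam * \<eta> * (LINT s:{0..T}|lborel. M s)"
      using lam0 \<eta> by (intro mult_left_mono) auto
    ultimately show "AE x in torus. cmod (v t x) \<le> z + \<eta> + D + lam * \<eta> * (LINT s:{0..T}|lborel. M s)"
      by (auto elim!: eventually_mono)
  qed
qed

text \<open>Y is the barrier for the square root of the mass and J the one for lam times the time
  integral of W; C is the bound for \<open>nf_bound\<close> that they imply, with w = 1 + W and lam
  T at most K. Below the barriers the modulus is at most z + 2 \<eta> + \<eta> K Y^2, hence at most
  z + 1. This in turn bounds y by z + 1 and the time integral by 2 pi K (z + 1)^4, each one unit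
  below its barrier.\<close>

lemma bootstrap:
  fixes z K \<eta> :: real
  defines "Y \<equiv> z + 2" and "J \<equiv> 2 * pi * K * (z + 1) ^ 4 + 1"
  defines "C \<equiv> trilinear_const / 2 * (2 * Y ^ 3 + K * (2 * Y ^ 5 + 3 * Y\<^sup>2) + 3 * Y\<^sup>2 * J)"
  assumes Low: "finite Low" and z: "(\<Sum>n\<in>Low. cmod (fourier_coefficient f n)) \<le> z"
    and \<eta>: "0 \<le> \<eta>" "\<eta> * (2 + K * Y\<^sup>2) \<le> 1" and small: "\<And>n. n \<notin> Low \<Longrightarrow> cmod (fourier_coefficient f n) \<le> \<eta>"
    and L: "filterlim \<Lambda> (finite_subsets_at_top UNIV) sequentially"
    and lin: "\<And>t m x. cmod (\<Sum>n\<in>\<Lambda> m - Low. cis (- (t * (of_int n)\<^sup>2)) * fourier_coefficient f n * cis (of_int n * x)) \<le> \<eta>"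
    and K: "lam * T \<le> K" "1 \<le> K" and C: "lam * C \<le> \<eta>"
    and t: "t \<in> {0..T}"
  shows "AE x in torus. cmod (v t x) \<le> z + \<eta> * (2 + K * Y\<^sup>2)"
proof -
  have z0: "0 \<le> z" using z by (meson norm_ge_zero order_trans sum_nonneg)
  have lam0: "0 < lam" by (rule modes.lam)
  have Y0: "0 \<le> Y" using z0 by (simp add: Y_def)
  have J0: "0 < J" unfolding J_def using z0 K by (intro add_nonneg_pos) auto
  have \<eta>1: "\<eta> \<le> 1"
  proof -
    have "\<eta> * 1 \<le> \<eta> * (2 + K * Y\<^sup>2)" using \<eta>(1) K by (intro mult_left_mono) (auto intro: add_increasing2)
    then show ?thesis using \<eta>(2) by simp
  qed
  define \<psi> where "\<psi> t = lam * (LINT s:{0..t}|lborel. W s)" for t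
  have cont\<psi>: "continuous_on {0..T} \<psi>"
  proof -
    have "continuous_on {0..T} (\<lambda>t. lam * integral {0..t} W)"
      using set_borel_integral_eq_integral(1)[OF W_int]
      by (intro continuous_intros indefinite_integral_continuous_1)
    then show ?thesis
    proof (rule continuous_on_eq)
      fix t assume "t \<in> {0..T}"
      then have "set_integrable lborel {0..t} W" by (rule modes.set_integrable_sub[OF W_int])
      then show "lam * integral {0..t} W = \<psi> t" unfolding \<psi>_def using set_borel_integral_eq_integral(2) by metis
    qed
  qed
  have bound: "AE x in torus. cmod (v t x) \<le> z + \<eta> * (2 + K * Y\<^sup>2)"
    if t: "t \<in> {0..T}" and h: "\<And>s. s \<in> {0..t} \<Longrightarrow> modes.y s \<le> Y \<and> \<psi> s \<le> J" for t
  proof -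
    have sub: "s \<in> {0..T}" if "s \<in> {0..t}" for s using that t by auto
    have lt: "lam * t \<le> K" using K(1) t lam0 by (smt (verit) atLeastAtMost_iff mult_left_mono)
    have sW: "set_integrable lborel {0..t} W" by (rule modes.set_integrable_sub[OF W_int t])
    have c1: "set_integrable lborel {0..t} (\<lambda>s. 2 * Y ^ 5 + 3 * Y\<^sup>2)"
      by (intro borel_integrable_atLeastAtMost' continuous_intros)
    have c2: "set_integrable lborel {0..t} (\<lambda>s. 3 * Y\<^sup>2 * W s)" using sW by simp
    have d: "lam * (LINT s:{0..t}|lborel. modes.nf_density s) \<le> K * (2 * Y ^ 5 + 3 * Y\<^sup>2) + 3 * Y\<^sup>2 * J"
    proof -
      have "(LINT s:{0..t}|lborel. modes.nf_density s) \<le> (LINT s:{0..t}|lborel. (2 * Y ^ 5 + 3 * Y\<^sup>2) + 3 * Y\<^sup>2 * W s)"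
      proof (rule set_integral_mono)
        show "set_integrable lborel {0..t} modes.nf_density" by (rule modes.set_integrable_sub[OF modes.nf_density_int t])
        show "set_integrable lborel {0..t} (\<lambda>s. (2 * Y ^ 5 + 3 * Y\<^sup>2) + 3 * Y\<^sup>2 * W s)"
          by (rule set_integral_add(1)[OF c1 c2])
        fix s assume s: "s \<in> {0..t}"
        have "modes.y s ^ 5 \<le> Y ^ 5" "(modes.y s)\<^sup>2 \<le> Y\<^sup>2"
          using h[OF s] modes.y_nonneg[OF sub[OF s]] by (auto intro!: power_mono)
        then have "modes.nf_density s \<le> 2 * Y ^ 5 + 3 * (w s * Y\<^sup>2)"
          unfolding modes.nf_density_def using W_nonneg[of s]
          by (intro add_mono mult_left_mono) (auto simp: w_def)
        then show "modes.nf_density s \<le> (2 * Y ^ 5 + 3 * Y\<^sup>2) + 3 * Y\<^sup>2 * W s"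
          by (simp add: w_def algebra_simps)
      qed
      also have "\<dots> = t * (2 * Y ^ 5 + 3 * Y\<^sup>2) + 3 * Y\<^sup>2 * (LINT s:{0..t}|lborel. W s)"
      proof -
        have "(LINT s:{0..t}|lborel. (2 * Y ^ 5 + 3 * Y\<^sup>2) + 3 * Y\<^sup>2 * W s)
          = (LINT s:{0..t}|lborel. (2 * Y ^ 5 + 3 * Y\<^sup>2)) + (LINT s:{0..t}|lborel. 3 * Y\<^sup>2 * W s)"
          by (rule set_integral_add(2)[OF c1 c2])
        then show ?thesis using t by (simp add: set_lebesgue_integral_def)
      qed
      finally have "lam * (LINT s:{0..t}|lborel. modes.nf_density s)
          \<le> lam * (t * (2 * Y ^ 5 + 3 * Y\<^sup>2) + 3 * Y\<^sup>2 * (LINT s:{0..t}|lborel. W s))"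
        using lam0 by simp
      also have "\<dots> = (lam * t) * (2 * Y ^ 5 + 3 * Y\<^sup>2) + 3 * Y\<^sup>2 * \<psi> t"
        by (simp add: \<psi>_def algebra_simps)
      also have "\<dots> \<le> K * (2 * Y ^ 5 + 3 * Y\<^sup>2) + 3 * Y\<^sup>2 * J"
        using lt h[of t] t Y0 by (intro add_mono mult_right_mono mult_left_mono) auto
      finally show ?thesis .
    qed
    have "modes.y t ^ 3 \<le> Y ^ 3" "modes.y 0 ^ 3 \<le> Y ^ 3"
      using h[of t] h[of 0] modes.y_nonneg[of t] modes.y_nonneg[of 0] t by (auto intro!: power_mono)
    then have "modes.nf_bound t \<le> C"
      unfolding modes.nf_bound_def C_def using d trilinear_const_nonneg by (intro mult_left_mono) auto
    then have "lam * modes.nf_bound t \<le> \<eta>" using C lam0 by (meson less_imp_le mult_left_mono order_trans)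
    then have D: "(\<Sum>n\<in>I. cmod (modes.b n t - a n 0)) \<le> \<eta>" if "finite I" for I
      using modes.sum_b_diff_le[OF t that] by simp
    have "(LINT s:{0..t}|lborel. M s) \<le> (LINT s:{0..t}|lborel. Y\<^sup>2)"
    proof (rule set_integral_mono)
      show "set_integrable lborel {0..t} M" by (rule modes.set_integrable_cont[OF modes.M_cont t])
      show "set_integrable lborel {0..t} (\<lambda>s. Y\<^sup>2)" by (intro borel_integrable_atLeastAtMost' continuous_intros)
      fix s assume s: "s \<in> {0..t}"
      then show "M s \<le> Y\<^sup>2"
        using h[OF s] modes.y_nonneg[OF sub[OF s]] modes.y_power2[OF sub[OF s]] by (metis power_mono)
    qed
    also have "\<dots> = t * Y\<^sup>2" using t by (simp add: set_lebesgue_integral_def)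
    finally have "lam * \<eta> * (LINT s:{0..t}|lborel. M s) \<le> lam * \<eta> * (t * Y\<^sup>2)"
      using lam0 \<eta> by (intro mult_left_mono) auto
    also have "\<dots> = \<eta> * Y\<^sup>2 * (lam * t)" by (simp add: ac_simps)
    also have "\<dots> \<le> \<eta> * Y\<^sup>2 * K" using lt \<eta> by (intro mult_left_mono) auto
    finally have le: "lam * \<eta> * (LINT s:{0..t}|lborel. M s) \<le> \<eta> * Y\<^sup>2 * K" .
    have "AE x in torus. cmod (v t x) \<le> z + \<eta> + \<eta> + lam * \<eta> * (LINT s:{0..t}|lborel. M s)"
      by (rule sup_bound[OF t Low z \<eta>(1) small L lin D])
    then show ?thesis by eventually_elim (use le in \<open>simp add: algebra_simps\<close>)
  qed
  have small1: "z + \<eta> * (2 + K * Y\<^sup>2) \<le> z + 1" using \<eta>(2) by simp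
  have sup1: "AE x in torus. cmod (v s x) \<le> z + 1"
    if t: "t \<in> {0..T}" and h: "\<And>s. s \<in> {0..t} \<Longrightarrow> modes.y s \<le> Y \<and> \<psi> s \<le> J" and s: "s \<in> {0..t}" for s t
  proof -
    have "AE x in torus. cmod (v s x) \<le> z + \<eta> * (2 + K * Y\<^sup>2)" by (rule bound) (use t h s in auto)
    then show ?thesis by eventually_elim (use small1 in linarith)
  qed
  have claim: "modes.y t < Y \<and> \<psi> t < J" if t: "t \<in> {0..T}" for t
  proof (rule continuity_method[OF modes.y_cont cont\<psi> _ _ _ t])
    have T0: "0 \<in> {0..T}" using T_pos by auto
    \<comment> \<open>At the initial time the modes agree with their initial values, so
      \<open>sup_bound\<close> applies with \<open>D = 0\<close> and puts the datum strictly below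
      the barriers.\<close>
    have "AE x in torus. cmod (v 0 x) \<le> z + \<eta> + 0 + lam * \<eta> * (LINT s:{0..0}|lborel. M s)"
      by (rule sup_bound[OF T0 Low z \<eta>(1) small L lin])
        (auto simp: modes.b_def modes.G_def set_integral_singleton)
    then have "AE x in torus. cmod (v 0 x) \<le> z + 1"
      by eventually_elim (use \<eta>1 in \<open>simp add: set_integral_singleton\<close>)
    from sup_imp_y(1)[OF this] show "modes.y 0 < Y" using z0 by (simp add: Y_def)
    show "\<psi> 0 < J" using J0 by (simp add: \<psi>_def set_integral_singleton)
  next
    fix t assume t: "t \<in> {0..T}" and h: "\<And>s. s \<in> {0..t} \<Longrightarrow> modes.y s \<le> Y \<and> \<psi> s \<le> J"
    have "modes.y t \<le> z + 1" using sup_imp_y(1)[OF sup1[OF t h]] z0 t by auto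
    moreover have "\<psi> t < J"
    proof -
      have "(LINT s:{0..t}|lborel. W s) \<le> (LINT s:{0..t}|lborel. 2 * pi * (z + 1) ^ 4)"
        using sup_imp_y(2)[OF sup1[OF t h]] z0
        by (intro set_integral_mono modes.set_integrable_sub[OF W_int t] borel_integrable_atLeastAtMost' continuous_intros) auto
      also have "\<dots> = t * (2 * pi * (z + 1) ^ 4)" using t by (simp add: set_lebesgue_integral_def)
      finally have "\<psi> t \<le> lam * (t * (2 * pi * (z + 1) ^ 4))" unfolding \<psi>_def using lam0 by simp
      also have "\<dots> = (lam * t) * (2 * pi * (z + 1) ^ 4)" by simp
      also have "\<dots> \<le> K * (2 * pi * (z + 1) ^ 4)"
      proof (rule mult_right_mono)
        show "lam * t \<le> K" using K(1) t lam0 by (smt (verit) atLeastAtMost_iff mult_left_mono)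
      qed (use z0 in simp)
      finally show ?thesis by (simp add: J_def algebra_simps)
    qed
    ultimately show "modes.y t < Y \<and> \<psi> t < J" by (simp add: Y_def)
  qed
  show ?thesis by (rule bound[OF t]) (use claim t in \<open>auto intro!: less_imp_le\<close>)
qed

end

subsection \<open>Picard iterates\<close>

text \<open>Only the factor |z|^2 is truncated, so the map has linear growth and agrees with the
  cubic wherever |z| is at most B.\<close>

definition cutoff_cubic :: "real \<Rightarrow> complex \<Rightarrow> complex" where
  "cutoff_cubic B z = of_real ((min (cmod z) B)\<^sup>2) * z"

lemma cutoff_cubic_measurable [measurable]: "cutoff_cubic B \<in> borel_measurable borel"
  unfolding cutoff_cubic_def[abs_def] by measurable

lemma cutoff_cubic_eq: "cmod z \<le> B \<Longrightarrow> cutoff_cubic B z = of_real ((cmod z)\<^sup>2) * z"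
  by (simp add: cutoff_cubic_def min_def)

lemma cutoff_cubic_norm: "0 \<le> B \<Longrightarrow> cmod (cutoff_cubic B z) \<le> B\<^sup>2 * cmod z"
  unfolding cutoff_cubic_def norm_mult norm_of_real
  by (intro mult_right_mono) (auto intro: power_mono)

text \<open>Only u, which will be the exact solution, is assumed bounded; the other argument, a
  Picard iterate, is arbitrary. Truncation at B does not increase the distance to |u|. The constant
  is 1 + 2: one for the linear factor and two for the difference of squares.\<close>

lemma cutoff_cubic_lipschitz:
  assumes u: "cmod u \<le> B"
  shows "cmod (cutoff_cubic B u - cutoff_cubic B z) \<le> 3 * B\<^sup>2 * cmod (u - z)"
proof -
  define m where "m = min (cmod z) B"
  have B0: "0 \<le> B" using u norm_ge_zero order_trans by blast
  have m: "0 \<le> m" "m \<le> B" using B0 by (auto simp: m_def)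
  have d: "\<bar>cmod u - m\<bar> \<le> cmod (u - z)"
    using u norm_triangle_ineq3[of u z] unfolding m_def by (auto simp: min_def abs_le_iff)
  have "cutoff_cubic B u - cutoff_cubic B z = of_real (m\<^sup>2) * (u - z) + of_real ((cmod u)\<^sup>2 - m\<^sup>2) * u"
    unfolding cutoff_cubic_eq[OF u] unfolding cutoff_cubic_def m_def by (simp add: algebra_simps)
  also have "cmod \<dots> \<le> m\<^sup>2 * cmod (u - z) + \<bar>(cmod u)\<^sup>2 - m\<^sup>2\<bar> * cmod u"
    by (rule order_trans[OF norm_triangle_ineq]) (simp add: norm_mult norm_power del: of_real_diff)
  also have "\<dots> \<le> B\<^sup>2 * cmod (u - z) + (cmod (u - z) * (2 * B)) * B"
  proof (intro add_mono mult_mono)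
    show "m\<^sup>2 \<le> B\<^sup>2" using m by (intro power_mono) auto
    have "\<bar>(cmod u)\<^sup>2 - m\<^sup>2\<bar> = \<bar>cmod u - m\<bar> * \<bar>cmod u + m\<bar>"
      by (simp add: power2_eq_square abs_mult[symmetric] algebra_simps)
    also have "\<dots> \<le> cmod (u - z) * (2 * B)" using d m u by (intro mult_mono) auto
    finally show "\<bar>(cmod u)\<^sup>2 - m\<^sup>2\<bar> \<le> cmod (u - z) * (2 * B)" .
  qed (use u B0 in auto)
  finally show ?thesis by (simp add: power2_eq_square algebra_simps)
qed

text \<open>Picard iterates for the equation with a globally Lipschitz nonlinearity, projected onto finitely
  many modes in each step so that they are built from finitely many measurable functions.\<close>

fun picard :: "real \<Rightarrow> real \<Rightarrow> (int \<Rightarrow> complex) \<Rightarrow> nat \<Rightarrow> real \<Rightarrow> int \<Rightarrow> complex" where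
  "picard lam B \<alpha> 0 t n = 0"
| "picard lam B \<alpha> (Suc k) t n = cis (- (t * (of_int n)\<^sup>2)) * \<alpha> n - \<i> * of_real lam *
    (LINT s:{0..t}|lborel. cis (- ((t - s) * (of_int n)\<^sup>2)) *
      fourier_coefficient (\<lambda>x. cutoff_cubic B (\<Sum>m\<in>{- int k..int k}. picard lam B \<alpha> k s m * cis (of_int m * x))) n)"

text \<open>Measurability jointly in \<omega> and time is the right induction hypothesis, as each
  iterate integrates the preceding one over time.\<close>

lemma picard_measurable:
  fixes \<alpha> :: "'w \<Rightarrow> int \<Rightarrow> complex"
  assumes \<alpha>: "\<And>n. (\<lambda>\<omega>. \<alpha> \<omega> n) \<in> borel_measurable P"
  shows "(\<lambda>z. picard lam B (\<alpha> (fst z)) k (snd z) n) \<in> borel_measurable (P \<Otimes>\<^sub>M (borel :: real measure))"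
proof (induction k arbitrary: n)
  case 0 show ?case by simp
next
  case (Suc k)
  let ?Q = "P \<Otimes>\<^sub>M (borel :: real measure)"
  have c: "(\<lambda>z. cis (a * snd z)) \<in> borel_measurable (?Q \<Otimes>\<^sub>M torus)" for a
    using measurable_compose[OF measurable_snd measurable_cis_torus[of a], of ?Q] by simp
  have p: "(\<lambda>z. picard lam B (\<alpha> (fst (fst z))) k (snd (fst z)) m) \<in> borel_measurable (?Q \<Otimes>\<^sub>M torus)" for m
    using measurable_compose[OF measurable_fst Suc.IH[of m], of torus] by simp
  have "(\<lambda>z. cutoff_cubic B (\<Sum>m\<in>{- int k..int k}. picard lam B (\<alpha> (fst (fst z))) k (snd (fst z)) m * cis (of_int m * snd z))
      * cis (- of_int n * snd z)) \<in> borel_measurable (?Q \<Otimes>\<^sub>M torus)"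
    by (intro borel_measurable_times borel_measurable_sum measurable_compose[OF _ cutoff_cubic_measurable] c p)
  then have "(\<lambda>z. LINT x|torus. cutoff_cubic B (\<Sum>m\<in>{- int k..int k}. picard lam B (\<alpha> (fst z)) k (snd z) m * cis (of_int m * x))
      * cis (- of_int n * x)) \<in> borel_measurable ?Q"
    by (intro torus.borel_measurable_lebesgue_integral) (simp add: case_prod_unfold)
  then have H [measurable]: "(\<lambda>z. fourier_coefficient (\<lambda>x. cutoff_cubic B (\<Sum>m\<in>{- int k..int k}. picard lam B (\<alpha> (fst z)) k (snd z) m * cis (of_int m * x))) n)
      \<in> borel_measurable ?Q" (is "?H \<in> _")
    unfolding fourier_coefficient_def by simp
  have J0: "(\<lambda>z. indicator {0..snd (fst z)} (snd z) *\<^sub>R (cis (- ((snd (fst z) - snd z) * (of_int n)\<^sup>2)) * ?H (fst (fst z), snd z)))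
      \<in> borel_measurable (?Q \<Otimes>\<^sub>M lborel)"
  proof -
    have sf: "(\<lambda>z. snd (fst z)) \<in> borel_measurable (?Q \<Otimes>\<^sub>M lborel)"
      by (rule measurable_compose[OF measurable_fst measurable_snd])
    have s: "snd \<in> borel_measurable (?Q \<Otimes>\<^sub>M lborel)" using measurable_snd[of ?Q lborel] by simp
    have ff: "(\<lambda>z. fst (fst z)) \<in> measurable (?Q \<Otimes>\<^sub>M lborel) P"
      by (rule measurable_compose[OF measurable_fst measurable_fst])
    have h: "(\<lambda>z. ?H (fst (fst z), snd z)) \<in> borel_measurable (?Q \<Otimes>\<^sub>M lborel)"
      by (rule measurable_compose[OF measurable_Pair[OF ff s] H])
    have e: "(\<lambda>z. cis (- ((snd (fst z) - snd z) * (of_int n)\<^sup>2))) \<in> borel_measurable (?Q \<Otimes>\<^sub>M lborel)"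
      by (intro measurable_compose[OF _ measurable_cis] borel_measurable_uminus borel_measurable_times
          borel_measurable_diff sf s borel_measurable_const)
    have "{z \<in> space (?Q \<Otimes>\<^sub>M lborel). 0 \<le> snd z \<and> snd z \<le> snd (fst z)}
        = {z \<in> space (?Q \<Otimes>\<^sub>M lborel). 0 \<le> snd z} \<inter> {z \<in> space (?Q \<Otimes>\<^sub>M lborel). snd z \<le> snd (fst z)}"
      by auto
    also have "\<dots> \<in> sets (?Q \<Otimes>\<^sub>M lborel)"
      by (intro sets.Int borel_measurable_le sf s borel_measurable_const)
    finally have "{z \<in> space (?Q \<Otimes>\<^sub>M lborel). 0 \<le> snd z \<and> snd z \<le> snd (fst z)} \<in> sets (?Q \<Otimes>\<^sub>M lborel)" .
    then have i: "(\<lambda>z. indicator {0..snd (fst z)} (snd z) :: real) \<in> borel_measurable (?Q \<Otimes>\<^sub>M lborel)"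
      by (subst measurable_cong[where g = "indicator {z \<in> space (?Q \<Otimes>\<^sub>M lborel). 0 \<le> snd z \<and> snd z \<le> snd (fst z)}"])
        (auto simp: indicator_def)
    show ?thesis by (intro borel_measurable_scaleR borel_measurable_times i e h)
  qed
  have J: "(\<lambda>z. LINT s:{0..snd z}|lborel. cis (- ((snd z - s) * (of_int n)\<^sup>2)) * ?H (fst z, s)) \<in> borel_measurable ?Q"
    unfolding set_lebesgue_integral_def
    by (rule lborel.borel_measurable_lebesgue_integral) (use J0 in \<open>simp only: case_prod_unfold\<close>)
  have a: "(\<lambda>z. \<alpha> (fst z) n) \<in> borel_measurable ?Q"
    by (rule measurable_compose[OF measurable_fst \<alpha>])
  have e: "(\<lambda>z. cis (- (snd z * (of_int n)\<^sup>2))) \<in> borel_measurable ?Q"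
    by (intro measurable_compose[OF _ measurable_cis] borel_measurable_uminus borel_measurable_times
          measurable_snd borel_measurable_const)
  show ?case unfolding picard.simps
    by (intro borel_measurable_diff borel_measurable_times a e borel_measurable_const J[unfolded fst_conv snd_conv])
qed

text \<open>Dini's theorem by sequential compactness. It will make the Fourier tails of the solution
  small uniformly in time, as the iteration of the error requires.\<close>

lemma Dini_decreasing:
  fixes \<phi> :: "nat \<Rightarrow> real \<Rightarrow> real"
  assumes c: "\<And>k. continuous_on {a..b} (\<phi> k)" and dec: "\<And>k t. t \<in> {a..b} \<Longrightarrow> \<phi> (Suc k) t \<le> \<phi> k t"
    and lim: "\<And>t. t \<in> {a..b} \<Longrightarrow> (\<lambda>k. \<phi> k t) \<longlonglongrightarrow> 0" and \<delta>: "0 < \<delta>"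
  shows "\<exists>K. \<forall>k\<ge>K. \<forall>t\<in>{a..b}. \<phi> k t < \<delta>"
proof (rule ccontr)
  have mono: "\<phi> k t \<le> \<phi> j t" if "t \<in> {a..b}" "j \<le> k" for j k t
    using lift_Suc_antimono_le[of "\<lambda>k. \<phi> k t", OF dec[OF that(1)] that(2)] .
  assume "\<not> ?thesis"
  then have "\<forall>K. \<exists>t\<in>{a..b}. \<phi> K t \<ge> \<delta>"
    using mono by (meson not_le order_trans)
  then obtain t where t: "\<And>K. t K \<in> {a..b}" "\<And>K. \<phi> K (t K) \<ge> \<delta>" by metis
  obtain l r where l: "l \<in> {a..b}" and r: "strict_mono r" "(t \<circ> r) \<longlonglongrightarrow> l"
    using compact_Icc[of a b] t(1) unfolding compact_def by metis
  have "\<phi> j l \<ge> \<delta>" for j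
  proof (rule tendsto_lowerbound)
    show "(\<lambda>i. \<phi> j (t (r i))) \<longlonglongrightarrow> \<phi> j l"
      using c[of j] l r t(1) unfolding continuous_on_sequentially by (auto simp: o_def)
    show "\<forall>\<^sub>F i in sequentially. \<delta> \<le> \<phi> j (t (r i))"
      using eventually_ge_at_top[of j]
    proof eventually_elim
      case (elim i)
      then have "j \<le> r i" using seq_suble[OF r(1), of i] by simp
      then show ?case using mono[OF t(1)] t(2)[of "r i"] by (meson order_trans)
    qed
  qed simp
  then have "\<delta> \<le> 0" using tendsto_lowerbound[OF lim[OF l], of \<delta>] by auto
  then show False using \<delta> by simp
qed

lemma set_integral_square_le:
  fixes \<phi> :: "real \<Rightarrow> complex"
  assumes t: "0 \<le> t" and [measurable]: "\<phi> \<in> borel_measurable borel"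
    and i: "set_integrable lborel {0..t} (\<lambda>s. (cmod (\<phi> s))\<^sup>2)"
  shows "(cmod (LINT s:{0..t}|lborel. \<phi> s))\<^sup>2 \<le> t * (LINT s:{0..t}|lborel. (cmod (\<phi> s))\<^sup>2)"
proof -
  let ?f = "\<lambda>s. complex_of_real (indicator {0..t} s)" and ?g = "\<lambda>s. indicator {0..t} s *\<^sub>R \<phi> s"
  have ff: "(cmod (?f s))\<^sup>2 = indicator {0..t} s" for s by (simp add: indicator_def)
  have gg: "(cmod (?g s))\<^sup>2 = indicator {0..t} s *\<^sub>R (cmod (\<phi> s))\<^sup>2" for s by (simp add: indicator_def)
  have fg: "?f s * ?g s = indicator {0..t} s *\<^sub>R \<phi> s" for s by (simp add: indicator_def)
  have "cmod (LINT s|lborel. ?f s * ?g s) \<le> sqrt (LINT s|lborel. (cmod (?f s))\<^sup>2) * sqrt (LINT s|lborel. (cmod (?g s))\<^sup>2)"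
  proof (rule Cauchy_Schwarz_integral_norm)
    show "integrable lborel (\<lambda>s. (cmod (?f s))\<^sup>2)" unfolding ff by (intro integrable_real_indicator) (auto simp: emeasure_lborel_Icc_eq)
    show "integrable lborel (\<lambda>s. (cmod (?g s))\<^sup>2)" unfolding gg using i by (simp add: set_integrable_def)
  qed measurable
  then have "cmod (LINT s:{0..t}|lborel. \<phi> s) \<le> sqrt t * sqrt (LINT s:{0..t}|lborel. (cmod (\<phi> s))\<^sup>2)"
    unfolding fg ff gg set_lebesgue_integral_def using t by simp
  then have "(cmod (LINT s:{0..t}|lborel. \<phi> s))\<^sup>2 \<le> (sqrt t * sqrt (LINT s:{0..t}|lborel. (cmod (\<phi> s))\<^sup>2))\<^sup>2"
    by (intro power_mono) auto
  moreover have "0 \<le> (LINT s:{0..t}|lborel. (cmod (\<phi> s))\<^sup>2)"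
    by (auto simp: set_lebesgue_integral_def intro!: Bochner_Integration.integral_nonneg)
  ultimately show ?thesis using t by (simp add: power_mult_distrib)
qed

section \<open>Convergence of the iterates to a bounded solution\<close>

locale nls_bounded = nls_solution +
  fixes B :: real
  assumes B: "0 < B" and v_bound: "\<And>t. t \<in> {0..T} \<Longrightarrow> AE x in torus. cmod (v t x) \<le> B"
begin

definition V :: "nat \<Rightarrow> real \<Rightarrow> int \<Rightarrow> complex" where
  "V k t n = picard lam B (fourier_coefficient f) k t n"

definition p :: "nat \<Rightarrow> real \<Rightarrow> real \<Rightarrow> complex" where
  "p k t x = (\<Sum>m\<in>{- int k..int k}. V k t m * cis (of_int m * x))"

definition err :: "nat \<Rightarrow> real \<Rightarrow> real" where
  "err k t = (norm_L2 (\<lambda>x. v t x - p k t x))\<^sup>2 / (2 * pi)"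

definition tail :: "nat \<Rightarrow> real \<Rightarrow> real" where
  "tail k t = M t - (\<Sum>n\<in>{- int k..int k}. (cmod (U n t))\<^sup>2)"

text \<open>The squared Lipschitz constant 9 B^4 of the truncated cubic, the factor T from
  Cauchy-Schwarz in time, and the squared coupling from the Duhamel formula.\<close>

definition c :: real where "c = lam\<^sup>2 * T * (9 * B ^ 4)"

lemma p_L2: "in_L2 (p k t)"
  unfolding p_def[abs_def] by (rule in_L2_trig) simp

text \<open>The iterate with index k lives on the modes from -k to k, so the modes of the solution
  outside this window enter the error unchanged, as the tail.\<close>

lemma err_eq: "err k t = tail k t + (\<Sum>n\<in>{- int k..int k}. (cmod (U n t - V k t n))\<^sup>2)"
  unfolding err_def p_def tail_def M_def U_def
  by (subst norm_L2_diff_trig[OF v_L2]) (simp_all add: field_simps)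

lemma err_nonneg: "0 \<le> err k t" by (simp add: err_def)

lemma tail_nonneg: "0 \<le> tail k t"
  using Bessel_inequality[OF v_L2, of "{- int k..int k}" t] by (simp add: tail_def M_def U_def field_simps)

lemma tail_le_M: "tail k t \<le> M t"
  by (simp add: tail_def sum_nonneg)

lemma V_measurable: "(\<lambda>t. V k t n) \<in> borel_measurable borel"
proof -
  have "(\<lambda>z. picard lam B (fourier_coefficient f) k (snd z) n) \<in> borel_measurable ((borel :: real measure) \<Otimes>\<^sub>M (borel :: real measure))"
    by (rule picard_measurable[of "\<lambda>_. fourier_coefficient f"]) simp
  from measurable_compose[OF measurable_Pair[OF measurable_const[of 0 borel] measurable_ident_sets[OF refl]] this]
  show ?thesis by (simp add: V_def)
qed

lemma V_Suc: "V (Suc k) t n = cis (- (t * (of_int n)\<^sup>2)) * fourier_coefficient f n - \<i> * of_real lam *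
    (LINT s:{0..t}|lborel. cis (- ((t - s) * (of_int n)\<^sup>2)) * fourier_coefficient (\<lambda>x. cutoff_cubic B (p k s x)) n)"
  by (simp add: V_def p_def)

lemma joint_measurable:
  "(\<lambda>z. v (fst z) (snd z)) \<in> borel_measurable (borel \<Otimes>\<^sub>M torus)"
  "(\<lambda>z. p k (fst z) (snd z)) \<in> borel_measurable (borel \<Otimes>\<^sub>M torus)"
proof -
  have s: "sets (lborel \<Otimes>\<^sub>M torus) = sets (borel \<Otimes>\<^sub>M torus)" by (rule sets_pair_measure_cong) auto
  show "(\<lambda>z. v (fst z) (snd z)) \<in> borel_measurable (borel \<Otimes>\<^sub>M torus)"
    using v_measurable unfolding measurable_cong_sets[OF s refl] by (simp add: case_prod_unfold)
  have "(\<lambda>z. V k (fst z) m * cis (of_int m * snd z)) \<in> borel_measurable (borel \<Otimes>\<^sub>M torus)" for m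
    using measurable_compose[OF measurable_fst V_measurable[of k m], of torus]
      measurable_compose[OF measurable_snd measurable_cis_torus[of "of_int m"], of borel]
    by (intro borel_measurable_times) simp_all
  then show "(\<lambda>z. p k (fst z) (snd z)) \<in> borel_measurable (borel \<Otimes>\<^sub>M torus)"
    unfolding p_def by (intro borel_measurable_sum)
qed

lemma err_measurable: "err k \<in> borel_measurable borel"
proof -
  note [measurable] = joint_measurable
  have "(\<lambda>t. LINT x|torus. (cmod (v t x - p k t x))\<^sup>2) \<in> borel_measurable borel"
    by (rule torus.borel_measurable_lebesgue_integral) (simp add: case_prod_unfold)
  then show ?thesis unfolding err_def[abs_def] norm_L2_power2 by simp
qed

definition \<phi> :: "nat \<Rightarrow> int \<Rightarrow> real \<Rightarrow> complex" where
  "\<phi> k n s = N n s - fourier_coefficient (\<lambda>x. cutoff_cubic B (p k s x)) n"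

lemma cut_p_fc_measurable: "(\<lambda>s. fourier_coefficient (\<lambda>x. cutoff_cubic B (p k s x)) n) \<in> borel_measurable borel"
proof -
  note [measurable] = joint_measurable(2)
  have c: "(\<lambda>z. cis (- of_int n * snd z)) \<in> borel_measurable (borel \<Otimes>\<^sub>M torus)"
    using measurable_compose[OF measurable_snd measurable_cis_torus[of "- of_int n"], of borel] by simp
  have "(\<lambda>z. cutoff_cubic B (p k (fst z) (snd z)) * cis (- of_int n * snd z)) \<in> borel_measurable (borel \<Otimes>\<^sub>M torus)"
    by (intro borel_measurable_times c) measurable
  then have "(\<lambda>s. LINT x|torus. cutoff_cubic B (p k s x) * cis (- of_int n * x)) \<in> borel_measurable borel"
    by (intro torus.borel_measurable_lebesgue_integral) (simp add: case_prod_unfold)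
  then show ?thesis unfolding fourier_coefficient_def by simp
qed

lemma \<phi>_measurable: "\<phi> k n \<in> borel_measurable borel"
  unfolding \<phi>_def[abs_def] using N_measurable[of n] cut_p_fc_measurable[of k n] by simp

lemma p_bounded: "\<exists>C. \<forall>x. cmod (p k s x) \<le> C"
proof (intro exI allI)
  show "cmod (p k s x) \<le> (\<Sum>m\<in>{- int k..int k}. cmod (V k s m))" for x
    unfolding p_def by (rule order_trans[OF norm_sum]) (simp add: norm_mult)
qed

lemma cut_p_L2: "in_L2 (\<lambda>x. cutoff_cubic B (p k s x))"
proof -
  obtain C where C: "\<And>x. cmod (p k s x) \<le> C" using p_bounded by blast
  have mp: "p k s \<in> borel_measurable torus" using p_L2 in_L2_measurable by blast
  show ?thesis
  proof (rule in_L2_bounded)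
    show "(\<lambda>x. cutoff_cubic B (p k s x)) \<in> borel_measurable torus"
      by (rule measurable_compose[OF mp]) measurable
    show "AE x in torus. cmod (cutoff_cubic B (p k s x)) \<le> B\<^sup>2 * C"
      using order_trans[OF cutoff_cubic_norm mult_left_mono[OF C]] B by simp
  qed
qed

text \<open>The cutoff does not act on the solution, so both terms are coefficients of the same
  Lipschitz map; Bessel's inequality carries the pointwise bound over to the modes.\<close>

lemma sum_\<phi>_le:
  assumes s: "s \<in> {0..T}" and I: "finite I"
  shows "(\<Sum>n\<in>I. (cmod (\<phi> k n s))\<^sup>2) \<le> 9 * B ^ 4 * err k s"
proof -
  have mv: "(\<lambda>x. cutoff_cubic B (v s x)) \<in> borel_measurable torus"
    by (rule measurable_compose[OF v_meas]) measurable
  have vL: "in_L2 (\<lambda>x. cutoff_cubic B (v s x))"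
  proof (rule in_L2_bounded[OF mv])
    show "AE x in torus. cmod (cutoff_cubic B (v s x)) \<le> B\<^sup>2 * B"
      using v_bound[OF s]
    proof eventually_elim
      case (elim x)
      show ?case using order_trans[OF cutoff_cubic_norm mult_left_mono[OF elim]] B by simp
    qed
  qed
  have Neq: "N n s = fourier_coefficient (\<lambda>x. cutoff_cubic B (v s x)) n" for n
    unfolding N_def fourier_coefficient_def
  proof (intro arg_cong[where f = "\<lambda>z. z / complex_of_real (2 * pi)"] integral_cong_AE)
    show "(\<lambda>x. of_real ((cmod (v s x))\<^sup>2) * v s x * cis (- (of_int n * x))) \<in> borel_measurable torus"
      using measurable_cis_torus[of "- of_int n"] v_meas by simp
    show "(\<lambda>x. cutoff_cubic B (v s x) * cis (- (of_int n * x))) \<in> borel_measurable torus"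
      using measurable_cis_torus[of "- of_int n"] mv by simp
    show "AE x in torus. of_real ((cmod (v s x))\<^sup>2) * v s x * cis (- (of_int n * x)) = cutoff_cubic B (v s x) * cis (- (of_int n * x))"
      using v_bound[OF s] by eventually_elim (simp add: cutoff_cubic_eq)
  qed
  let ?d = "\<lambda>x. cutoff_cubic B (v s x) - cutoff_cubic B (p k s x)"
  have dL: "in_L2 ?d" by (rule in_L2_diff[OF vL cut_p_L2])
  have \<phi>_eq: "\<phi> k n s = fourier_coefficient ?d n" for n
    unfolding \<phi>_def Neq fc_diff[OF vL cut_p_L2] ..
  have "2 * pi * (\<Sum>n\<in>I. (cmod (\<phi> k n s))\<^sup>2) \<le> (norm_L2 ?d)\<^sup>2"
    unfolding \<phi>_eq by (rule Bessel_inequality[OF dL I])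
  also have "\<dots> \<le> (LINT x|torus. 9 * B ^ 4 * (cmod (v s x - p k s x))\<^sup>2)"
    unfolding norm_L2_power2
  proof (rule integral_mono_AE)
    show "integrable torus (\<lambda>x. (cmod (?d x))\<^sup>2)" using dL by (simp add: in_L2_def)
    show "integrable torus (\<lambda>x. 9 * B ^ 4 * (cmod (v s x - p k s x))\<^sup>2)"
      using in_L2_diff[OF v_L2 p_L2] by (simp add: in_L2_def)
    show "AE x in torus. (cmod (?d x))\<^sup>2 \<le> 9 * B ^ 4 * (cmod (v s x - p k s x))\<^sup>2"
      using v_bound[OF s]
    proof eventually_elim
      case (elim x)
      have "(cmod (?d x))\<^sup>2 \<le> (3 * B\<^sup>2 * cmod (v s x - p k s x))\<^sup>2"
        by (intro power_mono cutoff_cubic_lipschitz elim) simp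
      then show ?case by (simp add: power_mult_distrib)
    qed
  qed
  also have "\<dots> = 9 * B ^ 4 * (2 * pi * err k s)"
    by (simp add: err_def norm_L2_power2)
  finally have "2 * pi * (\<Sum>n\<in>I. (cmod (\<phi> k n s))\<^sup>2) \<le> 2 * pi * (9 * B ^ 4 * err k s)" by (simp add: ac_simps)
  then show ?thesis by (simp add: mult_le_cancel_left_pos)
qed

text \<open>In the difference of the two Duhamel formulas the data cancel. Each mode is estimated by
  Cauchy-Schwarz in time, and the modes are then summed inside the time integral. The bound
  \<open>E0\<close> secures the integrability.\<close>

lemma err_step:
  assumes E0: "\<And>s. s \<in> {0..T} \<Longrightarrow> err k s \<le> E0" and t: "t \<in> {0..T}"
  shows "set_integrable lborel {0..t} (err k)"
    and "err (Suc k) t \<le> tail (Suc k) t + c * (LINT s:{0..t}|lborel. err k s)"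
proof -
  have bi: "set_integrable lborel {0..t} F"
    if m: "F \<in> borel_measurable borel" and b: "\<And>s. s \<in> {0..T} \<Longrightarrow> norm (F s) \<le> C" for F :: "real \<Rightarrow> real" and C
    unfolding set_integrable_def
  proof (rule Bochner_Integration.integrable_bound)
    show "integrable lborel (\<lambda>s. indicator {0..t} s *\<^sub>R C)"
      by (intro integrable_scaleR_left integrable_real_indicator) (auto simp: emeasure_lborel_Icc_eq)
    show "(\<lambda>s. indicator {0..t} s *\<^sub>R F s) \<in> borel_measurable lborel" using m by simp
    have "norm (indicator {0..t} s *\<^sub>R F s) \<le> norm (indicator {0..t} s *\<^sub>R C)" for s
    proof (cases "s \<in> {0..t}")
      case True
      then have "norm (F s) \<le> C" using t by (intro b) auto
      then show ?thesis using True by simp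
    qed simp
    then show "AE s in lborel. norm (indicator {0..t} s *\<^sub>R F s) \<le> norm (indicator {0..t} s *\<^sub>R C)" by simp
  qed
  show ie: "set_integrable lborel {0..t} (err k)"
    by (rule bi[OF err_measurable, where C = E0]) (use E0 err_nonneg in auto)
  have \<phi>i: "set_integrable lborel {0..t} (\<lambda>s. (cmod (\<phi> k n s))\<^sup>2)" for n
  proof (rule bi[where C = "9 * B ^ 4 * E0"])
    show "(\<lambda>s. (cmod (\<phi> k n s))\<^sup>2) \<in> borel_measurable borel" using \<phi>_measurable[of k n] by simp
    fix s assume s: "s \<in> {0..T}"
    have "(cmod (\<phi> k n s))\<^sup>2 \<le> 9 * B ^ 4 * err k s" using sum_\<phi>_le[OF s, of "{n}" k] by simp
    also have "\<dots> \<le> 9 * B ^ 4 * E0" using E0[OF s] B by (intro mult_left_mono) auto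
    finally show "norm ((cmod (\<phi> k n s))\<^sup>2) \<le> 9 * B ^ 4 * E0" by simp
  qed
  have diff: "(cmod (U n t - V (Suc k) t n))\<^sup>2 \<le> lam\<^sup>2 * T * (LINT s:{0..t}|lborel. (cmod (\<phi> k n s))\<^sup>2)" for n
  proof -
    let ?e = "\<lambda>s. cis (- ((t - s) * (of_int n)\<^sup>2))"
    have [measurable]: "\<phi> k n \<in> borel_measurable borel" by (rule \<phi>_measurable)
    have iN: "set_integrable lborel {0..t} (\<lambda>s. ?e s * N n s)"
    proof -
      have "set_integrable lborel {0..t} (\<lambda>s. cis (- (t * (of_int n)\<^sup>2)) * (cis (s * (of_int n)\<^sup>2) * N n s))"
        using modes.set_integrable_sub[OF h_int[of n] t] by simp
      moreover have "cis (- (t * (of_int n)\<^sup>2)) * (cis (s * (of_int n)\<^sup>2) * N n s) = ?e s * N n s" for s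
        unfolding mult.assoc[symmetric] cis_mult by (simp add: algebra_simps)
      ultimately show ?thesis by simp
    qed
    have i\<phi>: "set_integrable lborel {0..t} (\<lambda>s. ?e s * \<phi> k n s)"
    proof -
      have "integrable lborel (\<lambda>s. indicator {0..t} s *\<^sub>R (1 + (cmod (\<phi> k n s))\<^sup>2))"
        using set_integral_add(1)[OF borel_integrable_atLeastAtMost'[OF continuous_on_const[of "{0..t}" "1::real"]] \<phi>i[of n]]
        unfolding set_integrable_def .
      then show ?thesis unfolding set_integrable_def
      proof (rule Bochner_Integration.integrable_bound)
        show "(\<lambda>s. indicator {0..t} s *\<^sub>R (?e s * \<phi> k n s)) \<in> borel_measurable lborel" by measurable
        have "cmod z \<le> 1 + (cmod z)\<^sup>2" for z :: complex
          using sum_squares_bound[of 1 "cmod z"] norm_ge_zero[of z] unfolding power2_eq_square by linarith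
        then show "AE s in lborel. norm (indicator {0..t} s *\<^sub>R (?e s * \<phi> k n s)) \<le> norm (indicator {0..t} s *\<^sub>R (1 + (cmod (\<phi> k n s))\<^sup>2))"
          by (intro AE_I2) (simp add: norm_mult indicator_def add_nonneg_nonneg)
      qed
    qed
    have D: "U n t = cis (- (t * (of_int n)\<^sup>2)) * fourier_coefficient f n - \<i> * of_real lam * (LINT s:{0..t}|lborel. ?e s * N n s)"
    proof -
      have "(LBINT s=ereal 0..ereal t. ?e s * N n s) = (LINT s:{0..t}|lborel. ?e s * N n s)"
        using t by (intro interval_integral_Icc) auto
      then show ?thesis unfolding U_def v_duhamel[of t n] N_def[symmetric] lam_def[symmetric] by simp
    qed
    have cut: "(\<lambda>s. ?e s * fourier_coefficient (\<lambda>x. cutoff_cubic B (p k s x)) n) = (\<lambda>s. ?e s * N n s - ?e s * \<phi> k n s)"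
      by (simp add: \<phi>_def algebra_simps)
    have "V (Suc k) t n = cis (- (t * (of_int n)\<^sup>2)) * fourier_coefficient f n - \<i> * of_real lam *
        ((LINT s:{0..t}|lborel. ?e s * N n s) - (LINT s:{0..t}|lborel. ?e s * \<phi> k n s))"
      unfolding V_Suc cut using iN i\<phi> by (subst set_integral_diff(2)) simp_all
    then have "U n t - V (Suc k) t n = - (\<i> * of_real lam) * (LINT s:{0..t}|lborel. ?e s * \<phi> k n s)"
      unfolding D by (simp add: algebra_simps)
    then have "(cmod (U n t - V (Suc k) t n))\<^sup>2 = lam\<^sup>2 * (cmod (LINT s:{0..t}|lborel. ?e s * \<phi> k n s))\<^sup>2"
      by (simp add: norm_mult power_mult_distrib)
    also have "(cmod (LINT s:{0..t}|lborel. ?e s * \<phi> k n s))\<^sup>2 \<le> t * (LINT s:{0..t}|lborel. (cmod (?e s * \<phi> k n s))\<^sup>2)"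
      by (rule set_integral_square_le) (use t \<phi>i[of n] in \<open>auto simp: norm_mult\<close>)
    also have "\<dots> = t * (LINT s:{0..t}|lborel. (cmod (\<phi> k n s))\<^sup>2)" by (simp only: norm_mult norm_cis mult_1_left)
    also have "\<dots> \<le> T * (LINT s:{0..t}|lborel. (cmod (\<phi> k n s))\<^sup>2)"
    proof (rule mult_right_mono)
      show "0 \<le> (LINT s:{0..t}|lborel. (cmod (\<phi> k n s))\<^sup>2)"
        unfolding set_lebesgue_integral_def by (rule Bochner_Integration.integral_nonneg) simp
    qed (use t in simp)
    finally have "(cmod (U n t - V (Suc k) t n))\<^sup>2 \<le> lam\<^sup>2 * (T * (LINT s:{0..t}|lborel. (cmod (\<phi> k n s))\<^sup>2))"
      by (simp only: mult_left_mono zero_le_power2)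
    then show ?thesis by (simp only: mult.assoc)
  qed
  let ?I = "{- int (Suc k)..int (Suc k)}"
  have "(\<Sum>n\<in>?I. (cmod (U n t - V (Suc k) t n))\<^sup>2) \<le> (\<Sum>n\<in>?I. lam\<^sup>2 * T * (LINT s:{0..t}|lborel. (cmod (\<phi> k n s))\<^sup>2))"
    by (intro sum_mono diff)
  also have "\<dots> = lam\<^sup>2 * T * (LINT s:{0..t}|lborel. (\<Sum>n\<in>?I. (cmod (\<phi> k n s))\<^sup>2))"
    using \<phi>i by (subst set_integral_sum) (simp_all add: sum_distrib_left)
  also have "\<dots> \<le> lam\<^sup>2 * T * (LINT s:{0..t}|lborel. 9 * B ^ 4 * err k s)"
  proof (intro mult_left_mono set_integral_mono)
    show "set_integrable lborel {0..t} (\<lambda>s. \<Sum>n\<in>?I. (cmod (\<phi> k n s))\<^sup>2)" by (intro set_integrable_sum \<phi>i)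
    show "set_integrable lborel {0..t} (\<lambda>s. 9 * B ^ 4 * err k s)" using ie by simp
    show "(\<Sum>n\<in>?I. (cmod (\<phi> k n s))\<^sup>2) \<le> 9 * B ^ 4 * err k s" if "s \<in> {0..t}" for s
      using that t by (intro sum_\<phi>_le) auto
  qed (use T_pos in simp)
  also have "\<dots> = c * (LINT s:{0..t}|lborel. err k s)" by (simp add: c_def)
  finally show "err (Suc k) t \<le> tail (Suc k) t + c * (LINT s:{0..t}|lborel. err k s)"
    unfolding err_eq[of "Suc k"] by simp
qed

lemma M_bounded: "\<exists>A. \<forall>t\<in>{0..T}. M t \<le> A"
  using compact_continuous_image[OF modes.M_cont compact_Icc] compact_imp_bounded bounded_iff
  by (metis abs_le_D1 image_eqI real_norm_def)

lemma c_pos: "0 < c"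
  using T_pos B modes.lam by (simp add: c_def)

lemma err_bounded: "\<exists>A\<ge>0. \<forall>t\<in>{0..T}. err k t \<le> A"
proof (induction k)
  obtain A0 where A0: "\<And>t. t \<in> {0..T} \<Longrightarrow> M t \<le> A0" using M_bounded by blast
  have "0 \<le> M 0" by (simp add: M_def)
  moreover have "M 0 \<le> A0" using T_pos by (intro A0) simp
  ultimately have A00: "0 \<le> A0" by simp
  {
    case 0
    have "err 0 t \<le> M t" for t by (simp add: err_eq tail_def V_def)
    then have "err 0 t \<le> A0" if "t \<in> {0..T}" for t using A0[OF that] order_trans by blast
    then show ?case using A00 by blast
  next
    case (Suc k)
    then obtain A where A: "0 \<le> A" "\<And>t. t \<in> {0..T} \<Longrightarrow> err k t \<le> A" by blast
    show ?case
    proof (intro exI conjI ballI)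
      show "0 \<le> A0 + c * (T * A)" using A00 A c_pos T_pos by simp
      fix t assume t: "t \<in> {0..T}"
      have "(LINT s:{0..t}|lborel. err k s) \<le> (LINT s:{0..t}|lborel. A)"
        using t by (intro set_integral_mono err_step(1)[OF A(2) t] borel_integrable_atLeastAtMost' continuous_intros A(2)) auto
      also have "\<dots> = t * A" using t by (simp add: set_lebesgue_integral_def)
      also have "\<dots> \<le> T * A" using t A by (intro mult_right_mono) auto
      finally have "c * (LINT s:{0..t}|lborel. err k s) \<le> c * (T * A)" using c_pos by simp
      then show "err (Suc k) t \<le> A0 + c * (T * A)"
        using err_step(2)[OF A(2) t] tail_le_M[of "Suc k" t] A0[OF t] by simp
    qed
  }
qed

lemma tail_uniform:
  assumes "0 < \<delta>" shows "\<exists>K. \<forall>k\<ge>K. \<forall>t\<in>{0..T}. tail k t < \<delta>"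
proof (rule Dini_decreasing[OF _ _ _ assms])
  show "continuous_on {0..T} (tail k)" for k
    unfolding tail_def[abs_def] by (intro continuous_intros modes.M_cont modes.U_cont)
  show "tail (Suc k) t \<le> tail k t" for k t
    unfolding tail_def by (intro diff_left_mono sum_mono2) auto
  show "(\<lambda>k. tail k t) \<longlonglongrightarrow> 0" for t
  proof -
    have "((\<lambda>n. (cmod (U n t))\<^sup>2) has_sum M t) UNIV"
      using Parseval[OF v_L2[of t]] unfolding M_def U_def .
    from filterlim_compose[OF this[unfolded has_sum_def] filterlim_symmetric_intervals]
    have "(\<lambda>k. M t - (\<Sum>n\<in>{- int k..int k}. (cmod (U n t))\<^sup>2)) \<longlonglongrightarrow> M t - M t"
      by (intro tendsto_intros)
    then show ?thesis by (simp add: tail_def)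
  qed
qed

text \<open>The weight \<open>exp (2 * c * t)\<close> turns the integral operator of
  \<open>err_step\<close> into a contraction with factor 1/2. With \<delta> added in each step, the
  fixed point is 2 \<delta>, while the initial error is halved j times.\<close>

lemma err_iterate:
  assumes K: "\<And>k t. k \<ge> K \<Longrightarrow> t \<in> {0..T} \<Longrightarrow> tail k t < \<delta>" and \<delta>: "0 < \<delta>"
    and E0: "0 \<le> E0" "\<And>t. t \<in> {0..T} \<Longrightarrow> err K t \<le> E0" and t: "t \<in> {0..T}"
  shows "err (K + j) t \<le> (2 * \<delta> + E0 / 2 ^ j) * exp (2 * c * t)"
  using t
proof (induction j arbitrary: t)
  case 0
  have "1 \<le> exp (2 * c * t)" using 0 c_pos by simp
  then have "1 * E0 \<le> (2 * \<delta> + E0) * exp (2 * c * t)" 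
    using E0 \<delta> mult_mono[of E0 "2 * \<delta> + E0" 1 "exp (2 * c * t)"] by simp
  then show ?case using E0(2)[OF 0] by simp
next
  case (Suc j)
  let ?a = "2 * \<delta> + E0 / 2 ^ j"
  obtain A' where A': "\<And>t. t \<in> {0..T} \<Longrightarrow> err (K + j) t \<le> A'" using err_bounded by blast
  have "(LINT s:{0..t}|lborel. err (K + j) s) \<le> (LINT s:{0..t}|lborel. ?a * exp (2 * c * s))"
    using Suc by (intro set_integral_mono err_step(1)[OF A'] borel_integrable_atLeastAtMost' continuous_intros) auto
  also have "\<dots> = ?a * ((exp (2 * c * t) - 1) / (2 * c))"
  proof -
    have "((\<lambda>s. exp (2 * c * s)) has_integral (exp (2 * c * t) / (2 * c) - exp (2 * c * 0) / (2 * c))) {0..t}"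
      using Suc.prems c_pos
      by (intro fundamental_theorem_of_calculus)
        (auto intro!: derivative_eq_intros simp: has_real_derivative_iff_has_vector_derivative[symmetric])
    moreover have "(LINT s:{0..t}|lborel. exp (2 * c * s)) = integral {0..t} (\<lambda>s. exp (2 * c * s))"
      by (intro set_borel_integral_eq_integral(2) borel_integrable_atLeastAtMost' continuous_intros)
    ultimately have "(LINT s:{0..t}|lborel. exp (2 * c * s)) = (exp (2 * c * t) - 1) / (2 * c)"
      by (simp add: integral_unique diff_divide_distrib)
    then show ?thesis by simp
  qed
  also have "\<dots> \<le> ?a * (exp (2 * c * t) / (2 * c))"
    using E0 \<delta> c_pos by (intro mult_left_mono divide_right_mono) auto
  finally have "c * (LINT s:{0..t}|lborel. err (K + j) s) \<le> c * (?a * (exp (2 * c * t) / (2 * c)))"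
    using c_pos by (intro mult_left_mono) auto
  also have "\<dots> = (\<delta> + E0 / 2 ^ Suc j) * exp (2 * c * t)" using c_pos by (simp add: field_simps)
  finally have "err (K + Suc j) t \<le> \<delta> + (\<delta> + E0 / 2 ^ Suc j) * exp (2 * c * t)"
    using err_step(2)[OF A' Suc.prems] K[of "K + Suc j" t] Suc.prems by simp
  moreover have "\<delta> * 1 \<le> \<delta> * exp (2 * c * t)" using \<delta> Suc.prems c_pos by (intro mult_left_mono) auto
  ultimately show ?case by (simp add: algebra_simps)
qed

theorem picard_tendsto:
  assumes t: "t \<in> {0..T}"
  shows "(\<lambda>k. picard lam B (fourier_coefficient f) k t n) \<longlonglongrightarrow> fourier_coefficient (v t) n"
proof -
  have "(\<lambda>k. err k t) \<longlonglongrightarrow> 0"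
  proof (rule order_tendstoI)
    fix r :: real assume "r < 0"
    then show "\<forall>\<^sub>F k in sequentially. r < err k t" using err_nonneg by (auto intro: always_eventually less_le_trans)
  next
    fix r :: real assume r: "0 < r"
    \<comment> \<open>With this choice the limit 2 \<delta> exp (2 c t) of the bounds equals r /
      2.\<close>
    define \<delta> where "\<delta> = r / (4 * exp (2 * c * t))"
    have \<delta>: "0 < \<delta>" using r by (simp add: \<delta>_def)
    obtain K where K: "\<And>k t. k \<ge> K \<Longrightarrow> t \<in> {0..T} \<Longrightarrow> tail k t < \<delta>" using tail_uniform[OF \<delta>] by blast
    obtain A where A: "0 \<le> A" "\<And>t. t \<in> {0..T} \<Longrightarrow> err K t \<le> A" using err_bounded by blast
    have "(\<lambda>j. (2 * \<delta> + A * (1 / 2) ^ j) * exp (2 * c * t)) \<longlonglongrightarrow> (2 * \<delta> + A * 0) * exp (2 * c * t)"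
      by (intro tendsto_intros LIMSEQ_power_zero) simp
    moreover have "(2 * \<delta> + A * 0) * exp (2 * c * t) < r" using r by (simp add: \<delta>_def)
    ultimately have "\<forall>\<^sub>F j in sequentially. (2 * \<delta> + A * (1 / 2) ^ j) * exp (2 * c * t) < r"
      by (rule order_tendstoD(2))
    then have "\<forall>\<^sub>F j in sequentially. err (j + K) t < r"
    proof eventually_elim
      case (elim j)
      then show ?case using err_iterate[OF K \<delta> A t, of j] by (simp add: power_one_over add.commute)
    qed
    then show "\<forall>\<^sub>F k in sequentially. err k t < r" by (rule eventually_sequentially_seg[THEN iffD1])
  qed
  then have "(\<lambda>k. sqrt (err k t)) \<longlonglongrightarrow> 0" using tendsto_real_sqrt[of _ 0] by fastforce
  then have "(\<lambda>k. V k t n - U n t) \<longlonglongrightarrow> 0"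
  proof (rule Lim_null_comparison[rotated])
    show "\<forall>\<^sub>F k in sequentially. cmod (V k t n - U n t) \<le> sqrt (err k t)"
      using eventually_ge_at_top[of "nat \<bar>n\<bar>"]
    proof eventually_elim
      case (elim k)
      then have "n \<in> {- int k..int k}" by auto
      then have "(cmod (U n t - V k t n))\<^sup>2 \<le> (\<Sum>n\<in>{- int k..int k}. (cmod (U n t - V k t n))\<^sup>2)"
        by (intro member_le_sum) auto
      then have "(cmod (V k t n - U n t))\<^sup>2 \<le> err k t"
        using tail_nonneg[of k t] by (simp add: err_eq norm_minus_commute)
      then show ?case by (rule real_le_rsqrt)
    qed
  qed
  from LIM_zero_cancel[OF this] show ?thesis by (simp add: V_def U_def)
qed

end

subsection \<open>Gaussian tails\<close>

lemma (in prob_space) chernoff_bound: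
  assumes i: "integrable M (\<lambda>\<omega>. exp (X \<omega>))"
  shows "prob {\<omega> \<in> space M. X \<omega> \<ge> u} \<le> exp (- u) * expectation (\<lambda>\<omega>. exp (X \<omega>))"
proof -
  have "set_integrable M (space M) (\<lambda>\<omega>. exp (1 * X \<omega>))"
    unfolding set_integrable_def
    by (subst Bochner_Integration.integrable_cong[OF refl, where g = "\<lambda>\<omega>. exp (X \<omega>)"]) (auto simp: i)
  from Chernoff_ineq_ge[OF zero_less_one this sets.top, of u]
  show ?thesis by (simp add: set_integral_space[OF i])
qed

lemma (in prob_space) half_normal_mgf:
  assumes X: "distributed M lborel X (normal_density 0 (sqrt (1/2)))"
  shows "integrable M (\<lambda>\<omega>. exp (s * X \<omega>))" and "expectation (\<lambda>\<omega>. exp (s * X \<omega>)) = exp (s\<^sup>2 / 4)"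
proof -
  have eq: "normal_density 0 (sqrt (1/2)) x * exp (s * x) = exp (s\<^sup>2 / 4) * normal_density (s / 2) (sqrt (1/2)) x" for x
  proof -
    have "exp (- x\<^sup>2) * exp (s * x) = exp (s\<^sup>2 / 4) * exp (- (x - s / 2)\<^sup>2)"
      unfolding exp_add[symmetric] by (simp add: power2_eq_square field_simps)
    then show ?thesis by (simp add: normal_density_def)
  qed
  show "integrable M (\<lambda>\<omega>. exp (s * X \<omega>))"
    by (subst distributed_integrable[OF X, symmetric]) (simp_all add: eq)
  show "expectation (\<lambda>\<omega>. exp (s * X \<omega>)) = exp (s\<^sup>2 / 4)"
    by (subst distributed_integral[OF X, symmetric]) (simp_all add: eq)
qed

text \<open>The factor only changes the variance: the density times the exponential is a multiple of
  a normal density with variance 1 / (2 (1 - \<alpha>)). Hence the restriction \<alpha> < 1.\<close>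

lemma (in prob_space) half_normal_exp_square:
  assumes X: "distributed M lborel X (normal_density 0 (sqrt (1/2)))" and \<alpha>: "0 \<le> \<alpha>" "\<alpha> < 1"
  shows "integrable M (\<lambda>\<omega>. exp (\<alpha> * (X \<omega>)\<^sup>2))" and "expectation (\<lambda>\<omega>. exp (\<alpha> * (X \<omega>)\<^sup>2)) = 1 / sqrt (1 - \<alpha>)"
proof -
  let ?\<sigma> = "sqrt (1 / (2 * (1 - \<alpha>)))"
  have eq: "normal_density 0 (sqrt (1/2)) x * exp (\<alpha> * x\<^sup>2) = (1 / sqrt (1 - \<alpha>)) * normal_density 0 ?\<sigma> x" for x
  proof -
    have e: "exp (- x\<^sup>2) * exp (\<alpha> * x\<^sup>2) = exp (- x\<^sup>2 * (1 - \<alpha>))"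
      unfolding exp_add[symmetric] by (simp add: algebra_simps)
    have sq: "(sqrt (1/2 :: real))\<^sup>2 = 1/2" "?\<sigma>\<^sup>2 = 1 / (2 * (1 - \<alpha>))" using \<alpha> by simp_all
    have "normal_density 0 ?\<sigma> x = 1 / sqrt (2 * pi * (1 / (2 * (1 - \<alpha>)))) * exp (- x\<^sup>2 * (1 - \<alpha>))"
      unfolding normal_density_def sq using \<alpha> by (simp add: field_simps)
    also have "2 * pi * (1 / (2 * (1 - \<alpha>))) = pi / (1 - \<alpha>)" using \<alpha> by (simp add: field_simps)
    also have "sqrt (pi / (1 - \<alpha>)) = sqrt pi / sqrt (1 - \<alpha>)" by (rule real_sqrt_divide)
    finally have "(1 / sqrt (1 - \<alpha>)) * normal_density 0 ?\<sigma> x = 1 / sqrt pi * exp (- x\<^sup>2 * (1 - \<alpha>))"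
      using \<alpha> by simp
    moreover have "normal_density 0 (sqrt (1/2)) x = 1 / sqrt pi * exp (- x\<^sup>2)"
      unfolding normal_density_def sq by simp
    ultimately show ?thesis using e by simp
  qed
  have \<sigma>: "0 < ?\<sigma>" using \<alpha> by simp
  show "integrable M (\<lambda>\<omega>. exp (\<alpha> * (X \<omega>)\<^sup>2))"
    by (subst distributed_integrable[OF X, symmetric]) (use \<sigma> in \<open>simp_all only: eq, simp_all\<close>)
  show "expectation (\<lambda>\<omega>. exp (\<alpha> * (X \<omega>)\<^sup>2)) = 1 / sqrt (1 - \<alpha>)"
    by (subst distributed_integral[OF X, symmetric]) (use \<sigma> in \<open>simp_all only: eq, simp_all\<close>)
qed

locale complex_gaussians = prob_space M for M :: "'w measure" +
  fixes g :: "int \<Rightarrow> 'w \<Rightarrow> complex"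
  assumes gauss: "\<And>n. standard_complex_gaussian M (g n)"
    and indep: "indep_vars (\<lambda>_. borel) g UNIV"
begin

lemma Re_g: "distributed M lborel (\<lambda>\<omega>. Re (g n \<omega>)) (normal_density 0 (sqrt (1/2)))"
  and Im_g: "distributed M lborel (\<lambda>\<omega>. Im (g n \<omega>)) (normal_density 0 (sqrt (1/2)))"
  and Re_Im_indep: "indep_var borel (\<lambda>\<omega>. Re (g n \<omega>)) borel (\<lambda>\<omega>. Im (g n \<omega>))"
  using gauss[of n] unfolding standard_complex_gaussian_def by auto

lemma g_measurable [measurable]: "g n \<in> borel_measurable M"
  using indep unfolding indep_vars_def by auto

lemma indep_on: "indep_vars (\<lambda>_. borel) g I"
  using indep_vars_subset[OF indep] by simp

lemma g_mgf:
  "integrable M (\<lambda>\<omega>. exp (a * Re (g n \<omega>) + b * Im (g n \<omega>)))"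
  "expectation (\<lambda>\<omega>. exp (a * Re (g n \<omega>) + b * Im (g n \<omega>))) = exp ((a\<^sup>2 + b\<^sup>2) / 4)"
proof -
  have i: "indep_var borel (\<lambda>\<omega>. exp (a * Re (g n \<omega>))) borel (\<lambda>\<omega>. exp (b * Im (g n \<omega>)))"
    using indep_var_compose[OF Re_Im_indep, of "\<lambda>x. exp (a * x)" borel "\<lambda>x. exp (b * x)" borel n]
    by (simp add: comp_def)
  show "integrable M (\<lambda>\<omega>. exp (a * Re (g n \<omega>) + b * Im (g n \<omega>)))"
    unfolding exp_add by (intro indep_var_integrable[OF i] half_normal_mgf Re_g Im_g)
  show "expectation (\<lambda>\<omega>. exp (a * Re (g n \<omega>) + b * Im (g n \<omega>))) = exp ((a\<^sup>2 + b\<^sup>2) / 4)"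
    unfolding exp_add
    by (subst indep_var_lebesgue_integral[OF i])
      (simp_all add: half_normal_mgf Re_g Im_g exp_add[symmetric] add_divide_distrib)
qed

lemma linear_tail:
  assumes I: "finite I" and \<sigma>: "(\<Sum>n\<in>I. (a n)\<^sup>2 + (b n)\<^sup>2) \<le> \<sigma>2" "0 < \<sigma>2" and u: "0 < u"
  shows "prob {\<omega> \<in> space M. (\<Sum>n\<in>I. a n * Re (g n \<omega>) + b n * Im (g n \<omega>)) \<ge> u} \<le> exp (- u\<^sup>2 / \<sigma>2)"
proof -
  \<comment> \<open>This value minimises the exponent - s u + s^2 \<sigma>2 / 4 of the Chernoff
    bound.\<close>
  define s where "s = 2 * u / \<sigma>2"
  have s: "0 < s" using u \<sigma> by (simp add: s_def)
  let ?X = "\<lambda>\<omega>. \<Sum>n\<in>I. (s * a n) * Re (g n \<omega>) + (s * b n) * Im (g n \<omega>)"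
  let ?Y = "\<lambda>n \<omega>. exp ((s * a n) * Re (g n \<omega>) + (s * b n) * Im (g n \<omega>))"
  have ind: "indep_vars (\<lambda>_. borel) ?Y I"
    by (rule indep_vars_compose2[OF indep_on, of I "\<lambda>n z. exp ((s * a n) * Re z + (s * b n) * Im z)"]) measurable
  have e: "exp (?X \<omega>) = (\<Prod>n\<in>I. ?Y n \<omega>)" for \<omega> using I by (rule exp_sum)
  have i: "integrable M (\<lambda>\<omega>. exp (?X \<omega>))"
    unfolding e by (intro indep_vars_integrable I ind g_mgf)
  have E: "expectation (\<lambda>\<omega>. exp (?X \<omega>)) = exp (\<Sum>n\<in>I. ((s * a n)\<^sup>2 + (s * b n)\<^sup>2) / 4)"
    unfolding e by (subst indep_vars_lebesgue_integral[OF I ind]) (simp_all add: g_mgf exp_sum[OF I])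
  have sX: "?X \<omega> = s * (\<Sum>n\<in>I. a n * Re (g n \<omega>) + b n * Im (g n \<omega>))" for \<omega>
    by (simp add: sum_distrib_left algebra_simps)
  have "{\<omega> \<in> space M. (\<Sum>n\<in>I. a n * Re (g n \<omega>) + b n * Im (g n \<omega>)) \<ge> u} = {\<omega> \<in> space M. ?X \<omega> \<ge> s * u}"
    unfolding sX using s by simp
  also have "prob \<dots> \<le> exp (- (s * u)) * exp (\<Sum>n\<in>I. ((s * a n)\<^sup>2 + (s * b n)\<^sup>2) / 4)"
    using chernoff_bound[OF i, of "s * u"] unfolding E .
  also have "(\<Sum>n\<in>I. ((s * a n)\<^sup>2 + (s * b n)\<^sup>2) / 4) = s\<^sup>2 / 4 * (\<Sum>n\<in>I. (a n)\<^sup>2 + (b n)\<^sup>2)"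
    by (simp add: sum_distrib_left power_mult_distrib add_divide_distrib algebra_simps)
  also have "exp (- (s * u)) * exp (s\<^sup>2 / 4 * (\<Sum>n\<in>I. (a n)\<^sup>2 + (b n)\<^sup>2)) \<le> exp (- (s * u)) * exp (s\<^sup>2 / 4 * \<sigma>2)"
    using \<sigma> by (intro mult_left_mono) (auto intro!: mult_left_mono)
  also have "\<dots> = exp (- u\<^sup>2 / \<sigma>2)"
    unfolding exp_add[symmetric] s_def using \<sigma> by (simp add: power2_eq_square field_simps)
  finally show ?thesis .
qed

text \<open>A modulus above u forces one of the four numbers +-Re, +-Im to be at least u / 2. Each
  of these is a real linear form in the Gaussians whose coefficient pairs arise from c by a
  rotation, so all four have the same variance.\<close>

lemma trig_tail:
  assumes I: "finite I" and \<sigma>: "(\<Sum>n\<in>I. (c n)\<^sup>2) \<le> \<sigma>2" "0 < \<sigma>2" and u: "0 < u"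
  shows "prob {\<omega> \<in> space M. cmod (\<Sum>n\<in>I. of_real (c n) * g n \<omega> * cis (\<phi> n)) > u} \<le> 4 * exp (- (u\<^sup>2 / (4 * \<sigma>2)))"
proof -
  let ?z = "\<lambda>\<omega>. \<Sum>n\<in>I. of_real (c n) * g n \<omega> * cis (\<phi> n)"
  let ?E = "\<lambda>a b. {\<omega> \<in> space M. (\<Sum>n\<in>I. a n * Re (g n \<omega>) + b n * Im (g n \<omega>)) \<ge> u / 2}"
  define cc where "cc n = c n * cos (\<phi> n)" for n
  define ss where "ss n = c n * sin (\<phi> n)" for n
  have Re: "Re (?z \<omega>) = (\<Sum>n\<in>I. cc n * Re (g n \<omega>) + - ss n * Im (g n \<omega>))" for \<omega>
    unfolding Re_sum by (intro sum.cong refl) (simp add: cc_def ss_def algebra_simps)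
  have Im: "Im (?z \<omega>) = (\<Sum>n\<in>I. ss n * Re (g n \<omega>) + cc n * Im (g n \<omega>))" for \<omega>
    unfolding Im_sum by (intro sum.cong refl) (simp add: cc_def ss_def algebra_simps)
  have neg: "- (\<Sum>n\<in>I. a n * Re (g n \<omega>) + b n * Im (g n \<omega>)) = (\<Sum>n\<in>I. - a n * Re (g n \<omega>) + - b n * Im (g n \<omega>))" for a b \<omega>
    by (simp add: sum_negf[symmetric])
  have sq: "(cc n)\<^sup>2 + (ss n)\<^sup>2 = (c n)\<^sup>2" for n
    by (simp add: cc_def ss_def power_mult_distrib distrib_left[symmetric])
  have bound: "prob (?E a b) \<le> exp (- (u\<^sup>2 / (4 * \<sigma>2)))"
    if "\<And>n. (a n)\<^sup>2 + (b n)\<^sup>2 = (c n)\<^sup>2" for a b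
    using linear_tail[OF I, of a b \<sigma>2 "u / 2"] \<sigma> u that by (simp add: power_divide field_simps)
  have sub: "{\<omega> \<in> space M. cmod (?z \<omega>) > u} \<subseteq> ((?E cc (\<lambda>n. - ss n) \<union> ?E (\<lambda>n. - cc n) (\<lambda>n. - (- ss n))) \<union> (?E ss cc \<union> ?E (\<lambda>n. - ss n) (\<lambda>n. - cc n)))"
  proof
    fix \<omega> assume "\<omega> \<in> {\<omega> \<in> space M. cmod (?z \<omega>) > u}"
    then have w: "\<omega> \<in> space M" and z: "u < \<bar>Re (?z \<omega>)\<bar> + \<bar>Im (?z \<omega>)\<bar>"
      using cmod_le[of "?z \<omega>"] by auto
    then consider "Re (?z \<omega>) \<ge> u / 2" | "- Re (?z \<omega>) \<ge> u / 2" | "Im (?z \<omega>) \<ge> u / 2" | "- Im (?z \<omega>) \<ge> u / 2"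
      by linarith
    then show "\<omega> \<in> ((?E cc (\<lambda>n. - ss n) \<union> ?E (\<lambda>n. - cc n) (\<lambda>n. - (- ss n))) \<union> (?E ss cc \<union> ?E (\<lambda>n. - ss n) (\<lambda>n. - cc n)))"
      unfolding Re Im neg using w by cases (simp_all del: minus_minus)
  qed
  have m: "?E a b \<in> events" for a b by measurable
  have "prob {\<omega> \<in> space M. cmod (?z \<omega>) > u}
     \<le> prob ((?E cc (\<lambda>n. - ss n) \<union> ?E (\<lambda>n. - cc n) (\<lambda>n. - (- ss n))) \<union> (?E ss cc \<union> ?E (\<lambda>n. - ss n) (\<lambda>n. - cc n)))"
    by (rule finite_measure_mono[OF sub]) (intro sets.Un m)
  also have "\<dots> \<le> (prob (?E cc (\<lambda>n. - ss n)) + prob (?E (\<lambda>n. - cc n) (\<lambda>n. - (- ss n)))) + (prob (?E ss cc) + prob (?E (\<lambda>n. - ss n) (\<lambda>n. - cc n)))"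
    by (intro order_trans[OF measure_Un_le] add_mono measure_Un_le sets.Un m)
  also have "\<dots> \<le> (exp (- (u\<^sup>2 / (4 * \<sigma>2))) + exp (- (u\<^sup>2 / (4 * \<sigma>2)))) + (exp (- (u\<^sup>2 / (4 * \<sigma>2))) + exp (- (u\<^sup>2 / (4 * \<sigma>2))))"
    using sq by (intro add_mono bound) (simp_all add: add.commute)
  finally show ?thesis by simp
qed

text \<open>Each |g|^2 is exponential with mean 1, so the rate \<alpha> may be taken as close to 1
  as desired. The price is a factor that depends on the number of modes but not on u, and which is
  therefore lost in the logarithmic limit.\<close>

lemma sum_square_tail:
  assumes I: "finite I" and \<alpha>: "0 \<le> \<alpha>" "\<alpha> < 1"
  shows "prob {\<omega> \<in> space M. (\<Sum>n\<in>I. (cmod (g n \<omega>))\<^sup>2) \<ge> u} \<le> exp (- (\<alpha> * u)) * (1 / (1 - \<alpha>)) ^ card I"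
proof (cases "\<alpha> = 0")
  case True then show ?thesis by simp
next
  case False
  then have \<alpha>0: "0 < \<alpha>" using \<alpha> by simp
  let ?Y = "\<lambda>n \<omega>. exp (\<alpha> * (cmod (g n \<omega>))\<^sup>2)"
  have Ysplit: "?Y n \<omega> = exp (\<alpha> * (Re (g n \<omega>))\<^sup>2) * exp (\<alpha> * (Im (g n \<omega>))\<^sup>2)" for n \<omega>
    by (simp add: cmod_power2 exp_add[symmetric] distrib_left)
  have i1: "indep_var borel (\<lambda>\<omega>. exp (\<alpha> * (Re (g n \<omega>))\<^sup>2)) borel (\<lambda>\<omega>. exp (\<alpha> * (Im (g n \<omega>))\<^sup>2))" for n
    using indep_var_compose[OF Re_Im_indep, of "\<lambda>x. exp (\<alpha> * x\<^sup>2)" borel "\<lambda>x. exp (\<alpha> * x\<^sup>2)" borel n]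
    by (simp add: comp_def)
  have iY: "integrable M (?Y n)" for n
    unfolding Ysplit by (intro indep_var_integrable[OF i1] half_normal_exp_square Re_g Im_g \<alpha>)
  have EY: "expectation (?Y n) = 1 / (1 - \<alpha>)" for n
  proof -
    have "expectation (?Y n) = (1 / sqrt (1 - \<alpha>)) * (1 / sqrt (1 - \<alpha>))"
      unfolding Ysplit
      by (subst indep_var_lebesgue_integral[OF i1])
        (simp_all only: half_normal_exp_square[OF Re_g \<alpha>] half_normal_exp_square[OF Im_g \<alpha>])
    then show ?thesis using \<alpha> by simp
  qed
  have ind: "indep_vars (\<lambda>_. borel) ?Y I"
    by (rule indep_vars_compose2[OF indep_on, of I "\<lambda>n z. exp (\<alpha> * (cmod z)\<^sup>2)"]) measurable
  let ?X = "\<lambda>\<omega>. \<Sum>n\<in>I. \<alpha> * (cmod (g n \<omega>))\<^sup>2"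
  have e: "exp (?X \<omega>) = (\<Prod>n\<in>I. ?Y n \<omega>)" for \<omega> using I by (rule exp_sum)
  have i: "integrable M (\<lambda>\<omega>. exp (?X \<omega>))"
    unfolding e by (intro indep_vars_integrable I ind iY)
  have E: "expectation (\<lambda>\<omega>. exp (?X \<omega>)) = (1 / (1 - \<alpha>)) ^ card I"
    unfolding e by (subst indep_vars_lebesgue_integral[OF I ind]) (simp_all add: iY EY)
  have "{\<omega> \<in> space M. (\<Sum>n\<in>I. (cmod (g n \<omega>))\<^sup>2) \<ge> u} = {\<omega> \<in> space M. ?X \<omega> \<ge> \<alpha> * u}"
    unfolding sum_distrib_left[symmetric] using \<alpha>0 by simp
  then show ?thesis using chernoff_bound[OF i, of "\<alpha> * u"] unfolding E by simp
qed

text \<open>The weighted sum is normal with variance \<sigma>2 / 2. On the interval of length one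
  above u its density is at least its value at u + 1.\<close>

lemma weighted_Re_lower:
  assumes I: "finite I" "I \<noteq> {}" and w: "\<And>n. n \<in> I \<Longrightarrow> 0 < w n" and u: "0 \<le> u"
  defines "\<sigma>2 \<equiv> \<Sum>n\<in>I. (w n)\<^sup>2"
  shows "exp (- (u + 1)\<^sup>2 / \<sigma>2) / sqrt (pi * \<sigma>2) \<le> prob {\<omega> \<in> space M. (\<Sum>n\<in>I. w n * Re (g n \<omega>)) > u}"
proof -
  have \<sigma>0: "0 < \<sigma>2" unfolding \<sigma>2_def using I w by (intro sum_pos zero_less_power) blast+
  have "distributed M lborel (\<lambda>\<omega>. \<Sum>n\<in>I. w n * Re (g n \<omega>))
      (normal_density (\<Sum>n\<in>I. 0) (sqrt (\<Sum>n\<in>I. (w n * sqrt (1/2))\<^sup>2)))"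
  proof (rule sum_indep_normal[OF I])
    show "indep_vars (\<lambda>i. borel) (\<lambda>n \<omega>. w n * Re (g n \<omega>)) I"
      by (rule indep_vars_compose2[OF indep_on, of I "\<lambda>n z. w n * Re z"]) measurable
    show "0 < w n * sqrt (1/2)" if "n \<in> I" for n using w[OF that] by simp
    show "distributed M lborel (\<lambda>\<omega>. w n * Re (g n \<omega>)) (normal_density 0 (w n * sqrt (1/2)))" if "n \<in> I" for n
      using normal_density_affine[OF Re_g[of n], of "w n" 0] w[OF that] by (simp add: abs_mult)
  qed
  moreover have "(\<Sum>n\<in>I. (w n * sqrt (1/2))\<^sup>2) = \<sigma>2 / 2"
    by (simp add: power_mult_distrib \<sigma>2_def sum_divide_distrib)
  ultimately have D: "distributed M lborel (\<lambda>\<omega>. \<Sum>n\<in>I. w n * Re (g n \<omega>)) (normal_density 0 (sqrt (\<sigma>2 / 2)))" (is "distributed M lborel ?S _")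
    by simp
  let ?d = "normal_density 0 (sqrt (\<sigma>2 / 2))"
  have dens: "exp (- (u + 1)\<^sup>2 / \<sigma>2) / sqrt (pi * \<sigma>2) \<le> ?d x" if "x \<in> {u<..u+1}" for x
  proof -
    have "x\<^sup>2 \<le> (u + 1)\<^sup>2" using that u by (intro power_mono) auto
    then have "exp (- (u + 1)\<^sup>2 / \<sigma>2) \<le> exp (- x\<^sup>2 / \<sigma>2)"
      using \<sigma>0 by (simp add: divide_right_mono)
    then show ?thesis using \<sigma>0 by (simp add: normal_density_def divide_right_mono)
  qed
  have "ennreal (exp (- (u + 1)\<^sup>2 / \<sigma>2) / sqrt (pi * \<sigma>2)) = (\<integral>\<^sup>+x. ennreal (exp (- (u + 1)\<^sup>2 / \<sigma>2) / sqrt (pi * \<sigma>2)) * indicator {u<..u+1} x \<partial>lborel)"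
    by (subst nn_integral_cmult_indicator) auto
  also have "\<dots> \<le> (\<integral>\<^sup>+x. ennreal (?d x) * indicator {u<..} x \<partial>lborel)"
    using dens by (intro nn_integral_mono) (auto simp: indicator_def intro!: ennreal_leI)
  also have "\<dots> = emeasure M (?S -` {u<..} \<inter> space M)"
    by (rule distributed_emeasure[OF D, symmetric]) simp
  also have "?S -` {u<..} \<inter> space M = {\<omega> \<in> space M. ?S \<omega> > u}" by auto
  also have "emeasure M \<dots> = ennreal (prob {\<omega> \<in> space M. ?S \<omega> > u})" by (rule emeasure_eq_measure)
  finally show ?thesis by (simp add: ennreal_le_iff)
qed

end

subsection \<open>Random Fourier series\<close>

definition dyadic_low :: "nat \<Rightarrow> int set" where "dyadic_low m = {n. \<bar>n\<bar> < 2 ^ m}"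

definition dyadic_block :: "nat \<Rightarrow> int set" where "dyadic_block j = {n. 2 ^ j \<le> \<bar>n\<bar> \<and> \<bar>n\<bar> < 2 ^ Suc j}"

lemma finite_dyadic_low [simp]: "finite (dyadic_low m)"
  by (rule finite_subset[of _ "{- (2 ^ m)..2 ^ m}"]) (auto simp: dyadic_low_def)

lemma finite_dyadic_block [simp]: "finite (dyadic_block j)"
  by (rule finite_subset[of _ "{- (2 ^ Suc j)..2 ^ Suc j}"]) (auto simp: dyadic_block_def)

lemma card_dyadic_block: "card (dyadic_block j) \<le> 2 ^ Suc j"
proof -
  have "dyadic_block j \<subseteq> {2 ^ j..<2 ^ Suc j} \<union> {- (2 ^ Suc j)<..- (2 ^ j)}"
    by (auto simp: dyadic_block_def abs_if split: if_splits)
  then have "card (dyadic_block j) \<le> card ({2 ^ j..<2 ^ Suc j} \<union> {- (2 ^ Suc j)<..- (2 ^ j) :: int})"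
    by (intro card_mono) auto
  also have "\<dots> \<le> card {2 ^ j..<2 ^ Suc j :: int} + card {- (2 ^ Suc j)<..- (2 ^ j) :: int}" by (rule card_Un_le)
  also have "\<dots> = 2 ^ Suc j" by (simp add: nat_power_eq)
  finally show ?thesis .
qed

lemma dyadic_low_Suc: "dyadic_low (Suc m) = dyadic_low m \<union> dyadic_block m"
  and dyadic_disjoint: "j \<ge> J \<Longrightarrow> dyadic_block j \<inter> dyadic_low J = {}"
proof -
  show "dyadic_low (Suc m) = dyadic_low m \<union> dyadic_block m"
    by (auto simp: dyadic_low_def dyadic_block_def)
  show "dyadic_block j \<inter> dyadic_low J = {}" if "j \<ge> J"
  proof -
    have "(2::int) ^ J \<le> 2 ^ j" by (rule power_increasing[OF that]) simp
    then have "\<not> (2 ^ j \<le> \<bar>n\<bar> \<and> \<bar>n\<bar> < 2 ^ J)" for n :: int by linarith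
    then show ?thesis unfolding dyadic_low_def dyadic_block_def by blast
  qed
qed

lemma ex_dyadic_block:
  assumes "n \<notin> dyadic_low J" shows "\<exists>j\<ge>J. n \<in> dyadic_block j"
proof -
  have ex: "\<exists>m. n \<in> dyadic_low m"
  proof
    have "\<bar>n\<bar> < 2 ^ nat \<bar>n\<bar>" using of_nat_less_two_power[of "nat \<bar>n\<bar>", where 'a = int] by simp
    then show "n \<in> dyadic_low (nat \<bar>n\<bar>)" by (simp add: dyadic_low_def)
  qed
  define m where "m = (LEAST m. n \<in> dyadic_low m)"
  have m: "n \<in> dyadic_low m" unfolding m_def by (rule LeastI_ex[OF ex])
  have "J < m"
  proof (rule ccontr)
    assume "\<not> J < m"
    then have "(2::int) ^ m \<le> 2 ^ J" by (intro power_increasing) auto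
    then show False using m assms unfolding dyadic_low_def mem_Collect_eq by linarith
  qed
  then obtain j where j: "m = Suc j" "J \<le> j" by (cases m) auto
  have "n \<notin> dyadic_low j" using not_less_Least[of j "\<lambda>m. n \<in> dyadic_low m"] j by (simp add: m_def)
  then have "n \<in> dyadic_block j" using m unfolding j(1) dyadic_low_Suc by blast
  then show ?thesis using j by blast
qed

lemma filterlim_dyadic_low: "filterlim dyadic_low (finite_subsets_at_top UNIV) sequentially"
  unfolding filterlim_finite_subsets_at_top
proof (intro allI impI)
  fix X :: "int set" assume "finite X \<and> X \<subseteq> UNIV"
  then have X: "finite X" by simp
  obtain b where b: "\<And>n. n \<in> X \<Longrightarrow> \<bar>n\<bar> \<le> b"
    using finite_imageI[OF X, of abs] Max_ge by (metis image_eqI)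
  show "\<forall>\<^sub>F m in sequentially. finite (dyadic_low m) \<and> X \<subseteq> dyadic_low m \<and> dyadic_low m \<subseteq> UNIV"
    using eventually_ge_at_top[of "nat b"]
  proof eventually_elim
    case (elim m)
    have "n \<in> dyadic_low m" if "n \<in> X" for n
    proof -
      have "\<bar>n\<bar> \<le> int m" using b[OF that] elim by simp
      also have "int m < 2 ^ m" by (rule of_nat_less_two_power)
      finally show ?thesis by (simp add: dyadic_low_def)
    qed
    then show ?case by auto
  qed
qed

lemma sum_dyadic:
  fixes F :: "int \<Rightarrow> complex"
  assumes "J \<le> m"
  shows "(\<Sum>n\<in>dyadic_low m - dyadic_low J. F n) = (\<Sum>j\<in>{J..<m}. \<Sum>n\<in>dyadic_block j. F n)"
  using assms
proof (induction m rule: dec_induct)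
  case base show ?case by simp
next
  case (step m)
  have "dyadic_low (Suc m) - dyadic_low J = (dyadic_low m - dyadic_low J) \<union> dyadic_block m"
    using dyadic_disjoint[of J m] step unfolding dyadic_low_Suc by blast
  moreover have "(dyadic_low m - dyadic_low J) \<inter> dyadic_block m = {}"
    using dyadic_disjoint[of m m] by blast
  ultimately have "(\<Sum>n\<in>dyadic_low (Suc m) - dyadic_low J. F n) = (\<Sum>n\<in>dyadic_low m - dyadic_low J. F n) + (\<Sum>n\<in>dyadic_block m. F n)"
    by (simp add: sum.union_disjoint)
  then show ?case using step by simp
qed

lemma cmod_cis_diff: "cmod (cis a - cis b) \<le> \<bar>a - b\<bar>"
proof -
  have "cis a - cis b = cis b * (cis (a - b) - 1)" by (simp add: right_diff_distrib cis_mult)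
  then show ?thesis using cmod_cis_minus_1[of "a - b"] by (simp add: norm_mult)
qed

lemma reduce_mod_2pi:
  obtains k :: int and y where "x = y + 2 * pi * of_int k" "0 \<le> y" "y < 2 * pi"
proof
  let ?k = "\<lfloor>x / (2 * pi)\<rfloor>"
  show "x = (x - 2 * pi * of_int ?k) + 2 * pi * of_int ?k" by simp
  have "0 \<le> x - 2 * pi * r \<and> x - 2 * pi * r < 2 * pi"
    if "r * (2 * pi) \<le> x" "x < (r + 1) * (2 * pi)" for r
    using that by (simp add: algebra_simps)
  from this[OF floor_divide_lower floor_divide_upper]
  show "0 \<le> x - 2 * pi * of_int ?k" "x - 2 * pi * of_int ?k < 2 * pi" by simp_all
qed

lemma grid_point:
  fixes h y :: real
  assumes "0 < h" "0 \<le> y" "y < 2 * pi" "8 / h \<le> real P"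
  obtains p :: nat where "p \<le> P" "\<bar>y - real p * h\<bar> \<le> h"
proof
  let ?p = "nat \<lfloor>y / h\<rfloor>"
  have "0 \<le> y / h" using assms by simp
  then have f: "real ?p \<le> y / h" "y / h < real ?p + 1" by (auto simp: of_nat_nat)
  then show "\<bar>y - real ?p * h\<bar> \<le> h" using assms(1) by (simp add: field_simps abs_le_iff)
  have "y / h \<le> 8 / h" using assms pi_less_4 by (intro divide_right_mono) auto
  then have "real ?p \<le> real P" using f assms(4) by linarith
  then show "?p \<le> P" by simp
qed

text \<open>In block j one has |n| at most 2^(j+1), so moving to a grid point at mesh 2^(-3j-4)
  changes the phase by at most 2 * 2^(2j+2) * 2^(-3j-4) = 2^(-j-1). With at most 2^(j+1) modes of
  size u the sum changes by at most u. As n^2 is an integer, the sum is periodic in time too, so one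
  grid serves all times, however long the time interval.\<close>

lemma dyadic_block_grid_bound:
  fixes a :: "int \<Rightarrow> complex" and j :: nat
  defines "S \<equiv> \<lambda>t x. \<Sum>n\<in>dyadic_block j. a n * cis (of_int n * x - t * (of_int n)\<^sup>2)"
  assumes u: "\<And>n. n \<in> dyadic_block j \<Longrightarrow> cmod (a n) \<le> u"
    and grid: "\<And>p q. p \<le> 2 ^ (3 * j + 7) \<Longrightarrow> q \<le> 2 ^ (3 * j + 7) \<Longrightarrow>
      cmod (S (real p * (1 / 2 ^ (3 * j + 4))) (real q * (1 / 2 ^ (3 * j + 4)))) \<le> u"
  shows "cmod (S t x) \<le> 2 * u"
proof -
  define h :: real where "h = 1 / 2 ^ (3 * j + 4)"
  have h: "0 < h" by (simp add: h_def)
  have hP: "8 / h \<le> real (2 ^ (3 * j + 7))" by (simp add: h_def power_add)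
  obtain k x' where x: "x = x' + 2 * pi * of_int k" "0 \<le> x'" "x' < 2 * pi" by (rule reduce_mod_2pi)
  obtain l t' where t: "t = t' + 2 * pi * of_int l" "0 \<le> t'" "t' < 2 * pi" by (rule reduce_mod_2pi)
  obtain p where p: "p \<le> 2 ^ (3 * j + 7)" "\<bar>t' - real p * h\<bar> \<le> h" by (rule grid_point[OF h t(2,3) hP])
  obtain q where q: "q \<le> 2 ^ (3 * j + 7)" "\<bar>x' - real q * h\<bar> \<le> h" by (rule grid_point[OF h x(2,3) hP])
  have per: "S t x = S t' x'"
    unfolding S_def
  proof (intro sum.cong refl arg_cong2[where f = "(*)"])
    fix n :: int
    have "of_int n * x - t * (of_int n)\<^sup>2 = (of_int n * x' - t' * (of_int n)\<^sup>2) + 2 * pi * of_int (n * k - l * n\<^sup>2)"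
      unfolding x(1) t(1) by (simp add: algebra_simps)
    then show "cis (of_int n * x - t * (of_int n)\<^sup>2) = cis (of_int n * x' - t' * (of_int n)\<^sup>2)"
      by (simp only: cis_mult[symmetric] cis_multiple_2pi[OF Ints_of_int] mult_1_right)
  qed
  have "cmod (S t' x' - S (real p * h) (real q * h)) \<le> (\<Sum>n\<in>dyadic_block j. u * (1 / 2 ^ Suc j))"
    unfolding S_def sum_subtractf[symmetric]
  proof (rule order_trans[OF norm_sum sum_mono])
    fix n assume n: "n \<in> dyadic_block j"
    have n1: "\<bar>real_of_int n\<bar> \<le> 2 ^ Suc j"
    proof -
      have "\<bar>n\<bar> \<le> 2 ^ Suc j" using n by (simp add: dyadic_block_def)
      then have "real_of_int \<bar>n\<bar> \<le> real_of_int (2 ^ Suc j)" by (simp only: of_int_le_iff)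
      then show ?thesis by simp
    qed
    have n2: "(real_of_int n)\<^sup>2 \<le> (2 ^ Suc j)\<^sup>2" using power_mono[OF n1, of 2] by simp
    have n3: "\<bar>real_of_int n\<bar> \<le> (2 ^ Suc j)\<^sup>2"
      using n1 power_increasing[of 1 2 "2 ^ Suc j :: real"] by (simp del: power_Suc)
    have "\<bar>(of_int n * x' - t' * (of_int n)\<^sup>2) - (of_int n * (real q * h) - (real p * h) * (of_int n)\<^sup>2)\<bar>
        = \<bar>of_int n * (x' - real q * h) - (t' - real p * h) * (of_int n)\<^sup>2\<bar>"
      by (simp add: algebra_simps)
    also have "\<dots> \<le> \<bar>of_int n * (x' - real q * h)\<bar> + \<bar>(t' - real p * h) * (of_int n)\<^sup>2\<bar>" by (rule abs_triangle_ineq4)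
    also have "\<dots> = \<bar>of_int n\<bar> * \<bar>x' - real q * h\<bar> + \<bar>t' - real p * h\<bar> * (of_int n)\<^sup>2" by (simp add: abs_mult)
    also have "\<dots> \<le> (2 ^ Suc j)\<^sup>2 * h + h * (2 ^ Suc j)\<^sup>2"
      using n2 n3 p(2) q(2) h by (intro add_mono mult_mono) auto
    also have "\<dots> = 1 / 2 ^ Suc j" by (simp add: h_def power_add power_mult power2_eq_square power3_eq_cube power_mult_distrib field_simps flip: power_mult_distrib)
    finally have d: "\<bar>(of_int n * x' - t' * (of_int n)\<^sup>2) - (of_int n * (real q * h) - (real p * h) * (of_int n)\<^sup>2)\<bar> \<le> 1 / 2 ^ Suc j" .
    have "cmod (a n * cis (of_int n * x' - t' * (of_int n)\<^sup>2) - a n * cis (of_int n * (real q * h) - (real p * h) * (of_int n)\<^sup>2))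
        = cmod (a n) * cmod (cis (of_int n * x' - t' * (of_int n)\<^sup>2) - cis (of_int n * (real q * h) - (real p * h) * (of_int n)\<^sup>2))"
      by (simp add: norm_mult[symmetric] right_diff_distrib)
    also have "\<dots> \<le> u * (1 / 2 ^ Suc j)"
      using u[OF n] order_trans[OF cmod_cis_diff d] by (intro mult_mono) (auto intro: order_trans[OF norm_ge_zero])
    finally show "cmod (a n * cis (of_int n * x' - t' * (of_int n)\<^sup>2) - a n * cis (of_int n * (real q * h) - (real p * h) * (of_int n)\<^sup>2))
        \<le> u * (1 / 2 ^ Suc j)" .
  qed
  also have "\<dots> = real (card (dyadic_block j)) * (u * (1 / 2 ^ Suc j))" by simp
  also have "\<dots> \<le> 2 ^ Suc j * (u * (1 / 2 ^ Suc j))"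
  proof (rule mult_right_mono)
    have "real (card (dyadic_block j)) \<le> real (2 ^ Suc j)" using card_dyadic_block[of j] by (simp only: of_nat_le_iff)
    then show "real (card (dyadic_block j)) \<le> 2 ^ Suc j" by simp
    have "(2::int) ^ j \<in> dyadic_block j" by (simp add: dyadic_block_def)
    from order_trans[OF norm_ge_zero u[OF this]] show "0 \<le> u * (1 / 2 ^ Suc j)" by simp
  qed
  also have "\<dots> = u" by simp
  finally have "cmod (S t' x' - S (real p * h) (real q * h)) \<le> u" .
  moreover have "cmod (S (real p * h) (real q * h)) \<le> u" using grid[OF p(1) q(1)] by (simp add: h_def)
  ultimately have "cmod (S t' x') \<le> 2 * u"
    using norm_triangle_sub[of "S t' x'" "S (real p * h) (real q * h)"] by linarith
  then show ?thesis by (simp add: per)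
qed

lemma japanese_bracket_ge: "\<bar>of_int n\<bar> \<le> japanese_bracket n" "1 \<le> japanese_bracket n"
  unfolding japanese_bracket_def by (auto intro!: real_le_rsqrt)

section \<open>High frequencies of the random datum\<close>

locale gaussian_data = complex_gaussians +
  fixes c :: "int \<Rightarrow> real" and \<theta> :: real
  assumes \<theta>: "0 < \<theta>" and c_eq: "\<And>n. c n = japanese_bracket n powr (- (1/2 + \<theta>))"
begin

text \<open>Chosen with \<beta>^4 = 2^(-2 \<theta>), the decay of the variance from one dyadic block
  to the next. Thresholds proportional to \<beta>^j are then summable, while their squares exceed
  the variances by the growing factor \<beta>^(-2j).\<close>

definition \<beta> :: real where "\<beta> = 2 powr (- \<theta> / 2)"

lemma \<beta>: "0 < \<beta>" "\<beta> < 1"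
  using \<theta> powr_less_mono[of "- \<theta> / 2" 0 2] by (simp_all add: \<beta>_def)

lemma c_pos: "0 < c n"
  using japanese_bracket_ge(2)[of n] by (simp add: c_eq)

lemma c_sq: "(c n)\<^sup>2 = japanese_bracket n powr (- (1 + 2 * \<theta>))"
proof -
  have "(c n)\<^sup>2 = japanese_bracket n powr (- (1/2 + \<theta>)) * japanese_bracket n powr (- (1/2 + \<theta>))"
    by (simp add: c_eq power2_eq_square)
  also have "\<dots> = japanese_bracket n powr (- (1/2 + \<theta>) + - (1/2 + \<theta>))" by (rule powr_add[symmetric])
  also have "- (1/2 + \<theta>) + - (1/2 + \<theta>) = - (1 + 2 * \<theta>)" by simp
  finally show ?thesis .
qed

lemma c_sq_block:
  assumes "n \<in> dyadic_block j" shows "(c n)\<^sup>2 \<le> \<beta> ^ (4 * j) / 2 ^ j"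
proof -
  have "(2::real) ^ j \<le> \<bar>of_int n\<bar>"
  proof -
    have "(2::int) ^ j \<le> \<bar>n\<bar>" using assms by (simp add: dyadic_block_def)
    then have "real_of_int (2 ^ j) \<le> real_of_int \<bar>n\<bar>" by (simp only: of_int_le_iff)
    then show ?thesis by simp
  qed
  then have "2 ^ j \<le> japanese_bracket n" using japanese_bracket_ge(1)[of n] by linarith
  then have "(c n)\<^sup>2 \<le> (2 ^ j) powr (- (1 + 2 * \<theta>))"
    unfolding c_sq using \<theta> by (intro powr_mono2') auto
  also have "\<dots> = 2 powr (real j * (- (1 + 2 * \<theta>)))"
    by (simp add: powr_realpow[symmetric] powr_powr)
  also have "\<dots> = 2 powr (- \<theta> / 2 * real (4 * j)) * 2 powr (- real j)"
    by (simp add: powr_add[symmetric] algebra_simps)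
  also have "\<dots> = \<beta> ^ (4 * j) / 2 ^ j"
  proof -
    have "2 powr (- \<theta> / 2 * real (4 * j)) = (2 powr (- \<theta> / 2)) powr real (4 * j)" by (rule powr_powr[symmetric])
    also have "\<dots> = \<beta> ^ (4 * j)" unfolding \<beta>_def by (rule powr_realpow) simp
    finally have a: "2 powr (- \<theta> / 2 * real (4 * j)) = \<beta> ^ (4 * j)" .
    have "2 powr (- real j) = inverse (2 powr real j)" by (rule powr_minus)
    also have "2 powr real j = 2 ^ j" by (rule powr_realpow) simp
    finally have b: "2 powr (- real j) = inverse (2 ^ j)" .
    show ?thesis unfolding a b by (rule divide_inverse[symmetric])
  qed
  finally show ?thesis .
qed

lemma sum_c_sq_block: "(\<Sum>n\<in>dyadic_block j. (c n)\<^sup>2) \<le> 2 * \<beta> ^ (4 * j)"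
proof -
  have "(\<Sum>n\<in>dyadic_block j. (c n)\<^sup>2) \<le> (\<Sum>n\<in>dyadic_block j. \<beta> ^ (4 * j) / 2 ^ j)"
    by (intro sum_mono c_sq_block)
  also have "\<dots> = real (card (dyadic_block j)) * (\<beta> ^ (4 * j) / 2 ^ j)" by simp
  also have "\<dots> \<le> 2 ^ Suc j * (\<beta> ^ (4 * j) / 2 ^ j)"
  proof (rule mult_right_mono)
    have "real (card (dyadic_block j)) \<le> real (2 ^ Suc j)" using card_dyadic_block[of j] by (simp only: of_nat_le_iff)
    then show "real (card (dyadic_block j)) \<le> 2 ^ Suc j" by simp
  qed (use \<beta> in simp)
  finally show ?thesis by simp
qed

text \<open>The factor (1 - \<beta>) / 2 makes twice the sum of all levels at most \<eta> r; the
  doubling is the loss from the grid to all points.\<close>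

definition level :: "real \<Rightarrow> real \<Rightarrow> nat \<Rightarrow> real" where
  "level \<eta> r j = \<eta> * ((1 - \<beta>) / 2) * r * \<beta> ^ j"

definition block_sum :: "nat \<Rightarrow> real \<Rightarrow> real \<Rightarrow> 'a \<Rightarrow> complex" where
  "block_sum j t x \<omega> = (\<Sum>n\<in>dyadic_block j. of_real (c n) * g n \<omega> * cis (of_int n * x - t * (of_int n)\<^sup>2))"

text \<open>\<open>block_sum\<close> has period \<open>2 \<pi>\<close> in both variables, and the grid of mesh \<open>1 / 2\<^bsup>3 j + 4\<^esup>\<close> covers
  \<open>[0, 8]\<^sup>2\<close>, hence a full period. The mesh is so fine that the bounds on the single modes control the
  oscillation of \<open>block_sum\<close> between grid points.\<close>

definition bad_block :: "real \<Rightarrow> nat \<Rightarrow> 'a set" where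
  "bad_block u j = (\<Union>n\<in>dyadic_block j. {\<omega> \<in> space M. cmod (of_real (c n) * g n \<omega>) > u}) \<union>
     (\<Union>(p, q)\<in>{..2 ^ (3 * j + 7)} \<times> {..2 ^ (3 * j + 7)}.
        {\<omega> \<in> space M. cmod (block_sum j (real p * (1 / 2 ^ (3 * j + 4))) (real q * (1 / 2 ^ (3 * j + 4))) \<omega>) > u})"

lemma block_sum_measurable [measurable]: "block_sum j t x \<in> borel_measurable M"
  unfolding block_sum_def[abs_def] by measurable

lemma bad_block_events: "bad_block u j \<in> events"
  unfolding bad_block_def by (intro sets.Un sets.finite_UN) (auto intro!: sets.finite_UN)

lemma bad_block_prob:
  assumes u: "0 < u"
  shows "prob (bad_block u j) \<le> 2 ^ (6 * j + 19) * exp (- (u\<^sup>2 / (8 * \<beta> ^ (4 * j))))"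
proof -
  let ?e = "4 * exp (- (u\<^sup>2 / (4 * (2 * \<beta> ^ (4 * j)))))"
  let ?A = "\<lambda>n. {\<omega> \<in> space M. cmod (of_real (c n) * g n \<omega>) > u}"
  let ?P = "{..(2::nat) ^ (3 * j + 7)} \<times> {..(2::nat) ^ (3 * j + 7)}"
  let ?B = "\<lambda>(p, q). {\<omega> \<in> space M. cmod (block_sum j (real p * (1 / 2 ^ (3 * j + 4))) (real q * (1 / 2 ^ (3 * j + 4))) \<omega>) > u}"
  have s0: "0 < 2 * \<beta> ^ (4 * j)" using \<beta> by simp
  have A: "prob (?A n) \<le> ?e" if "n \<in> dyadic_block j" for n
  proof -
    have "(\<Sum>n\<in>{n}. (c n)\<^sup>2) \<le> (\<Sum>n\<in>dyadic_block j. (c n)\<^sup>2)" using that by (intro sum_mono2) auto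
    then have "(\<Sum>n\<in>{n}. (c n)\<^sup>2) \<le> 2 * \<beta> ^ (4 * j)" using sum_c_sq_block[of j] by simp
    from trig_tail[OF _ this s0 u, of "\<lambda>_. 0"] show ?thesis by simp
  qed
  have B: "prob (?B z) \<le> ?e" for z
  proof (cases z)
    case (Pair p q)
    show ?thesis unfolding Pair block_sum_def case_prod_conv
      by (rule trig_tail[OF finite_dyadic_block sum_c_sq_block s0 u])
  qed
  have mA: "?A n \<in> events" for n by measurable
  have mB: "?B z \<in> events" for z by (cases z) (simp, measurable)
  have fP: "finite ?P" by simp
  have "prob (bad_block u j) \<le> prob (\<Union>n\<in>dyadic_block j. ?A n) + prob (\<Union>z\<in>?P. ?B z)"
    unfolding bad_block_def by (intro measure_Un_le sets.finite_UN finite_dyadic_block fP mA mB)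
  also have "prob (\<Union>n\<in>dyadic_block j. ?A n) \<le> (\<Sum>n\<in>dyadic_block j. prob (?A n))"
    by (intro finite_measure_subadditive_finite) (use mA in auto)
  also have "\<dots> \<le> (\<Sum>n\<in>dyadic_block j. ?e)" by (intro sum_mono A)
  also have "\<dots> = real (card (dyadic_block j)) * ?e" by simp
  also have "\<dots> \<le> 2 ^ Suc j * ?e"
  proof (rule mult_right_mono)
    have "real (card (dyadic_block j)) \<le> real (2 ^ Suc j)" using card_dyadic_block[of j] by (simp only: of_nat_le_iff)
    then show "real (card (dyadic_block j)) \<le> 2 ^ Suc j" by simp
  qed simp
  also have "prob (\<Union>z\<in>?P. ?B z) \<le> (\<Sum>z\<in>?P. prob (?B z))"
    by (intro finite_measure_subadditive_finite fP) (use mB in auto)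
  also have "\<dots> \<le> (\<Sum>z\<in>?P. ?e)" by (intro sum_mono B)
  also have "\<dots> = (2 ^ (3 * j + 7) + 1)\<^sup>2 * ?e" by (simp add: power2_eq_square algebra_simps)
  \<comment> \<open>The modes and the grid points together give at most 2^(6j+17) events; the factor
    4 in \<open>?e\<close> raises the exponent to 6j + 19.\<close>
  also have "2 ^ Suc j * ?e + (2 ^ (3 * j + 7) + 1)\<^sup>2 * ?e \<le> 2 ^ (6 * j + 17) * ?e"
  proof -
    have "(1::real) \<le> 2 ^ (3 * j + 7)" by simp
    then have "(2 ^ (3 * j + 7) + 1)\<^sup>2 \<le> ((2 ^ (3 * j + 8))\<^sup>2 :: real)"
      by (intro power_mono) (auto simp: power_add)
    also have "\<dots> = 2 ^ (6 * j + 16)" by (simp add: power_mult[symmetric] algebra_simps)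
    finally have 1: "(2 ^ (3 * j + 7) + 1)\<^sup>2 \<le> (2 ^ (6 * j + 16) :: real)" .
    have 2: "2 ^ Suc j \<le> (2 ^ (6 * j + 16) :: real)" by (rule power_increasing) auto
    have "2 ^ Suc j + (2 ^ (3 * j + 7) + 1)\<^sup>2 \<le> (2 ^ (6 * j + 17) :: real)"
      using 1 2 by (simp add: power_add)
    then show ?thesis unfolding distrib_right[symmetric] by (intro mult_right_mono) auto
  qed
  also have "\<dots> = 2 ^ (6 * j + 19) * exp (- (u\<^sup>2 / (8 * \<beta> ^ (4 * j))))" by (simp add: power_add)
  finally show ?thesis by simp
qed

lemma good_block:
  assumes "\<omega> \<in> space M" "\<omega> \<notin> bad_block u j"
  shows "n \<in> dyadic_block j \<Longrightarrow> cmod (of_real (c n) * g n \<omega>) \<le> u" and "cmod (block_sum j t x \<omega>) \<le> 2 * u"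
proof -
  show 1: "cmod (of_real (c n) * g n \<omega>) \<le> u" if "n \<in> dyadic_block j" for n
  proof (rule ccontr)
    assume "\<not> cmod (of_real (c n) * g n \<omega>) \<le> u"
    then have "\<omega> \<in> {\<omega> \<in> space M. cmod (of_real (c n) * g n \<omega>) > u}" using assms(1) by simp
    then have "\<omega> \<in> (\<Union>n\<in>dyadic_block j. {\<omega> \<in> space M. cmod (of_real (c n) * g n \<omega>) > u})" by (rule UN_I[OF that])
    then show False using assms(2) unfolding bad_block_def by blast
  qed
  show "cmod (block_sum j t x \<omega>) \<le> 2 * u"
    unfolding block_sum_def
  proof (rule dyadic_block_grid_bound[OF 1])
    fix p q :: nat assume pq: "p \<le> 2 ^ (3 * j + 7)" "q \<le> 2 ^ (3 * j + 7)"
    have "\<not> cmod (block_sum j (real p * (1 / 2 ^ (3 * j + 4))) (real q * (1 / 2 ^ (3 * j + 4))) \<omega>) > u"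
    proof
      assume gt: "cmod (block_sum j (real p * (1 / 2 ^ (3 * j + 4))) (real q * (1 / 2 ^ (3 * j + 4))) \<omega>) > u"
      have "\<omega> \<in> (\<Union>(p, q)\<in>{..2 ^ (3 * j + 7)} \<times> {..2 ^ (3 * j + 7)}.
        {\<omega> \<in> space M. cmod (block_sum j (real p * (1 / 2 ^ (3 * j + 4))) (real q * (1 / 2 ^ (3 * j + 4))) \<omega>) > u})"
        by (rule UN_I[of "(p, q)"]) (use pq gt assms(1) in simp_all)
      then show False using assms(2) unfolding bad_block_def by blast
    qed
    then show "cmod (\<Sum>n\<in>dyadic_block j. of_real (c n) * g n \<omega> * cis (of_int n * (real q * (1 / 2 ^ (3 * j + 4))) - real p * (1 / 2 ^ (3 * j + 4)) * (of_int n)\<^sup>2)) \<le> u"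
      unfolding block_sum_def by simp
  qed
qed

definition bad_event :: "real \<Rightarrow> real \<Rightarrow> nat \<Rightarrow> 'a set" where
  "bad_event \<eta> r J = (\<Union>i. bad_block (level \<eta> r (J + i)) (J + i))"

lemma bad_event_events: "bad_event \<eta> r J \<in> events"
  unfolding bad_event_def using bad_block_events by (intro sets.countable_UN) auto

text \<open>The right side grows geometrically in j, so A may be any rate. The surplus 7 j pays for
  the 2^(6j) events of block j and leaves a factor 2^(-j) for the sum over the blocks, as exp (-7)
  is at most 2^(-7).\<close>

lemma ex_level_exponent:
  assumes \<eta>: "0 < \<eta>"
  shows "\<exists>J. \<forall>j\<ge>J. A + 7 * real j \<le> (\<eta> * ((1 - \<beta>) / 2))\<^sup>2 / 8 * (1 / \<beta>\<^sup>2) ^ j"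
proof -
  let ?C = "(\<eta> * ((1 - \<beta>) / 2))\<^sup>2 / 8"
  have C: "0 < ?C" using \<eta> \<beta> by simp
  have b1: "\<beta>\<^sup>2 < 1" using \<beta> by (simp add: power_less_one_iff)
  have "(\<lambda>j. A * (\<beta>\<^sup>2) ^ j + 7 * (of_nat j * (\<beta>\<^sup>2) ^ j)) \<longlonglongrightarrow> A * 0 + 7 * 0"
    using b1 \<beta> by (intro tendsto_intros LIMSEQ_power_zero powser_times_n_limit_0) auto
  then have "\<forall>\<^sub>F j in sequentially. A * (\<beta>\<^sup>2) ^ j + 7 * (of_nat j * (\<beta>\<^sup>2) ^ j) < ?C"
    using C by (intro order_tendstoD(2)) auto
  then obtain J where J: "\<And>j. j \<ge> J \<Longrightarrow> (A + 7 * real j) * (\<beta>\<^sup>2) ^ j < ?C"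
    by (auto simp: eventually_sequentially algebra_simps)
  show ?thesis
  proof (intro exI allI impI)
    fix j assume "j \<ge> J"
    from J[OF this] have "(A + 7 * real j) * (\<beta>\<^sup>2) ^ j \<le> ?C" by simp
    then show "A + 7 * real j \<le> ?C * (1 / \<beta>\<^sup>2) ^ j"
      using \<beta> by (simp add: power_one_over pos_le_divide_eq)
  qed
qed

text \<open>With r^2 = 1 / \<epsilon> the bound decays at the rate A / \<epsilon>: a large first
  block J makes the contribution of the higher modes as unlikely as desired on the scale of the
  theorem. The assumption on r keeps the surplus 7 j intact when the exponent is multiplied by
  r^2.\<close>

lemma bad_event_prob:
  assumes \<eta>: "0 < \<eta>" and r: "1 \<le> r" and A: "0 \<le> A"
    and J: "\<And>j. j \<ge> J \<Longrightarrow> A + 7 * real j \<le> (\<eta> * ((1 - \<beta>) / 2))\<^sup>2 / 8 * (1 / \<beta>\<^sup>2) ^ j"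
  shows "prob (bad_event \<eta> r J) \<le> 2 ^ 20 * exp (- (A * r\<^sup>2))"
proof -
  let ?b = "\<lambda>i. 2 ^ 19 * exp (- (A * r\<^sup>2)) * (1/2 :: real) ^ i"
  have le: "prob (bad_block (level \<eta> r (J + i)) (J + i)) \<le> ?b i" for i
  proof -
    let ?j = "J + i" let ?u = "level \<eta> r ?j"
    have u: "0 < ?u" unfolding level_def using \<eta> \<beta> r by simp
    have "?u\<^sup>2 / (8 * \<beta> ^ (4 * ?j)) = r\<^sup>2 * ((\<eta> * ((1 - \<beta>) / 2))\<^sup>2 / 8 * (1 / \<beta>\<^sup>2) ^ ?j)"
    proof -
      have e: "(\<beta> ^ ?j)\<^sup>2 / \<beta> ^ (4 * ?j) = (1 / \<beta>\<^sup>2) ^ ?j"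
      proof -
        have "\<beta> ^ (4 * ?j) = (\<beta> ^ ?j)\<^sup>2 * (\<beta>\<^sup>2) ^ ?j"
          by (simp add: power_mult[symmetric] power_add[symmetric] mult.commute)
        then show ?thesis using \<beta> by (simp add: power_one_over)
      qed
      have gen: "(a * r * b)\<^sup>2 / (8 * z) = r\<^sup>2 * (a\<^sup>2 / 8 * (b\<^sup>2 / z))" for a b z :: real
        by (simp add: power_mult_distrib)
      show ?thesis unfolding level_def gen e ..
    qed
    also have "\<dots> \<ge> r\<^sup>2 * (A + 7 * real ?j)"
      using J[of ?j] by (intro mult_left_mono) auto
    finally have "A * r\<^sup>2 + 7 * real i \<le> ?u\<^sup>2 / (8 * \<beta> ^ (4 * ?j)) - 7 * real J"
    proof -
      assume "r\<^sup>2 * (A + 7 * real ?j) \<le> ?u\<^sup>2 / (8 * \<beta> ^ (4 * ?j))"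
      moreover have "1 * (7 * real ?j) \<le> r\<^sup>2 * (7 * real ?j)" using r by (intro mult_right_mono) (auto simp: one_le_power)
      ultimately show ?thesis by (simp add: algebra_simps)
    qed
    then have ex: "exp (- (?u\<^sup>2 / (8 * \<beta> ^ (4 * ?j)))) \<le> exp (- (A * r\<^sup>2)) * exp (- 7) ^ ?j"
      by (simp add: exp_add[symmetric] exp_of_nat_mult[symmetric] algebra_simps)
    have e7: "exp (- 7 :: real) \<le> 1 / 128"
    proof -
      have "(2::real) \<le> exp 1" using exp_ge_add_one_self[of 1] by simp
      then have "(2::real) ^ 7 \<le> exp 1 ^ 7" by (intro power_mono) auto
      also have "exp 1 ^ 7 = exp (7 :: real)" by (simp add: exp_of_nat_mult[symmetric])
      finally show ?thesis by (simp add: exp_minus field_simps)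
    qed
    have "prob (bad_block ?u ?j) \<le> 2 ^ (6 * ?j + 19) * exp (- (?u\<^sup>2 / (8 * \<beta> ^ (4 * ?j))))" by (rule bad_block_prob[OF u])
    also have "\<dots> \<le> 2 ^ (6 * ?j + 19) * (exp (- (A * r\<^sup>2)) * exp (- 7) ^ ?j)"
      using ex by (intro mult_left_mono) auto
    also have "\<dots> \<le> 2 ^ (6 * ?j + 19) * (exp (- (A * r\<^sup>2)) * (1 / 128) ^ ?j)"
      using e7 by (intro mult_left_mono power_mono) auto
    also have "\<dots> = 2 ^ 19 * exp (- (A * r\<^sup>2)) * (1/2) ^ ?j"
    proof -
      have "(2::real) ^ (6 * k) * (1 / 128) ^ k = (1/2) ^ k" for k
        unfolding power_mult power_mult_distrib[symmetric] by simp
      moreover have "2 ^ (6 * k + 19) * (E * (1 / 128) ^ k) = 2 ^ 19 * E * (2 ^ (6 * k) * (1 / 128) ^ k)" for k and E :: real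
        by (simp add: power_add)
      ultimately show ?thesis by metis
    qed
    also have "\<dots> \<le> ?b i" by (intro mult_left_mono power_decreasing) auto
    finally show ?thesis .
  qed
  have sb: "summable ?b" by (intro summable_mult summable_geometric) simp
  have sp: "summable (\<lambda>i. prob (bad_block (level \<eta> r (J + i)) (J + i)))"
    by (rule summable_comparison_test'[OF sb, of 0]) (use le in simp)
  have "prob (bad_event \<eta> r J) \<le> (\<Sum>i. prob (bad_block (level \<eta> r (J + i)) (J + i)))"
    unfolding bad_event_def using bad_block_events by (intro finite_measure_subadditive_countably sp) auto
  also have "\<dots> \<le> (\<Sum>i. ?b i)" by (rule suminf_le[OF le sp sb])
  also have "\<dots> = 2 ^ 19 * exp (- (A * r\<^sup>2)) * 2"
    by (subst suminf_mult) (simp_all add: suminf_geometric summable_geometric)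
  finally show ?thesis by simp
qed

lemma good_event:
  assumes \<omega>: "\<omega> \<in> space M" "\<omega> \<notin> bad_event \<eta> r J" and \<eta>: "0 < \<eta>" and r: "0 < r"
  shows "n \<notin> dyadic_low J \<Longrightarrow> cmod (of_real (c n) * g n \<omega>) \<le> \<eta> * r"
    and "cmod (\<Sum>n\<in>dyadic_low m - dyadic_low J. cis (- (t * (of_int n)\<^sup>2)) * (of_real (c n) * g n \<omega>) * cis (of_int n * x)) \<le> \<eta> * r"
proof -
  have nb: "\<omega> \<notin> bad_block (level \<eta> r j) j" if "j \<ge> J" for j
    using \<omega>(2) that unfolding bad_event_def by (metis UNIV_I UN_I le_add_diff_inverse)
  have lev: "level \<eta> r j \<le> \<eta> * r" for j
  proof -
    have "(1 - \<beta>) / 2 * \<beta> ^ j \<le> 1 * 1" using \<beta> by (intro mult_mono) (auto simp: power_le_one)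
    then have "(\<eta> * r) * ((1 - \<beta>) / 2 * \<beta> ^ j) \<le> (\<eta> * r) * 1" using \<eta> r by (intro mult_left_mono) auto
    then show ?thesis unfolding level_def by (simp add: ac_simps)
  qed
  show "cmod (of_real (c n) * g n \<omega>) \<le> \<eta> * r" if n: "n \<notin> dyadic_low J"
  proof -
    obtain j where j: "j \<ge> J" "n \<in> dyadic_block j" using ex_dyadic_block[OF n] by blast
    show ?thesis using good_block(1)[OF \<omega>(1) nb[OF j(1)] j(2)] lev[of j] by linarith
  qed
  let ?F = "\<lambda>n. cis (- (t * (of_int n)\<^sup>2)) * (of_real (c n) * g n \<omega>) * cis (of_int n * x)"
  show "cmod (\<Sum>n\<in>dyadic_low m - dyadic_low J. ?F n) \<le> \<eta> * r"
  proof (cases "J \<le> m")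
    case True
    have bs: "(\<Sum>n\<in>dyadic_block j. ?F n) = block_sum j t x \<omega>" for j
      unfolding block_sum_def
    proof (intro sum.cong refl)
      fix n
      have e: "cis (of_int n * x - t * (of_int n)\<^sup>2) = cis (- (t * (of_int n)\<^sup>2)) * cis (of_int n * x)"
        by (simp add: cis_mult)
      show "?F n = of_real (c n) * g n \<omega> * cis (of_int n * x - t * (of_int n)\<^sup>2)"
        unfolding e by (simp only: ac_simps)
    qed
    have "cmod (\<Sum>n\<in>dyadic_low m - dyadic_low J. ?F n) \<le> (\<Sum>j\<in>{J..<m}. 2 * level \<eta> r j)"
      unfolding sum_dyadic[OF True] bs
      by (rule order_trans[OF norm_sum sum_mono]) (use good_block(2)[OF \<omega>(1) nb] in auto)
    also have "\<dots> \<le> (\<Sum>j\<in>{..<m}. 2 * level \<eta> r j)"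
      using \<eta> r \<beta> by (intro sum_mono2) (auto simp: level_def)
    also have "\<dots> = (\<Sum>j\<in>{..<m}. \<eta> * r * (1 - \<beta>) * \<beta> ^ j)"
      by (intro sum.cong refl) (simp add: level_def)
    also have "\<dots> = \<eta> * r * ((1 - \<beta>) * (\<Sum>j\<in>{..<m}. \<beta> ^ j))"
      by (simp only: sum_distrib_left[symmetric] mult.assoc)
    also have "(1 - \<beta>) * (\<Sum>j\<in>{..<m}. \<beta> ^ j) = 1 - \<beta> ^ m"
      by (simp add: one_diff_power_eq)
    also have "\<eta> * r * (1 - \<beta> ^ m) \<le> \<eta> * r * 1" using \<eta> r \<beta> by (intro mult_left_mono) auto
    finally show ?thesis by simp
  next
    case False
    then have "(2::int) ^ m \<le> 2 ^ J" by (intro power_increasing) auto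
    then have "\<bar>n\<bar> < 2 ^ m \<Longrightarrow> \<bar>n\<bar> < 2 ^ J" for n :: int by linarith
    then have e: "dyadic_low m - dyadic_low J = {}" unfolding dyadic_low_def by blast
    show ?thesis unfolding e using \<eta> r by simp
  qed
qed

end

subsection \<open>The supremum norm of a solution\<close>

lemma fc_has_sum_L2:
  assumes "has_sum_L2 (\<lambda>n x. \<alpha> n * cis (of_int n * x)) f"
  shows "fourier_coefficient f n = \<alpha> n"
proof -
  let ?G = "\<lambda>I x. \<Sum>m\<in>I. \<alpha> m * cis (of_int m * x)"
  have f: "in_L2 f" and lim: "((\<lambda>I. norm_L2 (\<lambda>x. f x - ?G I x)) \<longlongrightarrow> 0) (finite_subsets_at_top UNIV)"
    using assms unfolding has_sum_L2_def by auto
  have lim': "((\<lambda>I. (norm_L2 (\<lambda>x. f x - ?G I x))\<^sup>2 / (2 * pi)) \<longlongrightarrow> 0\<^sup>2 / (2 * pi)) (finite_subsets_at_top UNIV)"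
    by (intro tendsto_intros lim) simp
  have "(cmod (fourier_coefficient f n - \<alpha> n))\<^sup>2 \<le> 0\<^sup>2 / (2 * pi)"
  proof (rule tendsto_lowerbound[OF lim'])
    show "\<forall>\<^sub>F I in finite_subsets_at_top UNIV. (cmod (fourier_coefficient f n - \<alpha> n))\<^sup>2 \<le> (norm_L2 (\<lambda>x. f x - ?G I x))\<^sup>2 / (2 * pi)"
      unfolding eventually_finite_subsets_at_top
    proof (intro exI[of _ "{n}"] conjI allI impI)
      fix I :: "int set" assume "finite I \<and> {n} \<subseteq> I \<and> I \<subseteq> UNIV"
      then have I: "finite I" "n \<in> I" by auto
      have "fourier_coefficient (\<lambda>x. f x - ?G I x) n = fourier_coefficient f n - \<alpha> n"
        using fc_diff[OF f in_L2_trig[OF I(1)]] fc_trig[OF I(1)] I(2) by simp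
      then show "(cmod (fourier_coefficient f n - \<alpha> n))\<^sup>2 \<le> (norm_L2 (\<lambda>x. f x - ?G I x))\<^sup>2 / (2 * pi)"
        using fc_bound[OF in_L2_diff[OF f in_L2_trig[OF I(1)]], of \<alpha> n] by simp
    qed auto
  qed (rule finite_subsets_at_top_neq_bot)
  then show ?thesis by simp
qed

text \<open>Cubic homogeneity: multiplication by \<kappa> divides the coupling by \<kappa>^2. For
  \<kappa> = sqrt \<epsilon> the coupling becomes \<epsilon>.\<close>

lemma global_nls_solution_scale:
  assumes u: "global_nls_solution \<epsilon> f u" and \<kappa>: "\<kappa> > 0"
  shows "global_nls_solution (\<epsilon> / \<kappa>) (\<lambda>x. of_real \<kappa> * f x) (\<lambda>t x. of_real \<kappa> * u t x)"
  unfolding global_nls_solution_def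
proof (intro conjI allI impI)
  have m: "(\<lambda>(t, x). u t x) \<in> borel_measurable (lborel \<Otimes>\<^sub>M torus)" and L2: "\<And>t. in_L2 (u t)"
    and c: "\<And>t. ((\<lambda>s. norm_L2 (\<lambda>x. u s x - u t x)) \<longlongrightarrow> 0) (at t)"
    and i: "\<And>R. R > 0 \<Longrightarrow> integrable (restrict_space lborel {-R..R} \<Otimes>\<^sub>M torus) (\<lambda>(t, x). (cmod (u t x)) ^ 4)"
    and d: "\<And>t n. fourier_coefficient (u t) n =
        cis (- (t * (of_int n)\<^sup>2)) * fourier_coefficient f n
        - \<i> * of_real (\<epsilon>\<^sup>2) *
          (LBINT s=ereal 0..ereal t. cis (- ((t - s) * (of_int n)\<^sup>2)) *
             fourier_coefficient (\<lambda>x. of_real ((cmod (u s x))\<^sup>2) * u s x) n)"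
    using u unfolding global_nls_solution_def by auto
  have "(\<lambda>z. of_real \<kappa> * (case z of (t, x) \<Rightarrow> u t x)) \<in> borel_measurable (lborel \<Otimes>\<^sub>M torus)"
    by (intro borel_measurable_times m) simp
  then show "(\<lambda>(t, x). of_real \<kappa> * u t x) \<in> borel_measurable (lborel \<Otimes>\<^sub>M torus)"
    by (simp add: case_prod_unfold)
  show "in_L2 (\<lambda>x. of_real \<kappa> * u t x)" for t by (rule in_L2_scale[OF L2])
  show "((\<lambda>s. norm_L2 (\<lambda>x. of_real \<kappa> * u s x - of_real \<kappa> * u t x)) \<longlongrightarrow> 0) (at t)" for t
  proof -
    have "((\<lambda>s. cmod (of_real \<kappa>) * norm_L2 (\<lambda>x. u s x - u t x)) \<longlongrightarrow> cmod (of_real \<kappa>) * 0) (at t)"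
      by (intro tendsto_intros c)
    then show ?thesis by (simp only: norm_L2_scale[symmetric] right_diff_distrib mult_zero_right)
  qed
  show "integrable (restrict_space lborel {-R..R} \<Otimes>\<^sub>M torus) (\<lambda>(t, x). (cmod (of_real \<kappa> * u t x)) ^ 4)" if "R > 0" for R
  proof -
    have "integrable (restrict_space lborel {-R..R} \<Otimes>\<^sub>M torus) (\<lambda>z. \<kappa> ^ 4 * (case z of (t, x) \<Rightarrow> (cmod (u t x)) ^ 4))"
      using i[OF that] by simp
    then show ?thesis using \<kappa> by (simp add: case_prod_unfold norm_mult power_mult_distrib)
  qed
  show "fourier_coefficient (\<lambda>x. of_real \<kappa> * u t x) n =
        cis (- (t * (of_int n)\<^sup>2)) * fourier_coefficient (\<lambda>x. of_real \<kappa> * f x) n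
        - \<i> * of_real ((\<epsilon> / \<kappa>)\<^sup>2) *
          (LBINT s=ereal 0..ereal t. cis (- ((t - s) * (of_int n)\<^sup>2)) *
             fourier_coefficient (\<lambda>x. of_real ((cmod (of_real \<kappa> * u s x))\<^sup>2) * (of_real \<kappa> * u s x)) n)" for t n
  proof -
    let ?F = "\<lambda>s. fourier_coefficient (\<lambda>x. of_real ((cmod (u s x))\<^sup>2) * u s x) n"
    let ?e = "\<lambda>s. cis (- ((t - s) * (of_int n)\<^sup>2))"
    have "(\<lambda>x. of_real ((cmod (of_real \<kappa> * u s x))\<^sup>2) * (of_real \<kappa> * u s x)) =
        (\<lambda>x. of_real (\<kappa> ^ 3) * (of_real ((cmod (u s x))\<^sup>2) * u s x))" for s
      using \<kappa> by (simp add: fun_eq_iff norm_mult power_mult_distrib power2_eq_square power3_eq_cube)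
    then have F: "?e s * fourier_coefficient (\<lambda>x. of_real ((cmod (of_real \<kappa> * u s x))\<^sup>2) * (of_real \<kappa> * u s x)) n =
        of_real (\<kappa> ^ 3) * (?e s * ?F s)" for s
      by (simp only: fc_scale mult.left_commute)
    have k: "\<epsilon>\<^sup>2 * \<kappa> = (\<epsilon> / \<kappa>)\<^sup>2 * \<kappa> ^ 3" using \<kappa> by (simp add: power_divide power2_eq_square power3_eq_cube)
    have I: "(LBINT s=ereal 0..ereal t. of_real (\<kappa> ^ 3) * (?e s * ?F s)) = of_real (\<kappa> ^ 3) * (LBINT s=ereal 0..ereal t. ?e s * ?F s)"
      by (rule interval_lebesgue_integral_mult_right)
    have "of_real \<kappa> * (\<i> * of_real (\<epsilon>\<^sup>2) * X) = \<i> * of_real ((\<epsilon> / \<kappa>)\<^sup>2) * (of_real (\<kappa> ^ 3) * X)" for X :: complex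
    proof -
      have "of_real \<kappa> * (\<i> * of_real (\<epsilon>\<^sup>2) * X) = \<i> * X * of_real (\<epsilon>\<^sup>2 * \<kappa>)" by (simp add: mult_ac)
      also have "\<dots> = \<i> * of_real ((\<epsilon> / \<kappa>)\<^sup>2) * (of_real (\<kappa> ^ 3) * X)" unfolding k of_real_mult by (simp only: mult_ac)
      finally show ?thesis .
    qed
    then show ?thesis unfolding F I fc_scale d[of t n] right_diff_distrib by (simp only: mult.left_commute)
  qed
qed

section \<open>The essential supremum as a countable condition\<close>

lemma closed_contains_Icc:
  fixes S :: "real set"
  assumes S: "closed S" and T: "0 < T" and d: "\<And>a b. 0 \<le> a \<Longrightarrow> a < b \<Longrightarrow> b \<le> T \<Longrightarrow> \<exists>t\<in>{a<..<b}. t \<in> S"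
  shows "{0..T} \<subseteq> S"
proof
  fix t assume t: "t \<in> {0..T}"
  show "t \<in> S"
  proof (rule ccontr)
    assume "t \<notin> S"
    then obtain e where e: "0 < e" "\<And>s. dist s t < e \<Longrightarrow> s \<notin> S"
      using S unfolding closed_def open_dist by blast
    have "max 0 (t - e) < min T (t + e)" using t T e by auto
    from d[OF _ this] obtain s where s: "s \<in> {max 0 (t - e)<..<min T (t + e)}" "s \<in> S" by auto
    then have "dist s t < e" by (auto simp: dist_real_def)
    then show False using e(2) s(2) by blast
  qed
qed

context nls_solution
begin

lemma closed_bounded_times: "closed {t. AE x in torus. cmod (v t x) \<le> r}"
  unfolding closed_sequential_limits
proof (intro allI impI)
  fix s l assume "(\<forall>k. s k \<in> {t. AE x in torus. cmod (v t x) \<le> r}) \<and> s \<longlonglongrightarrow> l"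
  then have s: "\<And>k. AE x in torus. cmod (v (s k) x) \<le> r" "s \<longlonglongrightarrow> l" by auto
  have z: "norm_L2 (\<lambda>x. v l x - v l x) = 0" by (simp add: norm_L2_def)
  have "((\<lambda>t. norm_L2 (\<lambda>x. v t x - v l x)) \<longlongrightarrow> norm_L2 (\<lambda>x. v l x - v l x)) (nhds l)"
    using v_cont[of l] tendsto_at_iff_tendsto_nhds[of "\<lambda>t. norm_L2 (\<lambda>x. v t x - v l x)" l] z by simp
  from filterlim_compose[OF this s(2)]
  have "(\<lambda>k. norm_L2 (\<lambda>x. v l x - v (s k) x)) \<longlonglongrightarrow> 0"
    unfolding z by (simp only: norm_L2_minus_commute[of "v l"])
  from AE_norm_le_limit[OF v_L2 sequentially_bot _ this]
  show "l \<in> {t. AE x in torus. cmod (v t x) \<le> r}" using s(1) v_L2 by (simp add: always_eventually)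
qed

text \<open>Fubini gives the bound on almost every time slice. Continuity in time with values in L2
  makes the set of good times closed, and a closed set of full measure contains the whole
  interval.\<close>

lemma norm_Linf_le_iff_slices: "norm_Linf T v \<le> ereal r \<longleftrightarrow> (\<forall>t\<in>{0..T}. AE x in torus. cmod (v t x) \<le> r)"
proof -
  interpret s: sigma_finite_measure "restrict_space lborel {0..T}"
    by (intro sigma_finite_measure_restrict_space sigma_finite_lborel) auto
  interpret p: pair_sigma_finite "restrict_space lborel {0..T}" torus ..
  let ?P = "restrict_space lborel {0..T} \<Otimes>\<^sub>M torus"
  have id: "(\<lambda>t. t) \<in> restrict_space lborel {0..T} \<rightarrow>\<^sub>M lborel" by (rule measurable_restrict_space1) simp
  have "(\<lambda>z. (fst z, snd z)) \<in> ?P \<rightarrow>\<^sub>M lborel \<Otimes>\<^sub>M torus"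
    by (intro measurable_Pair measurable_compose[OF measurable_fst id] measurable_snd)
  from measurable_compose[OF this v_measurable]
  have vm: "(\<lambda>z. v (fst z) (snd z)) \<in> borel_measurable ?P" by simp
  then have m: "(\<lambda>(t, x). ereal (cmod (v t x))) \<in> borel_measurable ?P"
    by (simp add: case_prod_unfold)
  show ?thesis
  proof
    assume "norm_Linf T v \<le> ereal r"
    then have le: "esssup ?P (\<lambda>(t, x). ereal (cmod (v t x))) \<le> ereal r" by (simp add: norm_Linf_def)
    have "AE z in ?P. cmod (v (fst z) (snd z)) \<le> r"
      using esssup_AE[of "\<lambda>(t, x). ereal (cmod (v t x))" ?P]
    proof eventually_elim
      case (elim z)
      then have "ereal (cmod (v (fst z) (snd z))) \<le> ereal r" using le order_trans by (fastforce simp: case_prod_unfold)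
      then show ?case by simp
    qed
    from p.AE_pair[OF this] have "AE t in restrict_space lborel {0..T}. AE x in torus. cmod (v t x) \<le> r" by simp
    then have ae: "AE t in lborel. t \<in> {0..T} \<longrightarrow> (AE x in torus. cmod (v t x) \<le> r)"
      by (subst (asm) AE_restrict_space_iff) auto
    have "{0..T} \<subseteq> {t. AE x in torus. cmod (v t x) \<le> r}"
    proof (rule closed_contains_Icc[OF closed_bounded_times T_pos], rule ccontr)
      fix a b :: real assume ab: "0 \<le> a" "a < b" "b \<le> T"
        and no: "\<not> (\<exists>t\<in>{a<..<b}. t \<in> {t. AE x in torus. cmod (v t x) \<le> r})"
      have "AE t in lborel. t \<notin> {a<..<b}" using ae
      proof eventually_elim
        case (elim t) then show ?case using ab no by fastforce
      qed
      then have "{a<..<b} \<in> null_sets lborel" by (subst AE_iff_null_sets) auto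
      then show False using ab by (simp add: null_sets_def)
    qed
    then show "\<forall>t\<in>{0..T}. AE x in torus. cmod (v t x) \<le> r" by blast
  next
    assume *: "\<forall>t\<in>{0..T}. AE x in torus. cmod (v t x) \<le> r"
    have "AE z in ?P. cmod (v (fst z) (snd z)) \<le> r"
    proof (rule p.AE_pair_measure)
      show "{z \<in> space ?P. cmod (v (fst z) (snd z)) \<le> r} \<in> sets ?P" using vm by measurable
      show "AE t in restrict_space lborel {0..T}. AE x in torus. cmod (v (fst (t, x)) (snd (t, x))) \<le> r"
        using * by (subst AE_restrict_space_iff) auto
    qed
    then show "norm_Linf T v \<le> ereal r"
      unfolding norm_Linf_def by (intro esssup_I[OF m]) (simp add: case_prod_unfold)
  qed
qed

text \<open>Closedness of the set of good times also reduces the condition to rational times, and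
  the Fejer means reduce each slice to countably many inequalities.\<close>

lemma norm_Linf_le_iff_fejer:
  "norm_Linf T v \<le> ereal r \<longleftrightarrow>
    (\<forall>t\<in>\<rat> \<inter> {0..T}. \<forall>k>0. \<forall>x\<in>\<rat>. cmod (fejer_mean k (fourier_coefficient (v t)) x) \<le> r)"
  unfolding norm_Linf_le_iff_slices
proof
  assume "\<forall>t\<in>{0..T}. AE x in torus. cmod (v t x) \<le> r"
  then show "\<forall>t\<in>\<rat> \<inter> {0..T}. \<forall>k>0. \<forall>x\<in>\<rat>. cmod (fejer_mean k (fourier_coefficient (v t)) x) \<le> r"
    using fejer_mean_bound[OF v_L2] by blast
next
  assume *: "\<forall>t\<in>\<rat> \<inter> {0..T}. \<forall>k>0. \<forall>x\<in>\<rat>. cmod (fejer_mean k (fourier_coefficient (v t)) x) \<le> r"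
  have "{0..T} \<subseteq> {t. AE x in torus. cmod (v t x) \<le> r}"
  proof (rule closed_contains_Icc[OF closed_bounded_times T_pos])
    fix a b :: real assume ab: "0 \<le> a" "a < b" "b \<le> T"
    obtain q where q: "q \<in> \<rat>" "a < q" "q < b" using Rats_dense_in_real[OF ab(2)] by blast
    then have "AE x in torus. cmod (v q x) \<le> r"
      using * ab by (intro fejer_mean_bounded_imp_AE_bounded v_L2) auto
    then show "\<exists>t\<in>{a<..<b}. t \<in> {t. AE x in torus. cmod (v t x) \<le> r}" using q by auto
  qed
  then show "\<forall>t\<in>{0..T}. AE x in torus. cmod (v t x) \<le> r" by blast
qed

end

section \<open>Measurability of the exceedance event\<close>

context gaussian_data
begin

definition data :: "'a \<Rightarrow> int \<Rightarrow> complex" where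
  "data \<omega> n = of_real (c n) * g n \<omega>"

lemma data_measurable [measurable]: "(\<lambda>\<omega>. data \<omega> n) \<in> borel_measurable M"
  unfolding data_def by measurable

text \<open>A measurable version of the Fourier coefficients of the solution: for almost every \<open>\<omega>\<close> the
  solution is bounded on \<open>[0, T]\<close>, so the truncation of the nonlinearity at a large height \<open>b\<close> does not
  affect it.\<close>

definition flow :: "real \<Rightarrow> real \<Rightarrow> 'a \<Rightarrow> int \<Rightarrow> complex" where
  "flow \<epsilon> t \<omega> n = lim (\<lambda>b. lim (\<lambda>k. picard (\<epsilon>\<^sup>2) (real b) (data \<omega>) k t n))"

lemma flow_measurable [measurable]: "(\<lambda>\<omega>. flow \<epsilon> t \<omega> n) \<in> borel_measurable M"
  unfolding flow_def
proof (intro borel_measurable_lim_metric)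
  fix b k
  have "(\<lambda>\<omega>. (\<omega>, t)) \<in> M \<rightarrow>\<^sub>M M \<Otimes>\<^sub>M (borel :: real measure)" by measurable
  from measurable_compose[OF this picard_measurable[OF data_measurable]]
  show "(\<lambda>\<omega>. picard (\<epsilon>\<^sup>2) (real b) (data \<omega>) k t n) \<in> borel_measurable M" by simp
qed

text \<open>Formulated through \<open>flow\<close>, which is defined for every \<omega>, and with
  countable quantifiers: the set is measurable without reference to a solution, and it agrees with
  the event of the theorem almost surely.\<close>

definition exceed :: "real \<Rightarrow> real \<Rightarrow> real \<Rightarrow> 'a set" where
  "exceed \<epsilon> T r = {\<omega> \<in> space M. \<exists>t\<in>\<rat> \<inter> {0..T}. \<exists>k\<in>{0<..}. \<exists>x\<in>\<rat>. r < cmod (fejer_mean k (flow \<epsilon> t \<omega>) x)}"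

lemma exceed_events: "exceed \<epsilon> T r \<in> events"
proof -
  have [measurable]: "(\<lambda>\<omega>. fejer_mean k (flow \<epsilon> t \<omega>) x) \<in> borel_measurable M" for k t x
    unfolding fejer_mean_def by measurable
  have eq: "exceed \<epsilon> T r = (\<Union>t\<in>\<rat> \<inter> {0..T}. \<Union>k\<in>{0<..}. \<Union>x\<in>\<rat>. {\<omega> \<in> space M. r < cmod (fejer_mean k (flow \<epsilon> t \<omega>) x)})"
    unfolding exceed_def by blast
  show ?thesis unfolding eq
    by (intro sets.countable_UN'' countable_Int1 countable_rat countableI_type) measurable
qed

text \<open>The first block can be chosen for any rate m, so the intersection of all bad events has
  probability at most 2^20 exp (-m) for every m.\<close>

lemma AE_not_bad: "AE \<omega> in M. \<exists>J. \<omega> \<notin> bad_event 1 1 J"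
proof -
  let ?N = "\<Inter>J. bad_event 1 1 J"
  have N: "?N \<in> events" using bad_event_events by (intro sets.countable_INT) auto
  have le: "prob ?N \<le> 2 ^ 20 * exp (- real m)" for m
  proof -
    obtain J where J: "\<forall>j\<ge>J. real m + 7 * real j \<le> (1 * ((1 - \<beta>) / 2))\<^sup>2 / 8 * (1 / \<beta>\<^sup>2) ^ j"
      using ex_level_exponent[of 1] by auto
    have "prob ?N \<le> prob (bad_event 1 1 J)" by (intro finite_measure_mono bad_event_events) auto
    also have "\<dots> \<le> 2 ^ 20 * exp (- (real m * 1\<^sup>2))" using J by (intro bad_event_prob) auto
    finally show ?thesis by simp
  qed
  have "(\<lambda>m. 2 ^ 20 * exp (- 1 :: real) ^ m) \<longlonglongrightarrow> 2 ^ 20 * 0"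
    by (intro tendsto_mult tendsto_const LIMSEQ_power_zero) simp
  from LIMSEQ_le_const[OF this] have "prob ?N \<le> 0"
    using le unfolding exp_of_nat_mult[symmetric] by simp
  then have "prob ?N = 0" using measure_nonneg[of M ?N] by linarith
  then have "?N \<in> null_sets M" using N by (simp add: null_sets_def emeasure_eq_measure)
  from AE_not_in[OF this] show ?thesis by eventually_elim blast
qed

text \<open>At time 0 the Duhamel integral runs over a single point, so every iterate after the
  first equals the datum. This holds for all \<omega>, and the lower bound gets by without an
  exceptional set.\<close>

lemma flow_0: "flow \<epsilon> 0 \<omega> n = data \<omega> n"
proof -
  have step: "picard (\<epsilon>\<^sup>2) b (data \<omega>) (Suc k) 0 n = data \<omega> n" for b k
    by (simp add: set_integral_singleton)
  have "(\<lambda>k. picard (\<epsilon>\<^sup>2) b (data \<omega>) k 0 n) \<longlonglongrightarrow> data \<omega> n" for b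
    by (rule LIMSEQ_imp_Suc) (simp only: step tendsto_const)
  from limI[OF this] show ?thesis unfolding flow_def by (simp only: limI[OF tendsto_const])
qed

text \<open>Off the bad event the solution is bounded. For every cutoff b above the bound the inner
  limit is the true coefficient, so the outer limit is that of an eventually constant
  sequence.\<close>

lemma flow_eq:
  assumes \<epsilon>: "0 < \<epsilon>" and \<omega>: "\<omega> \<in> space M" "\<omega> \<notin> bad_event 1 1 J"
    and f: "has_sum_L2 (\<lambda>n x. data \<omega> n * cis (of_int n * x)) f"
    and v: "global_nls_solution \<epsilon> f v" and t: "0 < T" "t \<in> {0..T}"
  shows "flow \<epsilon> t \<omega> n = fourier_coefficient (v t) n"
proof -
  interpret nls_solution \<epsilon> T f v by unfold_locales (use \<epsilon> t v in auto)
  have fc: "fourier_coefficient f = data \<omega>" using fc_has_sum_L2[OF f] by blast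
  note good = good_event[OF \<omega> zero_less_one zero_less_one, folded data_def, unfolded mult_1]
  obtain B where B: "\<forall>t\<in>{0..T}. AE x in torus. cmod (v t x) \<le> B"
    using bounded_solution[of "dyadic_low J" 1 dyadic_low] good filterlim_dyadic_low unfolding fc by auto
  have "(\<lambda>b. lim (\<lambda>k. picard (\<epsilon>\<^sup>2) (real b) (data \<omega>) k t n)) \<longlonglongrightarrow> fourier_coefficient (v t) n"
  proof (rule tendsto_eventually)
    show "\<forall>\<^sub>F b in sequentially. lim (\<lambda>k. picard (\<epsilon>\<^sup>2) (real b) (data \<omega>) k t n) = fourier_coefficient (v t) n"
      using eventually_ge_at_top[of "nat \<lceil>max B 1\<rceil>"]
    proof eventually_elim
      case (elim b)
      then have b: "B \<le> real b" "0 < real b" by linarith+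
      interpret b: nls_bounded \<epsilon> T f v "real b"
      proof
        fix s assume "s \<in> {0..T}"
        with B have "AE x in torus. cmod (v s x) \<le> B" by blast
        then show "AE x in torus. cmod (v s x) \<le> real b" by eventually_elim (use b in linarith)
      qed (rule b)
      show ?case using b.picard_tendsto[OF t(2), of n] unfolding fc lam_def by (rule limI)
    qed
  qed
  then show ?thesis unfolding flow_def by (rule limI)
qed

lemma AE_exceed_iff:
  assumes \<epsilon>: "0 < \<epsilon>" and T: "0 < T"
    and f: "AE \<omega> in M. has_sum_L2 (\<lambda>n x. data \<omega> n * cis (of_int n * x)) (f \<omega>)"
    and v: "AE \<omega> in M. global_nls_solution \<epsilon> (f \<omega>) (v \<omega>)"
  shows "AE \<omega> in M. \<omega> \<in> space M \<and> norm_Linf T (v \<omega>) > ereal r \<longleftrightarrow> \<omega> \<in> exceed \<epsilon> T r"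
  using f v AE_not_bad AE_space
proof eventually_elim
  case (elim \<omega>)
  then obtain J where J: "\<omega> \<notin> bad_event 1 1 J" by blast
  interpret nls_solution \<epsilon> T "f \<omega>" "v \<omega>" by unfold_locales (use \<epsilon> T elim in auto)
  have "flow \<epsilon> t \<omega> = fourier_coefficient (v \<omega> t)" if "t \<in> {0..T}" for t
    using flow_eq[OF \<epsilon> elim(4) J elim(1,2) T that] by blast
  then have "norm_Linf T (v \<omega>) \<le> ereal r \<longleftrightarrow>
    (\<forall>t\<in>\<rat> \<inter> {0..T}. \<forall>k>0. \<forall>x\<in>\<rat>. cmod (fejer_mean k (flow \<epsilon> t \<omega>) x) \<le> r)"
    unfolding norm_Linf_le_iff_fejer by auto
  moreover have "\<omega> \<in> exceed \<epsilon> T r \<longleftrightarrow>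
    \<not> (\<forall>t\<in>\<rat> \<inter> {0..T}. \<forall>k>0. \<forall>x\<in>\<rat>. cmod (fejer_mean k (flow \<epsilon> t \<omega>) x) \<le> r)"
    using elim(4) by (simp add: exceed_def not_le Bex_def)
  moreover have "\<omega> \<in> space M \<and> norm_Linf T (v \<omega>) > ereal r \<longleftrightarrow> \<not> norm_Linf T (v \<omega>) \<le> ereal r"
    using elim(4) by (simp add: not_le)
  ultimately show ?case by simp
qed

text \<open>The left set differs from a measurable set only inside a null set. It is therefore
  measurable for the completion, with the same measure.\<close>

lemma measure_completion_exceed:
  assumes \<epsilon>: "0 < \<epsilon>" and T: "0 < T"
    and f: "AE \<omega> in M. has_sum_L2 (\<lambda>n x. data \<omega> n * cis (of_int n * x)) (f \<omega>)"
    and v: "AE \<omega> in M. global_nls_solution \<epsilon> (f \<omega>) (v \<omega>)"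
  shows "measure (completion M) {\<omega> \<in> space M. norm_Linf T (v \<omega>) > ereal r} = prob (exceed \<epsilon> T r)"
proof -
  let ?A = "{\<omega> \<in> space M. norm_Linf T (v \<omega>) > ereal r}"
  have ae: "AE \<omega> in completion M. \<omega> \<in> ?A \<longleftrightarrow> \<omega> \<in> exceed \<epsilon> T r"
    using AE_completion[OF AE_exceed_iff[OF assms, of r]] by simp
  have E: "exceed \<epsilon> T r \<in> sets (completion M)" using exceed_events by (rule sets_completionI_sets)
  have A: "?A \<in> sets (completion M)"
  proof (rule completion.in_sets_AE[OF _ E])
    show "AE \<omega> in completion M. \<omega> \<in> exceed \<epsilon> T r \<longleftrightarrow> \<omega> \<in> ?A" using ae by eventually_elim blast
  qed auto
  show ?thesis using measure_eq_AE[OF ae A E] measure_completion[OF exceed_events] by simp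
qed

section \<open>The total variance and the lower bound from the datum\<close>

lemma c_sq_summable: "(\<lambda>n. (c n)\<^sup>2) summable_on UNIV"
proof -
  obtain S where S: "S \<ge> 0" "\<And>F. finite F \<Longrightarrow> (\<Sum>n\<in>F. \<bar>of_int n\<bar> powr (- (1 + 2 * \<theta>))) \<le> S"
    using sum_abs_int_powr_le[of "1 + 2 * \<theta>"] \<theta> by auto
  have le: "(c n)\<^sup>2 \<le> \<bar>of_int n\<bar> powr (- (1 + 2 * \<theta>))" if "n \<noteq> 0" for n
    unfolding c_sq using that japanese_bracket_ge[of n] \<theta> by (intro powr_mono2') auto
  \<comment> \<open>The mode 0 gets its own term, since \<open>0 powr a = 0\<close> makes the power
    bound fail there.\<close>
  have le0: "(c n)\<^sup>2 \<le> (if n = 0 then (c 0)\<^sup>2 else 0) + \<bar>of_int n\<bar> powr (- (1 + 2 * \<theta>))" for n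
    using le[of n] by auto
  show ?thesis
  proof (rule nonneg_bdd_above_summable_on)
    show "bdd_above (sum (\<lambda>n. (c n)\<^sup>2) ` {F. F \<subseteq> UNIV \<and> finite F})"
    proof (rule bdd_aboveI2)
      fix F :: "int set" assume "F \<in> {F. F \<subseteq> UNIV \<and> finite F}"
      then have F: "finite F" by simp
      have "(\<Sum>n\<in>F. (c n)\<^sup>2) \<le> (\<Sum>n\<in>F. (if n = 0 then (c 0)\<^sup>2 else 0) + \<bar>of_int n\<bar> powr (- (1 + 2 * \<theta>)))"
        by (intro sum_mono le0)
      also have "\<dots> \<le> (c 0)\<^sup>2 + S" unfolding sum.distrib using S(2)[OF F] F by (intro add_mono) auto
      finally show "(\<Sum>n\<in>F. (c n)\<^sup>2) \<le> (c 0)\<^sup>2 + S" .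
    qed
  qed simp
qed

definition S :: real where "S = (\<Sum>\<^sub>\<infinity>n\<in>UNIV. (c n)\<^sup>2)"

lemma sum_c_sq_le: "finite F \<Longrightarrow> (\<Sum>n\<in>F. (c n)\<^sup>2) \<le> S"
  unfolding S_def by (intro finite_sum_le_infsum c_sq_summable) auto

lemma S_pos: "0 < S"
proof -
  have "0 < (c 0)\<^sup>2" using c_pos[of 0] by simp
  also have "\<dots> \<le> S" using sum_c_sq_le[of "{0}"] by simp
  finally show ?thesis .
qed

definition fejer_weight :: "nat \<Rightarrow> int \<Rightarrow> real" where
  "fejer_weight N n = (1 - \<bar>of_int n\<bar> / real N) * c n"

text \<open>Finitely many modes already carry more than s of the variance. On them the Fejer weights
  tend to c as N grows, and further modes only add.\<close>

lemma ex_fejer_variance: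
  assumes "s < S"
  shows "\<exists>N>0. s < (\<Sum>n\<in>{- int N<..<int N}. (fejer_weight N n)\<^sup>2)"
proof -
  have "(sum (\<lambda>n. (c n)\<^sup>2) \<longlongrightarrow> S) (finite_subsets_at_top UNIV)"
    unfolding S_def using has_sum_infsum[OF c_sq_summable] by (simp add: has_sum_def)
  from order_tendstoD(1)[OF this assms]
  have "\<forall>\<^sub>F N in sequentially. s < sum (\<lambda>n. (c n)\<^sup>2) (dyadic_low N)"
    by (rule eventually_compose_filterlim[OF _ filterlim_dyadic_low])
  then obtain m where m: "s < (\<Sum>n\<in>dyadic_low m. (c n)\<^sup>2)"
    using eventually_happens'[OF sequentially_bot] by blast
  have "(\<lambda>N. \<Sum>n\<in>dyadic_low m. (fejer_weight N n)\<^sup>2) \<longlonglongrightarrow> (\<Sum>n\<in>dyadic_low m. ((1 - 0) * c n)\<^sup>2)"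
    unfolding fejer_weight_def
    by (intro tendsto_intros tendsto_divide_0[OF tendsto_const] filterlim_at_top_imp_at_infinity filterlim_real_sequentially)
  then have "\<forall>\<^sub>F N in sequentially. s < (\<Sum>n\<in>dyadic_low m. (fejer_weight N n)\<^sup>2)"
    using m by (intro order_tendstoD(1)) auto
  then have "\<forall>\<^sub>F N in sequentially. s < (\<Sum>n\<in>dyadic_low m. (fejer_weight N n)\<^sup>2) \<and> 2 ^ m \<le> N"
    using eventually_ge_at_top[of "2 ^ m"] by eventually_elim auto
  then obtain N where N: "s < (\<Sum>n\<in>dyadic_low m. (fejer_weight N n)\<^sup>2)" "2 ^ m \<le> N"
    using eventually_happens'[OF sequentially_bot] by blast
  have "(2::int) ^ m \<le> int N" using N(2) by (metis of_nat_le_iff of_nat_numeral of_nat_power)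
  then have "n \<in> {- int N<..<int N}" if "n \<in> dyadic_low m" for n
    using that unfolding dyadic_low_def mem_Collect_eq greaterThanLessThan_iff by linarith
  then have "dyadic_low m \<subseteq> {- int N<..<int N}" by blast
  then have "(\<Sum>n\<in>dyadic_low m. (fejer_weight N n)\<^sup>2) \<le> (\<Sum>n\<in>{- int N<..<int N}. (fejer_weight N n)\<^sup>2)"
    by (intro sum_mono2) auto
  moreover have "0 < N" using N(2) by (metis less_le_trans pos2 zero_less_power)
  ultimately show ?thesis using N(1) by (intro exI[of _ N]) auto
qed

lemma exceed_lower:
  fixes N :: nat
  assumes N: "0 < N" and T: "0 < T" and r: "0 \<le> r"
  defines "\<sigma> \<equiv> \<Sum>n\<in>{- int N<..<int N}. (fejer_weight N n)\<^sup>2"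
  shows "exp (- (r + 1)\<^sup>2 / \<sigma>) / sqrt (pi * \<sigma>) \<le> prob (exceed \<epsilon> T r)"
proof -
  \<comment> \<open>The interval is open because the weights vanish at the end points, while
    \<open>weighted_Re_lower\<close> asks for positive weights.\<close>
  let ?I = "{- int N<..<int N}"
  have "0 \<in> ?I" using N by simp
  then have ne: "?I \<noteq> {}" by blast
  have w: "0 < fejer_weight N n" if "n \<in> ?I" for n
    unfolding fejer_weight_def using that N c_pos[of n] by (intro mult_pos_pos) (auto simp: abs_less_iff)
  have "exp (- (r + 1)\<^sup>2 / \<sigma>) / sqrt (pi * \<sigma>) \<le> prob {\<omega> \<in> space M. (\<Sum>n\<in>?I. fejer_weight N n * Re (g n \<omega>)) > r}"
    unfolding \<sigma>_def by (rule weighted_Re_lower[OF finite_greaterThanLessThan_int ne w r])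
  also have "\<dots> \<le> prob (exceed \<epsilon> T r)"
  proof (intro finite_measure_mono exceed_events subsetI)
    fix \<omega> assume "\<omega> \<in> {\<omega> \<in> space M. (\<Sum>n\<in>?I. fejer_weight N n * Re (g n \<omega>)) > r}"
    then have \<omega>: "\<omega> \<in> space M" "r < (\<Sum>n\<in>?I. fejer_weight N n * Re (g n \<omega>))" by auto
    have "Re (fejer_mean N (flow \<epsilon> 0 \<omega>) 0) = (\<Sum>n\<in>{- int N..int N}. fejer_weight N n * Re (g n \<omega>))"
      by (simp add: fejer_mean_def flow_0 data_def fejer_weight_def mult.assoc)
    also have "\<dots> = (\<Sum>n\<in>?I. fejer_weight N n * Re (g n \<omega>))"
    proof (rule sum.mono_neutral_right)
      show "\<forall>n\<in>{- int N..int N} - ?I. fejer_weight N n * Re (g n \<omega>) = 0"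
      proof
        fix n assume "n \<in> {- int N..int N} - ?I"
        then have "\<bar>n\<bar> = int N" by auto
        then have "\<bar>of_int n\<bar> = real N" by (metis of_int_abs of_int_of_nat_eq)
        then show "fejer_weight N n * Re (g n \<omega>) = 0" using N by (simp add: fejer_weight_def)
      qed
    qed auto
    finally have "r < cmod (fejer_mean N (flow \<epsilon> 0 \<omega>) 0)"
      using \<omega>(2) complex_Re_le_cmod[of "fejer_mean N (flow \<epsilon> 0 \<omega>) 0"] by linarith
    then show "\<omega> \<in> exceed \<epsilon> T r"
      unfolding exceed_def using \<omega>(1) N T by (auto intro!: bexI[of _ 0] bexI[of _ N])
  qed
  finally show ?thesis .
qed

end

subsection \<open>Large deviations\<close>

text \<open>The constant C of \<open>bootstrap\<close> with its barriers Y and J inserted.\<close>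

definition bootstrap_const :: "real \<Rightarrow> real \<Rightarrow> real" where
  "bootstrap_const z K = trilinear_const / 2 * (2 * (z + 2) ^ 3 + K * (2 * (z + 2) ^ 5 + 3 * (z + 2)\<^sup>2) +
     3 * (z + 2)\<^sup>2 * (2 * pi * K * (z + 1) ^ 4 + 1))"

lemma powr_minus_half:
  assumes "0 < (x::real)" shows "x powr (- 1/2) = 1 / sqrt x"
  using assms powr_minus_divide[of x "1/2"] by (simp add: powr_half_sqrt)

context gaussian_data
begin

lemma norm_Linf_bound:
  assumes \<epsilon>: "0 < \<epsilon>" and T: "0 < T" "\<epsilon> * T \<le> K" and K: "1 \<le> K" and z: "0 < z"
    and \<omega>: "\<omega> \<in> space M" "\<omega> \<notin> bad_event \<eta> (\<epsilon> powr (- 1/2)) J"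
    and low: "(\<Sum>n\<in>dyadic_low J. (cmod (g n \<omega>))\<^sup>2) < z\<^sup>2 / (S * \<epsilon>)"
    and \<eta>: "0 < \<eta>" "\<eta> * (2 + K * (z + 2)\<^sup>2) \<le> 1" "\<epsilon> * bootstrap_const z K \<le> \<eta>"
    and f: "has_sum_L2 (\<lambda>n x. data \<omega> n * cis (of_int n * x)) f" and v: "global_nls_solution \<epsilon> f v"
  shows "norm_Linf T v \<le> ereal ((z + \<eta> * (2 + K * (z + 2)\<^sup>2)) * \<epsilon> powr (- 1/2))"
proof -
  \<comment> \<open>This scaling turns the threshold z \<epsilon>^(-1/2) into z and the coupling
    into \<epsilon>, so that coupling times length of time is at most K, as \<open>bootstrap\<close>
    assumes.\<close>
  define \<kappa> where "\<kappa> = sqrt \<epsilon>"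
  have \<kappa>: "0 < \<kappa>" "\<kappa>\<^sup>2 = \<epsilon>" using \<epsilon> by (auto simp: \<kappa>_def)
  have r: "\<epsilon> powr (- 1/2) = 1 / \<kappa>"
    using powr_minus_half[OF \<epsilon>] by (simp add: \<kappa>_def)
  have eq: "\<epsilon> / \<kappa> = \<kappa>" using \<kappa> by (simp add: power2_eq_square field_simps)
  interpret v: nls_solution \<epsilon> T f v by unfold_locales (use \<epsilon> T v in auto)
  interpret s: nls_solution \<kappa> T "\<lambda>x. of_real \<kappa> * f x" "\<lambda>t x. of_real \<kappa> * v t x"
    by unfold_locales (use \<kappa> T global_nls_solution_scale[OF v \<kappa>(1)] eq in auto)
  have lam: "s.lam = \<epsilon>" by (simp add: s.lam_def \<kappa>)
  have fc: "fourier_coefficient (\<lambda>x. of_real \<kappa> * f x) n = of_real \<kappa> * data \<omega> n" for n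
    by (simp add: fc_scale fc_has_sum_L2[OF f])
  have "0 < 1 / \<kappa>" using \<kappa> by simp
  note good = good_event[OF \<omega>[unfolded r] \<eta>(1) this, folded data_def]
  let ?Z = "z + \<eta> * (2 + K * (z + 2)\<^sup>2)"
  have "AE x in torus. cmod (of_real \<kappa> * v t x) \<le> ?Z" if t: "t \<in> {0..T}" for t
  proof (rule s.bootstrap[where Low = "dyadic_low J" and z = z, OF finite_dyadic_low _ _ \<eta>(2) _ filterlim_dyadic_low _ _ K _ t])
    have "(\<Sum>n\<in>dyadic_low J. c n * cmod (g n \<omega>))\<^sup>2 \<le> (\<Sum>n\<in>dyadic_low J. (c n)\<^sup>2) * (\<Sum>n\<in>dyadic_low J. (cmod (g n \<omega>))\<^sup>2)"
      by (rule Cauchy_Schwarz_ineq_sum)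
    also have "\<dots> \<le> S * (z\<^sup>2 / (S * \<epsilon>))"
      using low S_pos by (intro mult_mono sum_c_sq_le sum_nonneg) auto
    also have "\<dots> = (z / \<kappa>)\<^sup>2" using S_pos \<kappa> by (simp add: power_divide)
    finally have "(\<Sum>n\<in>dyadic_low J. c n * cmod (g n \<omega>)) \<le> z / \<kappa>"
      by (rule power2_le_imp_le) (use z \<kappa> in simp)
    then have "\<kappa> * (\<Sum>n\<in>dyadic_low J. c n * cmod (g n \<omega>)) \<le> z"
      using \<kappa> by (simp add: field_simps)
    then show "(\<Sum>n\<in>dyadic_low J. cmod (fourier_coefficient (\<lambda>x. of_real \<kappa> * f x) n)) \<le> z"
      using \<kappa> c_pos by (simp add: fc data_def norm_mult sum_distrib_left abs_of_pos)
    show "cmod (fourier_coefficient (\<lambda>x. of_real \<kappa> * f x) n) \<le> \<eta>" if "n \<notin> dyadic_low J" for n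
    proof -
      have "\<kappa> * cmod (data \<omega> n) \<le> \<kappa> * (\<eta> * (1 / \<kappa>))" using good(1)[OF that] \<kappa> by (intro mult_left_mono) auto
      then show ?thesis using \<kappa> by (simp add: fc norm_mult)
    qed
    show "cmod (\<Sum>n\<in>dyadic_low m - dyadic_low J. cis (- (t * (of_int n)\<^sup>2)) *
        fourier_coefficient (\<lambda>x. of_real \<kappa> * f x) n * cis (of_int n * x)) \<le> \<eta>" for t m x
    proof -
      have "(\<Sum>n\<in>dyadic_low m - dyadic_low J. cis (- (t * (of_int n)\<^sup>2)) *
          fourier_coefficient (\<lambda>x. of_real \<kappa> * f x) n * cis (of_int n * x)) =
        of_real \<kappa> * (\<Sum>n\<in>dyadic_low m - dyadic_low J. cis (- (t * (of_int n)\<^sup>2)) * data \<omega> n * cis (of_int n * x))"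
        unfolding fc sum_distrib_left by (intro sum.cong refl) (simp only: mult_ac)
      also have "cmod \<dots> \<le> \<kappa> * (\<eta> * (1 / \<kappa>))"
        unfolding norm_mult using good(2) \<kappa> by (intro mult_mono) auto
      finally show ?thesis using \<kappa> by simp
    qed
    show "0 \<le> \<eta>" using \<eta> by simp
    show "s.lam * T \<le> K" using T by (simp add: lam)
    show "s.lam * (trilinear_const / 2 * (2 * (z + 2) ^ 3 + K * (2 * (z + 2) ^ 5 + 3 * (z + 2)\<^sup>2) +
       3 * (z + 2)\<^sup>2 * (2 * pi * K * (z + 1) ^ 4 + 1))) \<le> \<eta>"
      using \<eta>(3) unfolding lam bootstrap_const_def .
  qed
  then have "AE x in torus. cmod (v t x) \<le> ?Z * \<epsilon> powr (- 1/2)" if "t \<in> {0..T}" for t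
  proof -
    have "AE x in torus. cmod (of_real \<kappa> * v t x) \<le> ?Z" using that by fact
    then show ?thesis unfolding r
      by eventually_elim (use \<kappa> in \<open>simp add: norm_mult pos_le_divide_eq mult.commute\<close>)
  qed
  then show ?thesis unfolding v.norm_Linf_le_iff_slices by blast
qed

text \<open>The single parameter x is both the tolerance for the high modes and the loss 1 - x in
  the rate of the chi-squared event. The starting block J is chosen so that the high modes have this
  same rate. The condition on J does not involve \<epsilon>, so the prefactor can be kept fixed in
  the limit.\<close>

lemma exceed_upper:
  assumes \<epsilon>: "0 < \<epsilon>" "\<epsilon> \<le> 1" and T: "0 < T" "\<epsilon> * T \<le> K" and K: "1 \<le> K" and z: "0 < z"
    and x: "0 < x" "x < 1" "x * (2 + K * (z + 2)\<^sup>2) \<le> 1" "\<epsilon> * bootstrap_const z K \<le> x"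
    and z0: "z + x * (2 + K * (z + 2)\<^sup>2) \<le> z0"
    and J: "\<And>j. j \<ge> J \<Longrightarrow> (1 - x) * z\<^sup>2 / S + 7 * real j \<le> (x * ((1 - \<beta>) / 2))\<^sup>2 / 8 * (1 / \<beta>\<^sup>2) ^ j"
    and f: "AE \<omega> in M. has_sum_L2 (\<lambda>n x. data \<omega> n * cis (of_int n * x)) (f \<omega>)"
    and v: "AE \<omega> in M. global_nls_solution \<epsilon> (f \<omega>) (v \<omega>)"
  shows "prob (exceed \<epsilon> T (z0 * \<epsilon> powr (- 1/2))) \<le>
    (2 ^ 20 + (1 / x) ^ card (dyadic_low J)) * exp (- ((1 - x) * z\<^sup>2 / S / \<epsilon>))"
proof -
  let ?r = "\<epsilon> powr (- 1/2)"
  let ?B = "bad_event x ?r J"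
  let ?L = "{\<omega> \<in> space M. (\<Sum>n\<in>dyadic_low J. (cmod (g n \<omega>))\<^sup>2) \<ge> z\<^sup>2 / (S * \<epsilon>)}"
  have L: "?L \<in> events" by measurable
  have r2: "?r\<^sup>2 = 1 / \<epsilon>"
    using \<epsilon> by (simp only: powr_minus_half power_divide power_one real_sqrt_pow2 less_imp_le)
  have r1: "1 \<le> ?r" using powr_mono2'[of "-1/2" \<epsilon> 1] \<epsilon> by simp
  have "AE \<omega> in M. \<omega> \<in> exceed \<epsilon> T (z0 * ?r) \<longrightarrow> \<omega> \<in> ?B \<union> ?L"
    using f v AE_space AE_exceed_iff[OF \<epsilon>(1) T(1) f v, of "z0 * ?r"]
  proof eventually_elim
    case (elim \<omega>)
    show ?case
    proof (rule impI, rule ccontr)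
      assume e: "\<omega> \<in> exceed \<epsilon> T (z0 * ?r)" and "\<omega> \<notin> ?B \<union> ?L"
      then have n: "\<omega> \<notin> ?B" "(\<Sum>n\<in>dyadic_low J. (cmod (g n \<omega>))\<^sup>2) < z\<^sup>2 / (S * \<epsilon>)"
        using elim(3) by auto
      have "norm_Linf T (v \<omega>) \<le> ereal ((z + x * (2 + K * (z + 2)\<^sup>2)) * ?r)"
        by (rule norm_Linf_bound[OF \<epsilon>(1) T K z elim(3) n x(1,3,4) elim(1,2)])
      also have "\<dots> \<le> ereal (z0 * ?r)" using z0 by (simp add: mult_right_mono)
      finally show False using e elim(4) by (simp add: not_less[symmetric])
    qed
  qed
  then have "prob (exceed \<epsilon> T (z0 * ?r)) \<le> prob (?B \<union> ?L)"
    by (intro finite_measure_mono_AE sets.Un bad_event_events L)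
  also have "\<dots> \<le> prob ?B + prob ?L" by (intro measure_Un_le bad_event_events L)
  also have "prob ?B \<le> 2 ^ 20 * exp (- ((1 - x) * z\<^sup>2 / S / \<epsilon>))"
    using bad_event_prob[OF x(1) r1 _ J] x S_pos unfolding r2 by simp
  also have "prob ?L \<le> (1 / x) ^ card (dyadic_low J) * exp (- ((1 - x) * z\<^sup>2 / S / \<epsilon>))"
    using sum_square_tail[OF finite_dyadic_low[of J], where \<alpha> = "1 - x" and u = "z\<^sup>2 / (S * \<epsilon>)"] x by (simp add: mult.commute)
  finally show ?thesis by (simp add: algebra_simps)
qed

theorem large_deviation:
  assumes z0: "0 < z0" and K: "1 \<le> K"
    and f: "AE \<omega> in M. has_sum_L2 (\<lambda>n x. data \<omega> n * cis (of_int n * x)) (f \<omega>)"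
    and v: "\<And>\<epsilon>. 0 < \<epsilon> \<Longrightarrow> AE \<omega> in M. global_nls_solution \<epsilon> (f \<omega>) (v \<epsilon> \<omega>)"
    and T: "\<And>\<epsilon>. 0 < \<epsilon> \<Longrightarrow> 0 < T \<epsilon> \<and> \<epsilon> * T \<epsilon> \<le> K"
  shows "((\<lambda>\<epsilon>. \<epsilon> * ln (prob (exceed \<epsilon> (T \<epsilon>) (z0 * \<epsilon> powr (- 1/2))))) \<longlongrightarrow> - (z0\<^sup>2 / S)) (at_right 0)"
proof -
  let ?p = "\<lambda>\<epsilon>. prob (exceed \<epsilon> (T \<epsilon>) (z0 * \<epsilon> powr (- 1/2)))"
  have pos: "\<forall>\<^sub>F \<epsilon> in at_right (0::real). 0 < \<epsilon>" by (rule eventually_at_right_less)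
  have lower: "exp (- (z0 * \<epsilon> powr (- 1/2) + 1)\<^sup>2 / (\<Sum>n\<in>{- int N<..<int N}. (fejer_weight N n)\<^sup>2)) /
      sqrt (pi * (\<Sum>n\<in>{- int N<..<int N}. (fejer_weight N n)\<^sup>2)) \<le> ?p \<epsilon>" if "0 < N" "0 < \<epsilon>" for N \<epsilon>
    using exceed_lower[OF that(1), of "T \<epsilon>" "z0 * \<epsilon> powr (- 1/2)" \<epsilon>] T[OF that(2)] z0 by simp
  have sqrt0: "((\<lambda>\<epsilon>. sqrt \<epsilon>) \<longlongrightarrow> 0) (at_right 0)"
    using tendsto_real_sqrt[OF tendsto_ident_at[of 0 "{0<..}"]] by simp
  have id0: "((\<lambda>\<epsilon>. \<epsilon>) \<longlongrightarrow> 0) (at_right (0::real))" by (rule tendsto_ident_at)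
  show ?thesis
  proof (rule order_tendstoI)
    fix a assume a: "a < - (z0\<^sup>2 / S)"
    have "0 \<le> z0\<^sup>2 / S" using S_pos by simp
    with a have a0: "0 < - a" by linarith
    have "z0\<^sup>2 / (- a) < S" using a a0 S_pos by (simp add: field_simps)
    \<comment> \<open>A Fejer mean whose variance is this close to S has the exponent - z0^2 /
      \<sigma> above a.\<close>
    from ex_fejer_variance[OF this] obtain N where N: "0 < N"
      "z0\<^sup>2 / (- a) < (\<Sum>n\<in>{- int N<..<int N}. (fejer_weight N n)\<^sup>2)" by blast
    define \<sigma> where "\<sigma> = (\<Sum>n\<in>{- int N<..<int N}. (fejer_weight N n)\<^sup>2)"
    have "0 \<le> z0\<^sup>2 / (- a)" using a0 by (intro divide_nonneg_pos) auto
    then have \<sigma>: "0 < \<sigma>" using N(2) unfolding \<sigma>_def by linarith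
    have "((\<lambda>\<epsilon>. - ((z0 + sqrt \<epsilon>)\<^sup>2 / \<sigma>) - \<epsilon> * ln (sqrt (pi * \<sigma>))) \<longlongrightarrow> - ((z0 + 0)\<^sup>2 / \<sigma>) - 0 * ln (sqrt (pi * \<sigma>))) (at_right 0)"
      using \<sigma> by (intro tendsto_intros sqrt0) auto
    moreover have "a < - ((z0 + 0)\<^sup>2 / \<sigma>) - 0 * ln (sqrt (pi * \<sigma>))"
      using N(2) a0 \<sigma> unfolding \<sigma>_def[symmetric] by (simp add: field_simps)
    ultimately have "\<forall>\<^sub>F \<epsilon> in at_right 0. a < - ((z0 + sqrt \<epsilon>)\<^sup>2 / \<sigma>) - \<epsilon> * ln (sqrt (pi * \<sigma>))"
      by (rule order_tendstoD(1))
    then show "\<forall>\<^sub>F \<epsilon> in at_right 0. a < \<epsilon> * ln (?p \<epsilon>)"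
      using pos
    proof eventually_elim
      case (elim \<epsilon>)
      let ?b = "exp (- (z0 * \<epsilon> powr (- 1/2) + 1)\<^sup>2 / \<sigma>) / sqrt (pi * \<sigma>)"
      have q: "0 < sqrt (pi * \<sigma>)" using \<sigma> by simp
      have "\<epsilon> * (z0 * \<epsilon> powr (- 1/2) + 1)\<^sup>2 = (sqrt \<epsilon> * (z0 / sqrt \<epsilon> + 1))\<^sup>2"
        unfolding powr_minus_half[OF elim(2)] power_mult_distrib using elim by simp
      also have "\<dots> = (z0 + sqrt \<epsilon>)\<^sup>2" using elim by (simp add: algebra_simps)
      finally have e: "\<epsilon> * (z0 * \<epsilon> powr (- 1/2) + 1)\<^sup>2 = (z0 + sqrt \<epsilon>)\<^sup>2" .
      have "- ((z0 + sqrt \<epsilon>)\<^sup>2 / \<sigma>) - \<epsilon> * ln (sqrt (pi * \<sigma>)) = \<epsilon> * (- (z0 * \<epsilon> powr (- 1/2) + 1)\<^sup>2 / \<sigma> - ln (sqrt (pi * \<sigma>)))"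
        unfolding e[symmetric] by (simp add: algebra_simps)
      also have "\<dots> = \<epsilon> * ln ?b" using q by (subst ln_div) auto
      also have "\<dots> \<le> \<epsilon> * ln (?p \<epsilon>)"
        using lower[OF N(1) elim(2)] elim(2) q unfolding \<sigma>_def[symmetric]
        by (intro mult_left_mono ln_mono) (auto intro: less_le_trans[rotated])
      finally show ?case using elim(1) by linarith
    qed
  next
    fix a assume a: "- (z0\<^sup>2 / S) < a"
    \<comment> \<open>The error factor 2 + K (z + 2)^2 depends on the reduced threshold z, which in
      turn is z0 minus the error. Evaluating the factor at z0 bounds it for all smaller z and breaks
      the circle.\<close>
    define Q where "Q = 2 + K * (z0 + 2)\<^sup>2"
    have Q: "0 < Q" unfolding Q_def using K by (intro add_pos_nonneg) auto
    have "((\<lambda>x. - ((1 - x) * (z0 - x * Q)\<^sup>2 / S)) \<longlongrightarrow> - ((1 - 0) * (z0 - 0 * Q)\<^sup>2 / S)) (at_right 0)"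
      using S_pos by (intro tendsto_intros id0) auto
    then have 1: "\<forall>\<^sub>F x in at_right 0. - ((1 - x) * (z0 - x * Q)\<^sup>2 / S) < a"
      using a by (intro order_tendstoD(2)) auto
    have "((\<lambda>x. x * Q) \<longlongrightarrow> 0 * Q) (at_right 0)" by (intro tendsto_intros id0)
    then have 2: "\<forall>\<^sub>F x in at_right 0. x * Q < min 1 z0" using z0 by (intro order_tendstoD(2)) auto
    have 3: "\<forall>\<^sub>F x in at_right (0::real). x < 1" using id0 by (rule order_tendstoD(2)) simp
    obtain x where x: "- ((1 - x) * (z0 - x * Q)\<^sup>2 / S) < a" "x * Q < min 1 z0" "x < 1" "0 < x"
      using eventually_happens'[OF _ eventually_conj[OF 1 eventually_conj[OF 2 eventually_conj[OF 3 pos]]]]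
      by auto
    \<comment> \<open>The part \<open>x * Q\<close> of the threshold is reserved for the
      deterministic error, and the low modes have to reach the rest.\<close>
    define z where "z = z0 - x * Q"
    have z: "0 < z" "z \<le> z0" using x Q by (auto simp: z_def)
    have Qz: "2 + K * (z + 2)\<^sup>2 \<le> Q" unfolding Q_def using z K by (intro add_mono mult_left_mono power_mono) auto
    then have xQ: "x * (2 + K * (z + 2)\<^sup>2) \<le> x * Q" using x by (intro mult_left_mono) auto
    obtain J where J: "\<forall>j\<ge>J. (1 - x) * z\<^sup>2 / S + 7 * real j \<le> (x * ((1 - \<beta>) / 2))\<^sup>2 / 8 * (1 / \<beta>\<^sup>2) ^ j"
      using ex_level_exponent[OF x(4)] by blast
    define C where "C = 2 ^ 20 + (1 / x) ^ card (dyadic_low J)"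
    have C: "0 < C" unfolding C_def using x by (intro add_pos_pos) auto
    have "((\<lambda>\<epsilon>. \<epsilon> * bootstrap_const z K) \<longlongrightarrow> 0 * bootstrap_const z K) (at_right 0)"
      by (intro tendsto_intros id0)
    then have 4: "\<forall>\<^sub>F \<epsilon> in at_right 0. \<epsilon> * bootstrap_const z K < x"
      using x by (intro order_tendstoD(2)) auto
    have "((\<lambda>\<epsilon>. \<epsilon> * ln C - (1 - x) * z\<^sup>2 / S) \<longlongrightarrow> 0 * ln C - (1 - x) * z\<^sup>2 / S) (at_right 0)"
      by (intro tendsto_intros id0)
    then have "\<forall>\<^sub>F \<epsilon> in at_right 0. \<epsilon> * ln C - (1 - x) * z\<^sup>2 / S < a"
      using x(1) unfolding z_def by (intro order_tendstoD(2)) auto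
    then show "\<forall>\<^sub>F \<epsilon> in at_right 0. \<epsilon> * ln (?p \<epsilon>) < a"
      using 3 4 pos
    proof eventually_elim
      case (elim \<epsilon>)
      \<comment> \<open>Taking logarithms in the upper bound needs a positive probability, which the
        Gaussian lower bound provides.\<close>
      have p0: "0 < ?p \<epsilon>"
      proof -
        have 0: "0 < exp A / sqrt (pi * B)" if "0 < B" for A B :: real using that by simp
        obtain N where N: "0 < N" "0 < (\<Sum>n\<in>{- int N<..<int N}. (fejer_weight N n)\<^sup>2)"
          using ex_fejer_variance[OF S_pos] by blast
        show ?thesis by (rule less_le_trans[OF 0[OF N(2)] lower[OF N(1) elim(4)]])
      qed
      have "?p \<epsilon> \<le> C * exp (- ((1 - x) * z\<^sup>2 / S / \<epsilon>))"
        unfolding C_def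
        by (rule exceed_upper[OF _ _ _ _ K z(1) x(4,3) _ _ _ _ f v])
          (use elim T[OF elim(4)] xQ x(2) J in \<open>auto simp: z_def\<close>)
      then have "ln (?p \<epsilon>) \<le> ln (C * exp (- ((1 - x) * z\<^sup>2 / S / \<epsilon>)))" using p0 C by simp
      also have "\<dots> = ln C - (1 - x) * z\<^sup>2 / S / \<epsilon>" using C by (simp add: ln_mult)
      finally have "\<epsilon> * ln (?p \<epsilon>) \<le> \<epsilon> * (ln C - (1 - x) * z\<^sup>2 / S / \<epsilon>)" using elim by (intro mult_left_mono) auto
      also have "\<dots> = \<epsilon> * ln C - (1 - x) * z\<^sup>2 / S" using elim by (simp add: right_diff_distrib)
      finally show ?case using elim(1) by linarith
    qed
  qed
qed

end

(* The solution is only determined almost surely, so the event is measured with the completion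
   of M (which extends M). *)
theorem theorem1p1:
  fixes M :: "'w measure"
    and g :: "int \<Rightarrow> 'w \<Rightarrow> complex"
    and u0 :: "'w \<Rightarrow> real \<Rightarrow> complex"
    and u :: "real \<Rightarrow> 'w \<Rightarrow> real \<Rightarrow> real \<Rightarrow> complex"
    and c :: "int \<Rightarrow> real"
    and T :: "real \<Rightarrow> real"
    and \<theta> z0 K :: real
  assumes "prob_space M"
    and "\<theta> > 0" and "z0 > 0" and "K \<ge> 1"
    and "\<And>n. c n = japanese_bracket n powr (- (1/2 + \<theta>))"
    and "\<And>n. standard_complex_gaussian M (g n)"
    and "prob_space.indep_vars M (\<lambda>_. borel) g UNIV"
    and "AE \<omega> in M. has_sum_L2 (\<lambda>n x. of_real (c n) * g n \<omega> * cis (of_int n * x)) (u0 \<omega>)"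
    and "\<And>\<epsilon>. \<epsilon> > 0 \<Longrightarrow> AE \<omega> in M. global_nls_solution \<epsilon> (u0 \<omega>) (u \<epsilon> \<omega>)"
    and "\<And>\<epsilon>. \<epsilon> > 0 \<Longrightarrow> T \<epsilon> > 0 \<and> inverse K * inverse \<epsilon> \<le> T \<epsilon> \<and> T \<epsilon> \<le> K * inverse \<epsilon>"
  shows "((\<lambda>\<epsilon>. \<epsilon> * ln (measure (completion M)
             {\<omega> \<in> space M. norm_Linf (T \<epsilon>) (u \<epsilon> \<omega>) > ereal (z0 * \<epsilon> powr (-1/2))}))
          \<longlongrightarrow> - (z0\<^sup>2 / (\<Sum>\<^sub>\<infinity>n\<in>UNIV. \<bar>c n\<bar>\<^sup>2))) (at_right 0)"
proof -
  interpret prob_space M by fact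
  interpret gaussian_data M g c \<theta>
    by unfold_locales (use assms in auto)
  have f: "AE \<omega> in M. has_sum_L2 (\<lambda>n x. data \<omega> n * cis (of_int n * x)) (u0 \<omega>)"
    using assms(8) unfolding data_def .
  have T: "0 < T \<epsilon> \<and> \<epsilon> * T \<epsilon> \<le> K" if "0 < \<epsilon>" for \<epsilon>
    using assms(10)[OF that] that by (simp add: field_simps)
  have S: "S = (\<Sum>\<^sub>\<infinity>n\<in>UNIV. \<bar>c n\<bar>\<^sup>2)" by (simp add: S_def)
  have "\<forall>\<^sub>F \<epsilon> in at_right 0. \<epsilon> * ln (prob (exceed \<epsilon> (T \<epsilon>) (z0 * \<epsilon> powr (- 1/2)))) =
      \<epsilon> * ln (measure (completion M) {\<omega> \<in> space M. norm_Linf (T \<epsilon>) (u \<epsilon> \<omega>) > ereal (z0 * \<epsilon> powr (-1/2))})"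
    using eventually_at_right_less[of 0]
  proof eventually_elim
    case (elim \<epsilon>)
    show ?case
      by (simp only: measure_completion_exceed[OF elim conjunct1[OF T[OF elim]] f assms(9)[OF elim]])
  qed
  from Lim_transform_eventually[OF large_deviation[OF assms(3,4) f assms(9) T] this]
  show ?thesis unfolding S .
qed

end
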